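(* Consider the discrete memoryless state-dependent multiple access channel $p_{Y|X_1,X_2,S_1,S_2}$ with two state components, where Encoder 1 knows $S_1^n$ non-causally, Encoder 2 knows $S_2^n$ non-causally, the decoder knows $(S_1^n,S_2^n)$, and Encoder 2 observes in a causal manner the partial cribbing signal $Z_i=z(X_{1,i},S_{1,i})$ (so $X_{2,i}$ may depend on $Z^i$). Its capacity region is the set of rate pairs $(R_1,R_2)$ that satisfy \begin{align*} R_1&\le I(X_1;Y|X_2,Z,S_1,S_2,U)+H(Z|S_1,U)-I(U;S_1|S_2),\\ R_2&\le I(X_2;Y|X_1,S_1,S_2,U),\\ R_1+R_2&\le I(X_1,X_2;Y|Z,S_1,S_2,U)+H(Z|S_1,U)-I(U;S_1|S_2),\\ R_1+R_2&\le I(X_1,X_2;Y|S_1,S_2) \end{align*} for some PMF of the form $p_{X_1,U|S_1}\,p_{X_2|Z,U,S_2}$, with $Z=z(X_1,S_1)$, that satisfies $$I(U;S_1|S_2)\le H(Z|S_1,U).$$ Here all information quantities are computed under $p_{S_1,S_2}\,p_{X_1,U|S_1}\,\mathbf{1}[Z=z(X_1,S_1)]\,p_{X_2|Z,U,S_2}\,p_{Y|X_1,X_2,S_1,S_2}$.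
   Context: All alphabets $\mathcal{X}_1,\mathcal{X}_2,\mathcal{S}_1,\mathcal{S}_2,\mathcal{Z},\mathcal{Y}$ are finite; $U$ is a discrete auxiliary random variable; logarithms are base 2; $x^n=(x_1,\dots,x_n)$; $[1:2^{nR}]$ denotes the set of integers from $1$ to $2^{nR}$ (with $2^{nR}$ treated as an integer). Channel model. The state pairs $(S_{1,i},S_{2,i})$, $i=1,\dots,n$, are i.i.d. with PMF $p_{S_1,S_2}$ (the two components may be dependent). The messages $M_1,M_2$ are uniform on $[1:2^{nR_1}]$ and $[1:2^{nR_2}]$, independent of each other and of the states. The function $z:\mathcal{X}_1\times\mathcal{S}_1\to\mathcal{Z}$ is fixed. The channel is memoryless and without feedback: given the inputs and states at time $i$, $Y_i$ is drawn from $p_{Y|X_1,X_2,S_1,S_2}(\cdot|x_{1,i},x_{2,i},s_{1,i},s_{2,i})$ independently of everything else up to time $i$. An $(R_1,R_2,n)$ code $\mathcal{C}_n$ (causal cribbing) consists of: $x_1^n:[1:2^{nR_1}]\times\mathcal{S}_1^n\to\mathcal{X}_1^n$; $x_{2,i}:[1:2^{nR_2}]\times\mathcal{S}_2^n\times\mathcal{Z}^{i}\to\mathcal{X}_2$ for $1\le i\le n$; decoders $\hat m_w:\mathcal{Y}^n\times\mathcal{S}_1^n\times\mathcal{S}_2^n\to[1:2^{nR_w}]$, $w=1,2$. Encoder 2 transmits $X_{2,i}=x_{2,i}(M_2,S_2^n,Z^{i})$. A rate pair $(R_1,R_2)$ is achievable if for any $\epsilon>0$ and some sufficiently large $n$ there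 exists an $(R_1,R_2,n)$ code with $\Pr[(\hat m_1(Y^n,S_1^n,S_2^n),\hat m_2(Y^n,S_1^n,S_2^n))\ne(M_1,M_2)]\le\epsilon$. The capacity region is defined to be the union of all achievable rate pairs, that is, the set of all achievable rate pairs.
   Formalization: The capacity region is taken as the closure of the set of achievable rate pairs; without closure the claim fails on the boundary, e.g. a binary symmetric channel at rate exactly its capacity. *)

theory Defs
  imports "HOL-Probability.Probability"
begin

text \<open>Finite alphabets are types of class \<open>finite\<close>; a sequence of length \<open>n\<close> is a list of length \<open>n\<close>,
  indexed from \<open>0\<close>.\<close>

definition messages :: "nat \<Rightarrow> real \<Rightarrow> nat set" where
  "messages n R = {1..nat \<lfloor>2 powr (real n * R)\<rfloor>}"

text \<open>\<open>enc2 c i m\<^sub>2 s\<^sub>2 z\<close> is the symbol sent at time \<open>i\<close>. It is only ever applied to the list \<open>z\<close>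
  consisting of the cribbed symbols at times \<open>0, \<dots>, i\<close> (see \<open>encode2\<close>).\<close>

record ('x1, 'x2, 's1, 's2, 'z, 'y) mac_code =
  enc1 :: "nat \<Rightarrow> 's1 list \<Rightarrow> 'x1 list"
  enc2 :: "nat \<Rightarrow> nat \<Rightarrow> 's2 list \<Rightarrow> 'z list \<Rightarrow> 'x2"
  dec1 :: "'y list \<Rightarrow> 's1 list \<Rightarrow> 's2 list \<Rightarrow> nat"
  dec2 :: "'y list \<Rightarrow> 's1 list \<Rightarrow> 's2 list \<Rightarrow> nat"

definition is_code ::
  "real \<Rightarrow> real \<Rightarrow> nat \<Rightarrow> ('x1, 'x2, 's1, 's2, 'z, 'y) mac_code \<Rightarrow> bool" where
  "is_code R1 R2 n c \<longleftrightarrow>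
     (\<forall>m\<in>messages n R1. \<forall>s1. length s1 = n \<longrightarrow> length (enc1 c m s1) = n) \<and>
     (\<forall>y s1 s2. length y = n \<and> length s1 = n \<and> length s2 = n \<longrightarrow>
        dec1 c y s1 s2 \<in> messages n R1 \<and> dec2 c y s1 s2 \<in> messages n R2)"

definition encode2 ::
  "('x1, 'x2, 's1, 's2, 'z, 'y) mac_code \<Rightarrow> nat \<Rightarrow> nat \<Rightarrow> 's2 list \<Rightarrow> 'z list \<Rightarrow> 'x2 list" where
  "encode2 c n m2 s2 z = map (\<lambda>i. enc2 c i m2 s2 (take (Suc i) z)) [0..<n]"

text \<open>Independent \<open>Y\<^sub>i \<sim> p i\<close> for \<open>i < n\<close>, collected in a list. The second argument of \<open>Pi_pmf\<close> is the
  value taken outside \<open>{..<n}\<close>, which is never read.\<close>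

definition independent_list_pmf :: "nat \<Rightarrow> (nat \<Rightarrow> 'a pmf) \<Rightarrow> 'a list pmf" where
  "independent_list_pmf n p = map_pmf (\<lambda>y. map y [0..<n]) (Pi_pmf {..<n} undefined p)"

text \<open>Joint law of the message pair and its estimate. Meaningful for \<open>R1, R2 \<ge> 0\<close>, where both
  message sets are nonempty.\<close>

definition transmission ::
  "('s1 \<times> 's2) pmf \<Rightarrow> ('x1 \<Rightarrow> 's1 \<Rightarrow> 'z) \<Rightarrow> ('x1 \<Rightarrow> 'x2 \<Rightarrow> 's1 \<Rightarrow> 's2 \<Rightarrow> 'y pmf) \<Rightarrow>
   real \<Rightarrow> real \<Rightarrow> nat \<Rightarrow> ('x1, 'x2, 's1, 's2, 'z, 'y) mac_code \<Rightarrow>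
   ((nat \<times> nat) \<times> (nat \<times> nat)) pmf" where
  "transmission pS zf W R1 R2 n c = do {
     m1 \<leftarrow> pmf_of_set (messages n R1);
     m2 \<leftarrow> pmf_of_set (messages n R2);
     s \<leftarrow> replicate_pmf n pS;
     let s1 = map fst s;
     let s2 = map snd s;
     let x1 = enc1 c m1 s1;
     let x2 = encode2 c n m2 s2 (map2 zf x1 s1);
     y \<leftarrow> independent_list_pmf n (\<lambda>i. W (x1 ! i) (x2 ! i) (s1 ! i) (s2 ! i));
     return_pmf ((m1, m2), (dec1 c y s1 s2, dec2 c y s1 s2))
   }"

definition error_prob ::
  "('s1 \<times> 's2) pmf \<Rightarrow> ('x1 \<Rightarrow> 's1 \<Rightarrow> 'z) \<Rightarrow> ('x1 \<Rightarrow> 'x2 \<Rightarrow> 's1 \<Rightarrow> 's2 \<Rightarrow> 'y pmf) \<Rightarrow>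
   real \<Rightarrow> real \<Rightarrow> nat \<Rightarrow> ('x1, 'x2, 's1, 's2, 'z, 'y) mac_code \<Rightarrow> real" where
  "error_prob pS zf W R1 R2 n c =
     measure_pmf.prob (transmission pS zf W R1 R2 n c) {(m, m'). m' \<noteq> m}"

definition achievable ::
  "('s1 \<times> 's2) pmf \<Rightarrow> ('x1 \<Rightarrow> 's1 \<Rightarrow> 'z) \<Rightarrow> ('x1 \<Rightarrow> 'x2 \<Rightarrow> 's1 \<Rightarrow> 's2 \<Rightarrow> 'y pmf) \<Rightarrow>
   real \<Rightarrow> real \<Rightarrow> bool" where
  "achievable pS zf W R1 R2 \<longleftrightarrow> 0 \<le> R1 \<and> 0 \<le> R2 \<and>
     (\<forall>\<epsilon>>0. \<forall>N. \<exists>n\<ge>N. \<exists>c. is_code R1 R2 n c \<and> error_prob pS zf W R1 R2 n c \<le> \<epsilon>)"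

text \<open>The closure is needed for a single-letter formula to be exact: a rate pair on the boundary of
  the region need not itself be achievable. For instance, a binary symmetric channel used at a rate
  exactly equal to its capacity has error probability bounded away from zero.\<close>

definition capacity_region ::
  "('s1 \<times> 's2) pmf \<Rightarrow> ('x1 \<Rightarrow> 's1 \<Rightarrow> 'z) \<Rightarrow> ('x1 \<Rightarrow> 'x2 \<Rightarrow> 's1 \<Rightarrow> 's2 \<Rightarrow> 'y pmf) \<Rightarrow>
   (real \<times> real) set" where
  "capacity_region pS zf W = closure {(R1, R2). achievable pS zf W R1 R2}"

text \<open>Joint law of \<open>(S\<^sub>1, S\<^sub>2, X\<^sub>1, U, Z, X\<^sub>2, Y)\<close>. The discrete auxiliary variable \<open>U\<close> ranges over
  an arbitrary countable alphabet, encoded in \<open>nat\<close>.\<close>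

definition single_letter ::
  "('s1 \<times> 's2) pmf \<Rightarrow> ('x1 \<Rightarrow> 's1 \<Rightarrow> 'z) \<Rightarrow> ('x1 \<Rightarrow> 'x2 \<Rightarrow> 's1 \<Rightarrow> 's2 \<Rightarrow> 'y pmf) \<Rightarrow>
   ('s1 \<Rightarrow> ('x1 \<times> nat) pmf) \<Rightarrow> ('z \<Rightarrow> nat \<Rightarrow> 's2 \<Rightarrow> 'x2 pmf) \<Rightarrow>
   ('s1 \<times> 's2 \<times> 'x1 \<times> nat \<times> 'z \<times> 'x2 \<times> 'y) pmf" where
  "single_letter pS zf W pX1U pX2 = do {
     (s1, s2) \<leftarrow> pS;
     (x1, u) \<leftarrow> pX1U s1;
     let z = zf x1 s1;
     x2 \<leftarrow> pX2 z u s2;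
     y \<leftarrow> W x1 x2 s1 s2;
     return_pmf (s1, s2, x1, u, z, x2, y)
   }"

definition cond_mutual_info ::
  "'w pmf \<Rightarrow> ('w \<Rightarrow> 'a) \<Rightarrow> ('w \<Rightarrow> 'b) \<Rightarrow> ('w \<Rightarrow> 'c) \<Rightarrow> real" where
  "cond_mutual_info P A B C = prob_space.conditional_mutual_information (measure_pmf P) 2
     (count_space UNIV) (count_space UNIV) (count_space UNIV) A B C"

definition cond_entropy :: "'w pmf \<Rightarrow> ('w \<Rightarrow> 'a) \<Rightarrow> ('w \<Rightarrow> 'b) \<Rightarrow> real" where
  "cond_entropy P A B = prob_space.conditional_entropy (measure_pmf P) 2
     (count_space UNIV) (count_space UNIV) A B"

end

theory Submission
  imports Defs "HOL-Real_Asymp.Real_Asymp"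
begin

text \<open>
  Converse. For a code of block length n take \<open>U_i = (i, Z^{i-1}, S_1^{i-1}, (S_{2,j})_{j \<noteq> i})\<close>. Then
  the sum over i of \<open>H(Z_i|S_{1,i},U_i) - I(U_i;S_{1,i}|S_{2,i})\<close> is at least \<open>H(Z^n|S_1^n,S_2^n)\<close>, and
  Fano's inequality gives the rate bounds up to a vanishing error. To pass to the limit, the region is
  written as a condition on the convex hull of a compact set: a joint law is a barycentre of points
  \<open>(P(s_1,x_1|u), P(x_2|z,u,s_2))\<close>, and all quantities except \<open>I(X_1,X_2;Y|S_1,S_2)\<close>, which is
  continuous, are affine on the hull. So the region is closed, and U may be taken finite.

  Achievability. Block Markov coding with backward decoding. In each block Encoder 1 covers its state
  sequence by a codeword U, binned so that Encoder 2 can recover it from the bin and \<open>S_2\<close>; the bin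
  and a part of the message of the next block are sent through the cribbed sequence Z. The remaining
  messages select Shannon strategies \<open>V_1, V_2\<close>, which produce the inputs symbol by symbol, so that
  causality is automatic. Covering is done by rejection sampling, whose output law is dominated by a
  constant times the target law; together with thresholds on likelihood ratios this replaces joint
  typicality by the weak law of large numbers.

  The scheme needs \<open>I(U;S_1|S_2) < H(Z|S_1,U)\<close>. If \<open>z(-,s_1)\<close> is not constant for some \<open>s_1\<close> of positive
  probability, this is reached by mixing with a law that has constant U and uniform \<open>X_1\<close>. Otherwise
  both sides vanish, so \<open>P(u|s_1) = P(u|s_2)\<close> on the support: both encoders know this conditional law,
  and U is replaced by a function from conditional laws to values, independent of the state.
\<close>

section \<open>Conditional entropy as an expectation\<close>

text \<open>Since \<open>U\<close> may take countably many values, \<open>H(U)\<close> can be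
  infinite and the log-likelihood of \<open>U\<close> need not be integrable. Every information
  quantity is therefore reduced to \<open>hc\<close>, used for variables with finitely many values
  and written as an expected log-loss; one Gibbs inequality for log-losses then yields monotonicity,
  Fano's bound and the estimates of output laws. The bound \<open>I(X_1,X_2;Y|S_1,S_2)\<close> does
  not condition on \<open>U\<close> and hence is no average over the values of \<open>U\<close>;
  this forces the hull to carry the joint law besides the other quantities. In the direct part the
  obstacle is that Encoder 2 must know the codeword \<open>U\<close> before a block begins, although
  it sees neither \<open>S_1\<close> nor the future of the crib. So what it needs is announced one
  block ahead, which non-causal knowledge of \<open>S_1\<close> permits, and the decoder can
  recompute the announcement made in a block only from the block after it: hence the backward order.
  The announcement spends the rate \<open>I(U;S_1|S_2)\<close> out of \<open>H(Z|S_1,U)\<close>, and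
  what is left carries message bits, which explains the difference of these terms in the rate
  bounds.\<close>

definition hc :: "'w pmf \<Rightarrow> ('w \<Rightarrow> 'a) \<Rightarrow> ('w \<Rightarrow> 'b) \<Rightarrow> real" where
  "hc P A B = measure_pmf.expectation P (\<lambda>w.
     - log 2 (pmf (map_pmf (\<lambda>w. (A w, B w)) P) (A w, B w) / pmf (map_pmf B P) (B w)))"

lemma pmf_map_pos: "w \<in> set_pmf P \<Longrightarrow> pmf (map_pmf f P) (f w) > 0"
  by (auto simp: pmf_positive_iff)

lemma pmf_map_mono:
  assumes "\<And>w. w \<in> set_pmf P \<Longrightarrow> f w = a \<Longrightarrow> g w = b"
  shows "pmf (map_pmf f P) a \<le> pmf (map_pmf g P) b"
  unfolding pmf_map using assms
  by (intro measure_pmf.finite_measure_mono_AE) (auto simp: AE_measure_pmf_iff)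

lemma pmf_map_eq:
  assumes "\<And>w. w \<in> set_pmf P \<Longrightarrow> f w = a \<longleftrightarrow> g w = b"
  shows "pmf (map_pmf f P) a = pmf (map_pmf g P) b"
  by (intro antisym pmf_map_mono) (use assms in auto)

text \<open>Only the partitions that \<open>A\<close> and \<open>B\<close> induce on the support
  enter \<open>hc\<close>. This licenses every reordering, padding and recoding of random variables
  below, also across different types.\<close>

lemma hc_cong:
  assumes "\<And>w w'. w \<in> set_pmf P \<Longrightarrow> w' \<in> set_pmf P \<Longrightarrow> (A w', B w') = (A w, B w) \<longleftrightarrow> (A' w', B' w') = (A' w, B' w)"
    "\<And>w w'. w \<in> set_pmf P \<Longrightarrow> w' \<in> set_pmf P \<Longrightarrow> B w' = B w \<longleftrightarrow> B' w' = B' w"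
  shows "hc P A B = hc P A' B'"
  unfolding hc_def
proof (intro integral_cong_AE, simp_all add: AE_measure_pmf_iff, intro ballI)
  fix w assume w: "w \<in> set_pmf P"
  have "pmf (map_pmf (\<lambda>w. (A w, B w)) P) (A w, B w) = pmf (map_pmf (\<lambda>w. (A' w, B' w)) P) (A' w, B' w)"
    by (rule pmf_map_eq) (use assms(1) w in blast)
  moreover have "pmf (map_pmf B P) (B w) = pmf (map_pmf B' P) (B' w)"
    by (rule pmf_map_eq) (use assms(2) w in blast)
  ultimately show "log 2 (pmf (map_pmf (\<lambda>w. (A w, B w)) P) (A w, B w) / pmf (map_pmf B P) (B w)) =
         log 2 (pmf (map_pmf (\<lambda>w. (A' w, B' w)) P) (A' w, B' w) / pmf (map_pmf B' P) (B' w))" by simp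
qed

lemma hc_map: "hc (map_pmf g P) A B = hc P (\<lambda>w. A (g w)) (\<lambda>w. B (g w))"
  by (simp add: hc_def map_pmf_comp)

lemma log2_quot_nonpos: "0 < a \<Longrightarrow> a \<le> b \<Longrightarrow> log 2 (a / b) \<le> 0"
  by (simp add: log_divide)

lemma hc_nonneg: "0 \<le> hc P A B"
  unfolding hc_def
proof (intro integral_nonneg_AE, simp add: AE_measure_pmf_iff, intro ballI)
  fix w assume w: "w \<in> set_pmf P"
  have "pmf (map_pmf (\<lambda>w. (A w, B w)) P) (A w, B w) \<le> pmf (map_pmf B P) (B w)"
    by (rule pmf_map_mono) auto
  moreover have "0 < pmf (map_pmf (\<lambda>w. (A w, B w)) P) (A w, B w)" by (rule pmf_map_pos[OF w, of "\<lambda>w. (A w, B w)"])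
  ultimately show "log 2 (pmf (map_pmf (\<lambda>w. (A w, B w)) P) (A w, B w) / pmf (map_pmf B P) (B w)) \<le> 0"
    by (intro log2_quot_nonpos)
qed

lemma hc_determined:
  assumes "\<And>w w'. w \<in> set_pmf P \<Longrightarrow> w' \<in> set_pmf P \<Longrightarrow> B w' = B w \<Longrightarrow> A w' = A w"
  shows "hc P A B = 0"
proof -
  have "hc P A B = hc P (\<lambda>_. ()) B"
    by (rule hc_cong; (unfold prod.inject)?; use assms in blast)
  also have "\<dots> = measure_pmf.expectation P (\<lambda>w. 0)" unfolding hc_def
  proof (intro integral_cong_AE, simp_all add: AE_measure_pmf_iff, intro ballI)
    fix w assume w: "w \<in> set_pmf P"
    have "pmf (map_pmf (\<lambda>w. ((), B w)) P) ((), B w) = pmf (map_pmf B P) (B w)"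
      by (rule pmf_map_eq) auto
    with pmf_map_pos[OF w, of B] show "log 2 (pmf (map_pmf (\<lambda>w. ((), B w)) P) ((), B w) / pmf (map_pmf B P) (B w)) = 0"
      by simp
  qed
  finally show ?thesis by simp
qed

lemma integrable_finite_pmf: "finite (set_pmf P) \<Longrightarrow> integrable (measure_pmf P) (f :: _ \<Rightarrow> real)"
  by (rule integrable_measure_pmf_finite)

text \<open>Gibbs' inequality: no subnormalised guess \<open>r\<close> of \<open>A\<close> from
  \<open>B\<close> has a smaller log-loss than the true conditional law, by
  \<open>ln x \<le> x - 1\<close> at the ratio of the two. The sum condition is asked on attained
  values only, so guesses on infinite types qualify.\<close>

lemma hc_gibbs:
  assumes fin: "finite (set_pmf P)"
    and pos: "\<And>w. w \<in> set_pmf P \<Longrightarrow> 0 < r (A w) (B w)"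
    and nn: "\<And>a b. 0 \<le> r a b"
    and sub: "\<And>b. b \<in> B ` set_pmf P \<Longrightarrow> (\<Sum>a\<in>A ` set_pmf P. r a b) \<le> 1"
  shows "hc P A B \<le> measure_pmf.expectation P (\<lambda>w. - log 2 (r (A w) (B w)))"
proof -
  define pab where "pab = (\<lambda>w. pmf (map_pmf (\<lambda>w. (A w, B w)) P) (A w, B w))"
  define pb where "pb = (\<lambda>w. pmf (map_pmf B P) (B w))"
  note int = integrable_finite_pmf[OF fin]
  have pp: "0 < pab w" "0 < pb w" if "w \<in> set_pmf P" for w
    using pmf_map_pos[OF that, of "\<lambda>w. (A w, B w)"] pmf_map_pos[OF that, of B] by (auto simp: pab_def pb_def)
  have "hc P A B - measure_pmf.expectation P (\<lambda>w. - log 2 (r (A w) (B w)))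
     = measure_pmf.expectation P (\<lambda>w. - log 2 (pab w / pb w) - - log 2 (r (A w) (B w)))"
    unfolding hc_def pab_def pb_def by (subst Bochner_Integration.integral_diff) (auto intro: int)
  also have "\<dots> \<le> measure_pmf.expectation P (\<lambda>w. (r (A w) (B w) * pb w / pab w - 1) / ln 2)"
  proof (intro integral_mono_AE int, simp add: AE_measure_pmf_iff, intro ballI)
    fix w assume w: "w \<in> set_pmf P"
    have "log 2 (r (A w) (B w)) - log 2 (pab w / pb w) = ln (r (A w) (B w) * pb w / pab w) / ln 2"
      using pp[OF w] pos[OF w] unfolding log_def[of 2 "r (A w) (B w) * pb w / pab w", symmetric]
      by (simp add: log_divide log_mult)
    also have "\<dots> \<le> (r (A w) (B w) * pb w / pab w - 1) / ln 2"
      using pp[OF w] pos[OF w] by (intro divide_right_mono ln_le_minus_one) auto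
    finally show "log 2 (r (A w) (B w)) - log 2 (pab w / pb w) \<le> (r (A w) (B w) * pb w / pab w - 1) / ln 2" .
  qed
  also have "\<dots> = (measure_pmf.expectation P (\<lambda>w. r (A w) (B w) * pb w / pab w) - 1) / ln 2"
    by (subst integral_divide_zero, subst Bochner_Integration.integral_diff) (auto intro: int)
  also have "measure_pmf.expectation P (\<lambda>w. r (A w) (B w) * pb w / pab w) \<le> 1"
  proof -
    let ?Q = "map_pmf (\<lambda>w. (A w, B w)) P"
    let ?g = "\<lambda>(a,b). r a b * pmf (map_pmf B P) b / pmf ?Q (a,b)"
    have "measure_pmf.expectation P (\<lambda>w. r (A w) (B w) * pb w / pab w) = measure_pmf.expectation ?Q ?g"
      by (simp add: pab_def pb_def)
    also have "\<dots> = (\<Sum>x\<in>set_pmf ?Q. pmf ?Q x * ?g x)"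
      by (subst integral_measure_pmf_real[of "set_pmf ?Q"]) (use fin in \<open>auto simp: mult.commute\<close>)
    also have "\<dots> = (\<Sum>(a,b)\<in>set_pmf ?Q. r a b * pmf (map_pmf B P) b)"
      by (intro sum.cong) (auto simp del: set_map_pmf simp: set_pmf_iff)
    also have "\<dots> \<le> (\<Sum>(a,b)\<in>(A`set_pmf P) \<times> (B ` set_pmf P). r a b * pmf (map_pmf B P) b)"
      using fin nn by (intro sum_mono2) auto
    also have "\<dots> = (\<Sum>b\<in>B ` set_pmf P. (\<Sum>a\<in>A ` set_pmf P. r a b) * pmf (map_pmf B P) b)"
      by (subst sum.cartesian_product[symmetric], subst sum.swap) (simp add: sum_distrib_right)
    also have "\<dots> \<le> (\<Sum>b\<in>B ` set_pmf P. 1 * pmf (map_pmf B P) b)"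
      by (intro sum_mono mult_right_mono sub) auto
    also have "\<dots> = 1" using fin by (simp add: sum_pmf_eq_1)
    finally show ?thesis .
  qed
  finally show ?thesis by (simp add: divide_right_mono)
qed

lemma hc_chain:
  assumes fin: "finite (set_pmf P)"
  shows "hc P (\<lambda>w. (A w, B w)) C = hc P B C + hc P A (\<lambda>w. (B w, C w))"
proof -
  note int = integrable_finite_pmf[OF fin]
  show ?thesis unfolding hc_def
  proof (subst Bochner_Integration.integral_add[symmetric], (rule int)+,
      intro integral_cong_AE, simp_all add: AE_measure_pmf_iff, intro ballI)
    fix w assume w: "w \<in> set_pmf P"
    have "pmf (map_pmf (\<lambda>w. ((A w, B w), C w)) P) ((A w, B w), C w) = pmf (map_pmf (\<lambda>w. (A w, B w, C w)) P) (A w, B w, C w)"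
      by (rule pmf_map_eq) auto
    with pmf_map_pos[OF w, of C] pmf_map_pos[OF w, of "\<lambda>w. (B w, C w)"] pmf_map_pos[OF w, of "\<lambda>w. (A w, B w, C w)"]
    show "- log 2 (pmf (map_pmf (\<lambda>w. ((A w, B w), C w)) P) ((A w, B w), C w) / pmf (map_pmf C P) (C w)) =
         - log 2 (pmf (map_pmf (\<lambda>w. (B w, C w)) P) (B w, C w) / pmf (map_pmf C P) (C w)) -
           log 2 (pmf (map_pmf (\<lambda>w. (A w, B w, C w)) P) (A w, B w, C w) / pmf (map_pmf (\<lambda>w. (B w, C w)) P) (B w, C w))"
      by (simp add: log_divide)
  qed
qed

text \<open>The true conditional law of \<open>A\<close> given the coarser \<open>B\<close> is an
  admissible guess for an observer of \<open>B'\<close>, and \<open>hc_gibbs\<close> compares the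
  two. The map \<open>f\<close> recovers the coarse value from the fine one.\<close>

lemma hc_mono_cond:
  assumes fin: "finite (set_pmf P)"
    and det: "\<And>w w'. w \<in> set_pmf P \<Longrightarrow> w' \<in> set_pmf P \<Longrightarrow> B' w' = B' w \<Longrightarrow> B w' = B w"
  shows "hc P A B' \<le> hc P A B"
proof -
  define f where "f b' = (SOME b. \<exists>w\<in>set_pmf P. B' w = b' \<and> B w = b)" for b'
  have f: "f (B' w) = B w" if "w \<in> set_pmf P" for w
    unfolding f_def
  proof (rule some_equality)
    show "\<exists>w'\<in>set_pmf P. B' w' = B' w \<and> B w' = B w" using that by blast
    show "b = B w" if "\<exists>w'\<in>set_pmf P. B' w' = B' w \<and> B w' = b" for b
      using that det[OF \<open>w \<in> set_pmf P\<close>] by blast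
  qed
  let ?r = "\<lambda>a b'. pmf (map_pmf (\<lambda>w. (A w, B w)) P) (a, f b') / pmf (map_pmf B P) (f b')"
  have "hc P A B' \<le> measure_pmf.expectation P (\<lambda>w. - log 2 (?r (A w) (B' w)))"
  proof (rule hc_gibbs[OF fin])
    show "0 < ?r (A w) (B' w)" if "w \<in> set_pmf P" for w
      using f[OF that] pmf_map_pos[OF that, of B] pmf_map_pos[OF that, of "\<lambda>w. (A w, B w)"] by simp
    fix b' assume "b' \<in> B' ` set_pmf P"
    then obtain w where w: "w \<in> set_pmf P" "b' = B' w" by auto
    have "(\<Sum>a\<in>A ` set_pmf P. pmf (map_pmf (\<lambda>w. (A w, B w)) P) (a, B w)) =
       measure_pmf.prob (map_pmf (\<lambda>w. (A w, B w)) P) ((\<lambda>a. (a, B w)) ` (A ` set_pmf P))"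
      by (subst measure_measure_pmf_finite) (use fin in \<open>auto simp: sum.reindex inj_on_def\<close>)
    also have "\<dots> \<le> pmf (map_pmf B P) (B w)"
      by (simp add: pmf_map) (rule measure_pmf.finite_measure_mono, auto)
    finally show "(\<Sum>a\<in>A ` set_pmf P. ?r a b') \<le> 1"
      using f[OF w(1)] w pmf_map_pos[OF w(1), of B] by (simp add: sum_divide_distrib[symmetric])
  qed auto
  also have "\<dots> = hc P A B" unfolding hc_def
    by (intro integral_cong_AE) (auto simp: AE_measure_pmf_iff f)
  finally show ?thesis .
qed

text \<open>Adjoining \<open>A\<close> to \<open>A'\<close> does not change the entropy, because
  \<open>(A', B)\<close> determines \<open>A\<close>; the chain rule then leaves a nonnegative
  remainder.\<close>

lemma hc_mono_left:
  assumes fin: "finite (set_pmf P)"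
    and det: "\<And>w w'. w \<in> set_pmf P \<Longrightarrow> w' \<in> set_pmf P \<Longrightarrow> A' w' = A' w \<Longrightarrow> B w' = B w \<Longrightarrow> A w' = A w"
  shows "hc P A B \<le> hc P A' B"
proof -
  have "hc P A' B = hc P (\<lambda>w. (A' w, A w)) B"
    by (rule hc_cong; (unfold prod.inject)?; use det in blast)
  also have "\<dots> = hc P A B + hc P A' (\<lambda>w. (A w, B w))" by (rule hc_chain[OF fin])
  finally show ?thesis using hc_nonneg[of P A' "\<lambda>w. (A w, B w)"] by simp
qed

text \<open>Fano's inequality as a guess in \<open>hc_gibbs\<close>: half of the mass on the decoded
  value, the other half uniform on \<open>T\<close>. The loss is one bit, plus
  \<open>log |T|\<close> bits on an error.\<close>

lemma hc_fano:
  fixes A :: "'w \<Rightarrow> 'a" and B :: "'w \<Rightarrow> 'b"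
  assumes fin: "finite (set_pmf P)" and T: "finite T" "A ` set_pmf P \<subseteq> T"
  shows "hc P A B \<le> 1 + measure_pmf.prob P {w. g (B w) \<noteq> A w} * log 2 (real (card T))"
proof -
  let ?r = "\<lambda>a b. if g b = a then 1/2 else 1 / (2 * real (card T))"
  have "T \<noteq> {}" using T set_pmf_not_empty[of P] by auto
  with T have c: "card T > 0" by auto
  have "hc P A B \<le> measure_pmf.expectation P (\<lambda>w. - log 2 (?r (A w) (B w)))"
  proof (rule hc_gibbs[OF fin])
    fix b
    have "(\<Sum>a\<in>A ` set_pmf P. ?r a b) \<le> (\<Sum>a\<in>T. ?r a b)" using T by (intro sum_mono2) auto
    also have "\<dots> \<le> (\<Sum>a\<in>T. (if a = g b then 1/2 else 0) + 1 / (2 * real (card T)))"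
      by (intro sum_mono) auto
    also have "\<dots> \<le> 1/2 + 1/2" unfolding sum.distrib using T c by (intro add_mono) (auto simp: sum.delta)
    finally show "(\<Sum>a\<in>A ` set_pmf P. ?r a b) \<le> 1" by simp
  qed (use c in auto)
  also have "\<dots> \<le> measure_pmf.expectation P (\<lambda>w. 1 + indicator {w. g (B w) \<noteq> A w} w * log 2 (real (card T)))"
    using c by (intro integral_mono integrable_finite_pmf[OF fin])
      (auto simp: log_divide log_mult log_inverse split: split_indicator)
  also have "\<dots> = 1 + measure_pmf.prob P {w. g (B w) \<noteq> A w} * log 2 (real (card T))"
    by (subst Bochner_Integration.integral_add) (auto intro: integrable_finite_pmf[OF fin])
  finally show ?thesis .
qed

text \<open>If \<open>A\<close> is generated from \<open>B\<close> by the kernel \<open>k\<close>,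
  the ratio inside \<open>hc\<close> is \<open>k\<close> itself. Memorylessness of the channel and
  uniformity of the messages enter the converse through this lemma.\<close>

lemma hc_kernel:
  assumes fin: "finite (set_pmf P)"
    and law: "map_pmf (\<lambda>w. (B w, A w)) P = bind_pmf (map_pmf B P) (\<lambda>b. map_pmf (Pair b) (k b))"
  shows "hc P A B = measure_pmf.expectation P (\<lambda>w. - log 2 (pmf (k (B w)) (A w)))"
proof -
  have "pmf (map_pmf (\<lambda>w. (A w, B w)) P) (A w, B w) / pmf (map_pmf B P) (B w) = pmf (k (B w)) (A w)"
    if w: "w \<in> set_pmf P" for w
  proof -
    have pb: "pmf (map_pmf (Pair b) (k b)) (B w, A w) = (if b = B w then pmf (k (B w)) (A w) else 0)" for b
      by (auto simp: pmf_map_inj' inj_def pmf_eq_0_set_pmf)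
    have "pmf (map_pmf (\<lambda>w. (A w, B w)) P) (A w, B w) = pmf (map_pmf (\<lambda>w. (B w, A w)) P) (B w, A w)"
      by (rule pmf_map_eq) auto
    also have "\<dots> = measure_pmf.expectation (map_pmf B P) (\<lambda>b. if b = B w then pmf (k (B w)) (A w) else 0)"
      unfolding law pmf_bind pb ..
    also have "\<dots> = pmf (map_pmf B P) (B w) * pmf (k (B w)) (A w)"
      by (subst integral_measure_pmf_real[of "{B w}"]) (auto split: if_splits)
    finally show ?thesis using pmf_map_pos[OF w, of B] by (simp only:) simp
  qed
  then show ?thesis unfolding hc_def
    by (intro integral_cong_AE) (auto simp: AE_measure_pmf_iff)
qed

section \<open>Information measures of the library expressed through \<open>hc\<close>, with
  countable alphabets\<close>

lemma prob_pmf_info: "information_space (measure_pmf P) 2"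
  by unfold_locales simp

lemma pair_count_space: "count_space (UNIV :: 'a::countable set) \<Otimes>\<^sub>M count_space (UNIV :: 'b::countable set) = count_space UNIV"
  by (subst pair_measure_countable) auto

lemma distributed_pmf: "distributed (measure_pmf P) (count_space UNIV) A (pmf (map_pmf A P))"
  unfolding distributed_def
  by (auto simp: map_pmf_rep_eq[symmetric] measure_pmf_eq_density[symmetric])

lemma distributed_pmf_pair:
  fixes A :: "'w \<Rightarrow> 'a::countable" and B :: "'w \<Rightarrow> 'b::countable"
  shows "distributed (measure_pmf P) (count_space UNIV \<Otimes>\<^sub>M count_space UNIV) (\<lambda>w. (A w, B w)) (pmf (map_pmf (\<lambda>w. (A w, B w)) P))"
  unfolding pair_count_space by (rule distributed_pmf)

lemma pmf_map_nz: "w \<in> set_pmf P \<Longrightarrow> pmf (map_pmf f P) (f w) \<noteq> 0"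
  by (auto simp del: pmf_map simp: pmf_eq_0_set_pmf)

lemma integral_count_space_pmf:
  "(\<integral>x. pmf P x * g x \<partial>count_space UNIV) = measure_pmf.expectation P (g :: _ \<Rightarrow> real)"
  unfolding measure_pmf_eq_density by (subst integral_density) auto

lemma mutual_information_pmf:
  fixes A :: "'w \<Rightarrow> 'a::countable" and B :: "'w \<Rightarrow> 'b::countable"
  shows "prob_space.mutual_information (measure_pmf P) 2 (count_space UNIV) (count_space UNIV) A B =
    measure_pmf.expectation P (\<lambda>w. log 2 (pmf (map_pmf (\<lambda>w. (A w, B w)) P) (A w, B w) / (pmf (map_pmf A P) (A w) * pmf (map_pmf B P) (B w))))"
proof -
  interpret information_space "measure_pmf P" 2 by (rule prob_pmf_info)
  let ?Q = "map_pmf (\<lambda>w. (A w, B w)) P"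
  have "prob_space.mutual_information (measure_pmf P) 2 (count_space UNIV) (count_space UNIV) A B =
     (\<integral>x. pmf ?Q x * log 2 (pmf ?Q x / (pmf (map_pmf A P) (fst x) * pmf (map_pmf B P) (snd x))) \<partial>(count_space UNIV \<Otimes>\<^sub>M count_space UNIV))"
    by (rule mutual_information_distr[OF _ _ distributed_pmf _ distributed_pmf _ distributed_pmf_pair])
      (auto intro!: sigma_finite_measure_count_space_countable)
  also have "\<dots> = measure_pmf.expectation ?Q (\<lambda>x. log 2 (pmf ?Q x / (pmf (map_pmf A P) (fst x) * pmf (map_pmf B P) (snd x))))"
    unfolding pair_count_space by (rule integral_count_space_pmf)
  finally show ?thesis by simp
qed

lemma cond_entropy_eq_hc:
  fixes A :: "'w \<Rightarrow> 'a::countable" and B :: "'w \<Rightarrow> 'b::countable"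
  shows "cond_entropy P A B = hc P A B"
proof -
  interpret information_space "measure_pmf P" 2 by (rule prob_pmf_info)
  let ?Q = "map_pmf (\<lambda>w. (A w, B w)) P"
  have "cond_entropy P A B = - (\<integral>(x, y). pmf ?Q (x, y) * log 2 (pmf ?Q (x, y) / pmf (map_pmf B P) y) \<partial>(count_space UNIV \<Otimes>\<^sub>M count_space UNIV))"
    unfolding cond_entropy_def
    by (subst conditional_entropy_generic_eq[OF _ _ distributed_pmf _ distributed_pmf_pair])
      (auto intro!: sigma_finite_measure_count_space_countable)
  also have "\<dots> = - (\<integral>x. pmf ?Q x * log 2 (pmf ?Q x / pmf (map_pmf B P) (snd x)) \<partial>count_space UNIV)"
    unfolding pair_count_space by (simp add: split_beta')
  also have "\<dots> = - measure_pmf.expectation ?Q (\<lambda>x. log 2 (pmf ?Q x / pmf (map_pmf B P) (snd x)))"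
    by (subst integral_count_space_pmf) simp
  finally show ?thesis by (simp add: hc_def)
qed

lemma neg_x_log2_le: "0 < x \<Longrightarrow> - x * log 2 x \<le> 1 / ln 2"
proof -
  assume x: "0 < x"
  have "- ln x \<le> 1 / x - 1" using ln_le_minus_one[of "1/x"] x by (simp add: ln_div)
  then have "x * (- ln x) \<le> x * (1 / x - 1)" using x by (intro mult_left_mono) auto
  also have "\<dots> \<le> 1" using x by (simp add: algebra_simps)
  finally show ?thesis using divide_right_mono[of "x * (- ln x)" 1 "ln 2"] by (simp add: log_def)
qed

text \<open>The integrand times the joint probability is at most \<open>P(b) / ln 2\<close>, because
  \<open>- x log x\<close> is bounded. Summed over the finitely many values of \<open>A\<close> this
  stays finite, however large the range of \<open>B\<close> is; that makes conditioning on a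
  countable \<open>U\<close> harmless.\<close>

lemma integrable_log_cond:
  fixes A :: "'w \<Rightarrow> 'a::finite" and B :: "'w \<Rightarrow> 'b"
  shows "integrable (measure_pmf P) (\<lambda>w. log 2 (pmf (map_pmf (\<lambda>w. (A w, B w)) P) (A w, B w) / pmf (map_pmf B P) (B w)))"
proof -
  let ?Q = "map_pmf (\<lambda>w. (A w, B w)) P"
  let ?pb = "map_pmf B P"
  let ?g = "\<lambda>x. - log 2 (pmf ?Q x / pmf ?pb (snd x))"
  let ?Q' = "pair_pmf (pmf_of_set (UNIV :: 'a set)) ?pb"
  let ?c = "real CARD('a) / ln 2"
  have ap: "0 < pmf ?Q x \<and> 0 < pmf ?pb (snd x) \<and> pmf ?Q x \<le> pmf ?pb (snd x)" if x: "x \<in> set_pmf ?Q" for x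
  proof -
    obtain w where w: "w \<in> set_pmf P" "x = (A w, B w)" using x by auto
    show ?thesis using pmf_map_pos[OF w(1), of B] pmf_map_pos[OF w(1), of "\<lambda>w. (A w, B w)"] w(2)
      pmf_map_mono[of P "\<lambda>w. (A w, B w)" "(A w, B w)" B "B w"] by (simp del: pmf_map)
  qed
  have "integrable (measure_pmf ?Q) ?g"
  proof (rule integrableI_nonneg)
    show "AE x in measure_pmf ?Q. 0 \<le> ?g x"
      unfolding AE_measure_pmf_iff using ap log2_quot_nonpos by fastforce
    have "(\<integral>\<^sup>+ x. ennreal (?g x) \<partial>measure_pmf ?Q) = (\<integral>\<^sup>+ x. ennreal (pmf ?Q x) * ennreal (?g x) \<partial>count_space UNIV)"
      by (rule nn_integral_measure_pmf)
    also have "\<dots> \<le> (\<integral>\<^sup>+ x. ennreal ?c * ennreal (pmf ?Q' x) \<partial>count_space UNIV)"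
    proof (rule nn_integral_mono)
      fix x :: "'a \<times> 'b"
      show "ennreal (pmf ?Q x) * ennreal (?g x) \<le> ennreal ?c * ennreal (pmf ?Q' x)"
      proof (cases "x \<in> set_pmf ?Q")
        case True
        note p = ap[OF True]
        have "pmf ?Q x * ?g x = pmf ?pb (snd x) * (- (pmf ?Q x / pmf ?pb (snd x)) * log 2 (pmf ?Q x / pmf ?pb (snd x)))"
          using p by (simp del: pmf_map)
        also have "\<dots> \<le> pmf ?pb (snd x) * (1 / ln 2)"
          using p by (intro mult_left_mono neg_x_log2_le) (auto simp del: pmf_map)
        also have "\<dots> = ?c * pmf ?Q' x" by (cases x) (simp add: pmf_pair del: pmf_map)
        finally show ?thesis using p
          by (simp add: ennreal_mult'[symmetric] ennreal_mult''[symmetric] ennreal_leI del: pmf_map)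
      next
        case False
        then have "pmf ?Q x = 0" by (simp only: pmf_eq_0_set_pmf not_False_eq_True)
        then show ?thesis by (simp only: ennreal_0 mult_zero_left zero_le)
      qed
    qed
    also have "\<dots> = ennreal ?c" by (subst nn_integral_cmult) (auto simp: nn_integral_pmf)
    also have "\<dots> < \<infinity>" by simp
    finally show "(\<integral>\<^sup>+ x. ennreal (?g x) \<partial>measure_pmf ?Q) < \<infinity>" .
  qed auto
  then have "integrable (measure_pmf ?Q) (\<lambda>x. - ?g x)" by (rule integrable_minus)
  then show ?thesis by simp
qed

lemma integrable_log_marginal:
  fixes A :: "'w \<Rightarrow> 'a::finite"
  shows "integrable (measure_pmf P) (\<lambda>w. log 2 (pmf (map_pmf A P) (A w)))"
proof -
  have e: "pmf (map_pmf (\<lambda>w. (A w, ())) P) (A w, ()) = pmf (map_pmf A P) (A w)"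
    "pmf (map_pmf (\<lambda>w. ()) P) () = 1" for w
    by (rule pmf_map_eq) auto
  show ?thesis using integrable_log_cond[of P A "\<lambda>_. ()"] unfolding e by simp
qed

text \<open>The underlying definition is the difference \<open>I(A;(B,C)) - I(A;C)\<close>. With
  \<open>A\<close> finite, \<open>log P(A)\<close> is integrable and cancels between the
  two.\<close>

lemma cond_mutual_info_eq_hc:
  fixes A :: "'w \<Rightarrow> 'a::finite" and B :: "'w \<Rightarrow> 'b::finite" and C :: "'w \<Rightarrow> 'c::countable"
  shows "cond_mutual_info P A B C = hc P B C - hc P B (\<lambda>w. (A w, C w))"
proof -
  let ?p = "\<lambda>f w. pmf (map_pmf f P) (f w)"
  let ?abc = "?p (\<lambda>w. (A w, B w, C w))" and ?bc = "?p (\<lambda>w. (B w, C w))" and ?ac = "?p (\<lambda>w. (A w, C w))"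
  let ?E = "measure_pmf.expectation P"
  have perm: "pmf (map_pmf (\<lambda>w. (B w, A w, C w)) P) (B w, A w, C w) = ?abc w" for w
    by (rule pmf_map_eq) auto
  note pos = pmf_map_nz[of _ P "\<lambda>w. (A w, B w, C w)"] pmf_map_nz[of _ P "\<lambda>w. (B w, C w)"]
    pmf_map_nz[of _ P "\<lambda>w. (A w, C w)"] pmf_map_nz[of _ P A] pmf_map_nz[of _ P C]
  note int = integrable_log_cond[of P A "\<lambda>w. (B w, C w)"] integrable_log_cond[of P A C] integrable_log_marginal[of P A]
    integrable_log_cond[of P B C] integrable_log_cond[of P B "\<lambda>w. (A w, C w)", unfolded perm]
  have "cond_mutual_info P A B C = ?E (\<lambda>w. log 2 (?abc w / (?p A w * ?bc w))) - ?E (\<lambda>w. log 2 (?ac w / (?p A w * ?p C w)))"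
    unfolding cond_mutual_info_def prob_space.conditional_mutual_information_def[OF measure_pmf.prob_space_axioms] pair_count_space
    by (subst mutual_information_pmf, subst mutual_information_pmf) (rule refl)
  also have "?E (\<lambda>w. log 2 (?abc w / (?p A w * ?bc w))) = ?E (\<lambda>w. log 2 (?abc w / ?bc w) - log 2 (?p A w))"
    using pos by (intro integral_cong_AE) (auto simp: AE_measure_pmf_iff log_divide log_mult simp del: pmf_map)
  also have "?E (\<lambda>w. log 2 (?ac w / (?p A w * ?p C w))) = ?E (\<lambda>w. log 2 (?ac w / ?p C w) - log 2 (?p A w))"
    using pos by (intro integral_cong_AE) (auto simp: AE_measure_pmf_iff log_divide log_mult simp del: pmf_map)
  also have "?E (\<lambda>w. log 2 (?abc w / ?bc w) - log 2 (?p A w)) - ?E (\<lambda>w. log 2 (?ac w / ?p C w) - log 2 (?p A w))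
     = ?E (\<lambda>w. log 2 (?abc w / ?bc w) - log 2 (?ac w / ?p C w))"
    using int by (simp del: pmf_map)
  also have "\<dots> = ?E (\<lambda>w. - log 2 (?bc w / ?p C w) - - log 2 (?abc w / ?ac w))"
    using pos by (intro integral_cong_AE) (auto simp: AE_measure_pmf_iff log_divide log_mult simp del: pmf_map)
  also have "\<dots> = hc P B C - hc P B (\<lambda>w. (A w, C w))"
    unfolding hc_def perm by (subst Bochner_Integration.integral_diff) (use int in \<open>auto simp del: pmf_map\<close>)
  finally show ?thesis .
qed

text \<open>The variant for \<open>I(U;S_1|S_2)\<close>, where \<open>A\<close> is the countable
  \<open>U\<close> and \<open>log P(A)\<close> may fail to be integrable. The logarithms are grouped
  the other way: \<open>log P(B,C|A)\<close> and \<open>log P(C|A)\<close> against the marginals of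
  the finite \<open>(B,C)\<close> and \<open>C\<close>.\<close>

lemma cond_mutual_info_eq_hc':
  fixes A :: "'w \<Rightarrow> 'a::countable" and B :: "'w \<Rightarrow> 'b::finite" and C :: "'w \<Rightarrow> 'c::finite"
  shows "cond_mutual_info P A B C = hc P B C - hc P B (\<lambda>w. (A w, C w))"
proof -
  let ?p = "\<lambda>f w. pmf (map_pmf f P) (f w)"
  let ?abc = "?p (\<lambda>w. (A w, B w, C w))" and ?bc = "?p (\<lambda>w. (B w, C w))" and ?ac = "?p (\<lambda>w. (A w, C w))"
  let ?E = "measure_pmf.expectation P"
  have perm: "pmf (map_pmf (\<lambda>w. (B w, A w, C w)) P) (B w, A w, C w) = ?abc w"
    "pmf (map_pmf (\<lambda>w. ((B w, C w), A w)) P) ((B w, C w), A w) = ?abc w"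
    "pmf (map_pmf (\<lambda>w. (C w, A w)) P) (C w, A w) = ?ac w" for w
    by (rule pmf_map_eq; auto)+
  note pos = pmf_map_nz[of _ P "\<lambda>w. (A w, B w, C w)"] pmf_map_nz[of _ P "\<lambda>w. (B w, C w)"]
    pmf_map_nz[of _ P "\<lambda>w. (A w, C w)"] pmf_map_nz[of _ P A] pmf_map_nz[of _ P C]
  note int = integrable_log_cond[of P "\<lambda>w. (B w, C w)" A, unfolded perm] integrable_log_cond[of P C A, unfolded perm]
    integrable_log_marginal[of P C] integrable_log_marginal[of P "\<lambda>w. (B w, C w)"]
    integrable_log_cond[of P B C] integrable_log_cond[of P B "\<lambda>w. (A w, C w)", unfolded perm]
  have "cond_mutual_info P A B C = ?E (\<lambda>w. log 2 (?abc w / (?p A w * ?bc w))) - ?E (\<lambda>w. log 2 (?ac w / (?p A w * ?p C w)))"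
    unfolding cond_mutual_info_def prob_space.conditional_mutual_information_def[OF measure_pmf.prob_space_axioms] pair_count_space
    by (subst mutual_information_pmf, subst mutual_information_pmf) (rule refl)
  also have "?E (\<lambda>w. log 2 (?abc w / (?p A w * ?bc w))) = ?E (\<lambda>w. log 2 (?abc w / ?p A w) - log 2 (?bc w))"
    using pos by (intro integral_cong_AE) (auto simp: AE_measure_pmf_iff log_divide log_mult simp del: pmf_map)
  also have "?E (\<lambda>w. log 2 (?ac w / (?p A w * ?p C w))) = ?E (\<lambda>w. log 2 (?ac w / ?p A w) - log 2 (?p C w))"
    using pos by (intro integral_cong_AE) (auto simp: AE_measure_pmf_iff log_divide log_mult simp del: pmf_map)
  also have "?E (\<lambda>w. log 2 (?abc w / ?p A w) - log 2 (?bc w)) - ?E (\<lambda>w. log 2 (?ac w / ?p A w) - log 2 (?p C w))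
     = ?E (\<lambda>w. (log 2 (?abc w / ?p A w) - log 2 (?bc w)) - (log 2 (?ac w / ?p A w) - log 2 (?p C w)))"
    using int by (intro Bochner_Integration.integral_diff[symmetric] Bochner_Integration.integrable_diff) (auto simp del: pmf_map)
  also have "\<dots> = ?E (\<lambda>w. - log 2 (?bc w / ?p C w) - - log 2 (?abc w / ?ac w))"
    using pos by (intro integral_cong_AE) (auto simp: AE_measure_pmf_iff log_divide log_mult simp del: pmf_map)
  also have "\<dots> = hc P B C - hc P B (\<lambda>w. (A w, C w))"
    unfolding hc_def perm by (subst Bochner_Integration.integral_diff) (use int in \<open>auto simp del: pmf_map\<close>)
  finally show ?thesis .
qed

section \<open>The region as a condition on a convex hull\<close>

definition eta :: "real \<Rightarrow> real" where "eta x = - (x * log 2 x)"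

lemma continuous_on_eta: "continuous_on {0..} eta"
proof -
  have "((\<lambda>x::real. - (x * log 2 x)) \<longlongrightarrow> 0) (at_right 0)" by real_asymp
  then have z: "(eta \<longlongrightarrow> eta 0) (at 0 within {0..})"
    unfolding eta_def[abs_def] by (simp add: at_within_Ici_at_right)
  show ?thesis unfolding continuous_on_def
  proof
    fix x :: real assume x: "x \<in> {0..}"
    show "(eta \<longlongrightarrow> eta x) (at x within {0..})"
    proof (cases "x = 0")
      case False
      with x have "isCont eta x" unfolding eta_def[abs_def] by (intro continuous_intros) auto
      then have "(eta \<longlongrightarrow> eta x) (at x)" by (simp only: isCont_def)
      then show ?thesis by (rule tendsto_within_subset) simp
    qed (use z in simp)
  qed
qed

lemma eta_mult: "0 \<le> c \<Longrightarrow> 0 \<le> x \<Longrightarrow> eta (c * x) = c * eta x + x * eta c"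
  by (cases "c = 0"; cases "x = 0") (auto simp: eta_def log_mult algebra_simps)

text \<open>The mass need not sum to one: it will be the slice \<open>U = u\<close> of a joint law,
  not divided by \<open>P(u)\<close>, so that null values of \<open>U\<close> need no special
  case.\<close>

definition mass_ent :: "('w::finite \<Rightarrow> real) \<Rightarrow> ('w \<Rightarrow> 'a) \<Rightarrow> real" where
  "mass_ent j A = (\<Sum>a\<in>range A. eta (\<Sum>w | A w = a. j w))"

definition mass_hc :: "('w::finite \<Rightarrow> real) \<Rightarrow> ('w \<Rightarrow> 'a) \<Rightarrow> ('w \<Rightarrow> 'b) \<Rightarrow> real" where
  "mass_hc j A B = mass_ent j (\<lambda>w. (A w, B w)) - mass_ent j B"

lemma sum_fibres: "(\<Sum>a\<in>range A. (\<Sum>w | A w = a. f w)) = (\<Sum>w\<in>UNIV. f w)"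
  for A :: "'w::finite \<Rightarrow> 'a" and f :: "'w \<Rightarrow> real"
proof -
  have "(\<Sum>w\<in>UNIV. f w) = (\<Sum>a\<in>range A. sum f {w \<in> UNIV. A w = a})"
    by (rule sum.image_gen) simp
  then show ?thesis by simp
qed

lemma mass_ent_scale:
  assumes "0 \<le> c" "\<And>w. 0 \<le> j w"
  shows "mass_ent (\<lambda>w. c * j w) A = c * mass_ent j A + (\<Sum>w\<in>UNIV. j w) * eta c"
proof -
  have "mass_ent (\<lambda>w. c * j w) A = (\<Sum>a\<in>range A. c * eta (\<Sum>w | A w = a. j w) + (\<Sum>w | A w = a. j w) * eta c)"
    unfolding mass_ent_def by (intro sum.cong refl) (simp add: sum_distrib_left[symmetric] eta_mult assms sum_nonneg)
  then show ?thesis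
    by (simp add: sum.distrib mass_ent_def sum_distrib_left sum_distrib_right[symmetric] sum_fibres)
qed

text \<open>The terms \<open>eta c\<close> times the total mass, produced by the two entropies,
  cancel; so conditional entropy is homogeneous of degree one. A slice therefore contributes
  \<open>P(u)\<close> times the value at its normalisation, which is the source of all affinity
  statements.\<close>

lemma mass_hc_scale:
  assumes "0 \<le> c" "\<And>w. 0 \<le> j w"
  shows "mass_hc (\<lambda>w. c * j w) A B = c * mass_hc j A B"
  unfolding mass_hc_def mass_ent_scale[OF assms] by (simp add: algebra_simps)

lemma mass_ent_sum:
  assumes nn: "\<And>w. 0 \<le> j w"
  shows "mass_ent j A = (\<Sum>w\<in>UNIV. - (j w * log 2 (\<Sum>w' | A w' = A w. j w')))"
proof -
  have "(\<Sum>w\<in>UNIV. - (j w * log 2 (\<Sum>w' | A w' = A w. j w'))) =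
    (\<Sum>a\<in>range A. \<Sum>w | A w = a. - (j w * log 2 (\<Sum>w' | A w' = A w. j w')))"
    by (rule sum_fibres[symmetric])
  also have "\<dots> = mass_ent j A" unfolding mass_ent_def eta_def
    by (intro sum.cong refl) (simp add: sum_negf sum_distrib_right)
  finally show ?thesis ..
qed

text \<open>The form that matches the definition of \<open>hc\<close>. Points of mass zero
  contribute zero on both sides, whatever the logarithms are; at the others both fibre sums are
  positive.\<close>

lemma mass_hc_sum:
  assumes nn: "\<And>w. 0 \<le> j w"
  shows "mass_hc j A B = (\<Sum>w\<in>UNIV. j w * - log 2 ((\<Sum>w' | A w' = A w \<and> B w' = B w. j w') / (\<Sum>w' | B w' = B w. j w')))"
  unfolding mass_hc_def mass_ent_sum[OF nn] sum_subtractf[symmetric]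
proof (intro sum.cong refl)
  fix w
  show "- (j w * log 2 (\<Sum>w' | (A w', B w') = (A w, B w). j w')) - - (j w * log 2 (\<Sum>w' | B w' = B w. j w')) =
    j w * - log 2 ((\<Sum>w' | A w' = A w \<and> B w' = B w. j w') / (\<Sum>w' | B w' = B w. j w'))"
  proof (cases "j w = 0")
    case False
    with nn[of w] have p: "0 < j w" by simp
    have "j w \<le> (\<Sum>w' | A w' = A w \<and> B w' = B w. j w')" "j w \<le> (\<Sum>w' | B w' = B w. j w')"
      by (rule member_le_sum; use nn in auto)+
    with p have "(\<Sum>w' | A w' = A w \<and> B w' = B w. j w') \<noteq> 0" "(\<Sum>w' | B w' = B w. j w') \<noteq> 0" by auto
    then show ?thesis by (simp add: log_divide algebra_simps)
  qed simp
qed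

lemma continuous_on_mass_ent:
  assumes "\<And>w. continuous_on K (\<lambda>k. j k w)" "\<And>k w. k \<in> K \<Longrightarrow> 0 \<le> j k w"
  shows "continuous_on K (\<lambda>k. mass_ent (j k) A)"
  unfolding mass_ent_def
proof (intro continuous_on_sum)
  fix a
  show "continuous_on K (\<lambda>k. eta (\<Sum>w | A w = a. j k w))"
    by (rule continuous_on_compose2[OF continuous_on_eta]) (auto intro!: continuous_on_sum assms sum_nonneg)
qed

lemma continuous_on_mass_hc:
  assumes "\<And>w. continuous_on K (\<lambda>k. j k w)" "\<And>k w. k \<in> K \<Longrightarrow> 0 \<le> j k w"
  shows "continuous_on K (\<lambda>k. mass_hc (j k) A B)"
  unfolding mass_hc_def by (intro continuous_intros continuous_on_mass_ent assms)

lemma pmf_map_sum: "pmf (map_pmf A P) a = (\<Sum>w | A w = a. pmf P w)" for P :: "'w::finite pmf"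
proof -
  have "A -` {a} = {w. A w = a}" by auto
  then show ?thesis by (simp add: pmf_map measure_measure_pmf_finite)
qed

lemma hc_finite_type: "hc P A B = mass_hc (pmf P) A B" for P :: "'w::finite pmf"
  unfolding hc_def mass_hc_sum[of "pmf P", OF pmf_nonneg]
  by (subst integral_measure_pmf_real[of UNIV])
    (auto simp del: pmf_map simp: pmf_map_sum mult.commute)

lemma expectation_sums_snd:
  fixes P :: "('w::finite \<times> nat) pmf"
  assumes "integrable (measure_pmf P) g"
  shows "(\<lambda>u. \<Sum>w\<in>UNIV. pmf P (w, u) * g (w, u)) sums measure_pmf.expectation P g"
proof -
  interpret pair_sigma_finite "count_space (UNIV :: 'w set)" "count_space (UNIV :: nat set)"
    by (intro pair_sigma_finite.intro sigma_finite_measure_count_space_countable) auto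
  have i: "integrable (count_space UNIV \<Otimes>\<^sub>M count_space UNIV) (\<lambda>x. pmf P x * g x)"
    using assms unfolding pair_count_space measure_pmf_eq_density
    by (subst (asm) integrable_density) auto
  then have i': "integrable (count_space UNIV \<Otimes>\<^sub>M count_space UNIV) (\<lambda>(w, u). pmf P (w, u) * g (w, u))"
    by (simp add: split_beta')
  have "(\<lambda>u. \<integral>w. pmf P (w, u) * g (w, u) \<partial>count_space UNIV) sums
      (\<integral>u. \<integral>w. pmf P (w, u) * g (w, u) \<partial>count_space UNIV \<partial>count_space UNIV)"
    by (rule sums_integral_count_space_nat) (rule integrable_snd[OF i'])
  also have "(\<integral>u. \<integral>w. pmf P (w, u) * g (w, u) \<partial>count_space UNIV \<partial>count_space UNIV) =
     (\<integral>x. pmf P x * g x \<partial>(count_space UNIV \<Otimes>\<^sub>M count_space UNIV))"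
    using integral_snd[OF i'] by (simp add: split_beta')
  also have "\<dots> = measure_pmf.expectation P g"
    unfolding pair_count_space by (rule integral_count_space_pmf)
  finally show ?thesis by (simp add: lebesgue_integral_count_space_finite)
qed

text \<open>Conditioning on \<open>U\<close> splits the entropy into its slices. \<open>A\<close> is
  finite, so \<open>integrable_log_cond\<close> justifies exchanging the sum over \<open>u\<close>
  with the expectation.\<close>

lemma hc_sums:
  fixes P :: "('w::finite \<times> nat) pmf" and A :: "'w \<Rightarrow> 'a::finite" and B :: "'w \<Rightarrow> 'b"
  shows "(\<lambda>u. mass_hc (\<lambda>w. pmf P (w, u)) A B) sums hc P (\<lambda>x. A (fst x)) (\<lambda>x. (B (fst x), snd x))"
proof -
  let ?g = "\<lambda>x. - log 2 (pmf (map_pmf (\<lambda>x. (A (fst x), (B (fst x), snd x))) P) (A (fst x), (B (fst x), snd x)) / pmf (map_pmf (\<lambda>x. (B (fst x), snd x)) P) (B (fst x), snd x))"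
  have fib: "pmf (map_pmf (\<lambda>x. (C (fst x), snd x)) P) (C w, u) = (\<Sum>w' | C w' = C w. pmf P (w', u))" for C :: "'w \<Rightarrow> 'c" and w u
  proof -
    have "(\<lambda>x. (C (fst x), snd x)) -` {(C w, u)} = (\<lambda>w'. (w', u)) ` {w'. C w' = C w}" by auto
    then show ?thesis by (simp add: pmf_map measure_measure_pmf_finite sum.reindex inj_on_def)
  qed
  have fib2: "pmf (map_pmf (\<lambda>x. (A (fst x), (B (fst x), snd x))) P) (A w, (B w, u)) = (\<Sum>w' | A w' = A w \<and> B w' = B w. pmf P (w', u))" for w u
  proof -
    have "pmf (map_pmf (\<lambda>x. (A (fst x), (B (fst x), snd x))) P) (A w, (B w, u)) = pmf (map_pmf (\<lambda>x. ((A (fst x), B (fst x)), snd x)) P) ((A w, B w), u)"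
      by (rule pmf_map_eq) auto
    then show ?thesis using fib[of "\<lambda>w. (A w, B w)" w u] by simp
  qed
  have "(\<lambda>u. \<Sum>w\<in>UNIV. pmf P (w, u) * ?g (w, u)) sums measure_pmf.expectation P ?g"
    by (intro expectation_sums_snd Bochner_Integration.integrable_minus integrable_log_cond)
  moreover have "(\<Sum>w\<in>UNIV. pmf P (w, u) * ?g (w, u)) = mass_hc (\<lambda>w. pmf P (w, u)) A B" for u
    unfolding mass_hc_sum[of "\<lambda>w. pmf P (w, u)", OF pmf_nonneg] fst_conv snd_conv fib fib2 ..
  ultimately show ?thesis by (simp only: hc_def)
qed

lemma pmf_bind_Pair: "pmf (bind_pmf p (\<lambda>x. map_pmf (Pair x) (k x))) (x, y) = pmf p x * pmf (k x) y"
proof -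
  have e: "pmf (map_pmf (Pair x') (k x')) (x, y) = (if x' = x then pmf (k x) y else 0)" for x'
    by (auto simp: pmf_map_inj' inj_def pmf_eq_0_set_pmf)
  show ?thesis unfolding pmf_bind e
    by (subst integral_measure_pmf_real[of "{x}"]) (auto split: if_splits)
qed

section \<open>The single-letter bounds as sums over the values of \<open>U\<close>\<close>

definition region_bounds :: "('s1::finite \<times> 's2::finite \<times> 'x1::finite \<times> nat \<times> 'z::finite \<times> 'x2::finite \<times> 'y::finite) pmf \<Rightarrow> real \<Rightarrow> real \<Rightarrow> bool" where
  "region_bounds P R1 R2 \<longleftrightarrow> (let
            S1 = (\<lambda>(s1, s2, x1, u, z, x2, y). s1);
            S2 = (\<lambda>(s1, s2, x1, u, z, x2, y). s2);
            X1 = (\<lambda>(s1, s2, x1, u, z, x2, y). x1);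
            U = (\<lambda>(s1, s2, x1, u, z, x2, y). u);
            Z = (\<lambda>(s1, s2, x1, u, z, x2, y). z);
            X2 = (\<lambda>(s1, s2, x1, u, z, x2, y). x2);
            Y = (\<lambda>(s1, s2, x1, u, z, x2, y). y);
            HZ = cond_entropy P Z (\<lambda>w. (S1 w, U w));
            IU = cond_mutual_info P U S1 S2
        in IU \<le> HZ \<and>
           R1 \<le> cond_mutual_info P X1 Y (\<lambda>w. (X2 w, Z w, S1 w, S2 w, U w)) + HZ - IU \<and>
           R2 \<le> cond_mutual_info P X2 Y (\<lambda>w. (X1 w, S1 w, S2 w, U w)) \<and>
           R1 + R2 \<le> cond_mutual_info P (\<lambda>w. (X1 w, X2 w)) Y (\<lambda>w. (Z w, S1 w, S2 w, U w))
                       + HZ - IU \<and>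
           R1 + R2 \<le> cond_mutual_info P (\<lambda>w. (X1 w, X2 w)) Y (\<lambda>w. (S1 w, S2 w)))"

locale cribbing_mac =
  fixes pS :: "('s1::finite \<times> 's2::finite) pmf"
    and zf :: "'x1::finite \<Rightarrow> 's1 \<Rightarrow> 'z::finite"
    and W :: "'x1 \<Rightarrow> 'x2::finite \<Rightarrow> 's1 \<Rightarrow> 's2 \<Rightarrow> 'y::finite pmf"
begin

abbreviation "S1c \<equiv> (\<lambda>(s1 :: 's1, s2 :: 's2, x1 :: 'x1, x2 :: 'x2, y :: 'y). s1)"
abbreviation "S2c \<equiv> (\<lambda>(s1 :: 's1, s2 :: 's2, x1 :: 'x1, x2 :: 'x2, y :: 'y). s2)"
abbreviation "X1c \<equiv> (\<lambda>(s1 :: 's1, s2 :: 's2, x1 :: 'x1, x2 :: 'x2, y :: 'y). x1)"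
abbreviation "X2c \<equiv> (\<lambda>(s1 :: 's1, s2 :: 's2, x1 :: 'x1, x2 :: 'x2, y :: 'y). x2)"
abbreviation "Yc \<equiv> (\<lambda>(s1 :: 's1, s2 :: 's2, x1 :: 'x1, x2 :: 'x2, y :: 'y). y)"
abbreviation "Zc \<equiv> (\<lambda>(s1 :: 's1, s2 :: 's2, x1 :: 'x1, x2 :: 'x2, y :: 'y). zf x1 s1)"

text \<open>\<open>info1\<close> to \<open>info4\<close> are the informations about \<open>Y\<close>
  in the four rate bounds, \<open>crib\<close> stands for \<open>H(Z|S_1,U)\<close> and
  \<open>state_left\<close> for \<open>H(S_1|S_2,U)\<close>. All of them are evaluated on slices of
  \<open>U\<close> except \<open>info4\<close>, which is evaluated on the whole law.\<close>

definition info1 :: "('s1 \<times> 's2 \<times> 'x1 \<times> 'x2 \<times> 'y \<Rightarrow> real) \<Rightarrow> real" where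
  "info1 j = mass_hc j Yc (\<lambda>w. (X2c w, Zc w, S1c w, S2c w)) - mass_hc j Yc (\<lambda>w. (X1c w, X2c w, Zc w, S1c w, S2c w))"
definition info2 :: "('s1 \<times> 's2 \<times> 'x1 \<times> 'x2 \<times> 'y \<Rightarrow> real) \<Rightarrow> real" where
  "info2 j = mass_hc j Yc (\<lambda>w. (X1c w, S1c w, S2c w)) - mass_hc j Yc (\<lambda>w. (X2c w, X1c w, S1c w, S2c w))"
definition info3 :: "('s1 \<times> 's2 \<times> 'x1 \<times> 'x2 \<times> 'y \<Rightarrow> real) \<Rightarrow> real" where
  "info3 j = mass_hc j Yc (\<lambda>w. (Zc w, S1c w, S2c w)) - mass_hc j Yc (\<lambda>w. ((X1c w, X2c w), Zc w, S1c w, S2c w))"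
definition crib :: "('s1 \<times> 's2 \<times> 'x1 \<times> 'x2 \<times> 'y \<Rightarrow> real) \<Rightarrow> real" where
  "crib j = mass_hc j Zc S1c"
definition state_left :: "('s1 \<times> 's2 \<times> 'x1 \<times> 'x2 \<times> 'y \<Rightarrow> real) \<Rightarrow> real" where
  "state_left j = mass_hc j S1c S2c"
definition info4 :: "('s1 \<times> 's2 \<times> 'x1 \<times> 'x2 \<times> 'y \<Rightarrow> real) \<Rightarrow> real" where
  "info4 j = mass_hc j Yc (\<lambda>w. (S1c w, S2c w)) - mass_hc j Yc (\<lambda>w. ((X1c w, X2c w), S1c w, S2c w))"

lemmas info_defs = info1_def info2_def info3_def crib_def state_left_def

text \<open>\<open>U\<close> becomes a separate coordinate, ready for slicing, and \<open>Z\<close>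
  is dropped as a function of \<open>(X_1, S_1)\<close>; the remaining coordinates form a finite
  type.\<close>

definition letter_law :: "('s1 \<Rightarrow> ('x1 \<times> nat) pmf) \<Rightarrow> ('z \<Rightarrow> nat \<Rightarrow> 's2 \<Rightarrow> 'x2 pmf) \<Rightarrow> (('s1 \<times> 's2 \<times> 'x1 \<times> 'x2 \<times> 'y) \<times> nat) pmf" where
  "letter_law pX1U pX2 = map_pmf (\<lambda>(s1, s2, x1, u, z, x2, y). ((s1, s2, x1, x2, y), u)) (single_letter pS zf W pX1U pX2)"

lemma single_letter_z:
  "(s1, s2, x1, u, z, x2, y) \<in> set_pmf (single_letter pS zf W pX1U pX2) \<Longrightarrow> z = zf x1 s1"
  by (auto simp: single_letter_def Let_def)

lemma single_letter_eq_map: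
  "single_letter pS zf W pX1U pX2 = map_pmf (\<lambda>((s1, s2, x1, x2, y), u). (s1, s2, x1, u, zf x1 s1, x2, y)) (letter_law pX1U pX2)"
proof -
  have "single_letter pS zf W pX1U pX2 = map_pmf id (single_letter pS zf W pX1U pX2)" by simp
  also have "\<dots> = map_pmf (\<lambda>(s1, s2, x1, u, z, x2, y). (s1, s2, x1, u, zf x1 s1, x2, y)) (single_letter pS zf W pX1U pX2)"
    by (rule map_pmf_cong) (auto dest: single_letter_z)
  finally show ?thesis by (simp add: letter_law_def map_pmf_comp split_beta')
qed

lemma pmf_letter_law:
  "pmf (letter_law pX1U pX2) ((s1, s2, x1, x2, y), u) =
     pmf pS (s1, s2) * pmf (pX1U s1) (x1, u) * pmf (pX2 (zf x1 s1) u s2) x2 * pmf (W x1 x2 s1 s2) y"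
proof -
  define J where "J = bind_pmf pS (\<lambda>s. map_pmf (Pair s) (bind_pmf (pX1U (fst s)) (\<lambda>a. map_pmf (Pair a)
     (bind_pmf (pX2 (zf (fst a) (fst s)) (snd a) (snd s)) (\<lambda>x2. map_pmf (Pair x2) (W (fst a) x2 (fst s) (snd s)))))))"
  let ?f = "\<lambda>(s :: 's1 \<times> 's2, a :: 'x1 \<times> nat, x2 :: 'x2, y :: 'y). ((fst s, snd s, fst a, x2, y), snd a)"
  have "letter_law pX1U pX2 = map_pmf ?f J"
    unfolding letter_law_def J_def single_letter_def Let_def
    by (simp add: map_bind_pmf bind_map_pmf split_beta' map_pmf_comp) (simp add: map_pmf_def bind_assoc_pmf bind_return_pmf)
  moreover have "inj ?f" by (auto simp: inj_def)
  ultimately have "pmf (letter_law pX1U pX2) (?f ((s1, s2), (x1, u), x2, y)) = pmf J ((s1, s2), (x1, u), x2, y)"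
    by (simp only: pmf_map_inj')
  then show ?thesis by (simp add: J_def pmf_bind_Pair)
qed

lemma hc_single_letter:
  "hc (single_letter pS zf W pX1U pX2) A B =
   hc (letter_law pX1U pX2) (\<lambda>((s1, s2, x1, x2, y), u). A (s1, s2, x1, u, zf x1 s1, x2, y)) (\<lambda>((s1, s2, x1, x2, y), u). B (s1, s2, x1, u, zf x1 s1, x2, y))"
  unfolding single_letter_eq_map hc_map by (simp add: split_beta')

lemma marginal_S: "map_pmf (\<lambda>w. (S1c (fst w), S2c (fst w))) (letter_law pX1U pX2) = pS"
  unfolding letter_law_def single_letter_def Let_def
  by (simp add: map_bind_pmf bind_map_pmf split_beta' map_pmf_comp bind_return_pmf')

text \<open>\<open>I(U;S_1|S_2)\<close> is split as \<open>H(S_1|S_2) - H(S_1|S_2,U)\<close>, whose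
  first term depends on \<open>pS\<close> alone. After that, every bound but the last is linear in
  sums over \<open>u\<close> of slice functionals.\<close>

lemma region_bounds_iff:
  fixes pX1U pX2
  defines "L \<equiv> letter_law pX1U pX2"
  assumes "(\<lambda>u. info1 (\<lambda>w. pmf L (w, u))) sums i1" "(\<lambda>u. info2 (\<lambda>w. pmf L (w, u))) sums i2"
    "(\<lambda>u. info3 (\<lambda>w. pmf L (w, u))) sums i3" "(\<lambda>u. crib (\<lambda>w. pmf L (w, u))) sums hz"
    "(\<lambda>u. state_left (\<lambda>w. pmf L (w, u))) sums hs"
  shows "region_bounds (single_letter pS zf W pX1U pX2) R1 R2 \<longleftrightarrow>
     hc pS fst snd - hs \<le> hz \<and> R1 \<le> i1 + hz - (hc pS fst snd - hs) \<and> R2 \<le> i2 \<and>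
     R1 + R2 \<le> i3 + hz - (hc pS fst snd - hs) \<and> R1 + R2 \<le> info4 (pmf (map_pmf fst L))"
proof -
  let ?P = "single_letter pS zf W pX1U pX2"
  let ?S1 = "(\<lambda>(s1, s2, x1, u, z, x2, y). s1) :: 's1 \<times> 's2 \<times> 'x1 \<times> nat \<times> 'z \<times> 'x2 \<times> 'y \<Rightarrow> 's1"
  let ?S2 = "(\<lambda>(s1, s2, x1, u, z, x2, y). s2) :: 's1 \<times> 's2 \<times> 'x1 \<times> nat \<times> 'z \<times> 'x2 \<times> 'y \<Rightarrow> 's2"
  let ?X1 = "(\<lambda>(s1, s2, x1, u, z, x2, y). x1) :: 's1 \<times> 's2 \<times> 'x1 \<times> nat \<times> 'z \<times> 'x2 \<times> 'y \<Rightarrow> 'x1"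
  let ?U = "(\<lambda>(s1, s2, x1, u, z, x2, y). u) :: 's1 \<times> 's2 \<times> 'x1 \<times> nat \<times> 'z \<times> 'x2 \<times> 'y \<Rightarrow> nat"
  let ?Z = "(\<lambda>(s1, s2, x1, u, z, x2, y). z) :: 's1 \<times> 's2 \<times> 'x1 \<times> nat \<times> 'z \<times> 'x2 \<times> 'y \<Rightarrow> 'z"
  let ?X2 = "(\<lambda>(s1, s2, x1, u, z, x2, y). x2) :: 's1 \<times> 's2 \<times> 'x1 \<times> nat \<times> 'z \<times> 'x2 \<times> 'y \<Rightarrow> 'x2"
  let ?Y = "(\<lambda>(s1, s2, x1, u, z, x2, y). y) :: 's1 \<times> 's2 \<times> 'x1 \<times> nat \<times> 'z \<times> 'x2 \<times> 'y \<Rightarrow> 'y"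
  have d: "(\<lambda>u. mass_hc (\<lambda>w. pmf L (w, u)) A B - mass_hc (\<lambda>w. pmf L (w, u)) A' B') sums
     (hc L (\<lambda>x. A (fst x)) (\<lambda>x. (B (fst x), snd x)) - hc L (\<lambda>x. A' (fst x)) (\<lambda>x. (B' (fst x), snd x)))"
    for A :: "_ \<Rightarrow> 'y" and B :: "_ \<Rightarrow> 'b" and A' :: "_ \<Rightarrow> 'y" and B' :: "_ \<Rightarrow> 'c"
    by (intro sums_diff hc_sums)
  have cong: "hc L A B = hc L A' B'" if "\<And>w. A w = A' w" "\<And>w w'. B w = B w' \<longleftrightarrow> B' w = B' w'"
    for A A' :: "_ \<Rightarrow> 'e" and B :: "_ \<Rightarrow> 'f" and B' :: "_ \<Rightarrow> 'g"
  proof -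
    have "A = A'" using that(1) by (rule ext)
    show ?thesis unfolding \<open>A = A'\<close>
    proof (rule hc_cong)
      show "(A' w', B w') = (A' w, B w) \<longleftrightarrow> (A' w', B' w') = (A' w, B' w)" for w w'
        unfolding prod.inject using that(2)[of w' w] by blast
    qed (rule that(2))
  qed
  have 1: "cond_mutual_info ?P ?X1 ?Y (\<lambda>w. (?X2 w, ?Z w, ?S1 w, ?S2 w, ?U w)) = i1"
    unfolding cond_mutual_info_eq_hc hc_single_letter L_def[symmetric]
  proof (rule sums_unique2[OF _ assms(2)[unfolded info1_def]], rule back_subst[of "(sums) _", OF d], intro arg_cong2[where f="(-)"])
  qed (rule cong; force simp: split_beta')+
  have 2: "cond_mutual_info ?P ?X2 ?Y (\<lambda>w. (?X1 w, ?S1 w, ?S2 w, ?U w)) = i2"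
    unfolding cond_mutual_info_eq_hc hc_single_letter L_def[symmetric]
  proof (rule sums_unique2[OF _ assms(3)[unfolded info2_def]], rule back_subst[of "(sums) _", OF d], intro arg_cong2[where f="(-)"])
  qed (rule cong; force simp: split_beta')+
  have 3: "cond_mutual_info ?P (\<lambda>w. (?X1 w, ?X2 w)) ?Y (\<lambda>w. (?Z w, ?S1 w, ?S2 w, ?U w)) = i3"
    unfolding cond_mutual_info_eq_hc hc_single_letter L_def[symmetric]
  proof (rule sums_unique2[OF _ assms(4)[unfolded info3_def]], rule back_subst[of "(sums) _", OF d], intro arg_cong2[where f="(-)"])
  qed (rule cong; force simp: split_beta')+
  have 4: "cond_entropy ?P ?Z (\<lambda>w. (?S1 w, ?U w)) = hz"
    unfolding cond_entropy_eq_hc hc_single_letter L_def[symmetric]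
    by (rule sums_unique2[OF _ assms(5)[unfolded crib_def]], rule back_subst[of "(sums) _", OF hc_sums])
       (rule cong; force simp: split_beta')
  have 5: "cond_mutual_info ?P ?U ?S1 ?S2 = hc pS fst snd - hs"
  proof -
    have "hc ?P ?S1 (\<lambda>w. (?U w, ?S2 w)) = hs"
      unfolding hc_single_letter L_def[symmetric]
      by (rule sums_unique2[OF _ assms(6)[unfolded state_left_def]], rule back_subst[of "(sums) _", OF hc_sums])
       (rule cong; force simp: split_beta')
    moreover have "hc ?P ?S1 ?S2 = hc pS fst snd"
    proof -
      have "hc pS fst snd = hc (map_pmf (\<lambda>w. (S1c (fst w), S2c (fst w))) L) fst snd"
        by (simp only: marginal_S L_def)
      then show ?thesis unfolding hc_single_letter hc_map L_def by (simp add: split_beta')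
    qed
    ultimately show ?thesis by (simp add: cond_mutual_info_eq_hc')
  qed
  have 6: "cond_mutual_info ?P (\<lambda>w. (?X1 w, ?X2 w)) ?Y (\<lambda>w. (?S1 w, ?S2 w)) = info4 (pmf (map_pmf fst L))"
  proof -
    have m: "mass_hc (pmf (map_pmf fst L)) A B = hc L (\<lambda>x. A (fst x)) (\<lambda>x. B (fst x))"
      for A :: "_ \<Rightarrow> 'y" and B :: "_ \<Rightarrow> 'b"
      by (simp only: hc_finite_type[symmetric] hc_map)
    show ?thesis
      unfolding info4_def m cond_mutual_info_eq_hc hc_single_letter L_def[symmetric]
      by (simp add: split_beta' del: pmf_map)
  qed
  show ?thesis unfolding region_bounds_def Let_def 1 2 3 4 5 6 by blast
qed

end

section \<open>Joint laws as barycentres of a compact set\<close>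

lemma sums_Pair: "f sums a \<Longrightarrow> g sums b \<Longrightarrow> (\<lambda>n. (f n, g n)) sums (a, b)"
  unfolding sums_def sum_prod by (rule tendsto_Pair)

lemma sums_vec: "(\<And>i. (\<lambda>n. f n $ i) sums (v $ i)) \<Longrightarrow> f sums (v :: real ^ 'n)"
  unfolding sums_def by (rule vec_tendstoI) simp

text \<open>The normalised partial sums are finite convex combinations, and their limit stays in the
  closed set.\<close>

lemma barycenter_in_closed_convex:
  fixes C :: "'v::real_normed_vector set"
  assumes C: "closed C" "convex C" and x: "\<And>n::nat. x n \<in> C" and l: "\<And>n. 0 \<le> l n" "l sums 1"
    and v: "(\<lambda>n. l n *\<^sub>R x n) sums v"
  shows "v \<in> C"
proof -
  let ?L = "\<lambda>n. sum l {..<n}"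
  have L1: "?L \<longlonglongrightarrow> 1" using l(2) by (simp add: sums_def)
  have "(\<lambda>n. (\<Sum>i<n. l i *\<^sub>R x i) /\<^sub>R ?L n) \<longlonglongrightarrow> v /\<^sub>R 1"
    using v by (intro tendsto_intros L1) (auto simp: sums_def)
  moreover have "\<forall>\<^sub>F n in sequentially. (\<Sum>i<n. l i *\<^sub>R x i) /\<^sub>R ?L n \<in> C"
    using order_tendstoD(1)[OF L1, of 0, simplified]
  proof eventually_elim
    case (elim n)
    have "(\<Sum>i<n. l i *\<^sub>R x i) /\<^sub>R ?L n = (\<Sum>i<n. (l i / ?L n) *\<^sub>R x i)"
      by (simp add: scaleR_sum_right divide_inverse_commute)
    also have "\<dots> \<in> C" using elim l(1) x
      by (intro convex_sum C) (auto simp: sum_divide_distrib[symmetric])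
    finally show ?case .
  qed
  ultimately show ?thesis using Lim_in_closed_set[OF C(1)] by fastforce
qed

lemma marginal_sums: "(\<lambda>u. pmf P (w, u)) sums pmf (map_pmf fst P) w" for P :: "('w::finite \<times> nat) pmf"
proof -
  have "(\<lambda>u. \<Sum>w'\<in>UNIV. pmf P (w', u) * indicator (fst -` {w}) (w', u)) sums measure_pmf.expectation P (indicator (fst -` {w}))"
    by (rule expectation_sums_snd) (simp add: integrable_real_indicator measure_pmf.emeasure_eq_measure)
  moreover have "(\<Sum>w'\<in>UNIV. pmf P (w', u) * indicator (fst -` {w}) (w', u)) = pmf P (w, u)" for u
    by (subst sum.mono_neutral_right[of _ "{w}"]) (auto split: split_indicator)
  ultimately show ?thesis by (simp add: pmf_map)
qed

context cribbing_mac
begin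

text \<open>The data attached to one value \<open>u\<close>: the law \<open>P(s1,x1|u)\<close> and
  the kernel \<open>P(x2|z,u,s2)\<close>. The joint law of \<open>(s1,x1)\<close> is used rather
  than a kernel from \<open>s1\<close>, because \<open>P(s1|u)\<close> varies with \<open>u\<close>
  and the requirement that it averages to \<open>P(s1)\<close> is linear.\<close>

definition params :: "((real ^ ('s1 \<times> 'x1)) \<times> (real ^ ('z \<times> 's2 \<times> 'x2))) set" where
  "params = {k. (\<forall>i. 0 \<le> fst k $ i) \<and> (\<Sum>i\<in>UNIV. fst k $ i) = 1 \<and> (\<forall>i. 0 \<le> snd k $ i) \<and>
     (\<forall>z s2. (\<Sum>x2\<in>UNIV. snd k $ (z, s2, x2)) = 1)}"

text \<open>The quotient is \<open>P(s2|s1)\<close>: \<open>U\<close> and \<open>X_1\<close> depend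
  on the states through \<open>S_1\<close> only. At an \<open>s1\<close> of probability zero it is
  0, by the convention for division by zero.\<close>

definition letter_mass :: "(real ^ ('s1 \<times> 'x1)) \<times> (real ^ ('z \<times> 's2 \<times> 'x2)) \<Rightarrow> 's1 \<times> 's2 \<times> 'x1 \<times> 'x2 \<times> 'y \<Rightarrow> real" where
  "letter_mass k = (\<lambda>(s1, s2, x1, x2, y). fst k $ (s1, x1) * (pmf pS (s1, s2) / pmf (map_pmf fst pS) s1) *
     snd k $ (zf x1 s1, s2, x2) * pmf (W x1 x2 s1 s2) y)"

text \<open>The law of \<open>(s1,x1)\<close> is kept to express that \<open>S_1\<close> has the
  prescribed marginal, the five functionals because they average over \<open>U\<close>, and the law
  itself because \<open>info4\<close> is computed after averaging.\<close>

definition point :: "(real ^ ('s1 \<times> 'x1)) \<times> (real ^ ('z \<times> 's2 \<times> 'x2)) \<Rightarrow>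
    (real ^ ('s1 \<times> 'x1)) \<times> (real \<times> real \<times> real \<times> real \<times> real) \<times> (real ^ ('s1 \<times> 's2 \<times> 'x1 \<times> 'x2 \<times> 'y))" where
  "point k = (fst k, (info1 (letter_mass k), info2 (letter_mass k), info3 (letter_mass k), crib (letter_mass k), state_left (letter_mass k)),
     (\<chi> w. letter_mass k w))"

definition vec_bounds :: "(real ^ ('s1 \<times> 'x1)) \<times> (real \<times> real \<times> real \<times> real \<times> real) \<times> (real ^ ('s1 \<times> 's2 \<times> 'x1 \<times> 'x2 \<times> 'y)) \<Rightarrow> real \<Rightarrow> real \<Rightarrow> bool" where
  "vec_bounds v R1 R2 \<longleftrightarrow> (case v of (e, (i1, i2, i3, hz, hs), j) \<Rightarrow>
     (\<forall>s1. (\<Sum>x1\<in>UNIV. e $ (s1, x1)) = pmf (map_pmf fst pS) s1) \<and>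
     hc pS fst snd - hs \<le> hz \<and> R1 \<le> i1 + hz - (hc pS fst snd - hs) \<and> R2 \<le> i2 \<and>
     R1 + R2 \<le> i3 + hz - (hc pS fst snd - hs) \<and> R1 + R2 \<le> info4 (\<lambda>w. j $ w))"

lemma compact_params: "compact params"
proof (rule compact_eq_bounded_closed[THEN iffD2, OF conjI])
  have "norm k \<le> 1 + real CARD('z \<times> 's2)" if "k \<in> params" for k
  proof -
    have k: "\<And>i. 0 \<le> fst k $ i" "\<And>i. 0 \<le> snd k $ i" "(\<Sum>i\<in>UNIV. fst k $ i) = 1"
      "\<And>z s2. (\<Sum>x2\<in>UNIV. snd k $ (z, s2, x2)) = 1"
      using that unfolding params_def by blast+
    have "norm (fst k) \<le> (\<Sum>i\<in>UNIV. \<bar>fst k $ i\<bar>)" by (rule norm_le_l1_cart)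
    also have "\<dots> = 1" using k by (simp add: abs_of_nonneg)
    finally have 1: "norm (fst k) \<le> 1" .
    have "norm (snd k) \<le> (\<Sum>i\<in>UNIV. \<bar>snd k $ i\<bar>)" by (rule norm_le_l1_cart)
    also have "\<dots> = (\<Sum>i\<in>UNIV. snd k $ i)" using k by (simp add: abs_of_nonneg)
    also have "\<dots> = (\<Sum>(z, s2, x2)\<in>UNIV \<times> UNIV \<times> UNIV. snd k $ (z, s2, x2))" by simp
    also have "\<dots> = (\<Sum>z\<in>UNIV. \<Sum>s2\<in>UNIV. \<Sum>x2\<in>UNIV. snd k $ (z, s2, x2))"
      by (simp only: sum.cartesian_product split_beta' fst_conv snd_conv)
    also have "\<dots> = real CARD('z \<times> 's2)" using k by simp
    finally have 2: "norm (snd k) \<le> real CARD('z \<times> 's2)" .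
    show ?thesis using norm_Pair_le[of "fst k" "snd k"] 1 2 by simp
  qed
  then show "bounded params" unfolding bounded_iff by blast
  show "closed params" unfolding params_def
    by (intro closed_Collect_conj closed_Collect_all closed_Collect_le closed_Collect_eq continuous_intros)
qed

lemma letter_mass_nonneg: "k \<in> params \<Longrightarrow> 0 \<le> letter_mass k w"
  by (auto simp: letter_mass_def params_def split: prod.split)

lemma continuous_on_letter_mass: "continuous_on A (\<lambda>k. letter_mass k w)"
  by (cases w) (auto simp: letter_mass_def divide_inverse intro!: continuous_intros)

lemma continuous_on_point: "continuous_on params point"
  unfolding point_def info_defs
  by (intro continuous_intros continuous_on_mass_hc continuous_on_letter_mass letter_mass_nonneg)

lemma compact_hull: "compact (convex hull (point ` params))"
  by (intro compact_convex_hull compact_continuous_image continuous_on_point compact_params)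

lemma continuous_on_info4:
  assumes "\<And>w. continuous_on K (\<lambda>k. j k w)" "\<And>k w. k \<in> K \<Longrightarrow> 0 \<le> j k w"
  shows "continuous_on K (\<lambda>k. info4 (j k))"
  unfolding info4_def by (intro continuous_intros continuous_on_mass_hc assms)

lemma hull_nonneg: "v \<in> convex hull (point ` params) \<Longrightarrow> 0 \<le> snd (snd v) $ w"
proof -
  assume v: "v \<in> convex hull (point ` params)"
  have "convex {v :: (real ^ ('s1 \<times> 'x1)) \<times> (real \<times> real \<times> real \<times> real \<times> real) \<times> (real ^ ('s1 \<times> 's2 \<times> 'x1 \<times> 'x2 \<times> 'y)). 0 \<le> snd (snd v) $ w}"
    by (auto simp: convex_def)
  moreover have "point ` params \<subseteq> {v. 0 \<le> snd (snd v) $ w}"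
    by (auto simp: point_def letter_mass_nonneg)
  ultimately show ?thesis using hull_minimal[of "point ` params" _ convex] v by blast
qed

text \<open>Witnesses for a convergent sequence of rate pairs have a convergent subsequence in the
  compact hull, and all constraints are equations or weak inequalities between continuous functions,
  so the limit is a witness.\<close>

lemma closed_geo: "closed {(R1, R2). \<exists>v \<in> convex hull (point ` params). vec_bounds v R1 R2}"
  unfolding closed_sequential_limits
proof (intro allI impI, elim conjE)
  fix R :: "nat \<Rightarrow> real \<times> real" and L
  assume "\<forall>n. R n \<in> {(R1, R2). \<exists>v \<in> convex hull (point ` params). vec_bounds v R1 R2}" and L: "R \<longlonglongrightarrow> L"
  then have "\<forall>n. \<exists>v. v \<in> convex hull (point ` params) \<and> vec_bounds v (fst (R n)) (snd (R n))"
    unfolding mem_Collect_eq split_beta' Bex_def by blast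
  then obtain v where v: "\<And>n. v n \<in> convex hull (point ` params)" "\<And>n. vec_bounds (v n) (fst (R n)) (snd (R n))"
    by metis
  obtain l r where l: "l \<in> convex hull (point ` params)" and r: "strict_mono r" "(v \<circ> r) \<longlonglongrightarrow> l"
    using compact_hull v(1) unfolding compact_def by metis
  have R: "(\<lambda>n. R (r n)) \<longlonglongrightarrow> L" using LIMSEQ_subseq_LIMSEQ[OF L r(1)] by (simp add: o_def)
  have V: "(\<lambda>n. v (r n)) \<longlonglongrightarrow> l" using r(2) by (simp add: o_def)
  have I4: "(\<lambda>n. info4 (\<lambda>w. snd (snd (v (r n))) $ w)) \<longlonglongrightarrow> info4 (\<lambda>w. snd (snd l) $ w)"
  proof (rule continuous_on_tendsto_compose[OF _ V l])
    show "continuous_on (convex hull (point ` params)) (\<lambda>v. info4 (\<lambda>w. snd (snd v) $ w))"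
      by (intro continuous_on_info4 continuous_intros hull_nonneg)
  qed (use v in auto)
  note b = v(2)[unfolded vec_bounds_def split_beta']
  have "vec_bounds l (fst L) (snd L)"
    unfolding vec_bounds_def split_beta'
  proof (intro conjI allI)
    fix s1
    have "(\<lambda>n. \<Sum>x1\<in>UNIV. fst (v (r n)) $ (s1, x1)) \<longlonglongrightarrow> (\<Sum>x1\<in>UNIV. fst l $ (s1, x1))"
      by (intro tendsto_intros V)
    moreover have "(\<lambda>n. \<Sum>x1\<in>UNIV. fst (v (r n)) $ (s1, x1)) = (\<lambda>n. pmf (map_pmf fst pS) s1)" using b by (simp del: pmf_map)
    ultimately show "(\<Sum>x1\<in>UNIV. fst l $ (s1, x1)) = pmf (map_pmf fst pS) s1"
      using LIMSEQ_unique tendsto_const by metis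
    show "hc pS fst snd - (snd (snd (snd (snd (fst (snd l)))))) \<le> (fst (snd (snd (snd (fst (snd l))))))"
      by (rule LIMSEQ_le[where X="\<lambda>n. hc pS fst snd - (snd (snd (snd (snd (fst (snd (v (r n))))))))" and Y="\<lambda>n. (fst (snd (snd (snd (fst (snd (v (r n))))))))"])
        (use b in \<open>auto intro!: tendsto_intros V R I4\<close>)
    show "fst L \<le> (fst (fst (snd l))) + (fst (snd (snd (snd (fst (snd l)))))) - (hc pS fst snd - (snd (snd (snd (snd (fst (snd l)))))))"
      by (rule LIMSEQ_le[where X="\<lambda>n. fst (R (r n))" and Y="\<lambda>n. (fst (fst (snd (v (r n))))) + (fst (snd (snd (snd (fst (snd (v (r n)))))))) - (hc pS fst snd - (snd (snd (snd (snd (fst (snd (v (r n)))))))))"])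
        (use b in \<open>auto intro!: tendsto_intros V R I4\<close>)
    show "snd L \<le> (fst (snd (fst (snd l))))"
      by (rule LIMSEQ_le[where X="\<lambda>n. snd (R (r n))" and Y="\<lambda>n. (fst (snd (fst (snd (v (r n))))))"])
        (use b in \<open>auto intro!: tendsto_intros V R I4\<close>)
    show "fst L + snd L \<le> (fst (snd (snd (fst (snd l))))) + (fst (snd (snd (snd (fst (snd l)))))) - (hc pS fst snd - (snd (snd (snd (snd (fst (snd l)))))))"
      by (rule LIMSEQ_le[where X="\<lambda>n. fst (R (r n)) + snd (R (r n))" and Y="\<lambda>n. (fst (snd (snd (fst (snd (v (r n))))))) + (fst (snd (snd (snd (fst (snd (v (r n)))))))) - (hc pS fst snd - (snd (snd (snd (snd (fst (snd (v (r n)))))))))"])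
        (use b in \<open>auto intro!: tendsto_intros V R I4\<close>)
    show "fst L + snd L \<le> (info4 (($) (snd (snd l))))"
      by (rule LIMSEQ_le[where X="\<lambda>n. fst (R (r n)) + snd (R (r n))" and Y="\<lambda>n. (info4 (($) (snd (snd (v (r n))))))"])
        (use b in \<open>auto intro!: tendsto_intros V R I4\<close>)
  qed
  then show "L \<in> {(R1, R2). \<exists>v \<in> convex hull (point ` params). vec_bounds v R1 R2}"
    using l by (auto simp: split_beta')
qed

text \<open>\<open>l u\<close> plays the role of \<open>P(u)\<close>: every slice of the joint law
  is \<open>P(u)\<close> times a mass given by the parameters at \<open>u\<close>. This is the link
  between laws and convex combinations.\<close>

lemma pmf_letter_law_scaled:
  assumes k: "\<And>u. k u \<in> params" and l: "\<And>u. 0 \<le> l u"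
    and a: "\<And>s1 x1 u. pmf (map_pmf fst pS) s1 * pmf (pX1U s1) (x1, u) = l u * fst (k u) $ (s1, x1)"
    and b: "\<And>u z s2 x2. 0 < l u \<Longrightarrow> snd (k u) $ (z, s2, x2) = pmf (pX2 z u s2) x2"
  shows "pmf (letter_law pX1U pX2) (w, u) = l u * letter_mass (k u) w"
proof -
  obtain s1 s2 x1 x2 y where w: "w = (s1, s2, x1, x2, y)" by (cases w) auto
  have le: "pmf pS (s1, s2) \<le> pmf (map_pmf fst pS) s1"
    by (simp add: pmf_map) (metis insertI1 measure_pmf.finite_measure_mono measure_pmf_single sets_measure_pmf UNIV_I
        fst_conv singletonD subsetI vimageI)
  have z: "pmf pS (s1, s2) * pmf (pX1U s1) (x1, u) = l u * fst (k u) $ (s1, x1) * (pmf pS (s1, s2) / pmf (map_pmf fst pS) s1)"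
  proof (cases "pmf (map_pmf fst pS) s1 = 0")
    case True
    with le have "pmf pS (s1, s2) = 0" using pmf_nonneg[of pS "(s1,s2)"] by linarith
    then show ?thesis by simp
  next
    case False
    then show ?thesis unfolding a[symmetric] by simp
  qed
  show ?thesis
  proof (cases "l u = 0")
    case True
    then have "pmf pS (s1, s2) * pmf (pX1U s1) (x1, u) = 0" unfolding z by simp
    then show ?thesis unfolding w pmf_letter_law using True by simp
  next
    case False
    with l[of u] have "0 < l u" by simp
    then show ?thesis unfolding w pmf_letter_law letter_mass_def z by (simp add: b del: pmf_map)
  qed
qed

text \<open>Equality of all quantities rather than a transfer of inequalities, so that it serves
  both inclusions and also applies to points obtained by mixing in the hull.\<close>

definition represents where
  "represents v pX1U pX2 \<longleftrightarrow> (case v of (e :: real ^ ('s1 \<times> 'x1), (i1, i2, i3, hz, hs), j :: real ^ ('s1 \<times> 's2 \<times> 'x1 \<times> 'x2 \<times> 'y)) \<Rightarrow>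
     (\<forall>s1. (\<Sum>x1\<in>UNIV. e $ (s1, x1)) = pmf (map_pmf fst pS) s1) \<and>
     (\<lambda>u. info1 (\<lambda>w. pmf (letter_law pX1U pX2) (w, u))) sums i1 \<and> (\<lambda>u. info2 (\<lambda>w. pmf (letter_law pX1U pX2) (w, u))) sums i2 \<and>
     (\<lambda>u. info3 (\<lambda>w. pmf (letter_law pX1U pX2) (w, u))) sums i3 \<and> (\<lambda>u. crib (\<lambda>w. pmf (letter_law pX1U pX2) (w, u))) sums hz \<and>
     (\<lambda>u. state_left (\<lambda>w. pmf (letter_law pX1U pX2) (w, u))) sums hs \<and> (\<lambda>w. j $ w) = pmf (map_pmf fst (letter_law pX1U pX2)))"

lemma represents_bounds:
  "represents v pX1U pX2 \<Longrightarrow> region_bounds (single_letter pS zf W pX1U pX2) R1 R2 \<longleftrightarrow> vec_bounds v R1 R2"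
  unfolding represents_def vec_bounds_def
  by (clarsimp simp del: pmf_map split: prod.splits) (subst region_bounds_iff, auto simp del: pmf_map)

lemma represents_info:
  assumes "represents (e, (i1, i2, i3, hz, hs), j) pX1U pX2"
  defines "L \<equiv> letter_law pX1U pX2"
  shows "i1 = hc L (\<lambda>x. Yc (fst x)) (\<lambda>x. ((X2c (fst x), Zc (fst x), S1c (fst x), S2c (fst x)), snd x)) -
      hc L (\<lambda>x. Yc (fst x)) (\<lambda>x. ((X1c (fst x), X2c (fst x), Zc (fst x), S1c (fst x), S2c (fst x)), snd x))"
    "i2 = hc L (\<lambda>x. Yc (fst x)) (\<lambda>x. ((X1c (fst x), S1c (fst x), S2c (fst x)), snd x)) -
      hc L (\<lambda>x. Yc (fst x)) (\<lambda>x. ((X2c (fst x), X1c (fst x), S1c (fst x), S2c (fst x)), snd x))"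
    "i3 = hc L (\<lambda>x. Yc (fst x)) (\<lambda>x. ((Zc (fst x), S1c (fst x), S2c (fst x)), snd x)) -
      hc L (\<lambda>x. Yc (fst x)) (\<lambda>x. (((X1c (fst x), X2c (fst x)), Zc (fst x), S1c (fst x), S2c (fst x)), snd x))"
    "hz = hc L (\<lambda>x. Zc (fst x)) (\<lambda>x. (S1c (fst x), snd x))"
    "hs = hc L (\<lambda>x. S1c (fst x)) (\<lambda>x. (S2c (fst x), snd x))"
    "info4 (\<lambda>w. j $ w) = hc L (\<lambda>x. Yc (fst x)) (\<lambda>x. (S1c (fst x), S2c (fst x))) -
      hc L (\<lambda>x. Yc (fst x)) (\<lambda>x. ((X1c (fst x), X2c (fst x)), S1c (fst x), S2c (fst x)))"
proof -
  note rep = conjunct2[OF assms(1)[unfolded represents_def prod.case, folded L_def]]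
  note rep' = conjunct2[OF conjunct2[OF conjunct2[OF rep]]]
  show "i1 = hc L (\<lambda>x. Yc (fst x)) (\<lambda>x. ((X2c (fst x), Zc (fst x), S1c (fst x), S2c (fst x)), snd x)) -
      hc L (\<lambda>x. Yc (fst x)) (\<lambda>x. ((X1c (fst x), X2c (fst x), Zc (fst x), S1c (fst x), S2c (fst x)), snd x))"
    by (rule sums_unique2[OF conjunct1[OF rep, unfolded info1_def] sums_diff[OF hc_sums hc_sums]])
  show "i2 = hc L (\<lambda>x. Yc (fst x)) (\<lambda>x. ((X1c (fst x), S1c (fst x), S2c (fst x)), snd x)) -
      hc L (\<lambda>x. Yc (fst x)) (\<lambda>x. ((X2c (fst x), X1c (fst x), S1c (fst x), S2c (fst x)), snd x))"
    by (rule sums_unique2[OF conjunct1[OF conjunct2[OF rep], unfolded info2_def] sums_diff[OF hc_sums hc_sums]])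
  show "i3 = hc L (\<lambda>x. Yc (fst x)) (\<lambda>x. ((Zc (fst x), S1c (fst x), S2c (fst x)), snd x)) -
      hc L (\<lambda>x. Yc (fst x)) (\<lambda>x. (((X1c (fst x), X2c (fst x)), Zc (fst x), S1c (fst x), S2c (fst x)), snd x))"
    by (rule sums_unique2[OF conjunct1[OF conjunct2[OF conjunct2[OF rep]], unfolded info3_def] sums_diff[OF hc_sums hc_sums]])
  show "hz = hc L (\<lambda>x. Zc (fst x)) (\<lambda>x. (S1c (fst x), snd x))"
    by (rule sums_unique2[OF conjunct1[OF rep', unfolded crib_def] hc_sums])
  show "hs = hc L (\<lambda>x. S1c (fst x)) (\<lambda>x. (S2c (fst x), snd x))"
    by (rule sums_unique2[OF conjunct1[OF conjunct2[OF rep'], unfolded state_left_def] hc_sums])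
  have m: "mass_hc (pmf (map_pmf fst L)) A B = hc L (\<lambda>x. A (fst x)) (\<lambda>x. B (fst x))"
    for A :: "_ \<Rightarrow> 'y" and B :: "_ \<Rightarrow> 'b"
    by (simp only: hc_finite_type[symmetric] hc_map)
  show "info4 (\<lambda>w. j $ w) = hc L (\<lambda>x. Yc (fst x)) (\<lambda>x. (S1c (fst x), S2c (fst x))) -
      hc L (\<lambda>x. Yc (fst x)) (\<lambda>x. ((X1c (fst x), X2c (fst x)), S1c (fst x), S2c (fst x)))"
    unfolding conjunct2[OF conjunct2[OF rep']] info4_def m ..
qed

text \<open>The weights are the probabilities of the values of \<open>U\<close>, possibly infinitely
  many; the barycentre remains in the hull because a compact hull is closed.\<close>

lemma law_in_hull: "\<exists>v \<in> convex hull (point ` params). represents v pX1U pX2"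
proof -
  define L where "L = letter_law pX1U pX2"
  define Pe where "Pe = map_pmf (\<lambda>(s1, x1, u). ((s1, x1), u)) (bind_pmf (map_pmf fst pS) (\<lambda>s1. map_pmf (Pair s1) (pX1U s1)))"
  have Pe: "pmf Pe ((s1, x1), u) = pmf (map_pmf fst pS) s1 * pmf (pX1U s1) (x1, u)" for s1 x1 u
  proof -
    have "inj (\<lambda>(s1 :: 's1, x1 :: 'x1, u :: nat). ((s1, x1), u))" by (auto simp: inj_def)
    from pmf_map_inj'[OF this, of _ "(s1, x1, u)"] show ?thesis unfolding Pe_def by (simp add: pmf_bind_Pair del: pmf_map)
  qed
  define l where "l u = (\<Sum>i\<in>UNIV. pmf Pe (i, u))" for u
  define t :: "nat \<Rightarrow> real ^ ('z \<times> 's2 \<times> 'x2)" where "t u = (\<chi> i. case i of (z, s2, x2) \<Rightarrow> pmf (pX2 z u s2) x2)" for u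
  \<comment> \<open>A null \<open>u\<close> has no conditional law; the marginal law of
    \<open>(s1,x1)\<close> is a placeholder inside \<open>params\<close>.\<close>
  define k where "k u = (if l u = 0 then (\<chi> i. pmf (map_pmf fst Pe) i, t u) else (\<chi> i. pmf Pe (i, u) / l u, t u))" for u
  have l0: "0 \<le> l u" for u by (simp add: l_def sum_nonneg)
  have l1: "l sums 1" using expectation_sums_snd[of Pe "\<lambda>_. 1"] by (simp add: l_def[abs_def])
  have k: "k u \<in> params" for u
    using l0[of u] unfolding params_def k_def
    by (auto simp: t_def sum_pmf_eq_1 sum_divide_distrib[symmetric] simp flip: l_def simp del: pmf_map)
  have a: "pmf (map_pmf fst pS) s1 * pmf (pX1U s1) (x1, u) = l u * fst (k u) $ (s1, x1)" for s1 x1 u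
  proof (cases "l u = 0")
    case True
    have "pmf Pe ((s1, x1), u) \<le> l u" unfolding l_def by (rule member_le_sum) auto
    then have "pmf Pe ((s1, x1), u) = 0" using True pmf_nonneg[of Pe "((s1, x1), u)"] by linarith
    then show ?thesis using True Pe by simp
  qed (simp add: k_def Pe[symmetric])
  have m: "pmf L (w, u) = l u * letter_mass (k u) w" for w u
    unfolding L_def by (rule pmf_letter_law_scaled[OF k l0 a]) (auto simp: k_def t_def)
  have sc: "mass_hc (\<lambda>w. pmf L (w, u)) A B = l u * mass_hc (letter_mass (k u)) A B" for A :: "_ \<Rightarrow> 'b" and B :: "_ \<Rightarrow> 'c" and u
    unfolding m by (rule mass_hc_scale[OF l0 letter_mass_nonneg[OF k]])
  have H: "\<exists>h. (\<lambda>u. mass_hc (\<lambda>w. pmf L (w, u)) A B) sums h" for A :: "_ \<Rightarrow> 'b::finite" and B :: "_ \<Rightarrow> 'c"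
    using hc_sums by blast
  have D: "\<exists>h. (\<lambda>u. mass_hc (\<lambda>w. pmf L (w, u)) A B - mass_hc (\<lambda>w. pmf L (w, u)) A' B') sums h"
    for A A' :: "_ \<Rightarrow> 'b::finite" and B :: "_ \<Rightarrow> 'c" and B' :: "_ \<Rightarrow> 'd"
    using H[of A B] H[of A' B'] sums_diff by blast
  obtain i1 where i1: "(\<lambda>u. info1 (\<lambda>w. pmf L (w, u))) sums i1" unfolding info_defs using D by blast
  obtain i2 where i2: "(\<lambda>u. info2 (\<lambda>w. pmf L (w, u))) sums i2" unfolding info_defs using D by blast
  obtain i3 where i3: "(\<lambda>u. info3 (\<lambda>w. pmf L (w, u))) sums i3" unfolding info_defs using D by blast
  obtain hz where hz: "(\<lambda>u. crib (\<lambda>w. pmf L (w, u))) sums hz" unfolding info_defs using H by blast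
  obtain hs where hs: "(\<lambda>u. state_left (\<lambda>w. pmf L (w, u))) sums hs" unfolding info_defs using H by blast
  define v where "v = ((\<chi> i. pmf (map_pmf fst Pe) i), (i1, i2, i3, hz, hs), (\<chi> w. pmf (map_pmf fst L) w))"
  have "(\<lambda>u. l u *\<^sub>R point (k u)) sums v"
    unfolding v_def point_def scaleR_Pair
  proof (intro sums_Pair)
    show "(\<lambda>n. l n *\<^sub>R fst (k n)) sums (\<chi> i. pmf (map_pmf fst Pe) i)"
    proof (rule sums_vec)
      fix i :: "'s1 \<times> 'x1"
      obtain s1 x1 where i: "i = (s1, x1)" by (cases i)
      show "(\<lambda>n. (l n *\<^sub>R fst (k n)) $ i) sums ((\<chi> i. pmf (map_pmf fst Pe) i) $ i)"
        using marginal_sums[of Pe i] by (simp add: a[symmetric] Pe i del: pmf_map)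
    qed
    show "(\<lambda>n. l n *\<^sub>R (\<chi> w. letter_mass (k n) w)) sums (\<chi> w. pmf (map_pmf fst L) w)"
      by (rule sums_vec) (use marginal_sums[of L] in \<open>simp add: m del: pmf_map\<close>)
  qed (use i1 i2 i3 hz hs in \<open>simp_all add: info_defs sc right_diff_distrib\<close>)
  then have "v \<in> convex hull (point ` params)"
    by (rule barycenter_in_closed_convex[rotated -1]) (use k l0 l1 compact_hull in \<open>auto intro: hull_inc compact_imp_closed\<close>)
  moreover have "represents v pX1U pX2"
  proof -
    have "(\<Sum>x1\<in>UNIV. pmf (map_pmf fst Pe) (s1, x1)) = pmf (map_pmf fst pS) s1" for s1
    proof -
      have "map_pmf fst (map_pmf fst Pe) = map_pmf fst pS"
        unfolding Pe_def by (simp add: map_pmf_comp map_bind_pmf split_beta' map_pmf_def[symmetric] bind_return_pmf' del: bind_map_pmf)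
      moreover have "{w :: 's1 \<times> 'x1. fst w = s1} = Pair s1 ` UNIV" by auto
      ultimately show ?thesis using pmf_map_sum[of fst "map_pmf fst Pe" s1]
        by (simp add: sum.reindex inj_on_def del: pmf_map)
    qed
    moreover have "($) (vec_lambda h) = h" for h :: "'s1 \<times> 's2 \<times> 'x1 \<times> 'x2 \<times> 'y \<Rightarrow> real" by (rule ext) simp
    ultimately show ?thesis using i1 i2 i3 hz hs unfolding represents_def v_def L_def
      by (auto simp del: pmf_map)
  qed
  ultimately show ?thesis by blast
qed

lemma geo_of_region:
  assumes "region_bounds (single_letter pS zf W pX1U pX2) R1 R2"
  shows "\<exists>v \<in> convex hull (point ` params). vec_bounds v R1 R2"
  using law_in_hull represents_bounds assms by blast

text \<open>A point of a convex hull is a finite combination, and its index becomes the value of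
  \<open>U\<close>; hence the finite support. \<open>P(x1,u|s1)\<close> arises from weights and
  parameters by Bayes' rule, and the marginal constraint is exactly what makes it sum to
  one.\<close>

lemma law_of_hull:
  assumes "v \<in> convex hull (point ` params)" "\<And>s1. (\<Sum>x1\<in>UNIV. fst v $ (s1, x1)) = pmf (map_pmf fst pS) s1"
  shows "\<exists>pX1U pX2. (\<forall>s1. finite (set_pmf (pX1U s1))) \<and> represents v pX1U pX2"
proof -
  from assms(1) obtain n :: nat and c and x where c: "\<forall>i\<in>{1..n}. 0 \<le> c i \<and> x i \<in> point ` params" "sum c {1..n} = 1"
    and v: "(\<Sum>i=1..n. c i *\<^sub>R x i) = v"
    unfolding convex_hull_indexed by auto
  define l where "l u = (if u \<in> {1..n} then c u else 0)" for u
  have "n \<noteq> 0" using c(2) by (cases n) auto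
  then have "\<exists>k. \<forall>u. k u \<in> params \<and> (u \<in> {1..n} \<longrightarrow> point (k u) = x u)"
    using c(1) by (intro choice) (metis Suc_leI atLeastAtMost_iff imageE order_refl One_nat_def neq0_conv)
  then obtain k where k: "\<And>u. k u \<in> params" "\<And>u. u \<in> {1..n} \<Longrightarrow> point (k u) = x u" by blast
  have l0: "0 \<le> l u" for u using c(1) by (auto simp: l_def)
  have v': "v = (\<Sum>u=1..n. l u *\<^sub>R point (k u))"
    unfolding v[symmetric] by (intro sum.cong refl) (simp add: l_def k)
  have p: "\<And>u i. 0 \<le> fst (k u) $ i" "\<And>u. (\<Sum>i\<in>UNIV. fst (k u) $ i) = 1" "\<And>u i. 0 \<le> snd (k u) $ i"
     "\<And>u z s2. (\<Sum>x2\<in>UNIV. snd (k u) $ (z, s2, x2)) = 1"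
    using k(1) unfolding params_def by blast+
  define pX2 where "pX2 z u s2 = embed_pmf (\<lambda>x2. snd (k u) $ (z, s2, x2))" for z u s2
  have pX2: "pmf (pX2 z u s2) x2 = snd (k u) $ (z, s2, x2)" for z u s2 x2
    unfolding pX2_def by (rule pmf_embed_pmf) (auto simp: p nn_integral_count_space_finite sum_ennreal)
  let ?q = "pmf (map_pmf fst pS)"
  have fv: "fst v $ i = (\<Sum>u=1..n. l u * fst (k u) $ i)" for i
    unfolding v' by (simp add: fst_sum point_def)
  have marg: "(\<Sum>x1\<in>UNIV. \<Sum>u=1..n. l u * fst (k u) $ (s1, x1)) = ?q s1" for s1
    using assms(2) unfolding fv .
  define f where "f s1 = (\<lambda>(x1, u). if u \<in> {1..n} then l u * fst (k u) $ (s1, x1) / ?q s1 else 0)" for s1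
  \<comment> \<open>Bayes' rule says nothing at an \<open>s1\<close> of probability zero; a point
    mass keeps the support finite there.\<close>
  define pX1U where "pX1U s1 = (if ?q s1 = 0 then return_pmf (undefined, 0) else embed_pmf (f s1))" for s1
  have pX1U: "pmf (pX1U s1) (x1, u) = f s1 (x1, u)" if "?q s1 \<noteq> 0" for s1 x1 u
  proof -
    have q: "0 < ?q s1" using that by (simp add: pmf_pos del: pmf_map)
    have nn: "0 \<le> f s1 a" for a unfolding f_def using l0 p by (auto split: prod.split simp del: pmf_map)
    have "(\<integral>\<^sup>+ a. ennreal (f s1 a) \<partial>count_space UNIV) = (\<Sum>a\<in>UNIV \<times> {1..n}. ennreal (f s1 a))"
      by (rule nn_integral_count_space') (auto simp: f_def split: if_splits)
    also have "\<dots> = ennreal (\<Sum>a\<in>UNIV \<times> {1..n}. f s1 a)" by (rule sum_ennreal) (rule nn)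
    also have "(\<Sum>a\<in>UNIV \<times> {1..n}. f s1 a) = (\<Sum>x1\<in>UNIV. \<Sum>u=1..n. l u * fst (k u) $ (s1, x1) / ?q s1)"
      by (simp add: sum.cartesian_product' f_def del: pmf_map)
    also have "\<dots> = (\<Sum>x1\<in>UNIV. \<Sum>u=1..n. l u * fst (k u) $ (s1, x1)) / ?q s1"
      by (simp add: sum_divide_distrib del: pmf_map)
    also have "\<dots> = 1" using q unfolding marg by simp
    finally show ?thesis using that unfolding pX1U_def by (simp add: pmf_embed_pmf nn del: pmf_map)
  qed
  have fin: "finite (set_pmf (pX1U s1))" for s1
  proof (cases "?q s1 = 0")
    case True then show ?thesis unfolding pX1U_def by simp
  next
    case False
    have "set_pmf (pX1U s1) \<subseteq> UNIV \<times> {1..n}"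
      using pX1U[OF False] by (auto simp: set_pmf_iff f_def split: if_splits simp del: pmf_map)
    then show ?thesis by (rule finite_subset) simp
  qed
  have a: "?q s1 * pmf (pX1U s1) (x1, u) = l u * fst (k u) $ (s1, x1)" for s1 x1 u
  proof (cases "?q s1 = 0")
    case True
    have "l u * fst (k u) $ (s1, x1) = 0"
    proof (cases "u \<in> {1..n}")
      case u: True
      have "l u * fst (k u) $ (s1, x1) \<le> (\<Sum>u=1..n. l u * fst (k u) $ (s1, x1))"
        by (rule member_le_sum) (use u l0 p in auto)
      also have "\<dots> \<le> (\<Sum>x1\<in>UNIV. \<Sum>u=1..n. l u * fst (k u) $ (s1, x1))"
        by (rule member_le_sum) (use l0 p in \<open>auto intro!: sum_nonneg\<close>)
      also have "\<dots> = 0" using True unfolding marg by simp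
      finally show ?thesis by (intro antisym mult_nonneg_nonneg l0 p)
    qed (auto simp: l_def)
    then show ?thesis using True by simp
  next
    case False then show ?thesis unfolding pX1U[OF False] f_def by (auto simp: l_def simp del: pmf_map)
  qed
  define L where "L = letter_law pX1U pX2"
  have m: "pmf L (w, u) = l u * letter_mass (k u) w" for w u
    unfolding L_def by (rule pmf_letter_law_scaled[OF k(1) l0 a]) (simp add: pX2)
  have sc: "mass_hc (\<lambda>w. pmf L (w, u)) A B = l u * mass_hc (letter_mass (k u)) A B" for A :: "_ \<Rightarrow> 'b" and B :: "_ \<Rightarrow> 'c" and u
    unfolding m by (rule mass_hc_scale[OF l0 letter_mass_nonneg[OF k(1)]])
  have fs: "(\<lambda>u. l u * h u) sums (\<Sum>u=1..n. l u * h u)" for h :: "nat \<Rightarrow> real"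
    by (rule sums_finite) (auto simp: l_def)
  have "snd (snd v) $ w = pmf (map_pmf fst L) w" for w
  proof -
    have "(\<lambda>u. l u * letter_mass (k u) w) sums pmf (map_pmf fst L) w"
      using marginal_sums[of L w] unfolding m .
    moreover have "snd (snd v) $ w = (\<Sum>u=1..n. l u * letter_mass (k u) w)"
      unfolding v' by (simp add: snd_sum point_def)
    ultimately show ?thesis using sums_unique2[OF fs] by simp
  qed
  then have vj: "(\<lambda>w. snd (snd v) $ w) = pmf (map_pmf fst L)" by (rule ext)
  have vi: "fst (snd v) = ((\<Sum>u=1..n. l u * info1 (letter_mass (k u))), (\<Sum>u=1..n. l u * info2 (letter_mass (k u))),
     (\<Sum>u=1..n. l u * info3 (letter_mass (k u))), (\<Sum>u=1..n. l u * crib (letter_mass (k u))), (\<Sum>u=1..n. l u * state_left (letter_mass (k u))))"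
    unfolding v' by (simp add: snd_sum fst_sum point_def sum_prod)
  have "represents v pX1U pX2"
  proof -
    have s1: "(\<lambda>u. info1 (\<lambda>w. pmf L (w, u))) sums (\<Sum>u=1..n. l u * info1 (letter_mass (k u)))"
      using fs[of "\<lambda>u. info1 (letter_mass (k u))"] by (simp add: info1_def sc right_diff_distrib)
    have s2: "(\<lambda>u. info2 (\<lambda>w. pmf L (w, u))) sums (\<Sum>u=1..n. l u * info2 (letter_mass (k u)))"
      using fs[of "\<lambda>u. info2 (letter_mass (k u))"] by (simp add: info2_def sc right_diff_distrib)
    have s3: "(\<lambda>u. info3 (\<lambda>w. pmf L (w, u))) sums (\<Sum>u=1..n. l u * info3 (letter_mass (k u)))"
      using fs[of "\<lambda>u. info3 (letter_mass (k u))"] by (simp add: info3_def sc right_diff_distrib)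
    have s4: "(\<lambda>u. crib (\<lambda>w. pmf L (w, u))) sums (\<Sum>u=1..n. l u * crib (letter_mass (k u)))"
      using fs[of "\<lambda>u. crib (letter_mass (k u))"] by (simp add: crib_def sc)
    have s5: "(\<lambda>u. state_left (\<lambda>w. pmf L (w, u))) sums (\<Sum>u=1..n. l u * state_left (letter_mass (k u)))"
      using fs[of "\<lambda>u. state_left (letter_mass (k u))"] by (simp add: state_left_def sc)
    show ?thesis using s1 s2 s3 s4 s5 assms(2) vi vj unfolding represents_def L_def
      by (cases v) (simp del: pmf_map)
  qed
  with fin show ?thesis by blast
qed

end

section \<open>Sequences of independent symbols\<close>

lemma independent_list_pmf_0 [simp]: "independent_list_pmf 0 p = return_pmf []"
  by (simp add: independent_list_pmf_def)

lemma independent_list_pmf_Suc: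
  "independent_list_pmf (Suc n) p = bind_pmf (independent_list_pmf n p) (\<lambda>ys. map_pmf (\<lambda>y. ys @ [y]) (p n))"
proof -
  have "independent_list_pmf (Suc n) p = map_pmf (\<lambda>(y, f). map (f(n := y)) [0..<Suc n]) (pair_pmf (p n) (Pi_pmf {..<n} undefined p))"
    unfolding independent_list_pmf_def lessThan_Suc by (subst Pi_pmf_insert) (auto simp: map_pmf_comp split_beta')
  also have "\<dots> = map_pmf (\<lambda>(y, f). map f [0..<n] @ [y]) (pair_pmf (p n) (Pi_pmf {..<n} undefined p))"
    by (intro map_pmf_cong) auto
  also have "\<dots> = bind_pmf (p n) (\<lambda>y. bind_pmf (Pi_pmf {..<n} undefined p) (\<lambda>f. return_pmf (map f [0..<n] @ [y])))"
    by (simp add: pair_pmf_def map_bind_pmf map_pmf_def bind_assoc_pmf bind_return_pmf)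
  also have "\<dots> = bind_pmf (Pi_pmf {..<n} undefined p) (\<lambda>f. bind_pmf (p n) (\<lambda>y. return_pmf (map f [0..<n] @ [y])))"
    by (rule bind_commute_pmf)
  finally show ?thesis
    by (simp add: independent_list_pmf_def bind_map_pmf map_pmf_def[of "\<lambda>y. _ @ [y]"])
qed

lemma independent_list_pmf_cong:
  "(\<And>i. i < n \<Longrightarrow> p i = q i) \<Longrightarrow> independent_list_pmf n p = independent_list_pmf n q"
  by (induction n) (auto simp: independent_list_pmf_Suc)

lemma length_independent_list: "ys \<in> set_pmf (independent_list_pmf n p) \<Longrightarrow> length ys = n"
  by (auto simp: independent_list_pmf_def)

lemma nth_independent_list: "ys \<in> set_pmf (independent_list_pmf n p) \<Longrightarrow> i < n \<Longrightarrow> ys ! i \<in> set_pmf (p i)"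
  by (induction n arbitrary: ys) (auto simp: independent_list_pmf_Suc nth_append less_Suc_eq length_independent_list)

lemma finite_independent_list: "(\<And>i. i < n \<Longrightarrow> finite (set_pmf (p i))) \<Longrightarrow> finite (set_pmf (independent_list_pmf n p))"
  by (induction n) (auto simp: independent_list_pmf_Suc)

lemma pmf_independent_list:
  "length ys = n \<Longrightarrow> pmf (independent_list_pmf n p) ys = (\<Prod>i<n. pmf (p i) (ys ! i))"
proof (induction n arbitrary: ys)
  case (Suc n)
  obtain zs z where ys: "ys = zs @ [z]" "length zs = n" using Suc.prems by (cases ys rule: rev_cases) auto
  have inj: "inj (\<lambda>(ys, y :: 'a). ys @ [y])" by (auto simp: inj_def)
  have "independent_list_pmf (Suc n) p = map_pmf (\<lambda>(ys, y). ys @ [y]) (bind_pmf (independent_list_pmf n p) (\<lambda>ys. map_pmf (Pair ys) (p n)))"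
    by (simp add: independent_list_pmf_Suc map_bind_pmf map_pmf_comp)
  then have "pmf (independent_list_pmf (Suc n) p) ys = pmf (bind_pmf (independent_list_pmf n p) (\<lambda>ys. map_pmf (Pair ys) (p n))) (zs, z)"
    using pmf_map_inj'[OF inj, of _ "(zs, z)"] by (simp add: ys del: pmf_map)
  also have "\<dots> = (\<Prod>i<n. pmf (p i) (zs ! i)) * pmf (p n) z"
    unfolding pmf_bind_Pair by (simp add: Suc.IH ys)
  also have "\<dots> = (\<Prod>i<Suc n. pmf (p i) (ys ! i))" using ys by (simp add: nth_append)
  finally show ?case .
qed simp

lemma independent_list_pmf_add:
  "independent_list_pmf (n + m) p = bind_pmf (independent_list_pmf n p) (\<lambda>xs. map_pmf (append xs) (independent_list_pmf m (\<lambda>i. p (n + i))))"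
  by (induction m) (auto simp: independent_list_pmf_Suc bind_assoc_pmf bind_map_pmf map_bind_pmf map_pmf_comp bind_return_pmf')

lemma replicate_pmf_eq_independent_list: "replicate_pmf n p = independent_list_pmf n (\<lambda>_. p)"
proof (induction n)
  case (Suc n)
  have "replicate_pmf (n + 1) p = do {xs \<leftarrow> replicate_pmf n p; ys \<leftarrow> replicate_pmf 1 p; return_pmf (xs @ ys)}"
    by (rule replicate_pmf_distrib)
  then show ?case unfolding replicate_pmf_1 independent_list_pmf_Suc Suc.IH
    by (simp add: bind_map_pmf map_pmf_def[of "\<lambda>y. _ @ [y]"])
qed simp

text \<open>A product law fed into coordinatewise kernels stays a product law. With
  \<open>f = Pair\<close> this assembles the joint laws of whole blocks, with the second projection
  their output laws.\<close>

lemma independent_list_pmf_bind_map2: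
  "bind_pmf (independent_list_pmf n p) (\<lambda>xs. map_pmf (\<lambda>ys. map2 f xs ys) (independent_list_pmf n (\<lambda>i. k i (xs ! i)))) =
   independent_list_pmf n (\<lambda>i. bind_pmf (p i) (\<lambda>x. map_pmf (f x) (k i x)))"
proof (induction n)
  case (Suc n)
  have *: "independent_list_pmf n (\<lambda>i. k i ((xs @ [x]) ! i)) = independent_list_pmf n (\<lambda>i. k i (xs ! i))"
    if "length xs = n" for xs x
    using that by (intro independent_list_pmf_cong) (auto simp: nth_append)
  have "bind_pmf (independent_list_pmf (Suc n) p) (\<lambda>xs. map_pmf (\<lambda>ys. map2 f xs ys) (independent_list_pmf (Suc n) (\<lambda>i. k i (xs ! i)))) =
    bind_pmf (independent_list_pmf n p) (\<lambda>xs. bind_pmf (p n) (\<lambda>x.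
      map_pmf (\<lambda>ys. map2 f (xs @ [x]) ys) (independent_list_pmf (Suc n) (\<lambda>i. k i ((xs @ [x]) ! i)))))"
    by (subst independent_list_pmf_Suc[of n p]) (simp add: bind_assoc_pmf bind_map_pmf)
  also have "\<dots> = bind_pmf (independent_list_pmf n p) (\<lambda>xs. bind_pmf (p n) (\<lambda>x. bind_pmf (independent_list_pmf n (\<lambda>i. k i (xs ! i)))
      (\<lambda>ys. bind_pmf (k n x) (\<lambda>y. return_pmf (map2 f xs ys @ [f x y])))))"
  proof (intro bind_pmf_cong refl)
    fix xs x assume "xs \<in> set_pmf (independent_list_pmf n p)"
    then have l: "length xs = n" by (rule length_independent_list)
    have "map_pmf (\<lambda>ys. map2 f (xs @ [x]) ys) (independent_list_pmf (Suc n) (\<lambda>i. k i ((xs @ [x]) ! i))) =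
      bind_pmf (independent_list_pmf n (\<lambda>i. k i (xs ! i))) (\<lambda>ys. bind_pmf (k n x) (\<lambda>y. return_pmf (map2 f (xs @ [x]) (ys @ [y]))))"
      unfolding independent_list_pmf_Suc *[OF l] by (simp add: map_pmf_def bind_assoc_pmf bind_return_pmf nth_append l)
    also have "\<dots> = bind_pmf (independent_list_pmf n (\<lambda>i. k i (xs ! i))) (\<lambda>ys. bind_pmf (k n x) (\<lambda>y. return_pmf (map2 f xs ys @ [f x y])))"
      by (intro bind_pmf_cong refl) (auto simp: l dest!: length_independent_list)
    finally show "map_pmf (\<lambda>ys. map2 f (xs @ [x]) ys) (independent_list_pmf (Suc n) (\<lambda>i. k i ((xs @ [x]) ! i))) =
      bind_pmf (independent_list_pmf n (\<lambda>i. k i (xs ! i))) (\<lambda>ys. bind_pmf (k n x) (\<lambda>y. return_pmf (map2 f xs ys @ [f x y])))" .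
  qed
  also have "\<dots> = bind_pmf (bind_pmf (independent_list_pmf n p) (\<lambda>xs. map_pmf (\<lambda>ys. map2 f xs ys) (independent_list_pmf n (\<lambda>i. k i (xs ! i)))))
     (\<lambda>zs. bind_pmf (p n) (\<lambda>x. bind_pmf (k n x) (\<lambda>y. return_pmf (zs @ [f x y]))))"
    unfolding bind_assoc_pmf bind_map_pmf
    by (subst (2) bind_commute_pmf) (rule refl)
  also have "\<dots> = independent_list_pmf (Suc n) (\<lambda>i. bind_pmf (p i) (\<lambda>x. map_pmf (f x) (k i x)))"
    unfolding Suc.IH independent_list_pmf_Suc by (simp add: map_pmf_def bind_assoc_pmf bind_return_pmf)
  finally show ?case .
qed (simp add: bind_return_pmf)

lemma independent_list_pmf_bind:
  "bind_pmf (independent_list_pmf n p) (\<lambda>xs. independent_list_pmf n (\<lambda>i. k i (xs ! i))) =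
   independent_list_pmf n (\<lambda>i. bind_pmf (p i) (k i))"
proof -
  have "bind_pmf (independent_list_pmf n p) (\<lambda>xs. independent_list_pmf n (\<lambda>i. k i (xs ! i))) =
    bind_pmf (independent_list_pmf n p) (\<lambda>xs. map_pmf (\<lambda>ys. map2 (\<lambda>_ y. y) xs ys) (independent_list_pmf n (\<lambda>i. k i (xs ! i))))"
  proof (intro bind_pmf_cong refl)
    fix xs assume "xs \<in> set_pmf (independent_list_pmf n p)"
    then have "map2 (\<lambda>_ y. y) xs ys = ys" if "ys \<in> set_pmf (independent_list_pmf n (\<lambda>i. k i (xs ! i)))" for ys
      using that by (intro nth_equalityI) (auto simp: length_independent_list)
    then show "independent_list_pmf n (\<lambda>i. k i (xs ! i)) = map_pmf (\<lambda>ys. map2 (\<lambda>_ y. y) xs ys) (independent_list_pmf n (\<lambda>i. k i (xs ! i)))"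
      by (intro map_pmf_idI[symmetric])
  qed
  then show ?thesis unfolding independent_list_pmf_bind_map2 by simp
qed

lemma map_independent_list_pmf: "map_pmf (map f) (independent_list_pmf n p) = independent_list_pmf n (\<lambda>i. map_pmf f (p i))"
proof (induction n)
  case (Suc n)
  show ?case unfolding independent_list_pmf_Suc Suc.IH[symmetric]
    by (simp add: map_bind_pmf bind_map_pmf map_pmf_comp)
qed simp

lemma independent_list_component:
  assumes "i < n" shows "map_pmf (\<lambda>ys. ys ! i) (independent_list_pmf n p) = p i"
proof -
  have "map_pmf (\<lambda>ys. ys ! i) (independent_list_pmf n p) = map_pmf (\<lambda>f. f i) (Pi_pmf {..<n} undefined p)"
    unfolding independent_list_pmf_def map_pmf_comp using assms by (intro map_pmf_cong) auto
  then show ?thesis using assms by (simp add: Pi_pmf_component)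
qed

section \<open>The converse\<close>

lemma expectation_pmf_cong:
  fixes f g :: "'w \<Rightarrow> real"
  shows "(\<And>w. w \<in> set_pmf P \<Longrightarrow> f w = g w) \<Longrightarrow> measure_pmf.expectation P f = measure_pmf.expectation P g"
  by (intro integral_cong_AE) (auto simp: AE_measure_pmf_iff)

lemma hc_list_chain:
  assumes fin: "finite (set_pmf P)" and len: "\<And>w. w \<in> set_pmf P \<Longrightarrow> length (L w) = n"
  shows "hc P L C = (\<Sum>i<n. hc P (\<lambda>w. L w ! i) (\<lambda>w. (take i (L w), C w)))"
proof -
  have "hc P (\<lambda>w. take k (L w)) C = (\<Sum>i<k. hc P (\<lambda>w. L w ! i) (\<lambda>w. (take i (L w), C w)))" if "k \<le> n" for k
    using that
  proof (induction k)
    case 0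
    then show ?case by (simp add: hc_determined)
  next
    case (Suc k)
    have "hc P (\<lambda>w. take (Suc k) (L w)) C = hc P (\<lambda>w. (L w ! k, take k (L w))) C"
      by (rule hc_cong) (use Suc.prems len in \<open>auto simp: take_Suc_conv_app_nth\<close>)
    also have "\<dots> = hc P (\<lambda>w. take k (L w)) C + hc P (\<lambda>w. L w ! k) (\<lambda>w. (take k (L w), C w))"
      by (rule hc_chain[OF fin])
    finally show ?case using Suc by simp
  qed
  from this[of n] have "hc P (\<lambda>w. take n (L w)) C = (\<Sum>i<n. hc P (\<lambda>w. L w ! i) (\<lambda>w. (take i (L w), C w)))" by simp
  moreover have "hc P (\<lambda>w. take n (L w)) C = hc P L C" by (rule hc_cong) (auto simp: len)
  ultimately show ?thesis by simp
qed

lemma expectation_independent_list: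
  fixes g :: "nat \<Rightarrow> 'a \<Rightarrow> real"
  assumes fin: "\<And>i. i < n \<Longrightarrow> finite (set_pmf (p i))"
  shows "measure_pmf.expectation (independent_list_pmf n p) (\<lambda>ys. \<Sum>i<n. g i (ys ! i)) = (\<Sum>i<n. measure_pmf.expectation (p i) (g i))"
proof -
  have "measure_pmf.expectation (independent_list_pmf n p) (\<lambda>ys. \<Sum>i<n. g i (ys ! i)) =
    (\<Sum>i<n. measure_pmf.expectation (independent_list_pmf n p) (\<lambda>ys. g i (ys ! i)))"
    by (rule Bochner_Integration.integral_sum) (intro integrable_finite_pmf finite_independent_list fin)
  also have "\<dots> = (\<Sum>i<n. measure_pmf.expectation (p i) (g i))"
  proof (intro sum.cong refl)
    fix i assume "i \<in> {..<n}"
    then have "p i = map_pmf (\<lambda>ys. ys ! i) (independent_list_pmf n p)" by (simp add: independent_list_component)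
    then show "measure_pmf.expectation (independent_list_pmf n p) (\<lambda>ys. g i (ys ! i)) = measure_pmf.expectation (p i) (g i)"
      by simp
  qed
  finally show ?thesis .
qed

lemma log_prod_nz: "(\<And>i. i \<in> I \<Longrightarrow> f i \<noteq> 0) \<Longrightarrow> log 2 (\<Prod>i\<in>I. f i) = (\<Sum>i\<in>I. log 2 (f i))"
  by (induction I rule: infinite_finite_induct) (auto simp: log_mult)

text \<open>The law of the state pairs and that of their second components are both products, so the
  log ratio is a sum over the letters.\<close>

lemma hc_replicate:
  fixes p :: "('a::finite \<times> 'b::finite) pmf"
  shows "hc (replicate_pmf n p) (map fst) (map snd) = real n * hc p fst snd"
proof -
  let ?p2 = "map_pmf snd p"
  have nz: "pmf (map_pmf (\<lambda>s. (map fst s, map snd s)) (replicate_pmf n p)) (map fst s, map snd s) = (\<Prod>i<n. pmf p (s ! i))"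
    "pmf (map_pmf (map snd) (replicate_pmf n p)) (map snd s) = (\<Prod>i<n. pmf ?p2 (snd (s ! i)))"
    if "s \<in> set_pmf (replicate_pmf n p)" for s
  proof -
    have l: "length s = n" using that by (simp add: set_replicate_pmf)
    have "inj (\<lambda>s :: ('a \<times> 'b) list. (map fst s, map snd s))"
      by (rule injI) (metis zip_map_fst_snd prod.inject)
    from pmf_map_inj'[OF this] show "pmf (map_pmf (\<lambda>s. (map fst s, map snd s)) (replicate_pmf n p)) (map fst s, map snd s) = (\<Prod>i<n. pmf p (s ! i))"
      using l by (simp only: replicate_pmf_eq_independent_list pmf_independent_list)
    show "pmf (map_pmf (map snd) (replicate_pmf n p)) (map snd s) = (\<Prod>i<n. pmf ?p2 (snd (s ! i)))"
      unfolding replicate_pmf_eq_independent_list map_independent_list_pmf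
      by (subst pmf_independent_list) (use l in \<open>auto simp del: pmf_map\<close>)
  qed
  have "hc (replicate_pmf n p) (map fst) (map snd) =
    measure_pmf.expectation (replicate_pmf n p) (\<lambda>s. \<Sum>i<n. - log 2 (pmf p (s ! i) / pmf ?p2 (snd (s ! i))))"
    unfolding hc_def
  proof (rule integral_cong_AE; (simp del: pmf_map)?)
    show "AE s in measure_pmf (replicate_pmf n p). - log 2 (pmf (map_pmf (\<lambda>w. (map fst w, map snd w)) (replicate_pmf n p)) (map fst s, map snd s) /
            pmf (map_pmf (map snd) (replicate_pmf n p)) (map snd s)) = (\<Sum>i<n. - log 2 (pmf p (s ! i) / pmf ?p2 (snd (s ! i))))"
      unfolding AE_measure_pmf_iff
    proof
      fix s assume s: "s \<in> set_pmf (replicate_pmf n p)"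
      have si: "s ! i \<in> set_pmf p" if "i < n" for i
        using s that by (auto simp: set_replicate_pmf in_lists_conv_set)
      have "pmf p (s ! i) \<noteq> 0 \<and> pmf ?p2 (snd (s ! i)) \<noteq> 0" if "i < n" for i
        using si[OF that] pmf_map_nz[OF si[OF that], of snd] by (simp add: set_pmf_iff del: pmf_map)
      then have "log 2 (\<Prod>i<n. pmf p (s ! i) / pmf ?p2 (snd (s ! i))) = (\<Sum>i<n. log 2 (pmf p (s ! i) / pmf ?p2 (snd (s ! i))))"
        by (intro log_prod_nz) (auto simp del: pmf_map)
      then show "- log 2 (pmf (map_pmf (\<lambda>w. (map fst w, map snd w)) (replicate_pmf n p)) (map fst s, map snd s) /
            pmf (map_pmf (map snd) (replicate_pmf n p)) (map snd s)) = (\<Sum>i<n. - log 2 (pmf p (s ! i) / pmf ?p2 (snd (s ! i))))"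
        unfolding nz[OF s] prod_dividef[symmetric] by (simp add: sum_negf del: pmf_map)
    qed
  qed
  also have "\<dots> = (\<Sum>i<n. measure_pmf.expectation p (\<lambda>s. - log 2 (pmf p s / pmf ?p2 (snd s))))"
    unfolding replicate_pmf_eq_independent_list
    by (rule expectation_independent_list[where g="\<lambda>i s. - log 2 (pmf p s / pmf ?p2 (snd s))"]) simp
  also have "\<dots> = real n * hc p fst snd" by (simp add: hc_def del: pmf_map)
  finally show ?thesis .
qed

text \<open>The probability \<open>1 / n\<close> of the index cancels in the ratio because the index
  belongs to the condition; an average over the indices remains.\<close>

lemma hc_time_share:
  fixes A :: "nat \<Rightarrow> 'w \<Rightarrow> 'a" and B :: "nat \<Rightarrow> 'w \<Rightarrow> 'b"
  assumes fin: "finite (set_pmf G)" and n: "n > 0"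
  shows "hc (pair_pmf (pmf_of_set {..<n}) G) (\<lambda>x. A (fst x) (snd x)) (\<lambda>x. (fst x, B (fst x) (snd x))) = (\<Sum>i<n. hc G (A i) (B i)) / real n"
proof -
  let ?u = "pmf_of_set {..<n}"
  have u: "pmf ?u i = 1 / real n" if "i < n" for i using that n by (subst pmf_of_set) auto
  have su: "set_pmf ?u = {..<n}" by (rule set_pmf_of_set) (use n in auto)
  let ?Q = "pair_pmf ?u G"
  have law: "pmf (map_pmf (\<lambda>x. (fst x, f (fst x) (snd x))) ?Q) (i, c) = pmf ?u i * pmf (map_pmf (f i) G) c" for f :: "nat \<Rightarrow> 'w \<Rightarrow> 'c" and i c
  proof -
    have "map_pmf (\<lambda>x. (fst x, f (fst x) (snd x))) ?Q = bind_pmf ?u (\<lambda>i. map_pmf (Pair i) (map_pmf (f i) G))"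
      by (simp add: pair_pmf_def map_bind_pmf map_pmf_def bind_assoc_pmf bind_return_pmf)
    then show ?thesis by (simp only: pmf_bind_Pair)
  qed
  have ratio: "pmf (map_pmf (\<lambda>x. (A (fst x) (snd x), fst x, B (fst x) (snd x))) ?Q) (A (fst x) (snd x), fst x, B (fst x) (snd x)) /
      pmf (map_pmf (\<lambda>x. (fst x, B (fst x) (snd x))) ?Q) (fst x, B (fst x) (snd x)) =
    pmf (map_pmf (\<lambda>w. (A (fst x) w, B (fst x) w)) G) (A (fst x) (snd x), B (fst x) (snd x)) / pmf (map_pmf (B (fst x)) G) (B (fst x) (snd x))"
    if x: "x \<in> set_pmf ?Q" for x
  proof -
    have "pmf (map_pmf (\<lambda>x. (A (fst x) (snd x), fst x, B (fst x) (snd x))) ?Q) (A (fst x) (snd x), fst x, B (fst x) (snd x)) =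
      pmf (map_pmf (\<lambda>x. (fst x, (A (fst x) (snd x), B (fst x) (snd x)))) ?Q) (fst x, (A (fst x) (snd x), B (fst x) (snd x)))"
      by (rule pmf_map_eq) auto
    also have "\<dots> = pmf ?u (fst x) * pmf (map_pmf (\<lambda>w. (A (fst x) w, B (fst x) w)) G) (A (fst x) (snd x), B (fst x) (snd x))"
      using law[of "\<lambda>i w. (A i w, B i w)"] by simp
    finally have e: "pmf (map_pmf (\<lambda>x. (A (fst x) (snd x), fst x, B (fst x) (snd x))) ?Q) (A (fst x) (snd x), fst x, B (fst x) (snd x)) =
      pmf ?u (fst x) * pmf (map_pmf (\<lambda>w. (A (fst x) w, B (fst x) w)) G) (A (fst x) (snd x), B (fst x) (snd x))" .
    have "fst x < n" using x by (auto simp: su)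
    then have "pmf ?u (fst x) \<noteq> 0" using u n by simp
    then show ?thesis unfolding e law[of B] by (simp del: pmf_map)
  qed
  have "hc ?Q (\<lambda>x. A (fst x) (snd x)) (\<lambda>x. (fst x, B (fst x) (snd x))) =
     measure_pmf.expectation ?Q (\<lambda>x. - log 2 (pmf (map_pmf (\<lambda>w. (A (fst x) w, B (fst x) w)) G) (A (fst x) (snd x), B (fst x) (snd x)) /
       pmf (map_pmf (B (fst x)) G) (B (fst x) (snd x))))"
    unfolding hc_def by (rule expectation_pmf_cong) (simp only: ratio)
  also have "\<dots> = (\<Sum>i<n. hc G (A i) (B i)) / real n"
    unfolding pair_pmf_def hc_def
    by (subst pmf_expectation_bind[where A="{..<n}"])
       (use n fin in \<open>auto simp: su u sum_divide_distrib map_pmf_def[symmetric] simp del: pmf_map\<close>)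
  finally show ?thesis .
qed

context cribbing_mac
begin

lemma single_letter_alt:
  "single_letter pS zf W pX1U pX2 = bind_pmf pS (\<lambda>s. bind_pmf (pX1U (fst s)) (\<lambda>a. bind_pmf (pX2 (zf (fst a) (fst s)) (snd a) (snd s))
     (\<lambda>x2. map_pmf (\<lambda>y. (fst s, snd s, fst a, snd a, zf (fst a) (fst s), x2, y)) (W (fst a) x2 (fst s) (snd s)))))"
  unfolding single_letter_def by (simp add: split_beta' map_pmf_def Let_def)

text \<open>Memorylessness: once the condition reveals \<open>(x1,x2,s1,s2)\<close>, by means of
  \<open>g\<close>, the entropy is the expected log-loss of \<open>W\<close>. So the subtracted
  terms of all four mutual informations coincide.\<close>

lemma hc_output:
  assumes fin: "finite (set_pmf (single_letter pS zf W pX1U pX2))"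
    and g: "\<And>s1 s2 x1 u x2. g (b (s1, s2, x1, u, x2)) = (x1, x2, s1, s2)"
  shows "hc (single_letter pS zf W pX1U pX2) (\<lambda>(s1, s2, x1, u, z, x2, y). y) (\<lambda>(s1, s2, x1, u, z, x2, y). b (s1, s2, x1, u, x2)) =
    measure_pmf.expectation (single_letter pS zf W pX1U pX2) (\<lambda>(s1, s2, x1, u, z, x2, y). - log 2 (pmf (W x1 x2 s1 s2) y))"
proof (subst hc_kernel[OF fin, where k="\<lambda>b. case g b of (x1, x2, s1, s2) \<Rightarrow> W x1 x2 s1 s2"])
  show "map_pmf (\<lambda>w. (case w of (s1, s2, x1, u, z, x2, y) \<Rightarrow> b (s1, s2, x1, u, x2), case w of (s1, s2, x1, u, z, x2, y) \<Rightarrow> y)) (single_letter pS zf W pX1U pX2) =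
    bind_pmf (map_pmf (\<lambda>(s1, s2, x1, u, z, x2, y). b (s1, s2, x1, u, x2)) (single_letter pS zf W pX1U pX2))
     (\<lambda>b. map_pmf (Pair b) (case g b of (x1, x2, s1, s2) \<Rightarrow> W x1 x2 s1 s2))"
    unfolding single_letter_alt by (simp add: map_bind_pmf bind_map_pmf bind_assoc_pmf bind_return_pmf map_pmf_comp g split_beta')
  show "measure_pmf.expectation (single_letter pS zf W pX1U pX2)
     (\<lambda>w. - log 2 (pmf (case g (case w of (s1, s2, x1, u, z, x2, y) \<Rightarrow> b (s1, s2, x1, u, x2)) of (x1, x2, s1, s2) \<Rightarrow> W x1 x2 s1 s2)
                 (case w of (s1, s2, x1, u, z, x2, y) \<Rightarrow> y))) =
    measure_pmf.expectation (single_letter pS zf W pX1U pX2) (\<lambda>(s1, s2, x1, u, z, x2, y). - log 2 (pmf (W x1 x2 s1 s2) y))"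
    by (simp add: g split_beta')
qed

end

section \<open>The joint law of a block code and of its letters\<close>

locale block_code = cribbing_mac pS zf W
  for pS :: "('s1::finite \<times> 's2::finite) pmf"
    and zf :: "'x1::finite \<Rightarrow> 's1 \<Rightarrow> 'z::finite"
    and W :: "'x1 \<Rightarrow> 'x2::finite \<Rightarrow> 's1 \<Rightarrow> 's2 \<Rightarrow> 'y::finite pmf" +
  fixes n :: nat and R1 R2 :: real and c :: "('x1, 'x2, 's1, 's2, 'z, 'y) mac_code"
  assumes code: "is_code R1 R2 n c" and R: "0 \<le> R1" "0 \<le> R2" and n: "0 < n"
begin

definition cx1 :: "nat \<times> nat \<times> ('s1 \<times> 's2) list \<times> 'y list \<Rightarrow> 'x1 list" where
  "cx1 = (\<lambda>(m1, m2, s, y). enc1 c m1 (map fst s))"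
definition cz :: "nat \<times> nat \<times> ('s1 \<times> 's2) list \<times> 'y list \<Rightarrow> 'z list" where
  "cz = (\<lambda>(m1, m2, s, y). map2 zf (enc1 c m1 (map fst s)) (map fst s))"
definition cx2 :: "nat \<times> nat \<times> ('s1 \<times> 's2) list \<times> 'y list \<Rightarrow> 'x2 list" where
  "cx2 = (\<lambda>(m1, m2, s, y). encode2 c n m2 (map snd s) (map2 zf (enc1 c m1 (map fst s)) (map fst s)))"

text \<open>There is no feedback: the inputs are determined before the output, and \<open>[]\<close>
  stands for the output that has not been drawn yet.\<close>

definition code_law :: "(nat \<times> nat \<times> ('s1 \<times> 's2) list \<times> 'y list) pmf" where
  "code_law = bind_pmf (pmf_of_set (messages n R1)) (\<lambda>m1. bind_pmf (pmf_of_set (messages n R2)) (\<lambda>m2.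
     bind_pmf (replicate_pmf n pS) (\<lambda>s. map_pmf (\<lambda>y. (m1, m2, s, y))
       (independent_list_pmf n (\<lambda>i. W (cx1 (m1, m2, s, []) ! i) (cx2 (m1, m2, s, []) ! i) (map fst s ! i) (map snd s ! i))))))"

lemma transmission_eq: "transmission pS zf W R1 R2 n c =
   map_pmf (\<lambda>(m1, m2, s, y). ((m1, m2), (dec1 c y (map fst s) (map snd s), dec2 c y (map fst s) (map snd s)))) code_law"
  unfolding transmission_def code_law_def Let_def
  by (simp add: map_bind_pmf map_pmf_def bind_assoc_pmf bind_return_pmf cx1_def cx2_def)

text \<open>Rounding \<open>2 powr (real n * R)\<close> down loses at most one bit, because the
  power is at least 1.\<close>

lemma messages_facts:
  assumes "0 \<le> R" shows "finite (messages n R)" "messages n R \<noteq> {}" "real n * R - 1 \<le> log 2 (real (card (messages n R)))"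
    "log 2 (real (card (messages n R))) \<le> real n * R"
proof -
  let ?x = "2 powr (real n * R)"
  have x: "1 \<le> ?x" using assms by (intro ge_one_powr_ge_zero) auto
  then have f: "1 \<le> \<lfloor>?x\<rfloor>" by linarith
  show "finite (messages n R)" by (simp add: messages_def)
  have "1 \<le> nat \<lfloor>?x\<rfloor>" using f by linarith
  then show "messages n R \<noteq> {}" by (simp add: messages_def)
  have c: "real (card (messages n R)) = real_of_int \<lfloor>?x\<rfloor>" using f by (simp add: messages_def)
  have "?x / 2 \<le> real_of_int \<lfloor>?x\<rfloor>" using x f by linarith
  then have "log 2 (?x / 2) \<le> log 2 (real (card (messages n R)))" using c x by (intro log_mono) auto
  then show "real n * R - 1 \<le> log 2 (real (card (messages n R)))" by (simp add: log_divide)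
  have "log 2 (real (card (messages n R))) \<le> log 2 ?x" using c f by (intro log_mono) auto
  then show "log 2 (real (card (messages n R))) \<le> real n * R" by simp
qed

lemmas mf = messages_facts[OF R(1)] messages_facts[OF R(2)]

lemma code_law_support:
  assumes "w \<in> set_pmf code_law"
  obtains m1 m2 s y where "w = (m1, m2, s, y)" "m1 \<in> messages n R1" "m2 \<in> messages n R2" "length s = n" "length y = n"
    "length (cx1 w) = n" "length (cz w) = n" "length (cx2 w) = n"
    "\<And>i. i < n \<Longrightarrow> pmf (W (cx1 w ! i) (cx2 w ! i) (map fst s ! i) (map snd s ! i)) (y ! i) \<noteq> 0"
proof -
  from assms obtain m1 m2 s y where w: "w = (m1, m2, s, y)" "m1 \<in> messages n R1" "m2 \<in> messages n R2"
    "s \<in> set_pmf (replicate_pmf n pS)"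
    "y \<in> set_pmf (independent_list_pmf n (\<lambda>i. W (cx1 (m1, m2, s, []) ! i) (cx2 (m1, m2, s, []) ! i) (map fst s ! i) (map snd s ! i)))"
    unfolding code_law_def by (auto simp: mf)
  have e: "cx1 (m1, m2, s, []) = cx1 w" "cx2 (m1, m2, s, []) = cx2 w" by (auto simp: w(1) cx1_def cx2_def)
  have ls: "length s = n" using w(4) by (simp add: set_replicate_pmf)
  have lx: "length (cx1 w) = n" using code w(2) ls unfolding is_code_def w(1) cx1_def by simp
  show thesis
    by (rule that[OF w(1-3) ls length_independent_list[OF w(5)] lx])
      (use nth_independent_list[OF w(5)] lx ls in \<open>auto simp: e w(1) cx1_def cz_def cx2_def encode2_def set_pmf_iff\<close>)
qed

lemma finite_code_law: "finite (set_pmf code_law)"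
  unfolding code_law_def
  by (auto simp: mf set_pmf_of_set replicate_pmf_eq_independent_list intro!: finite_UN_I finite_imageI finite_independent_list)

text \<open>This is \<open>U_i\<close> without the index. The past and the future of
  \<open>S_2\<close> are included so that \<open>U_i\<close> and \<open>S_{2,i}\<close> together
  contain all of \<open>S_2^n\<close>, on which Encoder 2 depends.\<close>

definition side :: "nat \<Rightarrow> nat \<times> nat \<times> ('s1 \<times> 's2) list \<times> 'y list \<Rightarrow> 'z list \<times> 's1 list \<times> 's2 list \<times> 's2 list" where
  "side i w = (case w of (m1, m2, s, y) \<Rightarrow> (take i (cz w), take i (map fst s), take i (map snd s), drop (Suc i) (map snd s)))"

definition letter :: "nat \<Rightarrow> nat \<times> nat \<times> ('s1 \<times> 's2) list \<times> 'y list \<Rightarrow> 's1 \<times> 's2 \<times> 'x1 \<times> ('z list \<times> 's1 list \<times> 's2 list \<times> 's2 list) \<times> 'z \<times> 'x2 \<times> 'y" where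
  "letter i w = (case w of (m1, m2, s, y) \<Rightarrow> (map fst s ! i, map snd s ! i, cx1 w ! i, side i w, cz w ! i, cx2 w ! i, y ! i))"

text \<open>The conditional law of \<open>(X_{1,i}, U_i)\<close> given \<open>S_{1,i} = s1\<close>:
  the states at the other times are independent of those at time \<open>i\<close> and may be drawn
  afresh. \<open>S_{2,i}\<close> does not occur, as the form \<open>p_{X_1,U|S_1}\<close>
  demands.\<close>

definition kern1 :: "nat \<Rightarrow> 's1 \<Rightarrow> ('x1 \<times> ('z list \<times> 's1 list \<times> 's2 list \<times> 's2 list)) pmf" where
  "kern1 i s1 = bind_pmf (pmf_of_set (messages n R1)) (\<lambda>m1. bind_pmf (replicate_pmf i pS) (\<lambda>a. bind_pmf (replicate_pmf (n - Suc i) pS) (\<lambda>b.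
     let s1l = map fst a @ s1 # map fst b; x1l = enc1 c m1 s1l
     in return_pmf (x1l ! i, (take i (map2 zf x1l s1l), map fst a, map snd a, map snd b)))))"

text \<open>The crib up to time \<open>i\<close> is \<open>zp @ [z]\<close> and the whole state
  sequence is \<open>a2 @ s2 # b2\<close>. Given \<open>(z,u,s2)\<close> only the message of Encoder
  2 is random, and it is independent of these.\<close>

definition kern2 :: "nat \<Rightarrow> 'z \<Rightarrow> ('z list \<times> 's1 list \<times> 's2 list \<times> 's2 list) \<Rightarrow> 's2 \<Rightarrow> 'x2 pmf" where
  "kern2 i z u s2 = (case u of (zp, a1, a2, b2) \<Rightarrow>
     map_pmf (\<lambda>m2. enc2 c i m2 (a2 @ s2 # b2) (zp @ [z])) (pmf_of_set (messages n R2)))"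

text \<open>The letters at time \<open>i\<close> have the single-letter form. The draws are
  rearranged so that the states at time \<open>i\<close> come first and the second message comes
  last, just before the input that it determines.\<close>

lemma letter_law:
  assumes i: "i < n"
  shows "map_pmf (letter i) code_law = bind_pmf pS (\<lambda>s. bind_pmf (kern1 i (fst s)) (\<lambda>a. bind_pmf (kern2 i (zf (fst a) (fst s)) (snd a) (snd s))
     (\<lambda>x2. map_pmf (\<lambda>y. (fst s, snd s, fst a, snd a, zf (fst a) (fst s), x2, y)) (W (fst a) x2 (fst s) (snd s)))))"
proof -
  let ?u1 = "pmf_of_set (messages n R1)" and ?u2 = "pmf_of_set (messages n R2)"
  let ?A = "replicate_pmf i pS" and ?B = "replicate_pmf (n - Suc i) pS"
  define F where "F m1 m2 a t b = (let s1l = map fst a @ fst t # map fst b; x1l = enc1 c m1 s1l; zp = take i (map2 zf x1l s1l);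
      z = zf (x1l ! i) (fst t); x2 = enc2 c i m2 (map snd a @ snd t # map snd b) (zp @ [z]) in
      map_pmf (\<lambda>y. (fst t, snd t, x1l ! i, (zp, map fst a, map snd a, map snd b), z, x2, y)) (W (x1l ! i) x2 (fst t) (snd t)))"
    for m1 m2 a t b
  have rep: "replicate_pmf n pS = bind_pmf ?A (\<lambda>a. bind_pmf pS (\<lambda>t. map_pmf (\<lambda>b. a @ t # b) ?B))"
  proof -
    have "replicate_pmf n pS = replicate_pmf (i + Suc (n - Suc i)) pS" using i by simp
    then show ?thesis unfolding replicate_pmf_distrib
      by (simp add: map_pmf_def bind_assoc_pmf bind_return_pmf)
  qed
  have "map_pmf (letter i) code_law = bind_pmf ?u1 (\<lambda>m1. bind_pmf ?u2 (\<lambda>m2. bind_pmf ?A (\<lambda>a. bind_pmf pS (\<lambda>t. bind_pmf ?B (\<lambda>b. F m1 m2 a t b)))))"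
    unfolding code_law_def map_bind_pmf rep bind_assoc_pmf bind_map_pmf
  proof (intro bind_pmf_cong refl)
    fix m1 m2 :: nat and a t b
    assume m: "m1 \<in> set_pmf ?u1" "a \<in> set_pmf ?A" "b \<in> set_pmf ?B"
    let ?s = "a @ t # b"
    let ?w = "(m1, m2, ?s, [])"
    have l: "length a = i" "length b = n - Suc i" using m by (auto simp: set_replicate_pmf)
    have lx: "length (enc1 c m1 (map fst ?s)) = n" using code m(1) l i mf unfolding is_code_def by auto
    define f where "f y = (fst t, snd t, cx1 ?w ! i, side i ?w, cz ?w ! i, cx2 ?w ! i, y)" for y :: 'y
    have "map_pmf (letter i) (map_pmf (\<lambda>y. (m1, m2, ?s, y)) (independent_list_pmf n (\<lambda>j. W (cx1 ?w ! j) (cx2 ?w ! j) (map fst ?s ! j) (map snd ?s ! j)))) =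
      map_pmf f (map_pmf (\<lambda>y. y ! i) (independent_list_pmf n (\<lambda>j. W (cx1 ?w ! j) (cx2 ?w ! j) (map fst ?s ! j) (map snd ?s ! j))))"
      unfolding map_pmf_comp f_def
      by (intro map_pmf_cong refl) (use l in \<open>simp add: letter_def side_def cx1_def cx2_def cz_def nth_append\<close>)
    also have "\<dots> = map_pmf f (W (cx1 ?w ! i) (cx2 ?w ! i) (fst t) (snd t))"
      using i l by (simp add: independent_list_component nth_append)
    also have "\<dots> = F m1 m2 a t b"
    proof -
      have t: "take (Suc i) (cz ?w) = take i (cz ?w) @ [zf (cx1 ?w ! i) (fst t)]"
        using lx i l by (simp add: take_Suc_conv_app_nth cz_def cx1_def nth_append)
      have "cx2 ?w ! i = enc2 c i m2 (map snd ?s) (take i (cz ?w) @ [zf (cx1 ?w ! i) (fst t)])"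
        unfolding t[symmetric] using i by (simp add: cx2_def encode2_def cz_def)
      moreover have "cz ?w ! i = zf (cx1 ?w ! i) (fst t)"
        using lx i l by (simp add: cz_def cx1_def nth_append)
      ultimately show ?thesis
        unfolding F_def Let_def f_def side_def using l by (simp add: cx1_def cz_def)
    qed
    finally show "map_pmf (letter i) (map_pmf (\<lambda>y. (m1, m2, ?s, y)) (independent_list_pmf n (\<lambda>j. W (cx1 ?w ! j) (cx2 ?w ! j) (map fst ?s ! j) (map snd ?s ! j)))) = F m1 m2 a t b" .
  qed
  also have "\<dots> = bind_pmf ?u1 (\<lambda>m1. bind_pmf ?u2 (\<lambda>m2. bind_pmf pS (\<lambda>t. bind_pmf ?A (\<lambda>a. bind_pmf ?B (\<lambda>b. F m1 m2 a t b)))))"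
    by (intro bind_pmf_cong refl) (rule bind_commute_pmf)
  also have "\<dots> = bind_pmf ?u1 (\<lambda>m1. bind_pmf pS (\<lambda>t. bind_pmf ?u2 (\<lambda>m2. bind_pmf ?A (\<lambda>a. bind_pmf ?B (\<lambda>b. F m1 m2 a t b)))))"
    by (intro bind_pmf_cong refl) (rule bind_commute_pmf)
  also have "\<dots> = bind_pmf pS (\<lambda>t. bind_pmf ?u1 (\<lambda>m1. bind_pmf ?u2 (\<lambda>m2. bind_pmf ?A (\<lambda>a. bind_pmf ?B (\<lambda>b. F m1 m2 a t b)))))"
    by (rule bind_commute_pmf)
  also have "\<dots> = bind_pmf pS (\<lambda>t. bind_pmf ?u1 (\<lambda>m1. bind_pmf ?A (\<lambda>a. bind_pmf ?u2 (\<lambda>m2. bind_pmf ?B (\<lambda>b. F m1 m2 a t b)))))"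
    by (intro bind_pmf_cong refl) (rule bind_commute_pmf)
  also have "\<dots> = bind_pmf pS (\<lambda>t. bind_pmf ?u1 (\<lambda>m1. bind_pmf ?A (\<lambda>a. bind_pmf ?B (\<lambda>b. bind_pmf ?u2 (\<lambda>m2. F m1 m2 a t b)))))"
    by (intro bind_pmf_cong refl) (rule bind_commute_pmf)
  also have "\<dots> = bind_pmf pS (\<lambda>s. bind_pmf (kern1 i (fst s)) (\<lambda>a. bind_pmf (kern2 i (zf (fst a) (fst s)) (snd a) (snd s))
     (\<lambda>x2. map_pmf (\<lambda>y. (fst s, snd s, fst a, snd a, zf (fst a) (fst s), x2, y)) (W (fst a) x2 (fst s) (snd s)))))"
    unfolding kern1_def kern2_def Let_def bind_assoc_pmf bind_return_pmf bind_map_pmf F_def by (simp add: bind_map_pmf)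
  finally show ?thesis .
qed

end

text \<open>Symmetry of \<open>I(A;D|C)\<close>, by the chain rule in both orders. With messages for
  \<open>A\<close> and observations for \<open>D\<close> it turns a message entropy into an
  information plus a Fano term.\<close>

lemma hc_exchange:
  assumes fin: "finite (set_pmf P)"
  shows "hc P A C = hc P D C - hc P D (\<lambda>w. (A w, C w)) + hc P A (\<lambda>w. (D w, C w))"
proof -
  have "hc P (\<lambda>w. (A w, D w)) C = hc P (\<lambda>w. (D w, A w)) C" by (rule hc_cong) auto
  then show ?thesis using hc_chain[OF fin, of A D C] hc_chain[OF fin, of D A C] by simp
qed

lemma hc_list_bound:
  assumes fin: "finite (set_pmf P)" and len: "\<And>w. w \<in> set_pmf P \<Longrightarrow> length (L w) = n"
    and det: "\<And>i w w'. i < n \<Longrightarrow> w \<in> set_pmf P \<Longrightarrow> w' \<in> set_pmf P \<Longrightarrow> C w' = C w \<Longrightarrow> B i w' = B i w"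
  shows "hc P L C \<le> (\<Sum>i<n. hc P (\<lambda>w. L w ! i) (B i))"
proof (subst hc_list_chain[OF fin, of L n C, OF len], assumption, intro sum_mono hc_mono_cond[OF fin])
  fix i w w' assume "i \<in> {..<n}" "w \<in> set_pmf P" "w' \<in> set_pmf P" "(take i (L w'), C w') = (take i (L w), C w)"
  then show "B i w' = B i w" using det[of i w w'] by simp
qed

context cribbing_mac
begin

lemma hc_state:
  "hc (single_letter pS zf W pX1U pX2) (\<lambda>(s1, s2, x1, u, z, x2, y). s1) (\<lambda>(s1, s2, x1, u, z, x2, y). s2) = hc pS fst snd"
proof -
  have "hc pS fst snd = hc (map_pmf (\<lambda>w. (S1c (fst w), S2c (fst w))) (letter_law pX1U pX2)) fst snd"
    by (simp only: marginal_S)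
  then show ?thesis unfolding hc_single_letter hc_map by (simp add: split_beta')
qed

end

section \<open>Time sharing and the bounds on the entropies of whole blocks\<close>

context block_code
begin

definition ts_kern1 :: "'s1 \<Rightarrow> ('x1 \<times> nat) pmf" where
  "ts_kern1 s1 = bind_pmf (pmf_of_set {..<n}) (\<lambda>i. map_pmf (\<lambda>a. (fst a, to_nat (i, snd a))) (kern1 i s1))"
definition ts_kern2 :: "'z \<Rightarrow> nat \<Rightarrow> 's2 \<Rightarrow> 'x2 pmf" where
  "ts_kern2 z v s2 = (case from_nat v of (i, u) \<Rightarrow> kern2 i z u s2)"

definition ts_letter :: "nat \<times> nat \<times> nat \<times> ('s1 \<times> 's2) list \<times> 'y list \<Rightarrow> 's1 \<times> 's2 \<times> 'x1 \<times> nat \<times> 'z \<times> 'x2 \<times> 'y" where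
  "ts_letter = (\<lambda>(i, w). case letter i w of (s1, s2, x1, u, z, x2, y) \<Rightarrow> (s1, s2, x1, to_nat (i, u), z, x2, y))"

abbreviation "shared_law \<equiv> pair_pmf (pmf_of_set {..<n}) code_law"

lemma set_uniform_time: "set_pmf (pmf_of_set {..<n}) = {..<n}"
  by (rule set_pmf_of_set) (use n in auto)

lemma ts_law: "single_letter pS zf W ts_kern1 ts_kern2 = map_pmf ts_letter shared_law"
proof -
  let ?h = "\<lambda>i (s1, s2, x1, u, z, x2, y). (s1, s2, x1, to_nat (i, u), z, x2, y)"
  have "map_pmf ts_letter shared_law = bind_pmf (pmf_of_set {..<n}) (\<lambda>i. map_pmf (?h i) (map_pmf (letter i) code_law))"
    unfolding pair_pmf_def ts_letter_def by (simp add: map_bind_pmf map_pmf_def bind_assoc_pmf bind_return_pmf)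
  also have "\<dots> = bind_pmf (pmf_of_set {..<n}) (\<lambda>i. bind_pmf pS (\<lambda>s. bind_pmf (kern1 i (fst s)) (\<lambda>a. bind_pmf (kern2 i (zf (fst a) (fst s)) (snd a) (snd s))
     (\<lambda>x2. map_pmf (\<lambda>y. (fst s, snd s, fst a, to_nat (i, snd a), zf (fst a) (fst s), x2, y)) (W (fst a) x2 (fst s) (snd s))))))"
    by (intro bind_pmf_cong refl) (simp add: set_uniform_time letter_law map_bind_pmf map_pmf_comp)
  also have "\<dots> = bind_pmf pS (\<lambda>s. bind_pmf (pmf_of_set {..<n}) (\<lambda>i. bind_pmf (kern1 i (fst s)) (\<lambda>a. bind_pmf (kern2 i (zf (fst a) (fst s)) (snd a) (snd s))
     (\<lambda>x2. map_pmf (\<lambda>y. (fst s, snd s, fst a, to_nat (i, snd a), zf (fst a) (fst s), x2, y)) (W (fst a) x2 (fst s) (snd s))))))"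
    by (rule bind_commute_pmf)
  also have "\<dots> = single_letter pS zf W ts_kern1 ts_kern2"
    unfolding single_letter_alt ts_kern1_def ts_kern2_def by (simp add: bind_assoc_pmf bind_map_pmf)
  finally show ?thesis ..
qed

lemma finite_ts: "finite (set_pmf (single_letter pS zf W ts_kern1 ts_kern2))"
  unfolding ts_law by (simp add: set_uniform_time finite_code_law)

text \<open>The condition has to reveal the time index, which it does as soon as it contains the
  encoded \<open>U\<close>; the entropy is then an average over the times.\<close>

lemma hc_ts:
  assumes A: "\<And>i w. i < n \<Longrightarrow> A (ts_letter (i, w)) = a i w"
    and B: "\<And>i w i' w'. i < n \<Longrightarrow> i' < n \<Longrightarrow> B (ts_letter (i', w')) = B (ts_letter (i, w)) \<longleftrightarrow> i' = i \<and> b i' w' = b i w"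
  shows "hc (single_letter pS zf W ts_kern1 ts_kern2) A B = (\<Sum>i<n. hc code_law (a i) (b i)) / real n"
proof -
  have "hc (single_letter pS zf W ts_kern1 ts_kern2) A B = hc shared_law (\<lambda>x. A (ts_letter x)) (\<lambda>x. B (ts_letter x))"
    unfolding ts_law hc_map ..
  also have "\<dots> = hc shared_law (\<lambda>x. a (fst x) (snd x)) (\<lambda>x. (fst x, b (fst x) (snd x)))"
    by (rule hc_cong) (use A B in \<open>auto simp: set_uniform_time\<close>)
  also have "\<dots> = (\<Sum>i<n. hc code_law (a i) (b i)) / real n"
    by (rule hc_time_share[OF finite_code_law n])
  finally show ?thesis .
qed

definition m1r :: "nat \<times> nat \<times> ('s1 \<times> 's2) list \<times> 'y list \<Rightarrow> nat" where "m1r = (\<lambda>(m1, m2, s, y). m1)"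
definition m2r :: "nat \<times> nat \<times> ('s1 \<times> 's2) list \<times> 'y list \<Rightarrow> nat" where "m2r = (\<lambda>(m1, m2, s, y). m2)"
definition sr :: "nat \<times> nat \<times> ('s1 \<times> 's2) list \<times> 'y list \<Rightarrow> ('s1 \<times> 's2) list" where "sr = (\<lambda>(m1, m2, s, y). s)"
definition yr :: "nat \<times> nat \<times> ('s1 \<times> 's2) list \<times> 'y list \<Rightarrow> 'y list" where "yr = (\<lambda>(m1, m2, s, y). y)"

lemmas rv_defs = m1r_def m2r_def sr_def yr_def cx1_def cx2_def cz_def side_def

abbreviation "s1i i w \<equiv> map fst (sr w) ! i"
abbreviation "s2i i w \<equiv> map snd (sr w) ! i"

lemma ts_letter_eq: "ts_letter (i, w) = (s1i i w, s2i i w, cx1 w ! i, to_nat (i, side i w), cz w ! i, cx2 w ! i, yr w ! i)"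
  by (cases w) (simp add: ts_letter_def letter_def sr_def yr_def)

text \<open>Both sides are the expected log-loss of the channel, once averaged over letters and once
  for the whole block.\<close>

lemma output_entropy:
  "measure_pmf.expectation (single_letter pS zf W ts_kern1 ts_kern2) (\<lambda>(s1, s2, x1, u, z, x2, y). - log 2 (pmf (W x1 x2 s1 s2) y)) =
   hc code_law yr (\<lambda>w. (m1r w, m2r w, sr w)) / real n"
proof -
  let ?f = "\<lambda>i w. - log 2 (pmf (W (cx1 w ! i) (cx2 w ! i) (s1i i w) (s2i i w)) (yr w ! i))"
  have "measure_pmf.expectation (single_letter pS zf W ts_kern1 ts_kern2) (\<lambda>(s1, s2, x1, u, z, x2, y). - log 2 (pmf (W x1 x2 s1 s2) y)) =
    measure_pmf.expectation shared_law (\<lambda>x. ?f (fst x) (snd x))"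
    unfolding ts_law integral_map_pmf by (rule expectation_pmf_cong) (auto simp: ts_letter_eq)
  also have "\<dots> = (\<Sum>i<n. measure_pmf.expectation code_law (?f i)) / real n"
    unfolding pair_pmf_def
    by (subst pmf_expectation_bind_pmf_of_set)
      (use n finite_code_law in \<open>auto simp: sum_divide_distrib map_pmf_def[symmetric] divide_inverse_commute sum_distrib_left\<close>)
  also have "(\<Sum>i<n. measure_pmf.expectation code_law (?f i)) = measure_pmf.expectation code_law (\<lambda>w. \<Sum>i<n. ?f i w)"
    by (rule Bochner_Integration.integral_sum[symmetric]) (rule integrable_finite_pmf[OF finite_code_law])
  also have "\<dots> = hc code_law yr (\<lambda>w. (m1r w, m2r w, sr w))"
  proof -
    let ?k = "\<lambda>(m1, m2, s). independent_list_pmf n (\<lambda>i. W (cx1 (m1, m2, s, []) ! i) (cx2 (m1, m2, s, []) ! i) (map fst s ! i) (map snd s ! i))"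
    have "hc code_law yr (\<lambda>w. (m1r w, m2r w, sr w)) = measure_pmf.expectation code_law (\<lambda>w. - log 2 (pmf (?k (m1r w, m2r w, sr w)) (yr w)))"
    proof (rule hc_kernel[OF finite_code_law])
      show "map_pmf (\<lambda>w. ((m1r w, m2r w, sr w), yr w)) code_law = bind_pmf (map_pmf (\<lambda>w. (m1r w, m2r w, sr w)) code_law) (\<lambda>b. map_pmf (Pair b) (?k b))"
        unfolding code_law_def by (simp add: map_bind_pmf bind_map_pmf bind_assoc_pmf bind_return_pmf map_pmf_comp m1r_def m2r_def sr_def yr_def)
    qed
    also have "\<dots> = measure_pmf.expectation code_law (\<lambda>w. \<Sum>i<n. ?f i w)"
    proof (rule expectation_pmf_cong)
      fix w assume "w \<in> set_pmf code_law"
      then obtain m1 m2 s y where w: "w = (m1, m2, s, y)" "length s = n" "length y = n"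
        "\<And>i. i < n \<Longrightarrow> pmf (W (cx1 w ! i) (cx2 w ! i) (map fst s ! i) (map snd s ! i)) (y ! i) \<noteq> 0"
        by (rule code_law_support) blast
      have e: "cx1 (m1, m2, s, []) = cx1 w" "cx2 (m1, m2, s, []) = cx2 w" by (auto simp: w(1) cx1_def cx2_def)
      have "log 2 (\<Prod>i<n. pmf (W (cx1 w ! i) (cx2 w ! i) (map fst s ! i) (map snd s ! i)) (y ! i)) =
        (\<Sum>i<n. log 2 (pmf (W (cx1 w ! i) (cx2 w ! i) (map fst s ! i) (map snd s ! i)) (y ! i)))"
        by (rule log_prod_nz) (simp only: lessThan_iff w(4) not_False_eq_True)
      then show "- log 2 (pmf (?k (m1r w, m2r w, sr w)) (yr w)) = (\<Sum>i<n. ?f i w)"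
        using w(3) by (simp add: m1r_def m2r_def sr_def yr_def w(1) pmf_independent_list sum_negf e[unfolded w(1)])
    qed
    finally show ?thesis ..
  qed
  finally show ?thesis .
qed

lemma message_entropy1: "hc code_law m1r (\<lambda>w. (m2r w, sr w)) = log 2 (real (card (messages n R1)))"
proof -
  have "hc code_law m1r (\<lambda>w. (m2r w, sr w)) = measure_pmf.expectation code_law (\<lambda>w. - log 2 (pmf (pmf_of_set (messages n R1)) (m1r w)))"
  proof (rule hc_kernel[OF finite_code_law])
    let ?u1 = "pmf_of_set (messages n R1)" and ?u2 = "pmf_of_set (messages n R2)" and ?S = "replicate_pmf n pS"
    have "map_pmf (\<lambda>w. ((m2r w, sr w), m1r w)) code_law = bind_pmf ?u1 (\<lambda>m1. bind_pmf ?u2 (\<lambda>m2. bind_pmf ?S (\<lambda>s. return_pmf ((m2, s), m1))))"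
      unfolding code_law_def by (simp add: map_bind_pmf map_pmf_comp m1r_def m2r_def sr_def map_pmf_const)
    also have "\<dots> = bind_pmf ?u2 (\<lambda>m2. bind_pmf ?u1 (\<lambda>m1. bind_pmf ?S (\<lambda>s. return_pmf ((m2, s), m1))))"
      by (rule bind_commute_pmf)
    also have "\<dots> = bind_pmf ?u2 (\<lambda>m2. bind_pmf ?S (\<lambda>s. bind_pmf ?u1 (\<lambda>m1. return_pmf ((m2, s), m1))))"
      by (intro bind_pmf_cong refl) (rule bind_commute_pmf)
    also have "\<dots> = bind_pmf (map_pmf (\<lambda>w. (m2r w, sr w)) code_law) (\<lambda>b. map_pmf (Pair b) ?u1)"
      unfolding code_law_def by (simp add: map_bind_pmf bind_map_pmf bind_assoc_pmf map_pmf_comp m2r_def sr_def map_pmf_const bind_return_pmf) (simp add: map_pmf_def)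
    finally show "map_pmf (\<lambda>w. ((m2r w, sr w), m1r w)) code_law = bind_pmf (map_pmf (\<lambda>w. (m2r w, sr w)) code_law) (\<lambda>b. map_pmf (Pair b) ?u1)" .
  qed
  also have "\<dots> = measure_pmf.expectation code_law (\<lambda>w. log 2 (real (card (messages n R1))))"
  proof (rule expectation_pmf_cong)
    fix w assume "w \<in> set_pmf code_law"
    then obtain m1 m2 s y where w: "w = (m1, m2, s, y)" "m1 \<in> messages n R1"
      by (rule code_law_support) blast
    have "card (messages n R1) > 0" using mf by (simp add: card_gt_0_iff)
    then show "- log 2 (pmf (pmf_of_set (messages n R1)) (m1r w)) = log 2 (real (card (messages n R1)))"
      using w mf by (simp add: m1r_def log_divide)
  qed
  finally show ?thesis by simp
qed

lemma message_entropy2: "hc code_law m2r (\<lambda>w. (m1r w, sr w)) = log 2 (real (card (messages n R2)))"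
proof -
  have "hc code_law m2r (\<lambda>w. (m1r w, sr w)) = measure_pmf.expectation code_law (\<lambda>w. - log 2 (pmf (pmf_of_set (messages n R2)) (m2r w)))"
  proof (rule hc_kernel[OF finite_code_law])
    let ?u1 = "pmf_of_set (messages n R1)" and ?u2 = "pmf_of_set (messages n R2)" and ?S = "replicate_pmf n pS"
    have "map_pmf (\<lambda>w. ((m1r w, sr w), m2r w)) code_law = bind_pmf ?u1 (\<lambda>m1. bind_pmf ?u2 (\<lambda>m2. bind_pmf ?S (\<lambda>s. return_pmf ((m1, s), m2))))"
      unfolding code_law_def by (simp add: map_bind_pmf map_pmf_comp m1r_def m2r_def sr_def map_pmf_const)
    also have "\<dots> = bind_pmf ?u1 (\<lambda>m1. bind_pmf ?S (\<lambda>s. bind_pmf ?u2 (\<lambda>m2. return_pmf ((m1, s), m2))))"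
      by (intro bind_pmf_cong refl) (rule bind_commute_pmf)
    also have "\<dots> = bind_pmf (map_pmf (\<lambda>w. (m1r w, sr w)) code_law) (\<lambda>b. map_pmf (Pair b) ?u2)"
      unfolding code_law_def by (simp add: map_bind_pmf bind_map_pmf bind_assoc_pmf map_pmf_comp m1r_def sr_def map_pmf_const bind_return_pmf) (simp add: map_pmf_def)
    finally show "map_pmf (\<lambda>w. ((m1r w, sr w), m2r w)) code_law = bind_pmf (map_pmf (\<lambda>w. (m1r w, sr w)) code_law) (\<lambda>b. map_pmf (Pair b) ?u2)" .
  qed
  also have "\<dots> = measure_pmf.expectation code_law (\<lambda>w. log 2 (real (card (messages n R2))))"
  proof (rule expectation_pmf_cong)
    fix w assume "w \<in> set_pmf code_law"
    then obtain m1 m2 s y where w: "w = (m1, m2, s, y)" "m2 \<in> messages n R2"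
      by (rule code_law_support) blast
    have "card (messages n R2) > 0" using mf by (simp add: card_gt_0_iff)
    then show "- log 2 (pmf (pmf_of_set (messages n R2)) (m2r w)) = log 2 (real (card (messages n R2)))"
      using w mf by (simp add: m2r_def log_divide)
  qed
  finally show ?thesis by simp
qed

lemma lens:
  assumes "w \<in> set_pmf code_law"
  shows "length (cz w) = n" "length (sr w) = n" "length (yr w) = n"
  using assms by (auto simp: sr_def yr_def elim!: code_law_support)

text \<open>\<open>H(Z^n,S_1^n|S_2^n)\<close> is computed in two ways. As a whole it is
  \<open>n H(S_1|S_2) + H(Z^n|S^n)\<close>. Letter by letter, the term at time \<open>i\<close> is
  conditioned on the pasts of \<open>Z\<close> and \<open>S_1\<close> and on all of
  \<open>S_2\<close>, that is on \<open>U_i\<close> and \<open>S_{2,i}\<close>, and is at most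
  \<open>H(S_{1,i}|U_i,S_{2,i}) + H(Z_i|S_{1,i},U_i)\<close>. This expansion dictates the choice of
  \<open>U_i\<close>.\<close>

lemma crib_entropy_bound:
  "hc code_law cz sr \<le> (\<Sum>i<n. hc code_law (\<lambda>w. cz w ! i) (\<lambda>w. (s1i i w, side i w))) -
     (real n * hc pS fst snd - (\<Sum>i<n. hc code_law (s1i i) (\<lambda>w. (side i w, s2i i w))))"
proof -
  note fin = finite_code_law
  have len: "length (zip (cz w) (map fst (sr w))) = n" if "w \<in> set_pmf code_law" for w
    using lens[OF that] by simp
  have S: "map_pmf sr code_law = replicate_pmf n pS"
    unfolding code_law_def by (simp add: map_bind_pmf map_pmf_comp sr_def map_pmf_const bind_return_pmf')
  have "hc code_law (\<lambda>w. zip (cz w) (map fst (sr w))) (\<lambda>w. map snd (sr w)) \<le>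
     (\<Sum>i<n. hc code_law (\<lambda>w. zip (cz w) (map fst (sr w)) ! i) (\<lambda>w. (side i w, s2i i w)))"
  proof (subst hc_list_chain[OF fin, of _ n, OF len], assumption, intro sum_mono hc_mono_cond[OF fin])
    fix i w w' assume i: "i \<in> {..<n}" and w: "w \<in> set_pmf code_law" "w' \<in> set_pmf code_law"
      and e: "(take i (zip (cz w') (map fst (sr w'))), map snd (sr w')) = (take i (zip (cz w) (map fst (sr w))), map snd (sr w))"
    have l: "length (cz w) = length (sr w)" "length (cz w') = length (sr w')"
      using lens w by simp_all
    have "zip (take i (cz w')) (take i (map fst (sr w'))) = zip (take i (cz w)) (take i (map fst (sr w)))"
      using e by (simp add: take_zip)
    then have "take i (cz w') = take i (cz w) \<and> take i (map fst (sr w')) = take i (map fst (sr w))"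
      using l by (metis length_map length_take map_fst_zip map_snd_zip)
    then show "(side i w', s2i i w') = (side i w, s2i i w)"
      using e by (simp add: side_def sr_def split_beta')
  qed
  also have "\<dots> = (\<Sum>i<n. hc code_law (s1i i) (\<lambda>w. (side i w, s2i i w)) + hc code_law (\<lambda>w. cz w ! i) (\<lambda>w. (s1i i w, side i w, s2i i w)))"
  proof (intro sum.cong refl)
    fix i assume i: "i \<in> {..<n}"
    have "hc code_law (\<lambda>w. zip (cz w) (map fst (sr w)) ! i) (\<lambda>w. (side i w, s2i i w)) = hc code_law (\<lambda>w. (cz w ! i, s1i i w)) (\<lambda>w. (side i w, s2i i w))"
    proof (rule hc_cong)
      have "zip (cz w) (map fst (sr w)) ! i = (cz w ! i, s1i i w)" if "w \<in> set_pmf code_law" for w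
        using lens[OF that] i by simp
      then show "((zip (cz w') (map fst (sr w')) ! i, side i w', s2i i w') = (zip (cz w) (map fst (sr w)) ! i, side i w, s2i i w)) =
        (((cz w' ! i, s1i i w'), side i w', s2i i w') = ((cz w ! i, s1i i w), side i w, s2i i w))"
        if "w \<in> set_pmf code_law" "w' \<in> set_pmf code_law" for w w' using that by simp
    qed simp
    then show "hc code_law (\<lambda>w. zip (cz w) (map fst (sr w)) ! i) (\<lambda>w. (side i w, s2i i w)) =
      hc code_law (s1i i) (\<lambda>w. (side i w, s2i i w)) + hc code_law (\<lambda>w. cz w ! i) (\<lambda>w. (s1i i w, side i w, s2i i w))"
      using hc_chain[OF fin, of "\<lambda>w. cz w ! i" "s1i i" "\<lambda>w. (side i w, s2i i w)"] by simp
  qed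
  also have "\<dots> \<le> (\<Sum>i<n. hc code_law (s1i i) (\<lambda>w. (side i w, s2i i w)) + hc code_law (\<lambda>w. cz w ! i) (\<lambda>w. (s1i i w, side i w)))"
    by (intro sum_mono add_left_mono hc_mono_cond[OF fin]) auto
  finally have 1: "hc code_law (\<lambda>w. zip (cz w) (map fst (sr w))) (\<lambda>w. map snd (sr w)) \<le>
    (\<Sum>i<n. hc code_law (s1i i) (\<lambda>w. (side i w, s2i i w))) + (\<Sum>i<n. hc code_law (\<lambda>w. cz w ! i) (\<lambda>w. (s1i i w, side i w)))"
    by (simp add: sum.distrib)
  have "hc code_law (\<lambda>w. zip (cz w) (map fst (sr w))) (\<lambda>w. map snd (sr w)) = hc code_law (\<lambda>w. (cz w, map fst (sr w))) (\<lambda>w. map snd (sr w))"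
  proof (rule hc_cong)
    fix w w' assume w: "w \<in> set_pmf code_law" "w' \<in> set_pmf code_law"
    have l: "length (cz w) = length (sr w)" "length (cz w') = length (sr w')"
      using lens w by simp_all
    have "zip (cz w') (map fst (sr w')) = zip (cz w) (map fst (sr w)) \<longleftrightarrow> cz w' = cz w \<and> map fst (sr w') = map fst (sr w)"
      using l by (metis length_map map_fst_zip map_snd_zip)
    then show "((zip (cz w') (map fst (sr w')), map snd (sr w')) = (zip (cz w) (map fst (sr w)), map snd (sr w))) =
      (((cz w', map fst (sr w')), map snd (sr w')) = ((cz w, map fst (sr w)), map snd (sr w)))" by simp
  qed simp
  also have "\<dots> = hc code_law (\<lambda>w. map fst (sr w)) (\<lambda>w. map snd (sr w)) + hc code_law cz (\<lambda>w. (map fst (sr w), map snd (sr w)))"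
    by (rule hc_chain[OF fin])
  also have "hc code_law (\<lambda>w. map fst (sr w)) (\<lambda>w. map snd (sr w)) = real n * hc pS fst snd"
    using hc_replicate[of n pS] unfolding S[symmetric] hc_map .
  also have "hc code_law cz (\<lambda>w. (map fst (sr w), map snd (sr w))) = hc code_law cz sr"
  proof (rule hc_cong)
    have "(map fst a = map fst b \<and> map snd a = map snd b) = (a = b)" for a b :: "('s1 \<times> 's2) list"
      by (metis zip_map_fst_snd)
    then show "((cz w', map fst (sr w'), map snd (sr w')) = (cz w, map fst (sr w), map snd (sr w))) = ((cz w', sr w') = (cz w, sr w))"
      "((map fst (sr w'), map snd (sr w')) = (map fst (sr w), map snd (sr w))) = (sr w' = sr w)" for w w'
      by auto
  qed
  finally show ?thesis using 1 by simp
qed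

text \<open>Rounding costs one bit per message and Fano's inequality one more: two bits in the
  bounds on single rates, three in those on the sum, where the slack \<open>3 / n\<close> is
  available twice.\<close>

lemma converse_bounds:
  assumes err: "error_prob pS zf W R1 R2 n c \<le> \<epsilon>"
  shows "region_bounds (single_letter pS zf W ts_kern1 ts_kern2) (R1 - (3 / n + \<epsilon> * (R1 + R2))) (R2 - (3 / n + \<epsilon> * (R1 + R2)))"
proof -
  note fin = finite_code_law
  let ?P = "single_letter pS zf W ts_kern1 ts_kern2"
  let ?H = "hc code_law"
  let ?F = "1 + \<epsilon> * (real n * (R1 + R2))"
  let ?S1 = "(\<lambda>(s1, s2, x1, u, z, x2, y). s1) :: 's1 \<times> 's2 \<times> 'x1 \<times> nat \<times> 'z \<times> 'x2 \<times> 'y \<Rightarrow> 's1"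
  let ?S2 = "(\<lambda>(s1, s2, x1, u, z, x2, y). s2) :: 's1 \<times> 's2 \<times> 'x1 \<times> nat \<times> 'z \<times> 'x2 \<times> 'y \<Rightarrow> 's2"
  let ?X1 = "(\<lambda>(s1, s2, x1, u, z, x2, y). x1) :: 's1 \<times> 's2 \<times> 'x1 \<times> nat \<times> 'z \<times> 'x2 \<times> 'y \<Rightarrow> 'x1"
  let ?U = "(\<lambda>(s1, s2, x1, u, z, x2, y). u) :: 's1 \<times> 's2 \<times> 'x1 \<times> nat \<times> 'z \<times> 'x2 \<times> 'y \<Rightarrow> nat"
  let ?Z = "(\<lambda>(s1, s2, x1, u, z, x2, y). z) :: 's1 \<times> 's2 \<times> 'x1 \<times> nat \<times> 'z \<times> 'x2 \<times> 'y \<Rightarrow> 'z"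
  let ?X2 = "(\<lambda>(s1, s2, x1, u, z, x2, y). x2) :: 's1 \<times> 's2 \<times> 'x1 \<times> nat \<times> 'z \<times> 'x2 \<times> 'y \<Rightarrow> 'x2"
  let ?Y = "(\<lambda>(s1, s2, x1, u, z, x2, y). y) :: 's1 \<times> 's2 \<times> 'x1 \<times> nat \<times> 'z \<times> 'x2 \<times> 'y \<Rightarrow> 'y"
  define w0 where "w0 = ?H yr (\<lambda>w. (m1r w, m2r w, sr w))"
  define hz where "hz = (\<Sum>i<n. ?H (\<lambda>w. cz w ! i) (\<lambda>w. (s1i i w, side i w)))"
  define hs where "hs = (\<Sum>i<n. ?H (s1i i) (\<lambda>w. (side i w, s2i i w)))"
  define a1 where "a1 = (\<Sum>i<n. ?H (\<lambda>w. yr w ! i) (\<lambda>w. (cx2 w ! i, cz w ! i, s1i i w, s2i i w, side i w)))"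
  define a2 where "a2 = (\<Sum>i<n. ?H (\<lambda>w. yr w ! i) (\<lambda>w. (cx1 w ! i, s1i i w, s2i i w, side i w)))"
  define a3 where "a3 = (\<Sum>i<n. ?H (\<lambda>w. yr w ! i) (\<lambda>w. (cz w ! i, s1i i w, s2i i w, side i w)))"
  define a4 where "a4 = (\<Sum>i<n. ?H (\<lambda>w. yr w ! i) (\<lambda>w. (s1i i w, s2i i w)))"
  note out = hc_output[OF finite_ts, unfolded output_entropy]
  have W1: "hc ?P ?Y (\<lambda>w. (?X1 w, ?X2 w, ?Z w, ?S1 w, ?S2 w, ?U w)) = w0 / n"
  proof -
    have "hc ?P ?Y (\<lambda>w. (?X1 w, ?X2 w, ?Z w, ?S1 w, ?S2 w, ?U w)) = hc ?P ?Y (\<lambda>(s1, s2, x1, u, z, x2, y). (\<lambda>(s1, s2, x1, u, x2). (x1, x2, zf x1 s1, s1, s2, u)) (s1, s2, x1, u, x2))"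
      by (rule hc_cong) (auto dest: single_letter_z)
    also have "\<dots> = w0 / n" unfolding w0_def by (rule out[where g="\<lambda>(x1, x2, z, s1, s2, u). (x1, x2, s1, s2)"]) simp
    finally show ?thesis .
  qed
  have W2: "hc ?P ?Y (\<lambda>w. (?X2 w, ?X1 w, ?S1 w, ?S2 w, ?U w)) = w0 / n"
  proof -
    have "hc ?P ?Y (\<lambda>w. (?X2 w, ?X1 w, ?S1 w, ?S2 w, ?U w)) = hc ?P ?Y (\<lambda>w. (?X1 w, ?X2 w, ?Z w, ?S1 w, ?S2 w, ?U w))"
      by (rule hc_cong) (auto dest: single_letter_z)
    then show ?thesis using W1 by simp
  qed
  have W3: "hc ?P ?Y (\<lambda>w. ((?X1 w, ?X2 w), ?Z w, ?S1 w, ?S2 w, ?U w)) = w0 / n"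
  proof -
    have "hc ?P ?Y (\<lambda>w. ((?X1 w, ?X2 w), ?Z w, ?S1 w, ?S2 w, ?U w)) = hc ?P ?Y (\<lambda>w. (?X1 w, ?X2 w, ?Z w, ?S1 w, ?S2 w, ?U w))"
      by (rule hc_cong) auto
    then show ?thesis using W1 by simp
  qed
  have W4: "hc ?P ?Y (\<lambda>w. ((?X1 w, ?X2 w), ?S1 w, ?S2 w)) = w0 / n"
  proof -
    have "hc ?P ?Y (\<lambda>w. ((?X1 w, ?X2 w), ?S1 w, ?S2 w)) = hc ?P ?Y (\<lambda>(s1, s2, x1, u, z, x2, y). (\<lambda>(s1, s2, x1, u, x2). ((x1, x2), s1, s2)) (s1, s2, x1, u, x2))"
      by (rule hc_cong) auto
    also have "\<dots> = w0 / n" unfolding w0_def by (rule out[where g="\<lambda>((x1, x2), s1, s2). (x1, x2, s1, s2)"]) simp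
    finally show ?thesis .
  qed
  have HZ: "hc ?P ?Z (\<lambda>w. (?S1 w, ?U w)) = hz / n"
    unfolding hz_def by (rule hc_ts) (auto simp: ts_letter_eq)
  have HS: "hc ?P ?S1 (\<lambda>w. (?U w, ?S2 w)) = hs / n"
    unfolding hs_def by (rule hc_ts) (auto simp: ts_letter_eq)
  have A1: "hc ?P ?Y (\<lambda>w. (?X2 w, ?Z w, ?S1 w, ?S2 w, ?U w)) = a1 / n"
    unfolding a1_def by (rule hc_ts) (auto simp: ts_letter_eq)
  have A2: "hc ?P ?Y (\<lambda>w. (?X1 w, ?S1 w, ?S2 w, ?U w)) = a2 / n"
    unfolding a2_def by (rule hc_ts) (auto simp: ts_letter_eq)
  have A3: "hc ?P ?Y (\<lambda>w. (?Z w, ?S1 w, ?S2 w, ?U w)) = a3 / n"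
    unfolding a3_def by (rule hc_ts) (auto simp: ts_letter_eq)
  \<comment> \<open>Here the time index is not part of the condition, so time sharing gives an
    inequality only; dropping the index raises the entropy, which is the direction required.\<close>
  have A4: "a4 / n \<le> hc ?P ?Y (\<lambda>w. (?S1 w, ?S2 w))"
  proof -
    have "a4 / n = hc shared_law (\<lambda>x. yr (snd x) ! fst x) (\<lambda>x. (fst x, s1i (fst x) (snd x), s2i (fst x) (snd x)))"
      unfolding a4_def by (rule hc_time_share[OF fin n, symmetric])
    also have "\<dots> \<le> hc shared_law (\<lambda>x. yr (snd x) ! fst x) (\<lambda>x. (s1i (fst x) (snd x), s2i (fst x) (snd x)))"
      by (rule hc_mono_cond) (auto simp: set_uniform_time fin)
    also have "\<dots> = hc ?P ?Y (\<lambda>w. (?S1 w, ?S2 w))"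
      unfolding ts_law hc_map by (rule hc_cong) (auto simp: ts_letter_eq)
    finally show ?thesis .
  qed
  have S: "hc ?P ?S1 ?S2 = hc pS fst snd" by (rule hc_state)
  have fano: "?H (\<lambda>w. (m1r w, m2r w)) (\<lambda>w. (yr w, sr w)) \<le> ?F"
  proof -
    let ?T = "messages n R1 \<times> messages n R2"
    let ?g = "\<lambda>(y, s). (dec1 c y (map fst s) (map snd s), dec2 c y (map fst s) (map snd s))"
    have "?H (\<lambda>w. (m1r w, m2r w)) (\<lambda>w. (yr w, sr w)) \<le> 1 + measure_pmf.prob code_law {w. ?g (yr w, sr w) \<noteq> (m1r w, m2r w)} * log 2 (real (card ?T))"
      by (rule hc_fano[OF fin]) (auto simp: mf m1r_def m2r_def elim!: code_law_support)
    also have "measure_pmf.prob code_law {w. ?g (yr w, sr w) \<noteq> (m1r w, m2r w)} = error_prob pS zf W R1 R2 n c"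
      unfolding error_prob_def transmission_eq measure_map_pmf
      by (rule arg_cong[where f="measure_pmf.prob code_law"]) (auto simp: m1r_def m2r_def yr_def sr_def)
    also have "error_prob pS zf W R1 R2 n c * log 2 (real (card ?T)) \<le> \<epsilon> * (real n * (R1 + R2))"
    proof (rule mult_mono[OF err])
      have "card (messages n R1) \<noteq> 0" "card (messages n R2) \<noteq> 0" using mf by (auto simp: card_eq_0_iff)
      then show l: "log 2 (real (card ?T)) \<le> real n * (R1 + R2)" "0 \<le> log 2 (real (card ?T))"
        using mf(4,8) by (auto simp: card_cartesian_product log_mult algebra_simps intro!: add_nonneg_nonneg)
      show "0 \<le> \<epsilon>" using err by (rule order_trans[rotated]) (simp add: error_prob_def)
    qed
    finally show ?thesis by simp
  qed
  have zb: "?H cz sr \<le> hz - (n * hc pS fst snd - hs)"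
    using crib_entropy_bound unfolding hz_def hs_def .
  note b = hc_mono_cond[OF fin] hc_mono_left[OF fin]
  \<comment> \<open>The crib is handed to the decoder as a genie. Given \<open>M_2\<close>, the
    states and the crib, the sequence \<open>X_2^n\<close> is determined, so each output letter is
    conditioned on everything that occurs in \<open>a1\<close>.\<close>
  have R1: "real n * R1 - 1 \<le> ?H cz sr + a1 - w0 + ?F"
  proof -
    have lb: "w0 \<le> ?H (\<lambda>w. (yr w, cz w)) (\<lambda>w. (m1r w, m2r w, sr w))" unfolding w0_def by (rule b(2)) auto
    have "real n * R1 - 1 \<le> ?H m1r (\<lambda>w. (m2r w, sr w))" using mf(3) by (simp add: message_entropy1)
    also have "\<dots> = ?H (\<lambda>w. (yr w, cz w)) (\<lambda>w. (m2r w, sr w)) - ?H (\<lambda>w. (yr w, cz w)) (\<lambda>w. (m1r w, m2r w, sr w)) + ?H m1r (\<lambda>w. ((yr w, cz w), m2r w, sr w))"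
      by (rule hc_exchange[OF fin])
    also have "?H (\<lambda>w. (yr w, cz w)) (\<lambda>w. (m2r w, sr w)) = ?H cz (\<lambda>w. (m2r w, sr w)) + ?H yr (\<lambda>w. (cz w, m2r w, sr w))"
      by (rule hc_chain[OF fin])
    also have "?H cz (\<lambda>w. (m2r w, sr w)) \<le> ?H cz sr" by (rule b(1)) auto
    also have "?H yr (\<lambda>w. (cz w, m2r w, sr w)) \<le> a1" unfolding a1_def
      by (rule hc_list_bound[OF fin lens(3)]) (auto simp: rv_defs)
    also have "?H m1r (\<lambda>w. ((yr w, cz w), m2r w, sr w)) \<le> ?H (\<lambda>w. (m1r w, m2r w)) (\<lambda>w. ((yr w, cz w), m2r w, sr w))"
      by (rule b(2)) auto
    also have "\<dots> \<le> ?H (\<lambda>w. (m1r w, m2r w)) (\<lambda>w. (yr w, sr w))" by (rule b(1)) auto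
    also have "\<dots> \<le> ?F" by (rule fano)
    finally show ?thesis using lb by simp
  qed
  have R2: "real n * R2 - 1 \<le> a2 - w0 + ?F"
  proof -
    have "real n * R2 - 1 \<le> ?H m2r (\<lambda>w. (m1r w, sr w))" using mf(7) by (simp add: message_entropy2)
    also have "\<dots> = ?H yr (\<lambda>w. (m1r w, sr w)) - ?H yr (\<lambda>w. (m2r w, m1r w, sr w)) + ?H m2r (\<lambda>w. (yr w, m1r w, sr w))"
      by (rule hc_exchange[OF fin])
    also have "?H yr (\<lambda>w. (m1r w, sr w)) \<le> a2" unfolding a2_def
      by (rule hc_list_bound[OF fin lens(3)]) (auto simp: rv_defs)
    also have "?H yr (\<lambda>w. (m2r w, m1r w, sr w)) = w0" unfolding w0_def by (rule hc_cong) auto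
    also have "?H m2r (\<lambda>w. (yr w, m1r w, sr w)) \<le> ?H (\<lambda>w. (m1r w, m2r w)) (\<lambda>w. (yr w, m1r w, sr w))"
      by (rule b(2)) auto
    also have "\<dots> \<le> ?H (\<lambda>w. (m1r w, m2r w)) (\<lambda>w. (yr w, sr w))" by (rule b(1)) auto
    also have "\<dots> \<le> ?F" by (rule fano)
    finally show ?thesis by simp
  qed
  have both: "real n * (R1 + R2) - 2 \<le> ?H (\<lambda>w. (m1r w, m2r w)) sr"
  proof -
    have "?H (\<lambda>w. (m1r w, m2r w)) sr = ?H m2r sr + ?H m1r (\<lambda>w. (m2r w, sr w))" by (rule hc_chain[OF fin])
    moreover have "?H m2r (\<lambda>w. (m1r w, sr w)) \<le> ?H m2r sr" by (rule b(1)) auto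
    ultimately show ?thesis using mf(3,7) by (simp add: message_entropy1 message_entropy2 algebra_simps)
  qed
  have e4: "?H yr (\<lambda>w. ((m1r w, m2r w), sr w)) = w0" unfolding w0_def by (rule hc_cong) auto
  have R3: "real n * (R1 + R2) - 2 \<le> ?H cz sr + a3 - w0 + ?F"
  proof -
    have lb: "w0 \<le> ?H (\<lambda>w. (yr w, cz w)) (\<lambda>w. ((m1r w, m2r w), sr w))" unfolding e4[symmetric] by (rule b(2)) auto
    note both
    also have "?H (\<lambda>w. (m1r w, m2r w)) sr = ?H (\<lambda>w. (yr w, cz w)) sr - ?H (\<lambda>w. (yr w, cz w)) (\<lambda>w. ((m1r w, m2r w), sr w)) + ?H (\<lambda>w. (m1r w, m2r w)) (\<lambda>w. ((yr w, cz w), sr w))"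
      by (rule hc_exchange[OF fin])
    also have "?H (\<lambda>w. (yr w, cz w)) sr = ?H cz sr + ?H yr (\<lambda>w. (cz w, sr w))"
      by (rule hc_chain[OF fin])
    also have "?H yr (\<lambda>w. (cz w, sr w)) \<le> a3" unfolding a3_def
      by (rule hc_list_bound[OF fin lens(3)]) (auto simp: rv_defs)
    also have "?H (\<lambda>w. (m1r w, m2r w)) (\<lambda>w. ((yr w, cz w), sr w)) \<le> ?H (\<lambda>w. (m1r w, m2r w)) (\<lambda>w. (yr w, sr w))" by (rule b(1)) auto
    also have "\<dots> \<le> ?F" by (rule fano)
    finally show ?thesis using lb by simp
  qed
  have R4: "real n * (R1 + R2) - 2 \<le> a4 - w0 + ?F"
  proof -
    note both
    also have "?H (\<lambda>w. (m1r w, m2r w)) sr = ?H yr sr - ?H yr (\<lambda>w. ((m1r w, m2r w), sr w)) + ?H (\<lambda>w. (m1r w, m2r w)) (\<lambda>w. (yr w, sr w))"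
      by (rule hc_exchange[OF fin])
    also have "?H yr sr \<le> a4" unfolding a4_def
      by (rule hc_list_bound[OF fin lens(3)]) (auto simp: rv_defs)
    finally show ?thesis using fano unfolding e4 by simp
  qed
  let ?d = "3 / n + \<epsilon> * (R1 + R2)"
  have e0: "0 \<le> \<epsilon> * (R1 + R2)"
    using R order_trans[OF _ err] by (intro mult_nonneg_nonneg) (auto simp: error_prob_def)
  have scale: "x - ?d \<le> q / n" if "real n * x - 1 \<le> q + ?F" for x q
  proof -
    have "real n * (x - ?d) = real n * x - 3 - \<epsilon> * (real n * (R1 + R2))" using n by (simp add: algebra_simps)
    also have "\<dots> \<le> q" using that by simp
    finally show ?thesis using n by (simp add: field_simps)
  qed
  have scale2: "x - ?d + (y - ?d) \<le> q / n" if "real n * (x + y) - 2 \<le> q + ?F" for x y q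
  proof -
    have "real n * (x - ?d + (y - ?d)) = real n * (x + y) - 6 - 2 * (real n * (\<epsilon> * (R1 + R2)))" using n by (simp add: algebra_simps)
    also have "\<dots> \<le> q" using that mult_nonneg_nonneg[OF _ e0, of "real n"] by (simp add: algebra_simps)
    finally show ?thesis using n by (simp add: field_simps)
  qed
  have IU: "cond_mutual_info ?P ?U ?S1 ?S2 = hc pS fst snd - hs / n" by (simp only: cond_mutual_info_eq_hc' HS S)
  have CZ: "cond_entropy ?P ?Z (\<lambda>w. (?S1 w, ?U w)) = hz / n" by (simp only: cond_entropy_eq_hc HZ)
  have I1: "cond_mutual_info ?P ?X1 ?Y (\<lambda>w. (?X2 w, ?Z w, ?S1 w, ?S2 w, ?U w)) = a1 / n - w0 / n"
    by (simp only: cond_mutual_info_eq_hc A1 W1)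
  have I2: "cond_mutual_info ?P ?X2 ?Y (\<lambda>w. (?X1 w, ?S1 w, ?S2 w, ?U w)) = a2 / n - w0 / n"
    by (simp only: cond_mutual_info_eq_hc A2 W2)
  have I3: "cond_mutual_info ?P (\<lambda>w. (?X1 w, ?X2 w)) ?Y (\<lambda>w. (?Z w, ?S1 w, ?S2 w, ?U w)) = a3 / n - w0 / n"
    by (simp only: cond_mutual_info_eq_hc A3 W3)
  have I4: "a4 / n - w0 / n \<le> cond_mutual_info ?P (\<lambda>w. (?X1 w, ?X2 w)) ?Y (\<lambda>w. (?S1 w, ?S2 w))"
    using A4 by (simp only: cond_mutual_info_eq_hc W4)
  have nn: "(real n * k) / real n = k" for k using n by simp
  have zd: "?H cz sr / n \<le> hz / n - (hc pS fst snd - hs / n)"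
    using divide_right_mono[OF zb, of "real n"] by (simp add: diff_divide_distrib nn)
  have z0: "0 \<le> ?H cz sr / n" by (simp add: hc_nonneg)
  show ?thesis
    unfolding region_bounds_def Let_def CZ IU I1 I2 I3
  proof (intro conjI)
    show "hc pS fst snd - hs / n \<le> hz / n" using zd z0 by linarith
    show "R1 - ?d \<le> a1 / n - w0 / n + hz / n - (hc pS fst snd - hs / n)"
      using scale[of R1 "?H cz sr + a1 - w0"] R1 zd by (simp add: add_divide_distrib diff_divide_distrib)
    show "R2 - ?d \<le> a2 / n - w0 / n"
      using scale[of R2 "a2 - w0"] R2 by (simp add: diff_divide_distrib)
    show "R1 - ?d + (R2 - ?d) \<le> a3 / n - w0 / n + hz / n - (hc pS fst snd - hs / n)"
      using scale2[of R1 R2 "?H cz sr + a3 - w0"] R3 zd by (simp add: add_divide_distrib diff_divide_distrib)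
    show "R1 - ?d + (R2 - ?d) \<le> cond_mutual_info ?P (\<lambda>w. (?X1 w, ?X2 w)) ?Y (\<lambda>w. (?S1 w, ?S2 w))"
      using scale2[of R1 R2 "a4 - w0"] R4 I4 by (simp add: diff_divide_distrib)
  qed
qed

end

context cribbing_mac
begin

lemma vec_bounds_mono: "vec_bounds v R1 R2 \<Longrightarrow> R1' \<le> R1 \<Longrightarrow> R2' \<le> R2 \<Longrightarrow> vec_bounds v R1' R2'"
  unfolding vec_bounds_def by (auto split: prod.splits)

text \<open>Codes of error at most \<open>1 / (k + 1)\<close> and length at least
  \<open>k + 1\<close> leave a gap \<open>d k\<close> that tends to zero, and closedness of the
  geometric region removes it.\<close>

lemma converse:
  assumes "achievable pS zf W R1 R2"
  shows "\<exists>v \<in> convex hull (point ` params). vec_bounds v R1 R2"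
proof -
  let ?G = "{(R1, R2). \<exists>v \<in> convex hull (point ` params). vec_bounds v R1 R2}"
  have R: "0 \<le> R1" "0 \<le> R2" using assms by (auto simp: achievable_def)
  define d where "d k = (3 + R1 + R2) / real (Suc k)" for k
  have "(R1 - d k, R2 - d k) \<in> ?G" for k
  proof -
    have "\<forall>\<epsilon>>0. \<forall>N. \<exists>n\<ge>N. \<exists>c. is_code R1 R2 n c \<and> error_prob pS zf W R1 R2 n c \<le> \<epsilon>"
      using assms unfolding achievable_def by blast
    moreover have "0 < 1 / real (Suc k)" by simp
    ultimately have "\<exists>n\<ge>Suc k. \<exists>c. is_code R1 R2 n c \<and> error_prob pS zf W R1 R2 n c \<le> 1 / real (Suc k)" by blast
    then obtain n and c :: "('x1, 'x2, 's1, 's2, 'z, 'y) mac_code" where c: "n \<ge> Suc k" "is_code R1 R2 n c" "error_prob pS zf W R1 R2 n c \<le> 1 / real (Suc k)"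
      by blast
    interpret block_code pS zf W n R1 R2 c by unfold_locales (use c R in auto)
    obtain v where v: "v \<in> convex hull (point ` params)"
      "vec_bounds v (R1 - (3 / n + 1 / real (Suc k) * (R1 + R2))) (R2 - (3 / n + 1 / real (Suc k) * (R1 + R2)))"
      using geo_of_region[OF converse_bounds[OF c(3)]] by blast
    have "3 / real n \<le> 3 / real (Suc k)" using c(1) by (intro divide_left_mono) auto
    then have "3 / n + 1 / real (Suc k) * (R1 + R2) \<le> d k" by (simp add: d_def add_divide_distrib)
    then have "vec_bounds v (R1 - d k) (R2 - d k)" by (intro vec_bounds_mono[OF v(2)]) auto
    then show ?thesis using v(1) by blast
  qed
  moreover have "(\<lambda>k. (R1 - d k, R2 - d k)) \<longlonglongrightarrow> (R1, R2)"
  proof -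
    have "d \<longlonglongrightarrow> 0" unfolding d_def by real_asymp
    then have "(\<lambda>k. (R1 - d k, R2 - d k)) \<longlonglongrightarrow> (R1 - 0, R2 - 0)" by (intro tendsto_intros)
    then show ?thesis by simp
  qed
  ultimately have "(R1, R2) \<in> ?G"
    by (rule closed_sequentially[OF closed_geo, where f="\<lambda>k. (R1 - d k, R2 - d k)"])
  then show ?thesis by (simp only: mem_Collect_eq case_prod_conv)
qed

end

section \<open>A random code for one block\<close>

text \<open>Averages over random codes are nonnegative integrals throughout, so that draws can be
  exchanged and bounds added without integrability side conditions.\<close>

lemma nn_integral_pmf_swap:
  "(\<integral>\<^sup>+x. \<integral>\<^sup>+y. f x y \<partial>measure_pmf q \<partial>measure_pmf p) = (\<integral>\<^sup>+y. \<integral>\<^sup>+x. f x y \<partial>measure_pmf p \<partial>measure_pmf q)"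
proof -
  have "(\<integral>\<^sup>+z. f (fst z) (snd z) \<partial>bind_pmf p (\<lambda>x. bind_pmf q (\<lambda>y. return_pmf (x, y)))) =
    (\<integral>\<^sup>+z. f (fst z) (snd z) \<partial>bind_pmf q (\<lambda>y. bind_pmf p (\<lambda>x. return_pmf (x, y))))"
    by (simp only: bind_commute_pmf[of p q])
  then show ?thesis by simp
qed

lemma nn_integral_pmf_mono:
  "(\<And>x. x \<in> set_pmf p \<Longrightarrow> f x \<le> g x) \<Longrightarrow> (\<integral>\<^sup>+x. f x \<partial>measure_pmf p) \<le> (\<integral>\<^sup>+x. g x \<partial>measure_pmf p)"
  by (intro nn_integral_mono_AE) (auto simp: AE_measure_pmf_iff)

lemma nn_integral_pmf_cong:
  "(\<And>x. x \<in> set_pmf p \<Longrightarrow> f x = g x) \<Longrightarrow> (\<integral>\<^sup>+x. f x \<partial>measure_pmf p) = (\<integral>\<^sup>+x. g x \<partial>measure_pmf p)"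
  by (intro nn_integral_cong_AE) (auto simp: AE_measure_pmf_iff)

lemma nn_integral_pmf_const [simp]: "(\<integral>\<^sup>+x. c \<partial>measure_pmf p) = (c :: ennreal)"
  by simp

lemma nn_integral_pmf_le:
  fixes p :: "'a pmf"
  shows "(\<And>x. x \<in> set_pmf p \<Longrightarrow> f x \<le> c) \<Longrightarrow> (\<integral>\<^sup>+x. f x \<partial>measure_pmf p) \<le> c"
  using nn_integral_pmf_mono[of p f "\<lambda>_. c"] by simp

lemma nn_integral_replicate_Suc:
  fixes p :: "'a pmf"
  shows "(\<integral>\<^sup>+xs. f xs \<partial>replicate_pmf (Suc k) p) = (\<integral>\<^sup>+x. \<integral>\<^sup>+xs. f (x # xs) \<partial>replicate_pmf k p \<partial>p)"
  by simp

lemma emeasure_pmf_split: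
  "emeasure (measure_pmf q) {x. A x} + emeasure (measure_pmf q) {x. \<not> A x} = 1"
  by (subst plus_emeasure) (auto intro!: measure_pmf.emeasure_eq_1_AE)

text \<open>The first accepted of \<open>K\<close> independent draws has the law of one draw
  conditioned on acceptance, times the probability that some draw is accepted. So a bound on the
  conditional mean of \<open>F\<close> carries over, for every \<open>K\<close>.\<close>

lemma select_bound:
  fixes q :: "'a pmf"
  assumes dom: "(\<integral>\<^sup>+x. (if A x then F x else 0) \<partial>q) \<le> emeasure (measure_pmf q) {x. A x} * D"
  shows "(\<integral>\<^sup>+xs. (case find A xs of None \<Rightarrow> 0 | Some x \<Rightarrow> F x) \<partial>replicate_pmf K q) \<le> (D :: ennreal)"
proof (induction K)
  case (Suc K)
  let ?E = "\<integral>\<^sup>+xs. (case find A xs of None \<Rightarrow> 0 | Some x \<Rightarrow> F x) \<partial>replicate_pmf K q"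
  have "(\<integral>\<^sup>+xs. (case find A xs of None \<Rightarrow> 0 | Some x \<Rightarrow> F x) \<partial>replicate_pmf (Suc K) q) =
    (\<integral>\<^sup>+x. (if A x then F x else 0) + indicator {x. \<not> A x} x * ?E \<partial>q)"
    unfolding nn_integral_replicate_Suc by (intro nn_integral_cong) auto
  also have "\<dots> = (\<integral>\<^sup>+x. (if A x then F x else 0) \<partial>q) + emeasure (measure_pmf q) {x. \<not> A x} * ?E"
    by (subst nn_integral_add) (auto simp: nn_integral_multc)
  also have "\<dots> \<le> emeasure (measure_pmf q) {x. A x} * D + emeasure (measure_pmf q) {x. \<not> A x} * D"
    by (intro add_mono dom mult_left_mono Suc) auto
  also have "\<dots> = D" by (simp flip: distrib_right add: emeasure_pmf_split)
  finally show ?case .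
qed simp

lemma select_fail:
  fixes q :: "'a pmf"
  shows "(\<integral>\<^sup>+xs. (case find A xs of None \<Rightarrow> 1 | Some x \<Rightarrow> 0) \<partial>replicate_pmf K q) = (emeasure (measure_pmf q) {x. \<not> A x} :: ennreal) ^ K"
proof (induction K)
  case (Suc K)
  have "(\<integral>\<^sup>+xs. (case find A xs of None \<Rightarrow> 1 | Some x \<Rightarrow> 0) \<partial>replicate_pmf (Suc K) q) =
    (\<integral>\<^sup>+x. indicator {x. \<not> A x} x * (emeasure (measure_pmf q) {x. \<not> A x}) ^ K \<partial>q)"
    unfolding nn_integral_replicate_Suc Suc[symmetric] by (intro nn_integral_cong) (auto split: split_indicator)
  then show ?case by (simp add: nn_integral_multc)
qed simp

text \<open>The sum of \<open>g s y\<close> over all entries \<open>y\<close> other than the first accepted one, \<open>s\<close>.\<close>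

fun rivals :: "('a \<Rightarrow> bool) \<Rightarrow> ('a \<Rightarrow> 'a \<Rightarrow> ennreal) \<Rightarrow> 'a list \<Rightarrow> ennreal" where
  "rivals A g [] = 0"
| "rivals A g (x # xs) = (if A x then (\<Sum>y\<leftarrow>xs. g x y)
     else (case find A xs of None \<Rightarrow> 0 | Some s \<Rightarrow> g s x) + rivals A g xs)"

lemma nn_integral_sum_list:
  fixes q :: "'a pmf"
  shows "(\<integral>\<^sup>+xs. (\<Sum>y\<leftarrow>xs. f y) \<partial>replicate_pmf k q) = of_nat k * (\<integral>\<^sup>+y. f y \<partial>q)"
proof (induction k)
  case (Suc k)
  have "(\<integral>\<^sup>+xs. (\<Sum>y\<leftarrow>xs. f y) \<partial>replicate_pmf (Suc k) q) = (\<integral>\<^sup>+x. f x + of_nat k * (\<integral>\<^sup>+y. f y \<partial>q) \<partial>q)"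
    unfolding nn_integral_replicate_Suc Suc[symmetric] by (intro nn_integral_cong) (simp add: nn_integral_add)
  then show ?case by (simp add: nn_integral_add distrib_right)
qed simp

text \<open>Entries after the chosen one are independent of it. Entries before it are conditioned on
  rejection, and the estimate drops that condition; the factor 2 absorbs the loss in the induction
  over the number \<open>k\<close> of other entries.\<close>

lemma rivals_bound:
  fixes q :: "'a pmf"
  assumes dom: "(\<integral>\<^sup>+x. (if A x then (\<integral>\<^sup>+y. g x y \<partial>q) else 0) \<partial>q) \<le> emeasure (measure_pmf q) {x. A x} * D"
  shows "(\<integral>\<^sup>+xs. rivals A g xs \<partial>replicate_pmf (Suc k) q) \<le> of_nat (2 * k) * D"
proof (induction k)
  case (Suc k)
  let ?P = "emeasure (measure_pmf q) {x. A x}" and ?N = "emeasure (measure_pmf q) {x. \<not> A x}"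
  let ?R = "\<integral>\<^sup>+xs. rivals A g xs \<partial>replicate_pmf (Suc k) q"
  let ?C = "\<lambda>x. \<integral>\<^sup>+xs. (case find A xs of None \<Rightarrow> 0 | Some s \<Rightarrow> g s x) \<partial>replicate_pmf (Suc k) q"
  have "(\<integral>\<^sup>+xs. rivals A g xs \<partial>replicate_pmf (Suc (Suc k)) q) =
    (\<integral>\<^sup>+x. (if A x then of_nat (Suc k) * (\<integral>\<^sup>+y. g x y \<partial>q) else ?C x + ?R) \<partial>q)"
    unfolding nn_integral_replicate_Suc[where k="Suc k"]
    by (intro nn_integral_cong) (simp del: replicate_pmf.simps add: nn_integral_sum_list nn_integral_add)
  also have "\<dots> \<le> (\<integral>\<^sup>+x. of_nat (Suc k) * (if A x then (\<integral>\<^sup>+y. g x y \<partial>q) else 0) + (?C x + indicator {x. \<not> A x} x * ?R) \<partial>q)"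
    by (intro nn_integral_mono) (auto simp del: replicate_pmf.simps split: split_indicator)
  also have "\<dots> = of_nat (Suc k) * (\<integral>\<^sup>+x. (if A x then (\<integral>\<^sup>+y. g x y \<partial>q) else 0) \<partial>q) + ((\<integral>\<^sup>+x. ?C x \<partial>q) + ?N * ?R)"
    by (simp del: replicate_pmf.simps add: nn_integral_add nn_integral_cmult nn_integral_multc)
  also have "\<dots> \<le> of_nat (Suc k) * (?P * D) + (D + ?N * (of_nat (2 * k) * D))"
  proof (intro add_mono mult_left_mono dom Suc)
    have "(\<integral>\<^sup>+x. ?C x \<partial>q) = (\<integral>\<^sup>+xs. (case find A xs of None \<Rightarrow> 0 | Some s \<Rightarrow> \<integral>\<^sup>+x. g s x \<partial>q) \<partial>replicate_pmf (Suc k) q)"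
      by (subst nn_integral_pmf_swap) (intro nn_integral_cong, simp split: option.split)
    also have "\<dots> \<le> D" by (rule select_bound[OF dom])
    finally show "(\<integral>\<^sup>+x. ?C x \<partial>q) \<le> D" .
  qed auto
  also have "\<dots> = (of_nat (Suc k) * ?P + (1 + of_nat (2 * k) * ?N)) * D"
    by (simp add: algebra_simps)
  also have "\<dots> \<le> of_nat (2 * Suc k) * D"
  proof (intro mult_right_mono)
    have "of_nat (Suc k) * ?P + (1 + of_nat (2 * k) * ?N) \<le> of_nat (2 * k) * ?P + ?P + (1 + of_nat (2 * k) * ?N)"
    proof (intro add_right_mono)
      have "of_nat (Suc k) * ?P \<le> of_nat (2 * k + 1) * ?P" by (intro mult_right_mono) (auto simp: of_nat_mono simp del: of_nat_Suc)
      then show "of_nat (Suc k) * ?P \<le> of_nat (2 * k) * ?P + ?P" by (simp add: distrib_right)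
    qed
    also have "\<dots> = of_nat (2 * k) * (?P + ?N) + (?P + 1)" by (simp add: algebra_simps)
    also have "\<dots> \<le> of_nat (2 * k) * 1 + (1 + 1)"
      unfolding emeasure_pmf_split by (intro add_left_mono add_right_mono) (rule measure_pmf.emeasure_le_1)
    also have "\<dots> = of_nat (2 * Suc k)" by simp
    finally show "of_nat (Suc k) * ?P + (1 + of_nat (2 * k) * ?N) \<le> of_nat (2 * Suc k)" .
  qed auto
  finally show ?case .
qed (simp cong: if_cong)

text \<open>A value that is not zero is at least one, so the sum can dominate the indicator of a
  failure in a union bound.\<close>

lemma rivals_cases: "(\<And>x y. g x y = 0 \<or> 1 \<le> g x y) \<Longrightarrow> rivals A g xs = 0 \<or> 1 \<le> rivals A g xs"
proof (induction A g xs rule: rivals.induct)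
  case (2 A g x xs)
  have a: "p = 0 \<or> 1 \<le> p \<Longrightarrow> q = 0 \<or> 1 \<le> q \<Longrightarrow> p + q = 0 \<or> 1 \<le> p + q" for p q :: ennreal
    using add_increasing2[of q 1 p] add_increasing[of p 1 q] by auto
  have s: "(\<Sum>y\<leftarrow>ys. g x y) = 0 \<or> 1 \<le> (\<Sum>y\<leftarrow>ys. g x y)" for ys
  proof (induction ys)
    case (Cons y ys)
    show ?case using a[OF 2(2)[of x y] Cons] by simp
  qed simp
  show ?case
  proof (cases "A x")
    case True then show ?thesis using s by simp
  next
    case False
    have "(case find A xs of None \<Rightarrow> 0 | Some s \<Rightarrow> g s x) = 0 \<or> 1 \<le> (case find A xs of None \<Rightarrow> 0 | Some s \<Rightarrow> g s x)"
      using 2(2) by (auto split: option.split)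
    then show ?thesis using False a 2(1)[OF False 2(2)] by simp
  qed
qed simp

text \<open>Encoder 2 searches the list of Encoder 1 with a test \<open>B\<close> of its own. If the
  chosen entry is the only one to pass, the search stops there too.\<close>

lemma find_no_rivals:
  assumes "find A xs = Some s" "B s" "rivals A (\<lambda>s x. if B' s x then 1 else 0) xs = 0" "\<And>x. B x \<longleftrightarrow> B' s x"
  shows "find B xs = Some s"
  using assms(1,3)
proof (induction xs)
  case (Cons x xs)
  show ?case
  proof (cases "A x")
    case True
    then show ?thesis using Cons.prems assms(2) by simp
  next
    case False
    then have f: "find A xs = Some s" using Cons.prems by simp
    have "(if B' s x then 1 else 0 :: ennreal) = 0" "rivals A (\<lambda>s x. if B' s x then 1 else 0) xs = 0"
      using Cons.prems(2) False f by auto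
    then show ?thesis using Cons.IH[OF f] assms(4)[of x] by (auto split: if_splits)
  qed
qed simp

section \<open>Averages over a few entries of a random codebook, and coding in a single
  block\<close>

lemma replicate_component: "i < K \<Longrightarrow> map_pmf (\<lambda>xs. xs ! i) (replicate_pmf K p) = p"
  by (simp add: replicate_pmf_eq_independent_list independent_list_component)

lemma nn_integral_replicate_nth:
  fixes p :: "'a pmf"
  shows "i < K \<Longrightarrow> (\<integral>\<^sup>+xs. f (xs ! i) \<partial>replicate_pmf K p) = (\<integral>\<^sup>+x. f x \<partial>p)"
  using nn_integral_map_pmf[where f=f and g="\<lambda>xs. xs ! i" and M="replicate_pmf K p"] by (simp add: replicate_component)

lemma nn_integral_replicate_pair:
  fixes p :: "'a pmf"
  shows "i < K \<Longrightarrow> j < K \<Longrightarrow> i \<noteq> j \<Longrightarrow> (\<integral>\<^sup>+xs. f (xs ! i) (xs ! j) \<partial>replicate_pmf K p) = (\<integral>\<^sup>+x. \<integral>\<^sup>+y. f x y \<partial>p \<partial>p)"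
proof (induction K arbitrary: i j)
  case (Suc K)
  show ?case unfolding nn_integral_replicate_Suc
  proof (cases i; cases j)
    fix j' assume "i = 0" "j = Suc j'"
    then show "(\<integral>\<^sup>+x. \<integral>\<^sup>+xs. f ((x # xs) ! i) ((x # xs) ! j) \<partial>replicate_pmf K p \<partial>p) = (\<integral>\<^sup>+x. \<integral>\<^sup>+y. f x y \<partial>p \<partial>p)"
      using Suc.prems by (simp add: nn_integral_replicate_nth)
  next
    fix i' assume "i = Suc i'" "j = 0"
    then show "(\<integral>\<^sup>+x. \<integral>\<^sup>+xs. f ((x # xs) ! i) ((x # xs) ! j) \<partial>replicate_pmf K p \<partial>p) = (\<integral>\<^sup>+x. \<integral>\<^sup>+y. f x y \<partial>p \<partial>p)"
      using Suc.prems by (simp add: nn_integral_replicate_nth[where f="\<lambda>y. f y x" for x]) (rule nn_integral_pmf_swap)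
  next
    fix i' j' assume "i = Suc i'" "j = Suc j'"
    then show "(\<integral>\<^sup>+x. \<integral>\<^sup>+xs. f ((x # xs) ! i) ((x # xs) ! j) \<partial>replicate_pmf K p \<partial>p) = (\<integral>\<^sup>+x. \<integral>\<^sup>+y. f x y \<partial>p \<partial>p)"
      using Suc.prems Suc.IH[of i' j'] by simp
  qed (use Suc.prems in auto)
qed simp

lemma nn_integral_replicate_others:
  fixes p :: "'a pmf"
  assumes "i < K"
  shows "(\<integral>\<^sup>+xs. (\<Sum>j\<in>{..<K} - {i}. f (xs ! i) (xs ! j)) \<partial>replicate_pmf K p) = of_nat (K - 1) * (\<integral>\<^sup>+x. \<integral>\<^sup>+y. f x y \<partial>p \<partial>p)"
proof -
  have "(\<integral>\<^sup>+xs. (\<Sum>j\<in>{..<K} - {i}. f (xs ! i) (xs ! j)) \<partial>replicate_pmf K p) = (\<Sum>j\<in>{..<K} - {i}. \<integral>\<^sup>+xs. f (xs ! i) (xs ! j) \<partial>replicate_pmf K p)"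
    by (rule nn_integral_sum) simp
  also have "\<dots> = (\<Sum>j\<in>{..<K} - {i}. \<integral>\<^sup>+x. \<integral>\<^sup>+y. f x y \<partial>p \<partial>p)"
    by (intro sum.cong refl nn_integral_replicate_pair) (use assms in auto)
  finally show ?thesis using assms by simp
qed

text \<open>The message part \<open>a\<close> is known to Encoder 2 from the previous block and selects the codebook; \<open>w\<close> is
  what the cribbed sequence carries, namely the \<open>a\<close> and the bin of the next block.\<close>

record ('s1, 's2, 'x1, 'x2, 'z, 'y) block_scheme =
  bin_of :: "nat \<Rightarrow> 's1 \<Rightarrow> nat"
  send1 :: "nat \<Rightarrow> nat \<Rightarrow> nat \<Rightarrow> 's1 \<Rightarrow> 'x1"
  send2 :: "nat \<Rightarrow> nat \<Rightarrow> nat \<Rightarrow> 's2 \<Rightarrow> 'z \<Rightarrow> 'x2"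
  read_crib :: "nat \<Rightarrow> 'z \<Rightarrow> nat"
  decode :: "nat \<Rightarrow> 's1 \<Rightarrow> 's2 \<Rightarrow> 'y \<Rightarrow> nat \<times> nat \<times> nat"

text \<open>The error of one block when Encoder 2 has the right \<open>a\<close> and bin and the
  decoder the right \<open>w\<close>; the preceding and the following block provide these. A misread
  crib counts as an error, since it would mislead Encoder 2 in the next block. A wrong codeword at
  Encoder 2 counts only through its effect on decoding.\<close>

definition block_err ::
  "('x1 \<Rightarrow> 's1 \<Rightarrow> 'z) \<Rightarrow> ('x1 \<Rightarrow> 'x2 \<Rightarrow> 's1 \<Rightarrow> 's2 \<Rightarrow> 'y pmf) \<Rightarrow> ('s1, 's2, 'x1, 'x2, 'z, 'y) block_scheme \<Rightarrow>
    nat \<Rightarrow> nat \<Rightarrow> nat \<Rightarrow> nat \<Rightarrow> 's1 \<Rightarrow> 's2 \<Rightarrow> ennreal" where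
  "block_err zfun Wc k a w m1 m2 s1 s2 = (let x1 = send1 k a w m1 s1; z = zfun x1 s1 in
     if read_crib k a z \<noteq> w then 1
     else \<integral>\<^sup>+y. (if decode k w s1 s2 y = (a, m1, m2) then 0 else 1) \<partial>measure_pmf (Wc x1 (send2 k a (bin_of k a s1) m2 s2 z) s1 s2))"

text \<open>\<open>qU\<close> and \<open>qZ\<close> are laws of candidates, which carry auxiliary
  randomness besides the codewords read off by \<open>uu\<close> and \<open>zz\<close>.
  \<open>AU\<close> and \<open>AZ\<close> are acceptance tests of Encoder 1, \<open>G2\<close> is
  the test of Encoder 2 and \<open>Gd\<close> that of the decoder. By \<open>domU\<close> and
  \<open>domZ\<close> an accepted codeword has at most \<open>C\<close> times the law
  \<open>pU\<close> or \<open>pZ\<close>; all error estimates rest on this domination instead of the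
  exact law.\<close>

locale coding_scheme =
  fixes qU :: "'cu pmf" and lab :: "'cu \<Rightarrow> nat" and uu :: "'cu \<Rightarrow> 'u" and AU :: "'s1 \<Rightarrow> 'cu \<Rightarrow> bool"
    and qZ :: "'cz pmf" and zz :: "'cz \<Rightarrow> 'z" and AZ :: "'s1 \<Rightarrow> 'u \<Rightarrow> 'cz \<Rightarrow> bool"
    and p1 :: "'v1 pmf" and p2 :: "'v2 pmf"
    and f1 :: "'v1 \<Rightarrow> 'z \<Rightarrow> 'u \<Rightarrow> 's1 \<Rightarrow> 'x1" and f2 :: "'v2 \<Rightarrow> 'z \<Rightarrow> 'u \<Rightarrow> 's2 \<Rightarrow> 'x2"
    and zfun :: "'x1 \<Rightarrow> 's1 \<Rightarrow> 'z" and Wc :: "'x1 \<Rightarrow> 'x2 \<Rightarrow> 's1 \<Rightarrow> 's2 \<Rightarrow> 'y pmf"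
    and G2 :: "'s2 \<Rightarrow> 'u \<Rightarrow> bool" and Gd :: "'s1 \<Rightarrow> 's2 \<Rightarrow> 'u \<Rightarrow> 'z \<Rightarrow> 'v1 \<Rightarrow> 'v2 \<Rightarrow> 'y \<Rightarrow> bool"
    and K Kz nA nW M1 M2 :: nat
    and pU :: "'s1 \<Rightarrow> 'u pmf" and pZ :: "'s1 \<Rightarrow> 'u \<Rightarrow> 'z pmf" and C :: ennreal
  assumes domU: "\<And>s1 F. (\<integral>\<^sup>+c. (if AU s1 c then F (uu c) else 0) \<partial>qU) \<le>
      emeasure (measure_pmf qU) {c. AU s1 c} * (C * (\<integral>\<^sup>+u. F u \<partial>pU s1))"
    and domZ: "\<And>s1 u F. (\<integral>\<^sup>+d. (if AZ s1 u d then F (zz d) else 0) \<partial>qZ) \<le>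
      emeasure (measure_pmf qZ) {d. AZ s1 u d} * (C * (\<integral>\<^sup>+z. F z \<partial>pZ s1 u))"
    and consistent: "\<And>s1 c d v1. c \<in> set_pmf qU \<Longrightarrow> AU s1 c \<Longrightarrow> AZ s1 (uu c) d \<Longrightarrow> v1 \<in> set_pmf p1 \<Longrightarrow>
      zfun (f1 v1 (zz d) (uu c) s1) s1 = zz d"
    and K: "0 < K"
begin

text \<open>The value of \<open>F\<close> at the two codewords selected by Encoder 1. A failed
  selection gives 0 because failures are counted by terms of their own.\<close>

definition chain :: "'cu list \<Rightarrow> 'cz list \<Rightarrow> 's1 \<Rightarrow> ('u \<Rightarrow> 'z \<Rightarrow> ennreal) \<Rightarrow> ennreal" where
  "chain ul zs s1 F = (case find (AU s1) ul of None \<Rightarrow> 0 | Some c \<Rightarrow>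
     (case find (AZ s1 (uu c)) zs of None \<Rightarrow> 0 | Some d \<Rightarrow> F (uu c) (zz d)))"

text \<open>The default \<open>hd ul\<close> is a genuine candidate, so its label stays in range
  even when none is accepted.\<close>

definition u_cand :: "'cu list \<Rightarrow> 's1 \<Rightarrow> 'cu" where
  "u_cand ul s1 = (case find (AU s1) ul of Some c \<Rightarrow> c | None \<Rightarrow> hd ul)"

definition z_sel :: "'cu list \<Rightarrow> 'cz list \<Rightarrow> 's1 \<Rightarrow> 'z" where
  "z_sel ul zs s1 = zz (case find (AZ s1 (uu (u_cand ul s1))) zs of Some d \<Rightarrow> d | None \<Rightarrow> hd zs)"

definition u_dec :: "'cu list \<Rightarrow> nat \<Rightarrow> 's2 \<Rightarrow> 'u" where
  "u_dec ul l s2 = uu (case find (\<lambda>c. lab c = l \<and> G2 s2 (uu c)) ul of Some c \<Rightarrow> c | None \<Rightarrow> hd ul)"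

text \<open>The decoder knows \<open>s1\<close>. For a hypothesis on \<open>a\<close>, with
  \<open>w\<close> given, it repeats the selections of Encoder 1 and thus has \<open>u\<close> and
  \<open>z\<close> exactly; the test concerns the strategies.\<close>

definition ok :: "'cu list \<times> 'cz list list \<times> 'v1 list \<times> 'v2 list \<Rightarrow> nat \<Rightarrow> 's1 \<Rightarrow> 's2 \<Rightarrow> nat \<Rightarrow> nat \<Rightarrow> 'y \<Rightarrow> bool" where
  "ok b w s1 s2 m1 m2 y = (case b of (ul, zl, v1l, v2l) \<Rightarrow> (case find (AU s1) ul of None \<Rightarrow> False | Some c \<Rightarrow>
     (case find (AZ s1 (uu c)) (zl ! w) of None \<Rightarrow> False | Some d \<Rightarrow> Gd s1 s2 (uu c) (zz d) (v1l ! m1) (v2l ! m2) y)))"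

text \<open>The codebook for one value of \<open>a\<close>. There is a list of crib candidates for
  each \<open>w\<close>, so the transmitted crib identifies \<open>w\<close>; the other lists are
  common to all \<open>w\<close>.\<close>

definition book :: "('cu list \<times> 'cz list list \<times> 'v1 list \<times> 'v2 list) pmf" where
  "book = pair_pmf (replicate_pmf K qU) (pair_pmf (replicate_pmf nW (replicate_pmf Kz qZ)) (pair_pmf (replicate_pmf M1 p1) (replicate_pmf M2 p2)))"

definition scheme :: "('cu list \<times> 'cz list list \<times> 'v1 list \<times> 'v2 list) list \<Rightarrow> ('s1, 's2, 'x1, 'x2, 'z, 'y) block_scheme" where
  "scheme cb = \<lparr>
     bin_of = (\<lambda>a s1. lab (u_cand (fst (cb ! a)) s1)),
     send1 = (\<lambda>a w m1 s1. case cb ! a of (ul, zl, v1l, v2l) \<Rightarrow> f1 (v1l ! m1) (z_sel ul (zl ! w) s1) (uu (u_cand ul s1)) s1),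
     send2 = (\<lambda>a l m2 s2 z. case cb ! a of (ul, zl, v1l, v2l) \<Rightarrow> f2 (v2l ! m2) z (u_dec ul l s2) s2),
     read_crib = (\<lambda>a z. THE w. w < nW \<and> z \<in> zz ` set (fst (snd (cb ! a)) ! w)),
     decode = (\<lambda>w s1 s2 y. THE t. fst t < nA \<and> fst (snd t) < M1 \<and> snd (snd t) < M2 \<and>
        ok (cb ! fst t) w s1 s2 (fst (snd t)) (snd (snd t)) y)\<rparr>"

abbreviation out_law :: "'s1 \<Rightarrow> 's2 \<Rightarrow> 'u \<Rightarrow> 'z \<Rightarrow> 'v1 \<Rightarrow> 'v2 \<Rightarrow> 'y pmf" where
  "out_law s1 s2 u z v1 v2 \<equiv> Wc (f1 v1 z u s1) (f2 v2 z u s2) s1 s2"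

abbreviation ind :: "bool \<Rightarrow> ennreal" where "ind b \<equiv> (if b then 1 else 0)"

abbreviation rival_u :: "'s2 \<Rightarrow> 'cu \<Rightarrow> 'cu \<Rightarrow> ennreal" where
  "rival_u s2 s x \<equiv> ind (lab x = lab s \<and> G2 s2 (uu x))"

text \<open>A union bound sorted by what is still correct: with the right \<open>a\<close> the pair
  \<open>(u,z)\<close> is right and one strategy or both are wrong, with a wrong \<open>a\<close>
  the whole book is independent of the transmission. The four sums over rivals lead to the four
  mutual informations of the region.\<close>

lemma decode_ideal:
  assumes m: "a < nA" "m1 < M1" "m2 < M2" and b: "cb ! a = (ul, zl, v1l, v2l)"
    and c: "find (AU s1) ul = Some c" and d: "find (AZ s1 (uu c)) (zl ! w) = Some d"
  shows "ind (decode (scheme cb) w s1 s2 y \<noteq> (a, m1, m2)) \<le>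
      ind (\<not> Gd s1 s2 (uu c) (zz d) (v1l ! m1) (v2l ! m2) y) +
      (\<Sum>m1'\<in>{..<M1} - {m1}. ind (Gd s1 s2 (uu c) (zz d) (v1l ! m1') (v2l ! m2) y)) +
      (\<Sum>m2'\<in>{..<M2} - {m2}. ind (Gd s1 s2 (uu c) (zz d) (v1l ! m1) (v2l ! m2') y)) +
      (\<Sum>m1'\<in>{..<M1} - {m1}. \<Sum>m2'\<in>{..<M2} - {m2}. ind (Gd s1 s2 (uu c) (zz d) (v1l ! m1') (v2l ! m2') y)) +
      (\<Sum>a'\<in>{..<nA} - {a}. \<Sum>m1'<M1. \<Sum>m2'<M2. ind (ok (cb ! a') w s1 s2 m1' m2' y))"
    (is "_ \<le> ?t6 + ?t7 + ?t8 + ?t9 + ?t10")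
proof (cases "decode (scheme cb) w s1 s2 y = (a, m1, m2)")
  case False
  let ?Q = "\<lambda>t. fst t < nA \<and> fst (snd t) < M1 \<and> snd (snd t) < M2 \<and> ok (cb ! fst t) w s1 s2 (fst (snd t)) (snd (snd t)) y"
  have ok: "ok (cb ! a) w s1 s2 m1' m2' y \<longleftrightarrow> Gd s1 s2 (uu c) (zz d) (v1l ! m1') (v2l ! m2') y" for m1' m2'
    by (simp add: ok_def b c d)
  have "\<not> (?Q (a, m1, m2) \<and> (\<forall>t. ?Q t \<longrightarrow> t = (a, m1, m2)))"
  proof
    assume "?Q (a, m1, m2) \<and> (\<forall>t. ?Q t \<longrightarrow> t = (a, m1, m2))"
    then have "(THE t. ?Q t) = (a, m1, m2)" by (intro the_equality) blast+
    then show False using False by (simp add: scheme_def)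
  qed
  then have "\<not> ?Q (a, m1, m2) \<or> (\<exists>t. ?Q t \<and> t \<noteq> (a, m1, m2))" by blast
  moreover have "?Q (a, m1, m2) \<longleftrightarrow> Gd s1 s2 (uu c) (zz d) (v1l ! m1) (v2l ! m2) y"
    using m by (simp add: ok)
  ultimately have "\<not> Gd s1 s2 (uu c) (zz d) (v1l ! m1) (v2l ! m2) y \<or> (\<exists>a' m1' m2'. ?Q (a', m1', m2') \<and> (a', m1', m2') \<noteq> (a, m1, m2))"
    by (metis prod.exhaust)
  then consider "\<not> Gd s1 s2 (uu c) (zz d) (v1l ! m1) (v2l ! m2) y"
    | a' m1' m2' where "a' < nA" "m1' < M1" "m2' < M2" "ok (cb ! a') w s1 s2 m1' m2' y" "(a', m1', m2') \<noteq> (a, m1, m2)"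
    unfolding fst_conv snd_conv by blast
  then have "1 \<le> ?t6 + ?t7 + ?t8 + ?t9 + ?t10"
  proof cases
    case 1
    then have "1 = ?t6" by simp
    also have "\<dots> \<le> ?t6 + ?t7 + ?t8 + ?t9 + ?t10" by (simp add: add.assoc)
    finally show ?thesis .
  next
    case (2 a' m1' m2')
    have mem: "1 \<le> sum f A" if "finite A" "x \<in> A" "1 \<le> f x" for f :: "nat \<Rightarrow> ennreal" and A x
      using member_le_sum[OF that(2), of f] that(1,3) by (meson order_trans zero_le)
    consider "a' \<noteq> a" | "a' = a" "m1' \<noteq> m1" "m2' = m2" | "a' = a" "m1' = m1" "m2' \<noteq> m2" | "a' = a" "m1' \<noteq> m1" "m2' \<noteq> m2"
      using 2(5) by auto
    then show ?thesis
    proof cases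
      case 1
      have "1 \<le> ?t10"
        by (rule mem[of _ a'], simp, use 1 2 in simp, rule mem[of _ m1'], simp, use 2 in simp, rule mem[of _ m2'])
           (use 2 in simp_all)
      also have "\<dots> \<le> ?t6 + ?t7 + ?t8 + ?t9 + ?t10" by simp
      finally show ?thesis .
    next
      case c2: 2
      have "1 \<le> ?t7" by (rule mem[of _ m1']) (use c2 2 ok in simp_all)
      also have "\<dots> \<le> ?t6 + ?t7 + ?t8 + ?t9 + ?t10" by (simp add: add.assoc add_increasing)
      finally show ?thesis .
    next
      case 3
      have "1 \<le> ?t8" by (rule mem[of _ m2']) (use 3 2 ok in simp_all)
      also have "\<dots> \<le> ?t6 + ?t7 + ?t8 + ?t9 + ?t10" by (simp add: add.assoc add_increasing)
      finally show ?thesis .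
    next
      case 4
      have "1 \<le> ?t9"
        by (rule mem[of _ m1'], simp, use 4 2 in simp, rule mem[of _ m2']) (use 4 2 ok in simp_all)
      also have "\<dots> \<le> ?t6 + ?t7 + ?t8 + ?t9 + ?t10" by (simp add: add.assoc add_increasing)
      finally show ?thesis .
    qed
  qed
  then show ?thesis using False by simp
qed simp

text \<open>In order: no \<open>u\<close> accepted, no \<open>z\<close> accepted, the chosen
  \<open>u\<close> fails the test of Encoder 2, another candidate with the same label passes it, the
  crib occurs in the list of another \<open>w\<close>, and the decoding errors. Outside the first
  five events Encoder 2 finds the codeword and reads \<open>w\<close> correctly.\<close>

lemma pointwise_bound:
  assumes m: "a < nA" "w < nW" "m1 < M1" "m2 < M2" and b: "cb ! a = (ul, zl, v1l, v2l)"
    and supp: "set ul \<subseteq> set_pmf qU" "length v1l = M1" "set v1l \<subseteq> set_pmf p1"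
  shows "block_err zfun Wc (scheme cb) a w m1 m2 s1 s2 \<le>
      (case find (AU s1) ul of None \<Rightarrow> 1 | Some c \<Rightarrow> 0)
    + (case find (AU s1) ul of None \<Rightarrow> 0 | Some c \<Rightarrow> (case find (AZ s1 (uu c)) (zl ! w) of None \<Rightarrow> 1 | Some d \<Rightarrow> 0))
    + (case find (AU s1) ul of None \<Rightarrow> 0 | Some c \<Rightarrow> ind (\<not> G2 s2 (uu c)))
    + rivals (AU s1) (rival_u s2) ul
    + chain ul (zl ! w) s1 (\<lambda>u z. \<Sum>w'\<in>{..<nW} - {w}. \<Sum>d'\<leftarrow>zl ! w'. ind (zz d' = z))
    + chain ul (zl ! w) s1 (\<lambda>u z. \<integral>\<^sup>+y.
      (ind (\<not> Gd s1 s2 u z (v1l ! m1) (v2l ! m2) y) +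
      (\<Sum>m1'\<in>{..<M1} - {m1}. ind (Gd s1 s2 u z (v1l ! m1') (v2l ! m2) y)) +
      (\<Sum>m2'\<in>{..<M2} - {m2}. ind (Gd s1 s2 u z (v1l ! m1) (v2l ! m2') y)) +
      (\<Sum>m1'\<in>{..<M1} - {m1}. \<Sum>m2'\<in>{..<M2} - {m2}. ind (Gd s1 s2 u z (v1l ! m1') (v2l ! m2') y)) +
      (\<Sum>a'\<in>{..<nA} - {a}. \<Sum>m1'<M1. \<Sum>m2'<M2. ind (ok (cb ! a') w s1 s2 m1' m2' y))) \<partial>out_law s1 s2 u z (v1l ! m1) (v2l ! m2))"
    (is "_ \<le> ?t1 + ?t2 + ?t3 + ?t4 + ?t5 + ?t6")
proof -
  have err1: "block_err zfun Wc (scheme cb) a w m1 m2 s1 s2 \<le> 1"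
    unfolding block_err_def Let_def by (auto intro!: nn_integral_pmf_le)
  show ?thesis
  proof (cases "find (AU s1) ul")
    case None
    then have "1 \<le> ?t1 + ?t2 + ?t3 + ?t4 + ?t5 + ?t6" by (simp add: add.assoc)
    then show ?thesis using err1 by (rule order_trans[rotated])
  next
    case (Some c)
    note c = this
    have cs: "c \<in> set ul" "AU s1 c" using c by (auto simp: find_Some_iff)
    show ?thesis
    proof (cases "find (AZ s1 (uu c)) (zl ! w)")
      case None
      then have "1 \<le> ?t2" using c by simp
      also have "\<dots> \<le> ?t1 + ?t2 + ?t3 + ?t4 + ?t5 + ?t6" by (simp add: add.assoc add_increasing)
      finally show ?thesis using err1 by (rule order_trans[rotated])
    next
      case (Some d)
      note d = this
      have ds: "d \<in> set (zl ! w)" "AZ s1 (uu c) d" using d by (auto simp: find_Some_iff)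
      have cand: "u_cand ul s1 = c" "z_sel ul (zl ! w) s1 = zz d" by (simp_all add: u_cand_def z_sel_def c d)
      have v1: "v1l ! m1 \<in> set_pmf p1" using supp m by auto
      have z: "zfun (f1 (v1l ! m1) (zz d) (uu c) s1) s1 = zz d"
        by (rule consistent) (use cs ds v1 supp in auto)
      have s1: "send1 (scheme cb) a w m1 s1 = f1 (v1l ! m1) (zz d) (uu c) s1"
        by (simp add: scheme_def b cand)
      consider (g2) "\<not> G2 s2 (uu c)" | (riv) "rivals (AU s1) (rival_u s2) ul \<noteq> 0" | (crib) w' d' where "w' < nW" "w' \<noteq> w" "d' \<in> set (zl ! w')" "zz d' = zz d"
        | (good) "G2 s2 (uu c)" "rivals (AU s1) (rival_u s2) ul = 0" "\<And>w' d'. w' < nW \<Longrightarrow> d' \<in> set (zl ! w') \<Longrightarrow> zz d' = zz d \<Longrightarrow> w' = w"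
        by blast
      then show ?thesis
      proof cases
        case g2
        then have "1 \<le> ?t3" using c by simp
        also have "\<dots> \<le> ?t1 + ?t2 + ?t3 + ?t4 + ?t5 + ?t6" by (simp add: add.assoc add_increasing)
        finally show ?thesis using err1 by (rule order_trans[rotated])
      next
        case riv
        have "rivals (AU s1) (rival_u s2) ul = 0 \<or> 1 \<le> ?t4" by (rule rivals_cases) simp
        with riv have "1 \<le> ?t4" by blast
        also have "\<dots> \<le> ?t1 + ?t2 + ?t3 + ?t4 + ?t5 + ?t6" by (simp add: add.assoc add_increasing)
        finally show ?thesis using err1 by (rule order_trans[rotated])
      next
        case (crib w' d')
        have "1 \<le> (\<Sum>d'\<leftarrow>zl ! w'. ind (zz d' = zz d))"
          using member_le_sum_list[of "1 :: ennreal" "map (\<lambda>d'. ind (zz d' = zz d)) (zl ! w')"] crib by force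
        also have "\<dots> \<le> (\<Sum>w'\<in>{..<nW} - {w}. \<Sum>d'\<leftarrow>zl ! w'. ind (zz d' = zz d))"
          by (rule member_le_sum) (use crib in auto)
        also have "\<dots> = ?t5" by (simp add: chain_def c d)
        also have "\<dots> \<le> ?t1 + ?t2 + ?t3 + ?t4 + ?t5 + ?t6" by (simp add: add.assoc add_increasing)
        finally show ?thesis using err1 by (rule order_trans[rotated])
      next
        case good
        have "read_crib (scheme cb) a (zz d) = w"
        proof -
          have "(THE w'. w' < nW \<and> zz d \<in> zz ` set (zl ! w')) = w"
          proof (rule the_equality)
            show "w < nW \<and> zz d \<in> zz ` set (zl ! w)" using ds m by blast
            show "w' = w" if "w' < nW \<and> zz d \<in> zz ` set (zl ! w')" for w' using good(3)[of w'] that by auto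
          qed
          then show ?thesis by (simp add: scheme_def b)
        qed
        moreover have "find (\<lambda>x. lab x = lab c \<and> G2 s2 (uu x)) ul = Some c"
          by (rule find_no_rivals[OF c _ good(2)]) (use good in auto)
        then have "send2 (scheme cb) a (bin_of (scheme cb) a s1) m2 s2 (zz d) = f2 (v2l ! m2) (zz d) (uu c) s2"
          by (simp add: scheme_def b cand u_dec_def)
        ultimately have "block_err zfun Wc (scheme cb) a w m1 m2 s1 s2 =
          (\<integral>\<^sup>+y. ind (decode (scheme cb) w s1 s2 y \<noteq> (a, m1, m2)) \<partial>out_law s1 s2 (uu c) (zz d) (v1l ! m1) (v2l ! m2))"
          unfolding block_err_def Let_def s1 z by (simp add: if_not_P) (intro nn_integral_cong, simp)
        also have "\<dots> \<le> ?t6"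
          unfolding chain_def c d option.case
          by (intro nn_integral_mono decode_ideal) (use m b c d in auto)
        also have "\<dots> \<le> ?t1 + ?t2 + ?t3 + ?t4 + ?t5 + ?t6" by (simp add: add.assoc add_increasing)
        finally show ?thesis .
      qed
    qed
  qed
qed

end

section \<open>The error of one block averaged over the codebooks\<close>

context coding_scheme
begin

lemma chain_mono: "(\<And>u z. F u z \<le> G u z) \<Longrightarrow> chain ul zs s1 F \<le> chain ul zs s1 G"
  by (auto simp: chain_def split: option.split)

lemma chain_add: "chain ul zs s1 (\<lambda>u z. F u z + G u z) = chain ul zs s1 F + chain ul zs s1 G"
  by (auto simp: chain_def split: option.split)

lemma chain_sum: "chain ul zs s1 (\<lambda>u z. \<Sum>i\<in>I. F i u z) = (\<Sum>i\<in>I. chain ul zs s1 (F i))"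
  by (auto simp: chain_def split: option.split)

lemma chain_integral: "(\<integral>\<^sup>+x. chain ul zs s1 (F x) \<partial>measure_pmf p) = chain ul zs s1 (\<lambda>u z. \<integral>\<^sup>+x. F x u z \<partial>measure_pmf p)"
  by (auto simp: chain_def split: option.split)

lemma chain_le_const: "(\<And>u z. F u z \<le> e) \<Longrightarrow> chain ul zs s1 F \<le> e"
  by (auto simp: chain_def split: option.split)

lemma book_integral:
  "(\<integral>\<^sup>+b. (case b of (ul, zl, v1l, v2l) \<Rightarrow> f ul zl v1l v2l) \<partial>book) =
   (\<integral>\<^sup>+ul. \<integral>\<^sup>+zl. \<integral>\<^sup>+v1l. \<integral>\<^sup>+v2l. f ul zl v1l v2l \<partial>replicate_pmf M2 p2 \<partial>replicate_pmf M1 p1 \<partial>replicate_pmf nW (replicate_pmf Kz qZ) \<partial>replicate_pmf K qU)"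
  unfolding book_def by (simp add: nn_integral_pair_pmf')

lemma chain_bound:
  assumes "w < nW"
  shows "(\<integral>\<^sup>+ul. \<integral>\<^sup>+zl. chain ul (zl ! w) s1 F \<partial>replicate_pmf nW (replicate_pmf Kz qZ) \<partial>replicate_pmf K qU) \<le>
    C * (\<integral>\<^sup>+u. C * (\<integral>\<^sup>+z. F u z \<partial>pZ s1 u) \<partial>pU s1)"
proof -
  have "(\<integral>\<^sup>+zl. chain ul (zl ! w) s1 F \<partial>replicate_pmf nW (replicate_pmf Kz qZ)) \<le>
     (case find (AU s1) ul of None \<Rightarrow> 0 | Some c \<Rightarrow> C * (\<integral>\<^sup>+z. F (uu c) z \<partial>pZ s1 (uu c)))" for ul
  proof -
    have "(\<integral>\<^sup>+zl. chain ul (zl ! w) s1 F \<partial>replicate_pmf nW (replicate_pmf Kz qZ)) = (\<integral>\<^sup>+zs. chain ul zs s1 F \<partial>replicate_pmf Kz qZ)"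
      by (rule nn_integral_replicate_nth[OF assms, where f="\<lambda>zs. chain ul zs s1 F"])
    also have "\<dots> \<le> (case find (AU s1) ul of None \<Rightarrow> 0 | Some c \<Rightarrow> C * (\<integral>\<^sup>+z. F (uu c) z \<partial>pZ s1 (uu c)))"
      unfolding chain_def using select_bound[OF domZ] by (auto split: option.split)
    finally show ?thesis .
  qed
  then have "(\<integral>\<^sup>+ul. \<integral>\<^sup>+zl. chain ul (zl ! w) s1 F \<partial>replicate_pmf nW (replicate_pmf Kz qZ) \<partial>replicate_pmf K qU) \<le>
     (\<integral>\<^sup>+ul. (case find (AU s1) ul of None \<Rightarrow> 0 | Some c \<Rightarrow> C * (\<integral>\<^sup>+z. F (uu c) z \<partial>pZ s1 (uu c))) \<partial>replicate_pmf K qU)"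
    by (intro nn_integral_mono)
  also have "\<dots> \<le> C * (\<integral>\<^sup>+u. C * (\<integral>\<^sup>+z. F u z \<partial>pZ s1 u) \<partial>pU s1)"
    by (rule select_bound[OF domU[where F="\<lambda>u. C * (\<integral>\<^sup>+z. F u z \<partial>pZ s1 u)"]])
  finally show ?thesis .
qed

lemma book_chain_bound:
  assumes "w < nW" "m1 < M1" "m2 < M2"
  shows "(\<integral>\<^sup>+b. (case b of (ul, zl, v1l, v2l) \<Rightarrow> chain ul (zl ! w) s1 (\<lambda>u z. H u z (v1l ! m1) (v2l ! m2))) \<partial>book) \<le>
    C * (\<integral>\<^sup>+u. C * (\<integral>\<^sup>+z. \<integral>\<^sup>+v1. \<integral>\<^sup>+v2. H u z v1 v2 \<partial>p2 \<partial>p1 \<partial>pZ s1 u) \<partial>pU s1)"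
proof -
  have "(\<integral>\<^sup>+v1l. \<integral>\<^sup>+v2l. H u z (v1l ! m1) (v2l ! m2) \<partial>replicate_pmf M2 p2 \<partial>replicate_pmf M1 p1) = (\<integral>\<^sup>+v1. \<integral>\<^sup>+v2. H u z v1 v2 \<partial>p2 \<partial>p1)" for u z
    using nn_integral_replicate_nth[OF assms(2), where f="\<lambda>v1. \<integral>\<^sup>+v2l. H u z v1 (v2l ! m2) \<partial>replicate_pmf M2 p2" and p=p1]
      nn_integral_replicate_nth[OF assms(3), where f="H u z v1" and p=p2 for v1] by simp
  then show ?thesis
    unfolding book_integral chain_integral using chain_bound[OF assms(1)] by simp
qed

lemma book_chain_const:
  assumes "\<And>u z. (\<integral>\<^sup>+v1l. \<integral>\<^sup>+v2l. F u z v1l v2l \<partial>replicate_pmf M2 p2 \<partial>replicate_pmf M1 p1) \<le> e"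
  shows "(\<integral>\<^sup>+b. (case b of (ul, zl, v1l, v2l) \<Rightarrow> chain ul (zl ! w) s1 (\<lambda>u z. F u z v1l v2l)) \<partial>book) \<le> e"
  unfolding book_integral chain_integral
  by (intro nn_integral_pmf_le chain_le_const assms)

text \<open>Each selected codeword costs a factor \<open>C\<close>. A wrong \<open>a\<close> costs
  four of them: two for the transmitted pair and two for the pair that the decoder selects from the
  rival book.\<close>

lemma oneshot_bound:
  assumes m: "a < nA" "w < nW" "m1 < M1" "m2 < M2"
    and D5: "\<And>l. emeasure (measure_pmf qU) {c. lab c = l \<and> G2 s2 (uu c)} \<le> D5"
    and Dz: "\<And>z. emeasure (measure_pmf qZ) {d. zz d = z} \<le> Dz"
    and e1: "\<And>u z v2. (\<integral>\<^sup>+v1. \<integral>\<^sup>+y. \<integral>\<^sup>+v1'. ind (Gd s1 s2 u z v1' v2 y) \<partial>p1 \<partial>out_law s1 s2 u z v1 v2 \<partial>p1) \<le> e1"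
    and e2: "\<And>u z v1. (\<integral>\<^sup>+v2. \<integral>\<^sup>+y. \<integral>\<^sup>+v2'. ind (Gd s1 s2 u z v1 v2' y) \<partial>p2 \<partial>out_law s1 s2 u z v1 v2 \<partial>p2) \<le> e2"
    and e3: "\<And>u z. (\<integral>\<^sup>+v1. \<integral>\<^sup>+v2. \<integral>\<^sup>+y. \<integral>\<^sup>+v1'. \<integral>\<^sup>+v2'. ind (Gd s1 s2 u z v1' v2' y) \<partial>p2 \<partial>p1 \<partial>out_law s1 s2 u z v1 v2 \<partial>p2 \<partial>p1) \<le> e3"
    and e4: "(\<integral>\<^sup>+u. \<integral>\<^sup>+z. \<integral>\<^sup>+v1. \<integral>\<^sup>+v2. \<integral>\<^sup>+y. (\<integral>\<^sup>+u'. \<integral>\<^sup>+z'. \<integral>\<^sup>+v1'. \<integral>\<^sup>+v2'. ind (Gd s1 s2 u' z' v1' v2' y) \<partial>p2 \<partial>p1 \<partial>pZ s1 u' \<partial>pU s1)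
        \<partial>out_law s1 s2 u z v1 v2 \<partial>p2 \<partial>p1 \<partial>pZ s1 u \<partial>pU s1) \<le> e4"
  shows "(\<integral>\<^sup>+cb. block_err zfun Wc (scheme cb) a w m1 m2 s1 s2 \<partial>replicate_pmf nA book) \<le>
     emeasure (measure_pmf qU) {c. \<not> AU s1 c} ^ K
     + C * (\<integral>\<^sup>+u. emeasure (measure_pmf qZ) {d. \<not> AZ s1 u d} ^ Kz \<partial>pU s1)
     + C * (\<integral>\<^sup>+u. ind (\<not> G2 s2 u) \<partial>pU s1)
     + of_nat (2 * (K - 1)) * D5
     + of_nat (nW - 1) * (of_nat Kz * Dz)
     + C * (C * (\<integral>\<^sup>+u. \<integral>\<^sup>+z. \<integral>\<^sup>+v1. \<integral>\<^sup>+v2. \<integral>\<^sup>+y. ind (\<not> Gd s1 s2 u z v1 v2 y) \<partial>out_law s1 s2 u z v1 v2 \<partial>p2 \<partial>p1 \<partial>pZ s1 u \<partial>pU s1))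
     + of_nat (M1 - 1) * e1 + of_nat (M2 - 1) * e2 + of_nat (M1 - 1) * (of_nat (M2 - 1) * e3)
     + of_nat (nA - 1) * (of_nat M1 * (of_nat M2 * (C * (C * (C * (C * e4))))))"
proof -
  define x1 where "x1 = (\<lambda>(ul, zl :: 'cz list list, v1l :: 'v1 list, v2l :: 'v2 list). case find (AU s1) ul of None \<Rightarrow> (1 :: ennreal) | Some c \<Rightarrow> 0)"
  define x2 where "x2 = (\<lambda>(ul, zl :: 'cz list list, v1l :: 'v1 list, v2l :: 'v2 list). case find (AU s1) ul of None \<Rightarrow> (0 :: ennreal) | Some c \<Rightarrow> (case find (AZ s1 (uu c)) (zl ! w) of None \<Rightarrow> 1 | Some d \<Rightarrow> 0))"
  define x3 where "x3 = (\<lambda>(ul, zl :: 'cz list list, v1l :: 'v1 list, v2l :: 'v2 list). case find (AU s1) ul of None \<Rightarrow> 0 | Some c \<Rightarrow> ind (\<not> G2 s2 (uu c)))"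
  define x4 where "x4 = (\<lambda>(ul, zl :: 'cz list list, v1l :: 'v1 list, v2l :: 'v2 list). rivals (AU s1) (rival_u s2) ul)"
  define x5 where "x5 = (\<lambda>(ul, zl, v1l :: 'v1 list, v2l :: 'v2 list). chain ul (zl ! w) s1 (\<lambda>u z. \<Sum>w'\<in>{..<nW} - {w}. \<Sum>d'\<leftarrow>zl ! w'. ind (zz d' = z)))"
  define x6 where "x6 = (\<lambda>(ul, zl, v1l, v2l). chain ul (zl ! w) s1 (\<lambda>u z. \<integral>\<^sup>+y. ind (\<not> Gd s1 s2 u z (v1l ! m1) (v2l ! m2) y) \<partial>out_law s1 s2 u z (v1l ! m1) (v2l ! m2)))"
  define x7 where "x7 = (\<lambda>(ul, zl, v1l, v2l). chain ul (zl ! w) s1 (\<lambda>u z. \<integral>\<^sup>+y. (\<Sum>m1'\<in>{..<M1} - {m1}. ind (Gd s1 s2 u z (v1l ! m1') (v2l ! m2) y)) \<partial>out_law s1 s2 u z (v1l ! m1) (v2l ! m2)))"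
  define x8 where "x8 = (\<lambda>(ul, zl, v1l, v2l). chain ul (zl ! w) s1 (\<lambda>u z. \<integral>\<^sup>+y. (\<Sum>m2'\<in>{..<M2} - {m2}. ind (Gd s1 s2 u z (v1l ! m1) (v2l ! m2') y)) \<partial>out_law s1 s2 u z (v1l ! m1) (v2l ! m2)))"
  define x9 where "x9 = (\<lambda>(ul, zl, v1l, v2l). chain ul (zl ! w) s1 (\<lambda>u z. \<integral>\<^sup>+y. (\<Sum>m1'\<in>{..<M1} - {m1}. \<Sum>m2'\<in>{..<M2} - {m2}. ind (Gd s1 s2 u z (v1l ! m1') (v2l ! m2') y)) \<partial>out_law s1 s2 u z (v1l ! m1) (v2l ! m2)))"
  define x10 where "x10 = (\<lambda>(ul, zl, v1l, v2l) b'. chain ul (zl ! w) s1 (\<lambda>u z. \<integral>\<^sup>+y. (\<Sum>m1'<M1. \<Sum>m2'<M2. ind (ok b' w s1 s2 m1' m2' y)) \<partial>out_law s1 s2 u z (v1l ! m1) (v2l ! m2)))"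
  have "(\<integral>\<^sup>+cb. block_err zfun Wc (scheme cb) a w m1 m2 s1 s2 \<partial>replicate_pmf nA book) \<le>
    (\<integral>\<^sup>+cb. (x1 (cb ! a) + x2 (cb ! a) + x3 (cb ! a) + x4 (cb ! a) + x5 (cb ! a) + x6 (cb ! a) + x7 (cb ! a) + x8 (cb ! a) + x9 (cb ! a)) +
       (\<Sum>a'\<in>{..<nA} - {a}. x10 (cb ! a) (cb ! a')) \<partial>replicate_pmf nA book)"
  proof (rule nn_integral_pmf_mono)
    fix cb assume "cb \<in> set_pmf (replicate_pmf nA book)"
    then have "cb ! a \<in> set_pmf book" using m by (auto simp: set_replicate_pmf)
    moreover obtain ul zl v1l v2l where b: "cb ! a = (ul, zl, v1l, v2l)" by (cases "cb ! a")
    ultimately have supp: "set ul \<subseteq> set_pmf qU" "length v1l = M1" "set v1l \<subseteq> set_pmf p1"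
      by (auto simp: book_def set_replicate_pmf)
    show "block_err zfun Wc (scheme cb) a w m1 m2 s1 s2 \<le> (x1 (cb ! a) + x2 (cb ! a) + x3 (cb ! a) + x4 (cb ! a) + x5 (cb ! a) + x6 (cb ! a) + x7 (cb ! a) + x8 (cb ! a) + x9 (cb ! a)) +
       (\<Sum>a'\<in>{..<nA} - {a}. x10 (cb ! a) (cb ! a'))"
      using pointwise_bound[where cb=cb and a=a, OF m b supp, of s1 s2]
      unfolding b x1_def x2_def x3_def x4_def x5_def x6_def x7_def x8_def x9_def x10_def prod.case
      by (simp add: nn_integral_add nn_integral_sum chain_add chain_sum add.assoc)
  qed
  also have "\<dots> = (\<integral>\<^sup>+b. x1 b \<partial>book) + (\<integral>\<^sup>+b. x2 b \<partial>book) + (\<integral>\<^sup>+b. x3 b \<partial>book) + (\<integral>\<^sup>+b. x4 b \<partial>book) + (\<integral>\<^sup>+b. x5 b \<partial>book)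
     + (\<integral>\<^sup>+b. x6 b \<partial>book) + (\<integral>\<^sup>+b. x7 b \<partial>book) + (\<integral>\<^sup>+b. x8 b \<partial>book) + (\<integral>\<^sup>+b. x9 b \<partial>book)
     + of_nat (nA - 1) * (\<integral>\<^sup>+b. \<integral>\<^sup>+b'. x10 b b' \<partial>book \<partial>book)"
    by (simp add: nn_integral_add nn_integral_replicate_others[OF m(1)]
        nn_integral_replicate_nth[OF m(1), where f=x1] nn_integral_replicate_nth[OF m(1), where f=x2] nn_integral_replicate_nth[OF m(1), where f=x3]
        nn_integral_replicate_nth[OF m(1), where f=x4] nn_integral_replicate_nth[OF m(1), where f=x5] nn_integral_replicate_nth[OF m(1), where f=x6]
        nn_integral_replicate_nth[OF m(1), where f=x7] nn_integral_replicate_nth[OF m(1), where f=x8] nn_integral_replicate_nth[OF m(1), where f=x9])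
  also have "\<dots> \<le> emeasure (measure_pmf qU) {c. \<not> AU s1 c} ^ K
     + C * (\<integral>\<^sup>+u. emeasure (measure_pmf qZ) {d. \<not> AZ s1 u d} ^ Kz \<partial>pU s1)
     + C * (\<integral>\<^sup>+u. ind (\<not> G2 s2 u) \<partial>pU s1)
     + of_nat (2 * (K - 1)) * D5
     + of_nat (nW - 1) * (of_nat Kz * Dz)
     + C * (\<integral>\<^sup>+u. C * (\<integral>\<^sup>+z. \<integral>\<^sup>+v1. \<integral>\<^sup>+v2. \<integral>\<^sup>+y. ind (\<not> Gd s1 s2 u z v1 v2 y) \<partial>out_law s1 s2 u z v1 v2 \<partial>p2 \<partial>p1 \<partial>pZ s1 u) \<partial>pU s1)
     + of_nat (M1 - 1) * e1 + of_nat (M2 - 1) * e2 + of_nat (M1 - 1) * (of_nat (M2 - 1) * e3)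
     + of_nat (nA - 1) * (of_nat M1 * (of_nat M2 * (C * (C * (C * (C * e4))))))"
  proof (intro add_mono mult_left_mono)
    show "(\<integral>\<^sup>+b. x1 b \<partial>book) \<le> emeasure (measure_pmf qU) {c. \<not> AU s1 c} ^ K"
      unfolding x1_def book_integral by (simp add: select_fail)
    show "(\<integral>\<^sup>+b. x2 b \<partial>book) \<le> C * (\<integral>\<^sup>+u. emeasure (measure_pmf qZ) {d. \<not> AZ s1 u d} ^ Kz \<partial>pU s1)"
    proof -
      have "(\<integral>\<^sup>+zl. (case find (AU s1) ul of None \<Rightarrow> 0 | Some c \<Rightarrow> (case find (AZ s1 (uu c)) (zl ! w) of None \<Rightarrow> 1 | Some d \<Rightarrow> 0)) \<partial>replicate_pmf nW (replicate_pmf Kz qZ)) =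
        (case find (AU s1) ul of None \<Rightarrow> 0 | Some c \<Rightarrow> emeasure (measure_pmf qZ) {d. \<not> AZ s1 (uu c) d} ^ Kz)" for ul
        using nn_integral_replicate_nth[OF m(2), where f="\<lambda>zs. (case find (AZ s1 (uu c)) zs of None \<Rightarrow> 1 | Some d \<Rightarrow> 0)" and p="replicate_pmf Kz qZ" for c]
        by (auto simp: select_fail split: option.split)
      then have "(\<integral>\<^sup>+b. x2 b \<partial>book) = (\<integral>\<^sup>+ul. (case find (AU s1) ul of None \<Rightarrow> 0 | Some c \<Rightarrow> emeasure (measure_pmf qZ) {d. \<not> AZ s1 (uu c) d} ^ Kz) \<partial>replicate_pmf K qU)"
        unfolding x2_def book_integral by simp
      also have "\<dots> \<le> C * (\<integral>\<^sup>+u. emeasure (measure_pmf qZ) {d. \<not> AZ s1 u d} ^ Kz \<partial>pU s1)"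
        by (rule select_bound[OF domU])
      finally show ?thesis .
    qed
    show "(\<integral>\<^sup>+b. x3 b \<partial>book) \<le> C * (\<integral>\<^sup>+u. ind (\<not> G2 s2 u) \<partial>pU s1)"
      unfolding x3_def book_integral using select_bound[OF domU[where F="\<lambda>u. ind (\<not> G2 s2 u)"]] by simp
    show "(\<integral>\<^sup>+b. x4 b \<partial>book) \<le> of_nat (2 * (K - 1)) * D5"
    proof -
      have in5: "(\<integral>\<^sup>+y. rival_u s2 x y \<partial>qU) \<le> D5" for x
      proof -
        have "(\<integral>\<^sup>+y. rival_u s2 x y \<partial>qU) = (\<integral>\<^sup>+y. indicator {c. lab c = lab x \<and> G2 s2 (uu c)} y \<partial>qU)"
          by (intro nn_integral_cong) (auto split: split_indicator)
        then show ?thesis using D5[of "lab x"] by simp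
      qed
      have "(\<integral>\<^sup>+x. (if AU s1 x then (\<integral>\<^sup>+y. rival_u s2 x y \<partial>qU) else 0) \<partial>qU) \<le> (\<integral>\<^sup>+x. indicator {x. AU s1 x} x * D5 \<partial>qU)"
        by (intro nn_integral_mono) (auto simp: in5 split: split_indicator)
      also have "\<dots> = emeasure (measure_pmf qU) {x. AU s1 x} * D5" by (simp add: nn_integral_multc)
      finally have "(\<integral>\<^sup>+xs. rivals (AU s1) (rival_u s2) xs \<partial>replicate_pmf (Suc (K - 1)) qU) \<le> of_nat (2 * (K - 1)) * D5"
        by (rule rivals_bound)
      then show ?thesis using K unfolding x4_def book_integral by (simp del: replicate_pmf.simps)
    qed
    show "(\<integral>\<^sup>+b. x5 b \<partial>book) \<le> of_nat (nW - 1) * (of_nat Kz * Dz)"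
    proof -
      have "(\<integral>\<^sup>+zl. chain ul (zl ! w) s1 (\<lambda>u z. \<Sum>w'\<in>{..<nW} - {w}. \<Sum>d'\<leftarrow>zl ! w'. ind (zz d' = z)) \<partial>replicate_pmf nW (replicate_pmf Kz qZ)) \<le>
        of_nat (nW - 1) * (of_nat Kz * Dz)" for ul
      proof -
        have "(\<integral>\<^sup>+zl. chain ul (zl ! w) s1 (\<lambda>u z. \<Sum>w'\<in>{..<nW} - {w}. \<Sum>d'\<leftarrow>zl ! w'. ind (zz d' = z)) \<partial>replicate_pmf nW (replicate_pmf Kz qZ)) =
          of_nat (nW - 1) * (\<integral>\<^sup>+zs. \<integral>\<^sup>+zs'. chain ul zs s1 (\<lambda>u z. \<Sum>d'\<leftarrow>zs'. ind (zz d' = z)) \<partial>replicate_pmf Kz qZ \<partial>replicate_pmf Kz qZ)"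
          unfolding chain_sum by (rule nn_integral_replicate_others[OF m(2), where f="\<lambda>zs zs'. chain ul zs s1 (\<lambda>u z. \<Sum>d'\<leftarrow>zs'. ind (zz d' = z))"])
        also have "\<dots> \<le> of_nat (nW - 1) * (of_nat Kz * Dz)"
          unfolding chain_integral
        proof (rule mult_left_mono, rule nn_integral_pmf_le, rule chain_le_const)
          fix z
          have sl: "(\<integral>\<^sup>+zs'. (\<Sum>d'\<leftarrow>zs'. ind (zz d' = z)) \<partial>replicate_pmf Kz qZ) = of_nat Kz * (\<integral>\<^sup>+d. ind (zz d = z) \<partial>qZ)"
            by (rule nn_integral_sum_list)
          have "(\<integral>\<^sup>+d. ind (zz d = z) \<partial>qZ) = (\<integral>\<^sup>+d. indicator {d. zz d = z} d \<partial>qZ)"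
            by (intro nn_integral_cong) (auto split: split_indicator)
          then have "(\<integral>\<^sup>+d. ind (zz d = z) \<partial>qZ) \<le> Dz" using Dz[of z] by simp
          then show "(\<integral>\<^sup>+zs'. (\<Sum>d'\<leftarrow>zs'. ind (zz d' = z)) \<partial>replicate_pmf Kz qZ) \<le> of_nat Kz * Dz"
            unfolding sl by (intro mult_left_mono) auto
        qed auto
        finally show ?thesis .
      qed
      then show ?thesis unfolding x5_def book_integral nn_integral_pmf_const by (rule nn_integral_pmf_le)
    qed
    show "(\<integral>\<^sup>+b. x6 b \<partial>book) \<le> C * (\<integral>\<^sup>+u. C * (\<integral>\<^sup>+z. \<integral>\<^sup>+v1. \<integral>\<^sup>+v2. \<integral>\<^sup>+y. ind (\<not> Gd s1 s2 u z v1 v2 y) \<partial>out_law s1 s2 u z v1 v2 \<partial>p2 \<partial>p1 \<partial>pZ s1 u) \<partial>pU s1)"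
      unfolding x6_def by (rule book_chain_bound[OF m(2-4), where H="\<lambda>u z v1 v2. \<integral>\<^sup>+y. ind (\<not> Gd s1 s2 u z v1 v2 y) \<partial>out_law s1 s2 u z v1 v2"])
    show "(\<integral>\<^sup>+b. x7 b \<partial>book) \<le> of_nat (M1 - 1) * e1"
      unfolding x7_def
    proof (rule book_chain_const)
      fix u z
      have "(\<integral>\<^sup>+v1l. \<integral>\<^sup>+v2l. \<integral>\<^sup>+y. (\<Sum>m1'\<in>{..<M1} - {m1}. ind (Gd s1 s2 u z (v1l ! m1') (v2l ! m2) y)) \<partial>out_law s1 s2 u z (v1l ! m1) (v2l ! m2) \<partial>replicate_pmf M2 p2 \<partial>replicate_pmf M1 p1) =
        (\<integral>\<^sup>+v1l. \<integral>\<^sup>+v2. \<integral>\<^sup>+y. (\<Sum>m1'\<in>{..<M1} - {m1}. ind (Gd s1 s2 u z (v1l ! m1') v2 y)) \<partial>out_law s1 s2 u z (v1l ! m1) v2 \<partial>p2 \<partial>replicate_pmf M1 p1)"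
        by (intro nn_integral_cong nn_integral_replicate_nth[OF m(4), where f="\<lambda>v2. \<integral>\<^sup>+y. (\<Sum>m1'\<in>{..<M1} - {m1}. ind (Gd s1 s2 u z (v1l ! m1') v2 y)) \<partial>out_law s1 s2 u z (v1l ! m1) v2" for v1l])
      also have "\<dots> = (\<integral>\<^sup>+v2. \<integral>\<^sup>+v1l. (\<Sum>m1'\<in>{..<M1} - {m1}. \<integral>\<^sup>+y. ind (Gd s1 s2 u z (v1l ! m1') v2 y) \<partial>out_law s1 s2 u z (v1l ! m1) v2) \<partial>replicate_pmf M1 p1 \<partial>p2)"
        by (subst nn_integral_pmf_swap) (simp add: nn_integral_sum)
      also have "\<dots> = (\<integral>\<^sup>+v2. of_nat (M1 - 1) * (\<integral>\<^sup>+v1. \<integral>\<^sup>+v1'. \<integral>\<^sup>+y. ind (Gd s1 s2 u z v1' v2 y) \<partial>out_law s1 s2 u z v1 v2 \<partial>p1 \<partial>p1) \<partial>p2)"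
        by (intro nn_integral_cong nn_integral_replicate_others[OF m(3), where f="\<lambda>v1 v1'. \<integral>\<^sup>+y. ind (Gd s1 s2 u z v1' v2 y) \<partial>out_law s1 s2 u z v1 v2" for v2])
      also have "\<dots> \<le> of_nat (M1 - 1) * e1"
      proof (rule nn_integral_pmf_le, rule mult_left_mono)
        fix v2
        have "(\<integral>\<^sup>+v1. \<integral>\<^sup>+v1'. \<integral>\<^sup>+y. ind (Gd s1 s2 u z v1' v2 y) \<partial>out_law s1 s2 u z v1 v2 \<partial>p1 \<partial>p1) =
          (\<integral>\<^sup>+v1. \<integral>\<^sup>+y. \<integral>\<^sup>+v1'. ind (Gd s1 s2 u z v1' v2 y) \<partial>p1 \<partial>out_law s1 s2 u z v1 v2 \<partial>p1)"
          by (rule nn_integral_cong, rule nn_integral_pmf_swap)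
        then show "(\<integral>\<^sup>+v1. \<integral>\<^sup>+v1'. \<integral>\<^sup>+y. ind (Gd s1 s2 u z v1' v2 y) \<partial>out_law s1 s2 u z v1 v2 \<partial>p1 \<partial>p1) \<le> e1"
          using e1 by (simp only:)
      qed simp
      finally show "(\<integral>\<^sup>+v1l. \<integral>\<^sup>+v2l. \<integral>\<^sup>+y. (\<Sum>m1'\<in>{..<M1} - {m1}. ind (Gd s1 s2 u z (v1l ! m1') (v2l ! m2) y)) \<partial>out_law s1 s2 u z (v1l ! m1) (v2l ! m2) \<partial>replicate_pmf M2 p2 \<partial>replicate_pmf M1 p1) \<le> of_nat (M1 - 1) * e1" .
    qed
    show "(\<integral>\<^sup>+b. x8 b \<partial>book) \<le> of_nat (M2 - 1) * e2"
      unfolding x8_def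
    proof (rule book_chain_const)
      fix u z
      let ?h = "\<lambda>v1 v2 v2'. \<integral>\<^sup>+y. ind (Gd s1 s2 u z v1 v2' y) \<partial>out_law s1 s2 u z v1 v2"
      have "(\<integral>\<^sup>+v1l. \<integral>\<^sup>+v2l. \<integral>\<^sup>+y. (\<Sum>m2'\<in>{..<M2} - {m2}. ind (Gd s1 s2 u z (v1l ! m1) (v2l ! m2') y)) \<partial>out_law s1 s2 u z (v1l ! m1) (v2l ! m2) \<partial>replicate_pmf M2 p2 \<partial>replicate_pmf M1 p1) =
        (\<integral>\<^sup>+v1l. \<integral>\<^sup>+v2l. (\<Sum>m2'\<in>{..<M2} - {m2}. ?h (v1l ! m1) (v2l ! m2) (v2l ! m2')) \<partial>replicate_pmf M2 p2 \<partial>replicate_pmf M1 p1)"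
        by (simp add: nn_integral_sum)
      also have "\<dots> = (\<integral>\<^sup>+v1l. of_nat (M2 - 1) * (\<integral>\<^sup>+v2. \<integral>\<^sup>+v2'. ?h (v1l ! m1) v2 v2' \<partial>p2 \<partial>p2) \<partial>replicate_pmf M1 p1)"
        by (intro nn_integral_cong nn_integral_replicate_others[OF m(4), where f="?h v1" for v1])
      also have "\<dots> \<le> of_nat (M2 - 1) * e2"
      proof (rule nn_integral_pmf_le, rule mult_left_mono)
        fix v1l
        have "(\<integral>\<^sup>+v2. \<integral>\<^sup>+v2'. ?h (v1l ! m1) v2 v2' \<partial>p2 \<partial>p2) =
          (\<integral>\<^sup>+v2. \<integral>\<^sup>+y. \<integral>\<^sup>+v2'. ind (Gd s1 s2 u z (v1l ! m1) v2' y) \<partial>p2 \<partial>out_law s1 s2 u z (v1l ! m1) v2 \<partial>p2)"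
          by (rule nn_integral_cong, rule nn_integral_pmf_swap)
        then show "(\<integral>\<^sup>+v2. \<integral>\<^sup>+v2'. ?h (v1l ! m1) v2 v2' \<partial>p2 \<partial>p2) \<le> e2"
          using e2 by (simp only:)
      qed simp
      finally show "(\<integral>\<^sup>+v1l. \<integral>\<^sup>+v2l. \<integral>\<^sup>+y. (\<Sum>m2'\<in>{..<M2} - {m2}. ind (Gd s1 s2 u z (v1l ! m1) (v2l ! m2') y)) \<partial>out_law s1 s2 u z (v1l ! m1) (v2l ! m2) \<partial>replicate_pmf M2 p2 \<partial>replicate_pmf M1 p1) \<le> of_nat (M2 - 1) * e2" .
    qed
    show "(\<integral>\<^sup>+b. x9 b \<partial>book) \<le> of_nat (M1 - 1) * (of_nat (M2 - 1) * e3)"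
      unfolding x9_def
    proof (rule book_chain_const)
      fix u z
      let ?h = "\<lambda>v1 v1' v2 v2'. \<integral>\<^sup>+y. ind (Gd s1 s2 u z v1' v2' y) \<partial>out_law s1 s2 u z v1 v2"
      have "(\<integral>\<^sup>+v1l. \<integral>\<^sup>+v2l. \<integral>\<^sup>+y. (\<Sum>m1'\<in>{..<M1} - {m1}. \<Sum>m2'\<in>{..<M2} - {m2}. ind (Gd s1 s2 u z (v1l ! m1') (v2l ! m2') y)) \<partial>out_law s1 s2 u z (v1l ! m1) (v2l ! m2) \<partial>replicate_pmf M2 p2 \<partial>replicate_pmf M1 p1) =
        (\<integral>\<^sup>+v1l. (\<Sum>m1'\<in>{..<M1} - {m1}. \<integral>\<^sup>+v2l. (\<Sum>m2'\<in>{..<M2} - {m2}. ?h (v1l ! m1) (v1l ! m1') (v2l ! m2) (v2l ! m2')) \<partial>replicate_pmf M2 p2) \<partial>replicate_pmf M1 p1)"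
        by (simp add: nn_integral_sum)
      also have "\<dots> = (\<integral>\<^sup>+v1l. (\<Sum>m1'\<in>{..<M1} - {m1}. of_nat (M2 - 1) * (\<integral>\<^sup>+v2. \<integral>\<^sup>+v2'. ?h (v1l ! m1) (v1l ! m1') v2 v2' \<partial>p2 \<partial>p2)) \<partial>replicate_pmf M1 p1)"
        by (intro nn_integral_cong sum.cong refl nn_integral_replicate_others[OF m(4), where f="?h v1 v1'" for v1 v1'])
      also have "\<dots> = of_nat (M1 - 1) * (\<integral>\<^sup>+v1. \<integral>\<^sup>+v1'. of_nat (M2 - 1) * (\<integral>\<^sup>+v2. \<integral>\<^sup>+v2'. ?h v1 v1' v2 v2' \<partial>p2 \<partial>p2) \<partial>p1 \<partial>p1)"
        by (rule nn_integral_replicate_others[OF m(3), where f="\<lambda>v1 v1'. of_nat (M2 - 1) * (\<integral>\<^sup>+v2. \<integral>\<^sup>+v2'. ?h v1 v1' v2 v2' \<partial>p2 \<partial>p2)"])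
      also have "\<dots> = of_nat (M1 - 1) * (of_nat (M2 - 1) * (\<integral>\<^sup>+v1. \<integral>\<^sup>+v2. \<integral>\<^sup>+y. \<integral>\<^sup>+v1'. \<integral>\<^sup>+v2'. ind (Gd s1 s2 u z v1' v2' y) \<partial>p2 \<partial>p1 \<partial>out_law s1 s2 u z v1 v2 \<partial>p2 \<partial>p1))"
      proof -
        have "(\<integral>\<^sup>+v1'. \<integral>\<^sup>+v2. \<integral>\<^sup>+v2'. ?h v1 v1' v2 v2' \<partial>p2 \<partial>p2 \<partial>p1) = (\<integral>\<^sup>+v2. \<integral>\<^sup>+y. \<integral>\<^sup>+v1'. \<integral>\<^sup>+v2'. ind (Gd s1 s2 u z v1' v2' y) \<partial>p2 \<partial>p1 \<partial>out_law s1 s2 u z v1 v2 \<partial>p2)" for v1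
        proof -
          have "(\<integral>\<^sup>+v1'. \<integral>\<^sup>+v2. \<integral>\<^sup>+v2'. ?h v1 v1' v2 v2' \<partial>p2 \<partial>p2 \<partial>p1) = (\<integral>\<^sup>+v2. \<integral>\<^sup>+v1'. \<integral>\<^sup>+v2'. ?h v1 v1' v2 v2' \<partial>p2 \<partial>p1 \<partial>p2)"
            by (rule nn_integral_pmf_swap)
          also have "\<dots> = (\<integral>\<^sup>+v2. \<integral>\<^sup>+v1'. \<integral>\<^sup>+y. \<integral>\<^sup>+v2'. ind (Gd s1 s2 u z v1' v2' y) \<partial>p2 \<partial>out_law s1 s2 u z v1 v2 \<partial>p1 \<partial>p2)"
            by (intro nn_integral_cong nn_integral_pmf_swap)
          also have "\<dots> = (\<integral>\<^sup>+v2. \<integral>\<^sup>+y. \<integral>\<^sup>+v1'. \<integral>\<^sup>+v2'. ind (Gd s1 s2 u z v1' v2' y) \<partial>p2 \<partial>p1 \<partial>out_law s1 s2 u z v1 v2 \<partial>p2)"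
            by (intro nn_integral_cong nn_integral_pmf_swap)
          finally show ?thesis .
        qed
        then show ?thesis by (simp add: nn_integral_cmult)
      qed
      also have "\<dots> \<le> of_nat (M1 - 1) * (of_nat (M2 - 1) * e3)"
        by (intro mult_left_mono e3) auto
      finally show "(\<integral>\<^sup>+v1l. \<integral>\<^sup>+v2l. \<integral>\<^sup>+y. (\<Sum>m1'\<in>{..<M1} - {m1}. \<Sum>m2'\<in>{..<M2} - {m2}. ind (Gd s1 s2 u z (v1l ! m1') (v2l ! m2') y)) \<partial>out_law s1 s2 u z (v1l ! m1) (v2l ! m2) \<partial>replicate_pmf M2 p2 \<partial>replicate_pmf M1 p1) \<le> of_nat (M1 - 1) * (of_nat (M2 - 1) * e3)" .
    qed
    show "(\<integral>\<^sup>+b. \<integral>\<^sup>+b'. x10 b b' \<partial>book \<partial>book) \<le> of_nat M1 * (of_nat M2 * (C * (C * (C * (C * e4)))))"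
    proof -
      define G where "G y = (\<integral>\<^sup>+u'. \<integral>\<^sup>+z'. \<integral>\<^sup>+v1'. \<integral>\<^sup>+v2'. ind (Gd s1 s2 u' z' v1' v2' y) \<partial>p2 \<partial>p1 \<partial>pZ s1 u' \<partial>pU s1)" for y
      \<comment> \<open>The rival book is independent of the output, so its selections are averaged
        while \<open>y\<close> is held fixed.\<close>
      have okb: "(\<integral>\<^sup>+b'. ind (ok b' w s1 s2 m1' m2' y) \<partial>book) \<le> C * (C * G y)" if "m1' < M1" "m2' < M2" for m1' m2' y
      proof -
        have "ind (ok b' w s1 s2 m1' m2' y) = (case b' of (ul, zl, v1l, v2l) \<Rightarrow> chain ul (zl ! w) s1 (\<lambda>u z. ind (Gd s1 s2 u z (v1l ! m1') (v2l ! m2') y)))" for b'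
          by (auto simp: ok_def chain_def split: option.split prod.split)
        then show ?thesis
          using book_chain_bound[OF m(2) that, where H="\<lambda>u z v1 v2. ind (Gd s1 s2 u z v1 v2 y)"]
          by (simp add: nn_integral_cmult G_def)
      qed
      have "(\<integral>\<^sup>+b'. x10 b b' \<partial>book) \<le> (case b of (ul, zl, v1l, v2l) \<Rightarrow> chain ul (zl ! w) s1
         (\<lambda>u z. (\<integral>\<^sup>+y. of_nat M1 * (of_nat M2 * (C * (C * G y))) \<partial>out_law s1 s2 u z (v1l ! m1) (v2l ! m2))))" for b
      proof -
        obtain ul zl v1l v2l where b: "b = (ul, zl, v1l, v2l)" by (cases b)
        have "(\<integral>\<^sup>+b'. \<integral>\<^sup>+y. (\<Sum>m1'<M1. \<Sum>m2'<M2. ind (ok b' w s1 s2 m1' m2' y)) \<partial>out_law s1 s2 u z (v1l ! m1) (v2l ! m2) \<partial>book) \<le>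
          (\<integral>\<^sup>+y. of_nat M1 * (of_nat M2 * (C * (C * G y))) \<partial>out_law s1 s2 u z (v1l ! m1) (v2l ! m2))" for u z
        proof (subst nn_integral_pmf_swap, intro nn_integral_mono)
          fix y
          have "(\<integral>\<^sup>+b'. (\<Sum>m1'<M1. \<Sum>m2'<M2. ind (ok b' w s1 s2 m1' m2' y)) \<partial>book) = (\<Sum>m1'<M1. \<Sum>m2'<M2. \<integral>\<^sup>+b'. ind (ok b' w s1 s2 m1' m2' y) \<partial>book)"
            by (simp add: nn_integral_sum)
          also have "\<dots> \<le> (\<Sum>m1'<M1. \<Sum>m2'<M2. C * (C * G y))"
            by (intro sum_mono okb) auto
          finally show "(\<integral>\<^sup>+b'. (\<Sum>m1'<M1. \<Sum>m2'<M2. ind (ok b' w s1 s2 m1' m2' y)) \<partial>book) \<le> of_nat M1 * (of_nat M2 * (C * (C * G y)))"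
            by simp
        qed
        then show ?thesis unfolding x10_def b prod.case chain_integral by (rule chain_mono)
      qed
      then have "(\<integral>\<^sup>+b. \<integral>\<^sup>+b'. x10 b b' \<partial>book \<partial>book) \<le> (\<integral>\<^sup>+b. (case b of (ul, zl, v1l, v2l) \<Rightarrow> chain ul (zl ! w) s1
         (\<lambda>u z. (\<integral>\<^sup>+y. of_nat M1 * (of_nat M2 * (C * (C * G y))) \<partial>out_law s1 s2 u z (v1l ! m1) (v2l ! m2)))) \<partial>book)"
        by (intro nn_integral_mono)
      also have "\<dots> \<le> C * (\<integral>\<^sup>+u. C * (\<integral>\<^sup>+z. \<integral>\<^sup>+v1. \<integral>\<^sup>+v2. (\<integral>\<^sup>+y. of_nat M1 * (of_nat M2 * (C * (C * G y))) \<partial>out_law s1 s2 u z v1 v2) \<partial>p2 \<partial>p1 \<partial>pZ s1 u) \<partial>pU s1)"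
        by (rule book_chain_bound[OF m(2-4), where H="\<lambda>u z v1 v2. (\<integral>\<^sup>+y. of_nat M1 * (of_nat M2 * (C * (C * G y))) \<partial>out_law s1 s2 u z v1 v2)"])
      also have "\<dots> = of_nat M1 * (of_nat M2 * (C * (C * (C * (C * (\<integral>\<^sup>+u. \<integral>\<^sup>+z. \<integral>\<^sup>+v1. \<integral>\<^sup>+v2. \<integral>\<^sup>+y. G y \<partial>out_law s1 s2 u z v1 v2 \<partial>p2 \<partial>p1 \<partial>pZ s1 u \<partial>pU s1))))))"
        by (simp add: nn_integral_cmult) (simp add: mult_ac)
      also have "\<dots> \<le> of_nat M1 * (of_nat M2 * (C * (C * (C * (C * e4)))))"
        using e4 unfolding G_def by (intro mult_left_mono) auto
      finally show ?thesis .
    qed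
  qed auto
  finally show ?thesis by (simp add: nn_integral_cmult)
qed

end

section \<open>Block Markov coding with backward decoding\<close>

context cribbing_mac
begin

abbreviation block_channel :: "nat \<Rightarrow> 'x1 list \<Rightarrow> 'x2 list \<Rightarrow> 's1 list \<Rightarrow> 's2 list \<Rightarrow> 'y list pmf" where
  "block_channel n x1 x2 s1 s2 \<equiv> independent_list_pmf n (\<lambda>i. W (x1 ! i) (x2 ! i) (s1 ! i) (s2 ! i))"

abbreviation mean_err where
  "mean_err n C a w m1 m2 \<equiv>
    (\<integral>\<^sup>+b. \<integral>\<^sup>+s. block_err (map2 zf) (block_channel n) b a w m1 m2 (map fst s) (map snd s) \<partial>replicate_pmf n pS \<partial>C)"

lemma block_channel_append:
  assumes "length x1 = n" "length x2 = n" "length s1 = n" "length s2 = n"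
  shows "block_channel (n + m) (x1 @ x1') (x2 @ x2') (s1 @ s1') (s2 @ s2') =
    bind_pmf (block_channel n x1 x2 s1 s2) (\<lambda>y. map_pmf (append y) (block_channel m x1' x2' s1' s2'))"
proof -
  have "independent_list_pmf n (\<lambda>i. W ((x1 @ x1') ! i) ((x2 @ x2') ! i) ((s1 @ s1') ! i) ((s2 @ s2') ! i)) = block_channel n x1 x2 s1 s2"
    using assms by (intro independent_list_pmf_cong) (simp add: nth_append)
  then show ?thesis unfolding independent_list_pmf_add using assms by (simp add: nth_append)
qed

text \<open>What the concatenation of blocks requires: fixed block lengths, causality of Encoder 2
  inside a block, and bins below \<open>L\<close>, so that \<open>(a, bin)\<close> can be packed
  into one number.\<close>

definition sound :: "nat \<Rightarrow> nat \<Rightarrow> nat \<Rightarrow> ('s1 list, 's2 list, 'x1 list, 'x2 list, 'z list, 'y list) block_scheme \<Rightarrow> bool" where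
  "sound n L nA b \<longleftrightarrow> (\<forall>a w m1 s1. length (send1 b a w m1 s1) = n) \<and> (\<forall>a l m2 s2 z. length (send2 b a l m2 s2 z) = n) \<and>
     (\<forall>a l m2 s2 z i. i < n \<longrightarrow> i < length z \<longrightarrow> send2 b a l m2 s2 (take (Suc i) z) ! i = send2 b a l m2 s2 z ! i) \<and>
     (\<forall>a s1. a < nA \<longrightarrow> bin_of b a s1 < L)"

text \<open>What a block announces about its successor, packed in base \<open>L\<close>: the part
  \<open>a\<close> of the successor's message and the bin of the successor's states. The last block
  announces 0.\<close>

definition next_w :: "nat \<Rightarrow> nat \<Rightarrow> ('s1 list, 's2 list, 'x1 list, 'x2 list, 'z list, 'y list) block_scheme list \<Rightarrow> (nat \<times> 'r) list \<Rightarrow> 's1 list \<Rightarrow> nat" where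
  "next_w n L bs ms s1 = (case bs of [] \<Rightarrow> 0 | b # _ \<Rightarrow> (case ms of [] \<Rightarrow> 0 | (a, _) # _ \<Rightarrow> a * L + bin_of b a (take n s1)))"

fun t_send1 :: "nat \<Rightarrow> nat \<Rightarrow> ('s1 list, 's2 list, 'x1 list, 'x2 list, 'z list, 'y list) block_scheme list \<Rightarrow> (nat \<times> nat) list \<Rightarrow> 's1 list \<Rightarrow> 'x1 list" where
  "t_send1 n L (b # bs) ((a, m1) # ms) s1 = send1 b a (next_w n L bs ms (drop n s1)) m1 (take n s1) @ t_send1 n L bs ms (drop n s1)"
| "t_send1 n L _ _ s1 = []"

text \<open>The crib of a block is decoded when the block is over and used from the next block on.
  This is what makes the recursion causal across blocks.\<close>

fun t_send2 :: "nat \<Rightarrow> nat \<Rightarrow> ('s1 list, 's2 list, 'x1 list, 'x2 list, 'z list, 'y list) block_scheme list \<Rightarrow> nat \<Rightarrow> nat \<Rightarrow> nat list \<Rightarrow> 's2 list \<Rightarrow> 'z list \<Rightarrow> 'x2 list" where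
  "t_send2 n L [] a l ms s2 z = []"
| "t_send2 n L (b # bs) a l ms s2 z = send2 b a l (hd ms) (take n s2) (take n z) @
     (let w = read_crib b a (take n z) in t_send2 n L bs (w div L) (w mod L) (tl ms) (drop n s2) (drop n z))"

text \<open>The tail is decoded before the head, since the \<open>w\<close> of the head is
  recomputed from the decoded \<open>a\<close> and the known states of its successor.\<close>

fun t_dec :: "nat \<Rightarrow> nat \<Rightarrow> ('s1 list, 's2 list, 'x1 list, 'x2 list, 'z list, 'y list) block_scheme list \<Rightarrow> 's1 list \<Rightarrow> 's2 list \<Rightarrow> 'y list \<Rightarrow> (nat \<times> nat \<times> nat) list" where
  "t_dec n L [] s1 s2 y = []"
| "t_dec n L (b # bs) s1 s2 y = (let ms = t_dec n L bs (drop n s1) (drop n s2) (drop n y) in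
     decode b (next_w n L bs ms (drop n s1)) (take n s1) (take n s2) (take n y) # ms)"

definition enc_part :: "(nat \<times> nat \<times> nat) list \<Rightarrow> (nat \<times> nat) list" where
  "enc_part ms = map (\<lambda>(a, m1, m2). (a, m1)) ms"
definition m2_part :: "(nat \<times> nat \<times> nat) list \<Rightarrow> nat list" where
  "m2_part ms = map (\<lambda>(a, m1, m2). m2) ms"

lemma length_t_send1: "\<forall>b\<in>set bs. sound n L nA b \<Longrightarrow> length ms = length bs \<Longrightarrow> length (t_send1 n L bs ms s1) = length bs * n"
proof (induction bs arbitrary: ms s1)
  case (Cons b bs)
  then obtain a m1 ms' where "ms = (a, m1) # ms'" by (cases ms) auto
  then show ?case using Cons by (simp add: sound_def)
qed (cases "ms :: (nat \<times> nat) list"; simp)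

lemma length_t_send2: "\<forall>b\<in>set bs. sound n L nA b \<Longrightarrow> length (t_send2 n L bs a l ms s2 z) = length bs * n"
  by (induction bs arbitrary: a l ms s2 z) (simp_all add: sound_def Let_def)

text \<open>The encoder of the model receives a prefix of the crib; by this lemma the analysis may
  feed it the whole sequence.\<close>

lemma t_send2_causal:
  "\<forall>b\<in>set bs. sound n L nA b \<Longrightarrow> i < length bs * n \<Longrightarrow> i < length z \<Longrightarrow>
    t_send2 n L bs a l ms s2 (take (Suc i) z) ! i = t_send2 n L bs a l ms s2 z ! i"
proof (induction bs arbitrary: a l ms s2 z i)
  case (Cons b bs)
  have s: "sound n L nA b" using Cons.prems by simp
  have len: "length (send2 b a' l' m s z) = n" for a' l' m s z using s by (simp add: sound_def)
  show ?case
  proof (cases "i < n")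
    case True
    then have t: "take n (take (Suc i) z) = take (Suc i) (take n z)"
      by (cases "n = Suc i") (simp_all add: min_def)
    have "send2 b a l (hd ms) (take n s2) (take (Suc i) (take n z)) ! i = send2 b a l (hd ms) (take n s2) (take n z) ! i"
    proof -
      have c: "i < length z' \<Longrightarrow> send2 b a l (hd ms) (take n s2) (take (Suc i) z') ! i = send2 b a l (hd ms) (take n s2) z' ! i" for z'
        using s True unfolding sound_def by blast
      show ?thesis by (rule c) (use True Cons.prems in simp)
    qed
    then show ?thesis using True by (simp add: nth_append len t)
  next
    case False
    then have t: "take n (take (Suc i) z) = take n z" "drop n (take (Suc i) z) = take (Suc (i - n)) (drop n z)"
      by (simp_all add: min_def drop_take Suc_diff_le)
    have "i - n < length bs * n" "i - n < length (drop n z)" using False Cons.prems by auto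
    then show ?thesis using False Cons.prems(1) Cons.IH[of "i - n" "drop n z"] by (simp add: nth_append len t Let_def)
  qed
qed simp

text \<open>Encoder 2 starts from the correct announcement \<open>w\<close>; this is the hypothesis
  handed on from block to block.\<close>

definition tail_err :: "nat \<Rightarrow> nat \<Rightarrow> ('s1 list, 's2 list, 'x1 list, 'x2 list, 'z list, 'y list) block_scheme list \<Rightarrow> (nat \<times> nat \<times> nat) list \<Rightarrow> 's1 list \<Rightarrow> 's2 list \<Rightarrow> ennreal" where
  "tail_err n L bs ms s1 s2 = (let x1 = t_send1 n L bs (enc_part ms) s1; w = next_w n L bs ms s1;
     x2 = t_send2 n L bs (w div L) (w mod L) (m2_part ms) s2 (map2 zf x1 s1)
     in \<integral>\<^sup>+y. (if t_dec n L bs s1 s2 y = ms then 0 else 1) \<partial>block_channel (length bs * n) x1 x2 s1 s2)"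

lemma next_w_enc_part: "next_w n L bs (enc_part ms) s1 = next_w n L bs ms s1"
  by (auto simp: next_w_def enc_part_def split: list.split)

text \<open>If the crib of the head is read correctly, the tail runs with the right announcement; if
  not, \<open>block_err\<close> is 1 already. The second claim is for the opening block: its data
  are not decoded, and Encoder 2 may hold a wrong bin \<open>l0\<close>, because the crib does not
  depend on what Encoder 2 sends.\<close>

lemma tail_err_Cons:
  assumes s: "sound n L nA b" "\<forall>b\<in>set bs. sound n L nA b" and len: "length ms = length bs"
    and l: "length s1 = n" "length s2 = n" "length s1' = length bs * n" "length s2' = length bs * n"
    and w0: "w0 div L = a" "w0 mod L = bin_of b a s1"
  shows "(let x1 = t_send1 n L (b # bs) (enc_part ((a, m1, m2) # ms)) (s1 @ s1');
       x2 = t_send2 n L (b # bs) (w0 div L) (w0 mod L) (m2_part ((a, m1, m2) # ms)) (s2 @ s2') (map2 zf x1 (s1 @ s1'))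
       in \<integral>\<^sup>+y. (if t_dec n L (b # bs) (s1 @ s1') (s2 @ s2') y = (a, m1, m2) # ms then 0 else 1) \<partial>block_channel (length (b # bs) * n) x1 x2 (s1 @ s1') (s2 @ s2')) \<le>
     block_err (map2 zf) (block_channel n) b a (next_w n L bs ms s1') m1 m2 s1 s2 + tail_err n L bs ms s1' s2'" (is ?th1)
    and "(let x1 = t_send1 n L (b # bs) (enc_part ((a, m1, m2) # ms)) (s1 @ s1');
       x2 = t_send2 n L (b # bs) a l0 (m2_part ((a, m1, m2) # ms)) (s2 @ s2') (map2 zf x1 (s1 @ s1'))
       in \<integral>\<^sup>+y. (if t_dec n L bs s1' s2' (drop n y) = ms then 0 else 1) \<partial>block_channel (length (b # bs) * n) x1 x2 (s1 @ s1') (s2 @ s2')) \<le>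
     block_err (map2 zf) (block_channel n) b a (next_w n L bs ms s1') m1 m2 s1 s2 + tail_err n L bs ms s1' s2'" (is ?th2)
proof -
  let ?w = "next_w n L bs ms s1'"
  let ?xa = "send1 b a ?w m1 s1" and ?xb = "t_send1 n L bs (enc_part ms) s1'"
  let ?za = "map2 zf ?xa s1" and ?zb = "map2 zf ?xb s1'"
  let ?x2a = "\<lambda>l. send2 b a l m2 s2 ?za"
  let ?x2b = "\<lambda>w. t_send2 n L bs (w div L) (w mod L) (m2_part ms) s2' ?zb"
  have x1: "t_send1 n L (b # bs) (enc_part ((a, m1, m2) # ms)) (s1 @ s1') = ?xa @ ?xb"
    using l by (simp add: enc_part_def next_w_enc_part[unfolded enc_part_def])
  have lx: "length ?xa = n" "length ?xb = length bs * n"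
    using s length_t_send1[OF s(2), of "enc_part ms"] len by (auto simp: sound_def enc_part_def)
  have z: "map2 zf (?xa @ ?xb) (s1 @ s1') = ?za @ ?zb" using lx l by simp
  have lz: "length ?za = n" using lx l by simp
  have x2: "t_send2 n L (b # bs) a l' (m2_part ((a, m1, m2) # ms)) (s2 @ s2') (?za @ ?zb) = ?x2a l' @ ?x2b (read_crib b a ?za)" for l'
    using l lz by (simp add: m2_part_def Let_def)
  have lx2: "length (?x2a l') = n" for l' using s by (simp add: sound_def)
  have ch: "block_channel (length (b # bs) * n) (?xa @ ?xb) (?x2a l' @ x2') (s1 @ s1') (s2 @ s2') =
    bind_pmf (block_channel n ?xa (?x2a l') s1 s2) (\<lambda>y. map_pmf (append y) (block_channel (length bs * n) ?xb x2' s1' s2'))" for l' x2'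
    using block_channel_append[OF lx(1) lx2 l(1,2), of "length bs * n"] by simp
  show ?th1
  proof (cases "read_crib b a ?za = ?w")
    case False
    then have "block_err (map2 zf) (block_channel n) b a ?w m1 m2 s1 s2 = 1" by (simp add: block_err_def)
    then have le: "1 \<le> block_err (map2 zf) (block_channel n) b a ?w m1 m2 s1 s2 + tail_err n L bs ms s1' s2'" by simp
    show ?thesis unfolding Let_def by (rule order_trans[OF nn_integral_pmf_le le]) simp
  next
    case True
    have "(\<integral>\<^sup>+y. (if t_dec n L (b # bs) (s1 @ s1') (s2 @ s2') y = (a, m1, m2) # ms then 0 else 1) \<partial>block_channel (length (b # bs) * n) (?xa @ ?xb) (?x2a (bin_of b a s1) @ ?x2b ?w) (s1 @ s1') (s2 @ s2')) \<le>
      (\<integral>\<^sup>+y. (\<integral>\<^sup>+y'. (if decode b ?w s1 s2 y = (a, m1, m2) then 0 else 1) + (if t_dec n L bs s1' s2' y' = ms then 0 else 1) \<partial>block_channel (length bs * n) ?xb (?x2b ?w) s1' s2')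
         \<partial>block_channel n ?xa (?x2a (bin_of b a s1)) s1 s2)"
      unfolding ch nn_integral_bind_pmf nn_integral_map_pmf
    proof (intro nn_integral_pmf_mono)
      fix y y' assume "y \<in> set_pmf (block_channel n ?xa (?x2a (bin_of b a s1)) s1 s2)"
      then have "length y = n" by (rule length_independent_list)
      then show "(if t_dec n L (b # bs) (s1 @ s1') (s2 @ s2') (y @ y') = (a, m1, m2) # ms then 0 else 1) \<le>
         (if decode b ?w s1 s2 y = (a, m1, m2) then 0 else 1) + (if t_dec n L bs s1' s2' y' = ms then 0 else 1 :: ennreal)"
        using l by (auto simp: Let_def)
    qed
    also have "\<dots> = block_err (map2 zf) (block_channel n) b a ?w m1 m2 s1 s2 + tail_err n L bs ms s1' s2'"
      unfolding block_err_def tail_err_def Let_def using True by (simp add: nn_integral_add)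
    finally show ?thesis unfolding Let_def x1 z w0 x2 True .
  qed
  show ?th2
  proof (cases "read_crib b a ?za = ?w")
    case False
    then have "block_err (map2 zf) (block_channel n) b a ?w m1 m2 s1 s2 = 1" by (simp add: block_err_def)
    then have le: "1 \<le> block_err (map2 zf) (block_channel n) b a ?w m1 m2 s1 s2 + tail_err n L bs ms s1' s2'" by simp
    show ?thesis unfolding Let_def by (rule order_trans[OF nn_integral_pmf_le le]) simp
  next
    case True
    have "(\<integral>\<^sup>+y. (if t_dec n L bs s1' s2' (drop n y) = ms then 0 else 1) \<partial>block_channel (length (b # bs) * n) (?xa @ ?xb) (?x2a l0 @ ?x2b ?w) (s1 @ s1') (s2 @ s2')) \<le>
      (\<integral>\<^sup>+y. (\<integral>\<^sup>+y'. (if t_dec n L bs s1' s2' y' = ms then 0 else 1) \<partial>block_channel (length bs * n) ?xb (?x2b ?w) s1' s2')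
         \<partial>block_channel n ?xa (?x2a l0) s1 s2)"
      unfolding ch nn_integral_bind_pmf nn_integral_map_pmf
    proof (intro nn_integral_pmf_mono)
      fix y y' assume "y \<in> set_pmf (block_channel n ?xa (?x2a l0) s1 s2)"
      then have "length y = n" by (rule length_independent_list)
      then show "(if t_dec n L bs s1' s2' (drop n (y @ y')) = ms then 0 else 1) \<le> (if t_dec n L bs s1' s2' y' = ms then 0 else 1 :: ennreal)"
        by simp
    qed
    also have "\<dots> = tail_err n L bs ms s1' s2'"
      unfolding tail_err_def Let_def by simp
    also have "\<dots> \<le> block_err (map2 zf) (block_channel n) b a ?w m1 m2 s1 s2 + tail_err n L bs ms s1' s2'" by simp
    finally show ?thesis unfolding Let_def x1 z x2 True .
  qed
qed

lemma nn_integral_states_append: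
  "(\<integral>\<^sup>+s. f s \<partial>replicate_pmf (n + m) pS) = (\<integral>\<^sup>+s. \<integral>\<^sup>+s'. f (s @ s') \<partial>replicate_pmf m pS \<partial>replicate_pmf n pS)"
  unfolding replicate_pmf_distrib by simp

lemma next_w_less:
  assumes "\<forall>b\<in>set bs. sound n L nA b" "length ms = length bs" "\<forall>t\<in>set ms. fst t < nA" "0 < L" "0 < nA"
  shows "next_w n L bs ms s1 < nA * L"
    and "next_w n L bs ms s1 mod L < L"
proof -
  show "next_w n L bs ms s1 < nA * L"
  proof (cases bs)
    case (Cons b bs')
    then obtain a r ms' where ms: "ms = (a, r) # ms'" using assms(2) by (cases ms) auto
    have "bin_of b a (take n s1) < L" "a < nA" using assms Cons ms by (auto simp: sound_def)
    then have "a * L + bin_of b a (take n s1) < (a + 1) * L" by simp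
    also have "\<dots> \<le> nA * L" using \<open>a < nA\<close> by (intro mult_right_mono) auto
    finally show ?thesis by (simp add: next_w_def Cons ms)
  qed (use assms in \<open>simp add: next_w_def\<close>)
qed (use assms in simp)

text \<open>The \<open>w\<close> of a block is a function of the states and books of later blocks,
  which are independent of its own. With those fixed, the bound \<open>e\<close>, uniform in
  \<open>w\<close>, applies, and the errors of the blocks add up.\<close>

lemma tail_err_bound:
  assumes C: "\<And>b. b \<in> set_pmf C \<Longrightarrow> sound n L nA b"
    and err: "\<And>a w m1 m2. a < nA \<Longrightarrow> w < nA * L \<Longrightarrow> m1 < M1 \<Longrightarrow> m2 < M2 \<Longrightarrow>
      mean_err n C a w m1 m2 \<le> e"
    and pos: "0 < L" "0 < nA"
    and ms: "\<forall>(a, m1, m2) \<in> set ms. a < nA \<and> m1 < M1 \<and> m2 < M2"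
  shows "(\<integral>\<^sup>+bs. \<integral>\<^sup>+s. tail_err n L bs ms (map fst s) (map snd s) \<partial>replicate_pmf (length ms * n) pS \<partial>replicate_pmf (length ms) C) \<le> of_nat (length ms) * e"
  using ms
proof (induction ms)
  case Nil
  then show ?case by (simp add: tail_err_def)
next
  case (Cons t ms)
  obtain a m1 m2 where t: "t = (a, m1, m2)" by (cases t)
  have t': "a < nA" "m1 < M1" "m2 < M2" and ms: "\<forall>t\<in>set ms. fst t < nA" using Cons.prems t by auto
  let ?k = "length ms" and ?S = "replicate_pmf n pS"
  have "(\<integral>\<^sup>+bs. \<integral>\<^sup>+s. tail_err n L bs (t # ms) (map fst s) (map snd s) \<partial>replicate_pmf (length (t # ms) * n) pS \<partial>replicate_pmf (length (t # ms)) C) =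
    (\<integral>\<^sup>+b. \<integral>\<^sup>+bs. \<integral>\<^sup>+s. \<integral>\<^sup>+s'. tail_err n L (b # bs) (t # ms) (map fst (s @ s')) (map snd (s @ s')) \<partial>replicate_pmf (?k * n) pS \<partial>?S \<partial>replicate_pmf ?k C \<partial>C)"
    by (simp add: nn_integral_states_append)
  also have "\<dots> \<le> (\<integral>\<^sup>+b. \<integral>\<^sup>+bs. \<integral>\<^sup>+s. \<integral>\<^sup>+s'. block_err (map2 zf) (block_channel n) b a (next_w n L bs ms (map fst s')) m1 m2 (map fst s) (map snd s)
      + tail_err n L bs ms (map fst s') (map snd s') \<partial>replicate_pmf (?k * n) pS \<partial>?S \<partial>replicate_pmf ?k C \<partial>C)"
  proof (intro nn_integral_pmf_mono)
    fix b bs s s' assume b: "b \<in> set_pmf C" "bs \<in> set_pmf (replicate_pmf ?k C)" "s \<in> set_pmf ?S" "s' \<in> set_pmf (replicate_pmf (?k * n) pS)"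
    have bs: "\<forall>b\<in>set bs. sound n L nA b" "length bs = ?k" using b C by (auto simp: set_replicate_pmf in_lists_conv_set)
    have ls: "length s = n" "length s' = length bs * n" using b bs by (auto simp: set_replicate_pmf)
    let ?w0 = "next_w n L (b # bs) (t # ms) (map fst s @ map fst s')"
    have "bin_of b a (map fst s) < L" using C[OF b(1)] t' by (simp add: sound_def)
    then have "?w0 div L = a" "?w0 mod L = bin_of b a (map fst s)" using ls by (simp_all add: next_w_def t)
    from tail_err_Cons(1)[OF C[OF b(1)] bs(1) bs(2)[symmetric], of "map fst s" "map snd s" "map fst s'" "map snd s'", OF _ _ _ _ this, of m1 m2]
    show "tail_err n L (b # bs) (t # ms) (map fst (s @ s')) (map snd (s @ s')) \<le>
       block_err (map2 zf) (block_channel n) b a (next_w n L bs ms (map fst s')) m1 m2 (map fst s) (map snd s) + tail_err n L bs ms (map fst s') (map snd s')"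
      using ls unfolding tail_err_def[of n L "b # bs"] Let_def t by simp
  qed
  also have "\<dots> = (\<integral>\<^sup>+b. \<integral>\<^sup>+bs. \<integral>\<^sup>+s. \<integral>\<^sup>+s'. block_err (map2 zf) (block_channel n) b a (next_w n L bs ms (map fst s')) m1 m2 (map fst s) (map snd s) \<partial>replicate_pmf (?k * n) pS \<partial>?S \<partial>replicate_pmf ?k C \<partial>C)
      + (\<integral>\<^sup>+bs. \<integral>\<^sup>+s'. tail_err n L bs ms (map fst s') (map snd s') \<partial>replicate_pmf (?k * n) pS \<partial>replicate_pmf ?k C)"
    by (simp add: nn_integral_add)
  also have "\<dots> \<le> e + of_nat ?k * e"
  proof (rule add_mono)
    have "(\<integral>\<^sup>+b. \<integral>\<^sup>+bs. \<integral>\<^sup>+s. \<integral>\<^sup>+s'. block_err (map2 zf) (block_channel n) b a (next_w n L bs ms (map fst s')) m1 m2 (map fst s) (map snd s) \<partial>replicate_pmf (?k * n) pS \<partial>?S \<partial>replicate_pmf ?k C \<partial>C)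
      = (\<integral>\<^sup>+b. \<integral>\<^sup>+bs. \<integral>\<^sup>+s'. \<integral>\<^sup>+s. block_err (map2 zf) (block_channel n) b a (next_w n L bs ms (map fst s')) m1 m2 (map fst s) (map snd s) \<partial>?S \<partial>replicate_pmf (?k * n) pS \<partial>replicate_pmf ?k C \<partial>C)"
      by (rule nn_integral_cong, rule nn_integral_cong, rule nn_integral_pmf_swap)
    also have "\<dots> = (\<integral>\<^sup>+bs. \<integral>\<^sup>+b. \<integral>\<^sup>+s'. \<integral>\<^sup>+s. block_err (map2 zf) (block_channel n) b a (next_w n L bs ms (map fst s')) m1 m2 (map fst s) (map snd s) \<partial>?S \<partial>replicate_pmf (?k * n) pS \<partial>C \<partial>replicate_pmf ?k C)"
      by (rule nn_integral_pmf_swap)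
    also have "\<dots> = (\<integral>\<^sup>+bs. \<integral>\<^sup>+s'. \<integral>\<^sup>+b. \<integral>\<^sup>+s. block_err (map2 zf) (block_channel n) b a (next_w n L bs ms (map fst s')) m1 m2 (map fst s) (map snd s) \<partial>?S \<partial>C \<partial>replicate_pmf (?k * n) pS \<partial>replicate_pmf ?k C)"
      by (rule nn_integral_cong, rule nn_integral_pmf_swap)
    also have "\<dots> \<le> e"
    proof (rule nn_integral_pmf_le, rule nn_integral_pmf_le)
      fix bs s' assume "bs \<in> set_pmf (replicate_pmf ?k C)"
      then have bs: "\<forall>b\<in>set bs. sound n L nA b" "length bs = ?k" using C by (auto simp: set_replicate_pmf in_lists_conv_set)
      show "(\<integral>\<^sup>+b. \<integral>\<^sup>+s. block_err (map2 zf) (block_channel n) b a (next_w n L bs ms (map fst s')) m1 m2 (map fst s) (map snd s) \<partial>?S \<partial>C) \<le> e"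
        by (rule err[OF t'(1) next_w_less(1)[OF bs(1) bs(2)[symmetric] ms pos] t'(2,3)])
    qed
    finally show "(\<integral>\<^sup>+b. \<integral>\<^sup>+bs. \<integral>\<^sup>+s. \<integral>\<^sup>+s'. block_err (map2 zf) (block_channel n) b a (next_w n L bs ms (map fst s')) m1 m2 (map fst s) (map snd s) \<partial>replicate_pmf (?k * n) pS \<partial>?S \<partial>replicate_pmf ?k C \<partial>C) \<le> e" .
    show "(\<integral>\<^sup>+bs. \<integral>\<^sup>+s'. tail_err n L bs ms (map fst s') (map snd s') \<partial>replicate_pmf (?k * n) pS \<partial>replicate_pmf ?k C) \<le> of_nat ?k * e"
      using Cons by simp
  qed
  also have "\<dots> = of_nat (length (t # ms)) * e" by (simp add: distrib_right)
  finally show ?case .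
qed

end

section \<open>From random block schemes to one code\<close>

context cribbing_mac
begin

text \<open>The opening block carries fixed zeros. It exists to announce the data of the block after
  it, and the decoder skips it by \<open>tl bs\<close> and \<open>drop n\<close>. The default answer
  1 belongs to every message set of nonnegative rate.\<close>

definition markov_code :: "nat \<Rightarrow> nat \<Rightarrow> nat set \<Rightarrow> nat set \<Rightarrow> (nat \<Rightarrow> (nat \<times> nat) list) \<Rightarrow> (nat \<Rightarrow> nat list) \<Rightarrow>
    ('s1 list, 's2 list, 'x1 list, 'x2 list, 'z list, 'y list) block_scheme list \<Rightarrow> ('x1, 'x2, 's1, 's2, 'z, 'y) mac_code" where
  "markov_code n L T1 T2 i1 i2 bs = \<lparr>
     enc1 = (\<lambda>m s1. t_send1 n L bs ((0, 0) # i1 m) s1),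
     enc2 = (\<lambda>i m s2 z. t_send2 n L bs 0 0 (0 # i2 m) s2 z ! i),
     dec1 = (\<lambda>y s1 s2. let ms = enc_part (t_dec n L (tl bs) (drop n s1) (drop n s2) (drop n y)) in if ms \<in> i1 ` T1 then inv_into T1 i1 ms else 1),
     dec2 = (\<lambda>y s1 s2. let ms = m2_part (t_dec n L (tl bs) (drop n s1) (drop n s2) (drop n y)) in if ms \<in> i2 ` T2 then inv_into T2 i2 ms else 1)\<rparr>"

text \<open>The injections \<open>i1\<close> and \<open>i2\<close> spread the messages over
  \<open>k\<close> of the \<open>k + 1\<close> blocks. Averaged over independent books, the error is
  at most \<open>k + 1\<close> times that of a block, so some choice of books has error at most
  \<open>\<epsilon>\<close>.\<close>

lemma block_markov_code:
  assumes C: "\<And>b. b \<in> set_pmf C \<Longrightarrow> sound n L nA b"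
    and err: "\<And>a w m1 m2. a < nA \<Longrightarrow> w < nA * L \<Longrightarrow> m1 < M1 \<Longrightarrow> m2 < M2 \<Longrightarrow>
      mean_err n C a w m1 m2 \<le> e"
    and pos: "0 < L" "0 < nA" "0 < M1" "0 < M2" and R: "0 \<le> R1" "0 \<le> R2"
    and N: "N = Suc k * n"
    and card: "card (messages N R1) \<le> (nA * M1) ^ k" "card (messages N R2) \<le> M2 ^ k"
    and e: "of_nat (Suc k) * e < ennreal \<epsilon>"
  shows "\<exists>c. is_code R1 R2 N c \<and> error_prob pS zf W R1 R2 N c \<le> \<epsilon>"
proof -
  let ?T1 = "messages N R1" and ?T2 = "messages N R2"
  have T: "finite ?T1" "finite ?T2" "?T1 \<noteq> {}" "?T2 \<noteq> {}" "1 \<in> ?T1" "1 \<in> ?T2"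
  proof -
    have "1 \<le> 2 powr (real N * R1)" "1 \<le> 2 powr (real N * R2)" using R by (auto intro!: ge_one_powr_ge_zero)
    then have "1 \<le> nat \<lfloor>2 powr (real N * R1)\<rfloor>" "1 \<le> nat \<lfloor>2 powr (real N * R2)\<rfloor>" by linarith+
    then show "finite ?T1" "finite ?T2" "?T1 \<noteq> {}" "?T2 \<noteq> {}" "1 \<in> ?T1" "1 \<in> ?T2" by (auto simp: messages_def)
  qed
  let ?A1 = "{xs. set xs \<subseteq> {..<nA} \<times> {..<M1} \<and> length xs = k}" and ?A2 = "{xs. set xs \<subseteq> {..<M2} \<and> length xs = k}"
  have c: "card ?T1 \<le> card ?A1" "card ?T2 \<le> card ?A2"
    using card by (simp_all add: card_lists_length_eq card_cartesian_product)
  have f: "finite ?A1" "finite ?A2" by (simp_all add: finite_lists_length_eq)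
  from card_le_inj[OF T(1) f(1) c(1)] obtain i1 where i1: "i1 ` ?T1 \<subseteq> ?A1" "inj_on i1 ?T1" by (elim exE conjE)
  from card_le_inj[OF T(2) f(2) c(2)] obtain i2 where i2: "i2 ` ?T2 \<subseteq> ?A2" "inj_on i2 ?T2" by (elim exE conjE)
  let ?code = "markov_code n L ?T1 ?T2 i1 i2"
  have N': "N = n + k * n" using N by simp
  have is_code: "is_code R1 R2 N (?code bs)" if "bs \<in> set_pmf (replicate_pmf (Suc k) C)" for bs
    unfolding is_code_def
  proof (intro conjI ballI allI impI)
    have bs: "\<forall>b\<in>set bs. sound n L nA b" "length bs = Suc k" using that C by (auto simp: set_replicate_pmf in_lists_conv_set simp del: replicate_pmf.simps)
    show "length (enc1 (?code bs) m s1) = N" if "m \<in> ?T1" for m and s1 :: "'s1 list"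
    proof -
      have "length (i1 m) = k" using i1 that by auto
      then show ?thesis using length_t_send1[OF bs(1), of "(0, 0) # i1 m" s1] bs N by (simp add: markov_code_def)
    qed
    show "dec1 (?code bs) y s1 s2 \<in> ?T1" "dec2 (?code bs) y s1 s2 \<in> ?T2" for y s1 s2
      using T by (auto simp: markov_code_def Let_def inv_into_into)
  qed
  have E: "ennreal (error_prob pS zf W R1 R2 N (?code bs)) \<le>
     (\<integral>\<^sup>+m1. \<integral>\<^sup>+m2. \<integral>\<^sup>+s. \<integral>\<^sup>+s'. block_err (map2 zf) (block_channel n) (hd bs) 0 (next_w n L (tl bs) (map (\<lambda>((a, m1), m2). (a, m1, m2)) (zip (i1 m1) (i2 m2))) (map fst s')) 0 0 (map fst s) (map snd s)
       + tail_err n L (tl bs) (map (\<lambda>((a, m1), m2). (a, m1, m2)) (zip (i1 m1) (i2 m2))) (map fst s') (map snd s') \<partial>replicate_pmf (k * n) pS \<partial>replicate_pmf n pS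
       \<partial>pmf_of_set ?T2 \<partial>pmf_of_set ?T1)"
    if bs: "bs \<in> set_pmf (replicate_pmf (Suc k) C)" for bs
  proof -
    obtain b bs' where bb: "bs = b # bs'" "b \<in> set_pmf C" "bs' \<in> set_pmf (replicate_pmf k C)" using bs by auto
    have snd: "sound n L nA b" "\<forall>b\<in>set bs'. sound n L nA b" "length bs' = k" using bb C by (auto simp: set_replicate_pmf in_lists_conv_set)
    have "ennreal (error_prob pS zf W R1 R2 N (?code bs)) = emeasure (measure_pmf (transmission pS zf W R1 R2 N (?code bs))) {(m, m'). m' \<noteq> m}"
      by (simp add: error_prob_def measure_pmf.emeasure_eq_measure)
    also have "\<dots> = (\<integral>\<^sup>+t. indicator {(m, m'). m' \<noteq> m} t \<partial>transmission pS zf W R1 R2 N (?code bs))" by simp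
    also have "\<dots> = (\<integral>\<^sup>+m1. \<integral>\<^sup>+m2. \<integral>\<^sup>+s. \<integral>\<^sup>+s'. (let s1 = map fst (s @ s'); s2 = map snd (s @ s'); x1 = enc1 (?code bs) m1 s1; x2 = encode2 (?code bs) N m2 s2 (map2 zf x1 s1) in
        \<integral>\<^sup>+y. indicator {(m, m'). m' \<noteq> m} ((m1, m2), (dec1 (?code bs) y s1 s2, dec2 (?code bs) y s1 s2)) \<partial>block_channel N x1 x2 s1 s2)
        \<partial>replicate_pmf (k * n) pS \<partial>replicate_pmf n pS \<partial>pmf_of_set ?T2 \<partial>pmf_of_set ?T1)"
      unfolding transmission_def Let_def by (simp only: nn_integral_bind_pmf nn_integral_return_pmf[OF zero_le] N' nn_integral_states_append)
    also have "\<dots> \<le> (\<integral>\<^sup>+m1. \<integral>\<^sup>+m2. \<integral>\<^sup>+s. \<integral>\<^sup>+s'. block_err (map2 zf) (block_channel n) (hd bs) 0 (next_w n L (tl bs) (map (\<lambda>((a, m1), m2). (a, m1, m2)) (zip (i1 m1) (i2 m2))) (map fst s')) 0 0 (map fst s) (map snd s)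
       + tail_err n L (tl bs) (map (\<lambda>((a, m1), m2). (a, m1, m2)) (zip (i1 m1) (i2 m2))) (map fst s') (map snd s') \<partial>replicate_pmf (k * n) pS \<partial>replicate_pmf n pS
       \<partial>pmf_of_set ?T2 \<partial>pmf_of_set ?T1)"
    proof (intro nn_integral_pmf_mono)
      fix m1 m2 s s'
      assume m: "m1 \<in> set_pmf (pmf_of_set ?T1)" "m2 \<in> set_pmf (pmf_of_set ?T2)" and s: "s \<in> set_pmf (replicate_pmf n pS)" "s' \<in> set_pmf (replicate_pmf (k * n) pS)"
      have m': "m1 \<in> ?T1" "m2 \<in> ?T2" using m T by auto
      have li: "length (i1 m1) = k" "length (i2 m2) = k" using i1 i2 m' by auto
      let ?ms = "map (\<lambda>((a, m1), m2). (a, m1, m2)) (zip (i1 m1) (i2 m2))"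
      have parts: "enc_part ?ms = i1 m1" "m2_part ?ms = i2 m2"
        unfolding enc_part_def m2_part_def using li by (simp_all add: o_def split_beta' map_fst_zip map_snd_zip flip: fst_def snd_def)
      have ls: "length s = n" "length s' = length bs' * n" using s snd by (auto simp: set_replicate_pmf)
      let ?s1 = "map fst (s @ s')" and ?s2 = "map snd (s @ s')"
      let ?x1 = "t_send1 n L (b # bs') (enc_part ((0, 0, 0) # ?ms)) (map fst s @ map fst s')"
      let ?x2 = "t_send2 n L (b # bs') 0 0 (m2_part ((0, 0, 0) # ?ms)) (map snd s @ map snd s') (map2 zf ?x1 (map fst s @ map fst s'))"
      have sb: "\<forall>b\<in>set bs. sound n L nA b" using snd bb by simp
      have p0: "enc_part ((0, 0, 0) # ?ms) = (0, 0) # i1 m1" "m2_part ((0, 0, 0) # ?ms) = 0 # i2 m2"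
        using parts by (simp_all add: enc_part_def m2_part_def)
      have x1: "enc1 (?code bs) m1 ?s1 = ?x1" unfolding p0 by (simp add: markov_code_def bb)
      have lx1: "length ?x1 = N"
        by (subst length_t_send1[where nA=nA]) (use snd li N in \<open>auto simp: p0\<close>)
      have lz: "length (map2 zf ?x1 (map fst s @ map fst s')) = N" using lx1 ls snd N' by simp
      have x2: "encode2 (?code bs) N m2 ?s2 (map2 zf ?x1 ?s1) = ?x2"
      proof (rule nth_equalityI)
        show "length (encode2 (?code bs) N m2 ?s2 (map2 zf ?x1 ?s1)) = length ?x2"
          by (subst length_t_send2[where nA=nA]) (use snd N in \<open>auto simp: encode2_def\<close>)
        fix i assume "i < length (encode2 (?code bs) N m2 ?s2 (map2 zf ?x1 ?s1))"
        then have i: "i < N" by (simp add: encode2_def)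
        have "encode2 (?code bs) N m2 ?s2 (map2 zf ?x1 ?s1) ! i = t_send2 n L (b # bs') 0 0 (m2_part ((0, 0, 0) # ?ms)) (map snd s @ map snd s') (take (Suc i) (map2 zf ?x1 (map fst s @ map fst s'))) ! i"
          using i unfolding p0 by (simp add: encode2_def markov_code_def bb)
        also have "\<dots> = ?x2 ! i"
          by (rule t_send2_causal[of _ n L nA]) (use snd i N lz in auto)
        finally show "encode2 (?code bs) N m2 ?s2 (map2 zf ?x1 ?s1) ! i = ?x2 ! i" .
      qed
      have "(\<integral>\<^sup>+y. indicator {(m, m'). m' \<noteq> m} ((m1, m2), (dec1 (?code bs) y ?s1 ?s2, dec2 (?code bs) y ?s1 ?s2)) \<partial>block_channel N ?x1 ?x2 ?s1 ?s2) \<le>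
        (\<integral>\<^sup>+y. (if t_dec n L bs' (map fst s') (map snd s') (drop n y) = ?ms then 0 else 1) \<partial>block_channel (length (b # bs') * n) ?x1 ?x2 (map fst s @ map fst s') (map snd s @ map snd s'))"
      proof -
        have h: "indicator {(m, m'). m' \<noteq> m} ((m1, m2), (dec1 (?code bs) y ?s1 ?s2, dec2 (?code bs) y ?s1 ?s2)) \<le>
          (if t_dec n L bs' (map fst s') (map snd s') (drop n y) = ?ms then 0 else 1 :: ennreal)" for y
          using m' ls i1 i2 by (auto simp: markov_code_def bb Let_def parts inv_into_f_f split: split_indicator)
        have Nb: "length (b # bs') * n = N" using N snd by simp
        show ?thesis unfolding Nb map_append by (rule nn_integral_mono) (rule h[unfolded map_append])
      qed
      also have "\<dots> \<le> block_err (map2 zf) (block_channel n) b 0 (next_w n L bs' ?ms (map fst s')) 0 0 (map fst s) (map snd s) + tail_err n L bs' ?ms (map fst s') (map snd s')"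
      proof -
        have "bin_of b 0 (map fst s) < L" using snd(1) pos by (simp add: sound_def)
        then show ?thesis
          using tail_err_Cons(2)[OF snd(1,2), of ?ms "map fst s" "map snd s" "map fst s'" "map snd s'" "bin_of b 0 (map fst s)" 0 0 0 0] ls li snd(3)
          unfolding Let_def by simp
      qed
      finally show "(let s1 = ?s1; s2 = ?s2; x1 = enc1 (?code bs) m1 s1; x2 = encode2 (?code bs) N m2 s2 (map2 zf x1 s1) in
        \<integral>\<^sup>+y. indicator {(m, m'). m' \<noteq> m} ((m1, m2), (dec1 (?code bs) y s1 s2, dec2 (?code bs) y s1 s2)) \<partial>block_channel N x1 x2 s1 s2) \<le>
        block_err (map2 zf) (block_channel n) (hd bs) 0 (next_w n L (tl bs) ?ms (map fst s')) 0 0 (map fst s) (map snd s) + tail_err n L (tl bs) ?ms (map fst s') (map snd s')"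
        unfolding Let_def x1 x2 by (simp only: bb list.sel)
    qed
    finally show ?thesis .
  qed
  have avg: "(\<integral>\<^sup>+bs. ennreal (error_prob pS zf W R1 R2 N (?code bs)) \<partial>replicate_pmf (Suc k) C) \<le> of_nat (Suc k) * e"
  proof -
    let ?ms = "\<lambda>m1 m2. map (\<lambda>((a, m1), m2). (a, m1, m2)) (zip (i1 m1) (i2 m2))"
    let ?f = "\<lambda>b bs m1 m2 s s'. block_err (map2 zf) (block_channel n) b 0 (next_w n L bs (?ms m1 m2) (map fst s')) 0 0 (map fst s) (map snd s)"
    let ?g = "\<lambda>bs m1 m2 s'. tail_err n L bs (?ms m1 m2) (map fst s') (map snd s')"
    let ?S = "replicate_pmf n pS" and ?S' = "replicate_pmf (k * n) pS" and ?B = "replicate_pmf k C"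
    let ?U1 = "pmf_of_set ?T1" and ?U2 = "pmf_of_set ?T2"
    have "(\<integral>\<^sup>+bs. ennreal (error_prob pS zf W R1 R2 N (?code bs)) \<partial>replicate_pmf (Suc k) C) \<le>
      (\<integral>\<^sup>+bs. \<integral>\<^sup>+m1. \<integral>\<^sup>+m2. \<integral>\<^sup>+s. \<integral>\<^sup>+s'. ?f (hd bs) (tl bs) m1 m2 s s' + ?g (tl bs) m1 m2 s' \<partial>?S' \<partial>?S \<partial>?U2 \<partial>?U1 \<partial>replicate_pmf (Suc k) C)"
      by (rule nn_integral_pmf_mono) (rule E)
    also have "\<dots> = (\<integral>\<^sup>+b. \<integral>\<^sup>+bs. \<integral>\<^sup>+m1. \<integral>\<^sup>+m2. \<integral>\<^sup>+s. \<integral>\<^sup>+s'. ?f b bs m1 m2 s s' + ?g bs m1 m2 s' \<partial>?S' \<partial>?S \<partial>?U2 \<partial>?U1 \<partial>?B \<partial>C)"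
      unfolding nn_integral_replicate_Suc by (simp only: list.sel)
    also have "\<dots> = (\<integral>\<^sup>+b. \<integral>\<^sup>+m1. \<integral>\<^sup>+m2. \<integral>\<^sup>+bs. \<integral>\<^sup>+s. \<integral>\<^sup>+s'. ?f b bs m1 m2 s s' + ?g bs m1 m2 s' \<partial>?S' \<partial>?S \<partial>?B \<partial>?U2 \<partial>?U1 \<partial>C)"
      by (rule nn_integral_cong, subst nn_integral_pmf_swap, rule nn_integral_cong, rule nn_integral_pmf_swap)
    also have "\<dots> = (\<integral>\<^sup>+m1. \<integral>\<^sup>+m2. \<integral>\<^sup>+b. \<integral>\<^sup>+bs. \<integral>\<^sup>+s. \<integral>\<^sup>+s'. ?f b bs m1 m2 s s' + ?g bs m1 m2 s' \<partial>?S' \<partial>?S \<partial>?B \<partial>C \<partial>?U2 \<partial>?U1)"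
      by (subst nn_integral_pmf_swap, rule nn_integral_cong, rule nn_integral_pmf_swap)
    also have "\<dots> \<le> of_nat (Suc k) * e"
    proof (rule nn_integral_pmf_le, rule nn_integral_pmf_le)
      fix m1 m2 assume "m1 \<in> set_pmf ?U1" "m2 \<in> set_pmf ?U2"
      then have m': "m1 \<in> ?T1" "m2 \<in> ?T2" using T by auto
      have A: "i1 m1 \<in> ?A1" "i2 m2 \<in> ?A2" using i1 i2 m' by auto
      have li: "length (i1 m1) = k" "length (i2 m2) = k" using A by auto
      have lm: "length (?ms m1 m2) = k" using li by simp
      have mm: "\<forall>(a, m1', m2') \<in> set (?ms m1 m2). a < nA \<and> m1' < M1 \<and> m2' < M2"
      proof -
        have "fst p \<in> set (i1 m1) \<and> snd p \<in> set (i2 m2)" if "p \<in> set (zip (i1 m1) (i2 m2))" for p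
          using that set_zip_leftD[of "fst p" "snd p"] set_zip_rightD[of "fst p" "snd p"] by simp
        then show ?thesis using A by fastforce
      qed
      have "(\<integral>\<^sup>+b. \<integral>\<^sup>+bs. \<integral>\<^sup>+s. \<integral>\<^sup>+s'. ?f b bs m1 m2 s s' + ?g bs m1 m2 s' \<partial>?S' \<partial>?S \<partial>?B \<partial>C) =
         (\<integral>\<^sup>+b. \<integral>\<^sup>+bs. \<integral>\<^sup>+s. \<integral>\<^sup>+s'. ?f b bs m1 m2 s s' \<partial>?S' \<partial>?S \<partial>?B \<partial>C) + (\<integral>\<^sup>+bs. \<integral>\<^sup>+s'. ?g bs m1 m2 s' \<partial>?S' \<partial>?B)"
        by (simp add: nn_integral_add)
      also have "\<dots> \<le> e + of_nat k * e"
      proof (rule add_mono)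
        have "(\<integral>\<^sup>+b. \<integral>\<^sup>+bs. \<integral>\<^sup>+s. \<integral>\<^sup>+s'. ?f b bs m1 m2 s s' \<partial>?S' \<partial>?S \<partial>?B \<partial>C) = (\<integral>\<^sup>+b. \<integral>\<^sup>+bs. \<integral>\<^sup>+s'. \<integral>\<^sup>+s. ?f b bs m1 m2 s s' \<partial>?S \<partial>?S' \<partial>?B \<partial>C)"
          by (rule nn_integral_cong, rule nn_integral_cong, rule nn_integral_pmf_swap)
        also have "\<dots> = (\<integral>\<^sup>+bs. \<integral>\<^sup>+b. \<integral>\<^sup>+s'. \<integral>\<^sup>+s. ?f b bs m1 m2 s s' \<partial>?S \<partial>?S' \<partial>C \<partial>?B)"
          by (rule nn_integral_pmf_swap)
        also have "\<dots> = (\<integral>\<^sup>+bs. \<integral>\<^sup>+s'. \<integral>\<^sup>+b. \<integral>\<^sup>+s. ?f b bs m1 m2 s s' \<partial>?S \<partial>C \<partial>?S' \<partial>?B)"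
          by (rule nn_integral_cong, rule nn_integral_pmf_swap)
        also have "\<dots> \<le> e"
        proof (rule nn_integral_pmf_le, rule nn_integral_pmf_le)
          fix bs s' assume "bs \<in> set_pmf ?B"
          then have bs: "\<forall>b\<in>set bs. sound n L nA b" "length bs = k" using C by (auto simp: set_replicate_pmf in_lists_conv_set)
          have "\<forall>t\<in>set (?ms m1 m2). fst t < nA" using mm by auto
          then show "(\<integral>\<^sup>+b. \<integral>\<^sup>+s. ?f b bs m1 m2 s s' \<partial>?S \<partial>C) \<le> e"
            using bs lm pos by (intro err next_w_less(1)) auto
        qed
        finally show "(\<integral>\<^sup>+b. \<integral>\<^sup>+bs. \<integral>\<^sup>+s. \<integral>\<^sup>+s'. ?f b bs m1 m2 s s' \<partial>?S' \<partial>?S \<partial>?B \<partial>C) \<le> e" .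
        show "(\<integral>\<^sup>+bs. \<integral>\<^sup>+s'. ?g bs m1 m2 s' \<partial>?S' \<partial>?B) \<le> of_nat k * e"
          using tail_err_bound[OF C err pos(1,2) mm] unfolding lm .
      qed
      also have "\<dots> = of_nat (Suc k) * e" by (simp add: distrib_right)
      finally show "(\<integral>\<^sup>+b. \<integral>\<^sup>+bs. \<integral>\<^sup>+s. \<integral>\<^sup>+s'. ?f b bs m1 m2 s s' + ?g bs m1 m2 s' \<partial>?S' \<partial>?S \<partial>?B \<partial>C) \<le> of_nat (Suc k) * e" .
    qed
    finally show ?thesis .
  qed
  have "\<exists>bs\<in>set_pmf (replicate_pmf (Suc k) C). error_prob pS zf W R1 R2 N (?code bs) \<le> \<epsilon>"
  proof (rule ccontr)
    assume n: "\<not> ?thesis"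
    have "ennreal \<epsilon> = (\<integral>\<^sup>+bs. ennreal \<epsilon> \<partial>replicate_pmf (Suc k) C)" by (simp del: replicate_pmf.simps)
    also have "\<dots> \<le> (\<integral>\<^sup>+bs. ennreal (error_prob pS zf W R1 R2 N (?code bs)) \<partial>replicate_pmf (Suc k) C)"
      by (rule nn_integral_pmf_mono, rule ennreal_leI) (use n in \<open>auto simp del: replicate_pmf.simps simp: not_le less_imp_le\<close>)
    also note avg
    also note e
    finally show False by simp
  qed
  then show ?thesis using is_code by blast
qed

end

section \<open>Rejection sampling and the weak law\<close>

lemma expectation_pair_finite:
  fixes f :: "'a \<Rightarrow> 'b \<Rightarrow> real"
  assumes "finite (set_pmf p)" "finite (set_pmf q)"
  shows "measure_pmf.expectation (pair_pmf p q) (\<lambda>(x, y). f x y) = measure_pmf.expectation p (\<lambda>x. measure_pmf.expectation q (f x))"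
  unfolding pair_pmf_def
  by (subst pmf_expectation_bind[of "set_pmf p"])
     (use assms in \<open>auto simp: map_pmf_def[symmetric] integral_measure_pmf_real[of "set_pmf p"] mult.commute\<close>)

text \<open>The cross terms vanish, the summands being independent and centred.\<close>

lemma second_moment_replicate:
  fixes h :: "'a \<Rightarrow> real"
  assumes fin: "finite (set_pmf p)" and mean: "measure_pmf.expectation p h = 0"
  shows "measure_pmf.expectation (replicate_pmf n p) (\<lambda>xs. (\<Sum>x\<leftarrow>xs. h x)\<^sup>2) = real n * measure_pmf.expectation p (\<lambda>x. (h x)\<^sup>2)"
proof (induction n)
  case (Suc n)
  have fr: "finite (set_pmf (replicate_pmf n p))"
    unfolding replicate_pmf_eq_independent_list by (intro finite_independent_list fin)
  note int = integrable_finite_pmf[OF fin] integrable_finite_pmf[OF fr]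
  have r: "replicate_pmf (Suc n) p = map_pmf (\<lambda>(x, xs). x # xs) (pair_pmf p (replicate_pmf n p))"
    by (simp add: pair_pmf_def map_bind_pmf map_pmf_def bind_assoc_pmf bind_return_pmf)
  have m1: "measure_pmf.expectation (replicate_pmf n p) (\<lambda>xs. (h x)\<^sup>2 + 2 * h x * (\<Sum>x\<leftarrow>xs. h x) + (\<Sum>x\<leftarrow>xs. h x)\<^sup>2) =
     (h x)\<^sup>2 + 2 * measure_pmf.expectation (replicate_pmf n p) (\<lambda>xs. \<Sum>x\<leftarrow>xs. h x) * h x + measure_pmf.expectation (replicate_pmf n p) (\<lambda>xs. (\<Sum>x\<leftarrow>xs. h x)\<^sup>2)" for x
    by (simp add: int)
  have "measure_pmf.expectation (replicate_pmf (Suc n) p) (\<lambda>xs. (\<Sum>x\<leftarrow>xs. h x)\<^sup>2) =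
    measure_pmf.expectation (pair_pmf p (replicate_pmf n p)) (\<lambda>(x, xs). (h x)\<^sup>2 + 2 * h x * (\<Sum>x\<leftarrow>xs. h x) + (\<Sum>x\<leftarrow>xs. h x)\<^sup>2)"
    unfolding r integral_map_pmf by (rule expectation_pmf_cong) (auto simp: power2_sum)
  also have "\<dots> = measure_pmf.expectation p (\<lambda>x. (h x)\<^sup>2 + 2 * measure_pmf.expectation (replicate_pmf n p) (\<lambda>xs. \<Sum>x\<leftarrow>xs. h x) * h x + measure_pmf.expectation (replicate_pmf n p) (\<lambda>xs. (\<Sum>x\<leftarrow>xs. h x)\<^sup>2))"
    unfolding expectation_pair_finite[OF fin fr] m1 ..
  also have "\<dots> = measure_pmf.expectation p (\<lambda>x. (h x)\<^sup>2) + measure_pmf.expectation (replicate_pmf n p) (\<lambda>xs. (\<Sum>x\<leftarrow>xs. h x)\<^sup>2)"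
    by (simp add: int mean)
  finally show ?case unfolding Suc by (simp add: distrib_right)
qed simp

lemma weak_law:
  fixes g :: "'a \<Rightarrow> real"
  assumes fin: "finite (set_pmf p)" and d: "0 < d" "0 < e"
  shows "\<forall>\<^sub>F n in sequentially. measure_pmf.prob (replicate_pmf n p) {xs. d * real n \<le> \<bar>(\<Sum>x\<leftarrow>xs. g x) - real n * measure_pmf.expectation p g\<bar>} \<le> e"
proof -
  let ?mu = "measure_pmf.expectation p g"
  define h where "h x = g x - ?mu" for x
  define V where "V = measure_pmf.expectation p (\<lambda>x. (h x)\<^sup>2)"
  have mean: "measure_pmf.expectation p h = 0" unfolding h_def by (simp add: integrable_finite_pmf[OF fin])
  have b: "measure_pmf.prob (replicate_pmf n p) {xs. d * real n \<le> \<bar>(\<Sum>x\<leftarrow>xs. g x) - real n * ?mu\<bar>} \<le> V / (d\<^sup>2 * real n)" if n: "0 < n" for n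
  proof -
    have fr: "finite (set_pmf (replicate_pmf n p))"
      unfolding replicate_pmf_eq_independent_list by (intro finite_independent_list fin)
    let ?B = "{xs. d * real n \<le> \<bar>(\<Sum>x\<leftarrow>xs. g x) - real n * ?mu\<bar>}"
    have sh: "(\<Sum>x\<leftarrow>xs. h x) = (\<Sum>x\<leftarrow>xs. g x) - real n * ?mu" if "length xs = n" for xs
      using that unfolding h_def by (induction xs arbitrary: n) (auto simp: algebra_simps)
    have "measure_pmf.prob (replicate_pmf n p) ?B = measure_pmf.expectation (replicate_pmf n p) (indicator ?B)" by simp
    also have "\<dots> \<le> measure_pmf.expectation (replicate_pmf n p) (\<lambda>xs. (\<Sum>x\<leftarrow>xs. h x)\<^sup>2 / (d * real n)\<^sup>2)"
    proof (intro integral_mono_AE integrable_finite_pmf[OF fr], unfold AE_measure_pmf_iff, intro ballI)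
      fix xs assume "xs \<in> set_pmf (replicate_pmf n p)"
      then have l: "length xs = n" by (simp add: set_replicate_pmf)
      show "indicator ?B xs \<le> (\<Sum>x\<leftarrow>xs. h x)\<^sup>2 / (d * real n)\<^sup>2"
      proof (cases "xs \<in> ?B")
        case True
        then have "(d * real n)\<^sup>2 \<le> (\<Sum>x\<leftarrow>xs. h x)\<^sup>2" unfolding sh[OF l]
          using d by (subst abs_le_square_iff[symmetric]) (auto simp: abs_mult)
        then show ?thesis using True d n by (simp add: field_simps)
      qed simp
    qed
    also have "\<dots> = real n * V / (d * real n)\<^sup>2"
      unfolding integral_divide_zero second_moment_replicate[OF fin mean] V_def ..
    also have "\<dots> = V / (d\<^sup>2 * real n)" using n by (simp add: power2_eq_square)
    finally show ?thesis .
  qed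
  have "(\<lambda>n. V / (d\<^sup>2 * real n)) \<longlonglongrightarrow> 0" using d by real_asymp
  then have "\<forall>\<^sub>F n in sequentially. V / (d\<^sup>2 * real n) < e" using d by (intro order_tendstoD) auto
  then show ?thesis using eventually_gt_at_top[of 0] by eventually_elim (use b in \<open>meson less_imp_le order_trans\<close>)
qed

text \<open>Markov's inequality for the likelihood ratio, whose mean under \<open>P\<close> is at
  most 1. Confusions within a bin and confusions by the decoder both reduce to it.\<close>

lemma ratio_bound:
  fixes P R :: "'a pmf"
  assumes "0 < \<theta>"
  shows "emeasure (measure_pmf P) {y. \<theta> * pmf P y \<le> pmf R y} \<le> ennreal (1 / \<theta>)"
proof -
  have "emeasure (measure_pmf P) {y. \<theta> * pmf P y \<le> pmf R y} = (\<integral>\<^sup>+y. indicator {y. \<theta> * pmf P y \<le> pmf R y} y \<partial>P)" by simp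
  also have "\<dots> = (\<integral>\<^sup>+y. ennreal (pmf P y) * indicator {y. \<theta> * pmf P y \<le> pmf R y} y \<partial>count_space UNIV)"
    by (rule nn_integral_measure_pmf)
  also have "\<dots> \<le> (\<integral>\<^sup>+y. ennreal (1 / \<theta>) * ennreal (pmf R y) \<partial>count_space UNIV)"
    using assms by (intro nn_integral_mono) (auto split: split_indicator simp: ennreal_mult'[symmetric] ennreal_mult''[symmetric] field_simps intro!: ennreal_leI)
  also have "\<dots> = ennreal (1 / \<theta>)" by (subst nn_integral_cmult) (auto simp: nn_integral_pmf)
  finally show ?thesis .
qed

text \<open>For an \<open>s\<close> that violates the ratio bound \<open>M\<close> on more than half
  of the mass of \<open>p s\<close>, acceptance will be switched off altogether. For every other
  \<open>s\<close> the acceptance probability has a lower bound uniform in \<open>s\<close>.\<close>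

definition acc_good :: "('s \<Rightarrow> 'u pmf) \<Rightarrow> 'u pmf \<Rightarrow> real \<Rightarrow> 's \<Rightarrow> bool" where
  "acc_good p q M s \<longleftrightarrow> 1 / 2 \<le> measure_pmf.prob (p s) {u. pmf (p s) u \<le> M * pmf q u}"

text \<open>One step of rejection sampling, on a candidate \<open>(u, t, l)\<close> with \<open>u\<close> drawn from \<open>q\<close> and \<open>t < D\<close> uniform:
  an accepted \<open>u\<close> has law close to \<open>p s\<close>. The label \<open>l\<close> plays no part in it; it is the random bin of \<open>u\<close>.\<close>

definition acc :: "('s \<Rightarrow> 'u pmf) \<Rightarrow> 'u pmf \<Rightarrow> real \<Rightarrow> nat \<Rightarrow> 's \<Rightarrow> 'u \<times> nat \<times> nat \<Rightarrow> bool" where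
  "acc p q M D s = (\<lambda>(u, t, l). acc_good p q M s \<and> pmf (p s) u \<le> M * pmf q u \<and> real (Suc t) \<le> real D * (pmf (p s) u / (M * pmf q u)))"

definition cand :: "'u pmf \<Rightarrow> nat \<Rightarrow> nat \<Rightarrow> ('u \<times> nat \<times> nat) pmf" where
  "cand q D L = pair_pmf q (pair_pmf (pmf_of_set {..<D}) (pmf_of_set {..<L}))"

lemma acc_pos: "acc p q M D s (u, t, l) \<Longrightarrow> pmf (p s) u \<noteq> 0"
  by (auto simp: acc_def)

text \<open>The coin of rejection sampling is a uniform \<open>t\<close> on a grid of
  \<open>D\<close> points, so an acceptance probability \<open>x\<close> is rounded down to a
  multiple of \<open>1 / D\<close>.\<close>

lemma nn_integral_threshold:
  assumes "0 < D" "0 \<le> x" "x \<le> 1"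
  shows "(\<integral>\<^sup>+t. (if real (Suc t) \<le> real D * x then 1 else (0 :: ennreal)) \<partial>pmf_of_set {..<D}) = ennreal (real_of_int \<lfloor>real D * x\<rfloor> / real D)"
proof -
  let ?k = "nat \<lfloor>real D * x\<rfloor>"
  have k: "?k \<le> D"
  proof -
    have "real D * x \<le> real D * 1" using assms by (intro mult_left_mono) auto
    then have "\<lfloor>real D * x\<rfloor> \<le> int D" by linarith
    then show ?thesis by simp
  qed
  have iff: "real (Suc t) \<le> real D * x \<longleftrightarrow> t < ?k" for t
  proof
    assume "real (Suc t) \<le> real D * x" then show "t < ?k" using le_nat_floor[of "Suc t"] by (simp only: Suc_le_eq)
  next
    assume "t < ?k"
    then have "real (Suc t) \<le> real ?k" by simp
    also have "\<dots> \<le> real D * x" using assms by (intro of_nat_floor) simp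
    finally show "real (Suc t) \<le> real D * x" .
  qed
  have "(\<integral>\<^sup>+t. (if real (Suc t) \<le> real D * x then 1 else (0 :: ennreal)) \<partial>pmf_of_set {..<D}) = (\<Sum>t<D. if t < ?k then 1 else 0) / ennreal (real D)"
    unfolding iff using assms by (subst nn_integral_pmf_of_set) (auto simp: ennreal_of_nat_eq_real_of_nat lessThan_empty_iff)
  also have "(\<Sum>t<D. if t < ?k then 1 else 0 :: ennreal) = of_nat ?k"
  proof -
    have "{..<D} \<inter> {t. t < ?k} = {..<?k}" using k by auto
    then show ?thesis by (simp add: sum.If_cases)
  qed
  also have "of_nat ?k / ennreal (real D) = ennreal (real ?k / real D)"
    using assms by (simp add: divide_ennreal ennreal_of_nat_eq_real_of_nat)
  also have "real ?k = real_of_int \<lfloor>real D * x\<rfloor>" using assms by simp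
  finally show ?thesis .
qed

lemma acc_integral:
  fixes F :: "'u \<Rightarrow> ennreal"
  assumes D: "0 < D" "0 < M" and g: "acc_good p q M s"
  shows "(\<integral>\<^sup>+c. (if acc p q M D s c then F (fst c) else 0) \<partial>cand q D L) =
    (\<integral>\<^sup>+u. F u * (if pmf (p s) u \<le> M * pmf q u then ennreal (real_of_int \<lfloor>real D * (pmf (p s) u / (M * pmf q u))\<rfloor> / real D) else 0) \<partial>q)"
proof -
  have "(\<integral>\<^sup>+t. \<integral>\<^sup>+l. (if acc p q M D s (u, t, l) then F u else 0) \<partial>pmf_of_set {..<L} \<partial>pmf_of_set {..<D}) =
    F u * (if pmf (p s) u \<le> M * pmf q u then ennreal (real_of_int \<lfloor>real D * (pmf (p s) u / (M * pmf q u))\<rfloor> / real D) else 0)" for u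
  proof (cases "pmf (p s) u \<le> M * pmf q u")
    case True
    let ?x = "pmf (p s) u / (M * pmf q u)"
    have x: "0 \<le> ?x" "?x \<le> 1"
      using True D by (auto simp: divide_le_eq_1 mult_nonneg_nonneg not_less zero_less_mult_iff)
    have "(\<integral>\<^sup>+t. \<integral>\<^sup>+l. (if acc p q M D s (u, t, l) then F u else 0) \<partial>pmf_of_set {..<L} \<partial>pmf_of_set {..<D}) =
      (\<integral>\<^sup>+t. F u * (if real (Suc t) \<le> real D * ?x then 1 else (0 :: ennreal)) \<partial>pmf_of_set {..<D})"
      using True g by (intro nn_integral_cong) (simp add: acc_def del: of_nat_Suc)
    also have "\<dots> = F u * (\<integral>\<^sup>+t. (if real (Suc t) \<le> real D * ?x then 1 else (0 :: ennreal)) \<partial>pmf_of_set {..<D})"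
      by (rule nn_integral_cmult) simp
    finally show ?thesis using True unfolding nn_integral_threshold[OF D(1) x] by simp
  qed (simp add: acc_def)
  then show ?thesis unfolding cand_def nn_integral_pair_pmf' fst_conv by (simp only:)
qed

text \<open>Without rounding, a candidate is accepted with probability at least
  \<open>1 / (2 * M)\<close>, as half of the mass is covered. Rounding loses at most
  \<open>1 / D\<close>, and \<open>D\<close> is so large that half of this probability
  remains.\<close>

lemma acc_prob_ge:
  assumes D: "4 * M \<le> real D" "0 < M" and g: "acc_good p q M s"
  shows "ennreal (1 / (4 * M)) \<le> emeasure (measure_pmf (cand q D L)) {c. acc p q M D s c}"
proof -
  have D0: "0 < D" using D by (cases "D = 0") auto
  let ?G = "{u. pmf (p s) u \<le> M * pmf q u}"
  let ?h = "\<lambda>u. if pmf (p s) u \<le> M * pmf q u then ennreal (real_of_int \<lfloor>real D * (pmf (p s) u / (M * pmf q u))\<rfloor> / real D) else 0"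
  have "emeasure (measure_pmf (cand q D L)) {c. acc p q M D s c} = (\<integral>\<^sup>+c. indicator {c. acc p q M D s c} c \<partial>cand q D L)" by simp
  also have "\<dots> = (\<integral>\<^sup>+c. (if acc p q M D s c then 1 else (0 :: ennreal)) \<partial>cand q D L)"
    by (intro nn_integral_cong) (auto split: split_indicator)
  also have "\<dots> = (\<integral>\<^sup>+u. ?h u \<partial>q)"
    using acc_integral[OF D0 D(2) g, where F = "\<lambda>_. 1" and L = L] by simp
  finally have e: "emeasure (measure_pmf (cand q D L)) {c. acc p q M D s c} = (\<integral>\<^sup>+u. ?h u \<partial>q)" .
  have "ennreal (1 / (2 * M)) \<le> ennreal (1 / M) * emeasure (measure_pmf (p s)) ?G"
  proof -
    have "1 / (2 * M) \<le> 1 / M * measure_pmf.prob (p s) ?G" using g D(2) by (simp add: acc_good_def field_simps)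
    then show ?thesis using D(2) by (simp add: measure_pmf.emeasure_eq_measure ennreal_mult'[symmetric] ennreal_leI)
  qed
  also have "\<dots> = (\<integral>\<^sup>+u. ennreal (1 / M) * (ennreal (pmf (p s) u) * indicator ?G u) \<partial>count_space UNIV)"
    by (subst nn_integral_cmult) (auto simp: nn_integral_measure_pmf[symmetric])
  also have "\<dots> \<le> (\<integral>\<^sup>+u. ennreal (pmf q u) * (?h u + ennreal (1 / real D)) \<partial>count_space UNIV)"
  proof (rule nn_integral_mono)
    fix u
    show "ennreal (1 / M) * (ennreal (pmf (p s) u) * indicator ?G u) \<le> ennreal (pmf q u) * (?h u + ennreal (1 / real D))"
    proof (cases "u \<in> ?G \<and> pmf q u \<noteq> 0")
      case True
      then have q: "0 < pmf q u" by (simp add: pmf_pos)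
      let ?x = "pmf (p s) u / (M * pmf q u)"
      have fl: "0 \<le> real_of_int \<lfloor>real D * ?x\<rfloor>" using D by simp
      have "real D * ?x \<le> real_of_int \<lfloor>real D * ?x\<rfloor> + 1" by linarith
      then have "?x \<le> real_of_int \<lfloor>real D * ?x\<rfloor> / real D + 1 / real D"
        using D0 by (simp add: field_simps)
      then have "pmf q u * ?x \<le> pmf q u * (real_of_int \<lfloor>real D * ?x\<rfloor> / real D + 1 / real D)"
        by (intro mult_left_mono) auto
      moreover have "pmf q u * ?x = 1 / M * pmf (p s) u" using q by simp
      ultimately show ?thesis using True fl D(2) D0
        by (simp add: ennreal_plus[symmetric] ennreal_mult'[symmetric] ennreal_leI del: ennreal_plus)
    next
      case False
      then have "u \<notin> ?G \<or> pmf (p s) u = 0" by auto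
      then show ?thesis by auto
    qed
  qed
  also have "\<dots> = (\<integral>\<^sup>+u. ?h u + ennreal (1 / real D) \<partial>q)" by (rule nn_integral_measure_pmf[symmetric])
  also have "\<dots> = (\<integral>\<^sup>+u. ?h u \<partial>q) + ennreal (1 / real D)" by (simp add: nn_integral_add)
  also have "\<dots> \<le> (\<integral>\<^sup>+u. ?h u \<partial>q) + ennreal (1 / (4 * M))"
    using D by (intro add_left_mono ennreal_leI) (auto intro!: divide_left_mono)
  finally have "ennreal (1 / (4 * M)) + ennreal (1 / (4 * M)) \<le> (\<integral>\<^sup>+u. ?h u \<partial>q) + ennreal (1 / (4 * M))"
    using D(2) by (simp add: ennreal_plus[symmetric] del: ennreal_plus)
  then have "ennreal (1 / (4 * M)) + ennreal (1 / (4 * M)) \<le> ennreal (1 / (4 * M)) + (\<integral>\<^sup>+u. ?h u \<partial>q)"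
    by (simp only: add.commute)
  then show ?thesis unfolding e ennreal_add_left_cancel_le by simp
qed

text \<open>Rounding down only helps here: the accepted part is at most \<open>1 / M\<close> times
  \<open>p s\<close>. Division by the acceptance probability, at least \<open>1 / (4 * M)\<close>,
  gives the constant 4.\<close>

lemma acc_dom:
  fixes F :: "'u \<Rightarrow> ennreal"
  assumes D: "4 * M \<le> real D" "0 < M"
  shows "(\<integral>\<^sup>+c. (if acc p q M D s c then F (fst c) else 0) \<partial>cand q D L) \<le>
     emeasure (measure_pmf (cand q D L)) {c. acc p q M D s c} * (4 * (\<integral>\<^sup>+u. F u \<partial>p s))"
proof (cases "acc_good p q M s")
  case False
  then have "acc p q M D s c = False" for c by (auto simp: acc_def)
  then show ?thesis by simp
next
  case True
  have D0: "0 < D" using D by (cases "D = 0") auto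
  have "(\<integral>\<^sup>+c. (if acc p q M D s c then F (fst c) else 0) \<partial>cand q D L) =
    (\<integral>\<^sup>+u. F u * (if pmf (p s) u \<le> M * pmf q u then ennreal (real_of_int \<lfloor>real D * (pmf (p s) u / (M * pmf q u))\<rfloor> / real D) else 0) \<partial>q)"
    by (rule acc_integral[OF D0 D(2) True])
  also have "\<dots> = (\<integral>\<^sup>+u. ennreal (pmf q u) * (F u * (if pmf (p s) u \<le> M * pmf q u then ennreal (real_of_int \<lfloor>real D * (pmf (p s) u / (M * pmf q u))\<rfloor> / real D) else 0)) \<partial>count_space UNIV)"
    by (rule nn_integral_measure_pmf)
  also have "\<dots> \<le> (\<integral>\<^sup>+u. ennreal (1 / M) * (ennreal (pmf (p s) u) * F u) \<partial>count_space UNIV)"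
  proof (rule nn_integral_mono)
    fix u
    let ?x = "pmf (p s) u / (M * pmf q u)"
    show "ennreal (pmf q u) * (F u * (if pmf (p s) u \<le> M * pmf q u then ennreal (real_of_int \<lfloor>real D * ?x\<rfloor> / real D) else 0)) \<le> ennreal (1 / M) * (ennreal (pmf (p s) u) * F u)"
    proof (cases "pmf (p s) u \<le> M * pmf q u \<and> pmf q u \<noteq> 0")
      case c: True
      have "real_of_int \<lfloor>real D * ?x\<rfloor> \<le> real D * ?x" by linarith
      then have "real_of_int \<lfloor>real D * ?x\<rfloor> / real D \<le> ?x" using D0 by (simp add: field_simps)
      then have "pmf q u * (real_of_int \<lfloor>real D * ?x\<rfloor> / real D) \<le> pmf q u * ?x" by (intro mult_left_mono) auto
      also have "\<dots> = 1 / M * pmf (p s) u" using c by simp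
      finally have "ennreal (pmf q u) * ennreal (real_of_int \<lfloor>real D * ?x\<rfloor> / real D) \<le> ennreal (1 / M) * ennreal (pmf (p s) u)"
        using D by (simp add: ennreal_mult'[symmetric] ennreal_leI)
      then have "F u * (ennreal (pmf q u) * ennreal (real_of_int \<lfloor>real D * ?x\<rfloor> / real D)) \<le> F u * (ennreal (1 / M) * ennreal (pmf (p s) u))"
        by (rule mult_left_mono) simp
      then show ?thesis using c by (simp add: mult_ac)
    qed auto
  qed
  also have "\<dots> = ennreal (1 / M) * (\<integral>\<^sup>+u. F u \<partial>p s)"
    by (simp add: nn_integral_cmult nn_integral_measure_pmf)
  also have "ennreal (1 / M) = 4 * ennreal (1 / (4 * M))"
    using D(2) by (simp add: ennreal_numeral[symmetric] ennreal_mult'[symmetric] del: ennreal_numeral)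
  also have "4 * ennreal (1 / (4 * M)) * (\<integral>\<^sup>+u. F u \<partial>p s) \<le> 4 * emeasure (measure_pmf (cand q D L)) {c. acc p q M D s c} * (\<integral>\<^sup>+u. F u \<partial>p s)"
    by (intro mult_right_mono mult_left_mono acc_prob_ge[OF D True]) auto
  finally show ?thesis by (simp add: mult_ac)
qed

text \<open>If \<open>acc_good\<close> holds, \<open>K\<close> attempts fail with probability at
  most \<open>(1 - 1 / (4 * M)) ^ K\<close>. If it does not, the exceptional set has probability
  above one half, and twice that exceeds 1.\<close>

lemma acc_fail:
  assumes D: "4 * M \<le> real D" "0 < M"
  shows "emeasure (measure_pmf (cand q D L)) {c. \<not> acc p q M D s c} ^ K \<le>
    2 * emeasure (measure_pmf (p s)) {u. M * pmf q u < pmf (p s) u} + ennreal (exp (- real K / (4 * M)))"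
proof -
  let ?N = "measure_pmf.prob (cand q D L) {c. \<not> acc p q M D s c}"
  show ?thesis
  proof (cases "acc_good p q M s")
    case True
    have "?N = 1 - measure_pmf.prob (cand q D L) {c. acc p q M D s c}"
      using measure_pmf.prob_compl[of "{c. acc p q M D s c}" "cand q D L"] by (simp add: Collect_neg_eq Compl_eq_Diff_UNIV)
    also have "\<dots> \<le> 1 - 1 / (4 * M)"
      using acc_prob_ge[OF D True, of L] D(2) by (simp add: measure_pmf.emeasure_eq_measure)
    also have "\<dots> \<le> exp (- (1 / (4 * M)))" using exp_ge_add_one_self[of "- (1 / (4 * M))"] by simp
    finally have "?N ^ K \<le> exp (- (1 / (4 * M))) ^ K" by (intro power_mono) auto
    also have "\<dots> = exp (- real K / (4 * M))" by (simp add: exp_of_nat_mult[symmetric])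
    finally have "ennreal (?N ^ K) \<le> ennreal (exp (- real K / (4 * M)))" by (rule ennreal_leI)
    then show ?thesis
      by (simp add: measure_pmf.emeasure_eq_measure ennreal_power add_increasing)
  next
    case False
    have "1 - measure_pmf.prob (p s) {u. pmf (p s) u \<le> M * pmf q u} = measure_pmf.prob (p s) {u. M * pmf q u < pmf (p s) u}"
      using measure_pmf.prob_compl[of "{u. pmf (p s) u \<le> M * pmf q u}" "p s"]
      by (simp add: Compl_eq_Diff_UNIV[symmetric] Collect_neg_eq[symmetric] not_le)
    then have "1 \<le> 2 * measure_pmf.prob (p s) {u. M * pmf q u < pmf (p s) u}" using False by (simp add: acc_good_def)
    then have "1 \<le> ennreal (2 * measure_pmf.prob (p s) {u. M * pmf q u < pmf (p s) u})" by simp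
    also have "\<dots> = 2 * emeasure (measure_pmf (p s)) {u. M * pmf q u < pmf (p s) u}"
      by (simp add: measure_pmf.emeasure_eq_measure ennreal_mult')
    finally have "1 \<le> 2 * emeasure (measure_pmf (p s)) {u. M * pmf q u < pmf (p s) u}" .
    moreover have "emeasure (measure_pmf (cand q D L)) {c. \<not> acc p q M D s c} ^ K \<le> 1"
      by (intro power_le_one measure_pmf.emeasure_le_1) simp
    ultimately show ?thesis by (meson add_increasing2 order_trans zero_le)
  qed
qed

text \<open>With equal laws and \<open>M = 1\<close> every \<open>t < D\<close> passes the
  threshold. This serves the degenerate case, where no rate is available to announce a choice among
  candidates.\<close>

lemma acc_certain:
  assumes D: "0 < D" and pq: "p s = q"
  shows "emeasure (measure_pmf (cand q D L)) {c. \<not> acc p q 1 D s c} = 0"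
proof -
  have g: "acc_good p q 1 s" by (simp add: acc_good_def pq)
  have "acc p q 1 D s c" if "c \<in> set_pmf (cand q D L)" for c
  proof -
    obtain u t l where c: "c = (u, t, l)" by (cases c)
    have "t < D" "pmf q u \<noteq> 0" using that D by (auto simp: c cand_def set_pmf_of_set set_pmf_iff lessThan_empty_iff)
    then show ?thesis using g by (simp add: c acc_def pq)
  qed
  then have "measure_pmf (cand q D L) {c. \<not> acc p q 1 D s c} = measure_pmf (cand q D L) {}"
    by (intro emeasure_eq_AE) (auto simp: AE_measure_pmf_iff)
  then show ?thesis by simp
qed

section \<open>Test channels and vanishing error\<close>

definition pair_kernel :: "'a pmf \<Rightarrow> ('a \<Rightarrow> 'b pmf) \<Rightarrow> ('a \<times> 'b) pmf" where
  "pair_kernel p k = bind_pmf p (\<lambda>x. map_pmf (Pair x) (k x))"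

text \<open>Merges an outer and an inner average into one over pairs. Iterated, it turns the nested
  averages of a random code into an average over sequences drawn from a single-letter law. The
  hypothesis on \<open>k'\<close> is confined to lists of length \<open>n\<close>, where
  \<open>nth\<close> is meaningful.\<close>

lemma nn_integral_pair_kernel_list:
  fixes F :: "'a list \<Rightarrow> 'b list \<Rightarrow> ennreal"
  assumes "\<And>xs i. length xs = n \<Longrightarrow> i < n \<Longrightarrow> k' xs i = k (xs ! i)"
  shows "(\<integral>\<^sup>+xs. \<integral>\<^sup>+ys. F xs ys \<partial>independent_list_pmf n (k' xs) \<partial>independent_list_pmf n (\<lambda>_. p)) =
    (\<integral>\<^sup>+ws. F (map fst ws) (map snd ws) \<partial>independent_list_pmf n (\<lambda>_. pair_kernel p k))"
proof -
  have "(\<integral>\<^sup>+ws. F (map fst ws) (map snd ws) \<partial>independent_list_pmf n (\<lambda>_. pair_kernel p k)) =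
    (\<integral>\<^sup>+xs. \<integral>\<^sup>+ys. F (map fst (map2 Pair xs ys)) (map snd (map2 Pair xs ys)) \<partial>independent_list_pmf n (\<lambda>i. k (xs ! i)) \<partial>independent_list_pmf n (\<lambda>_. p))"
    unfolding pair_kernel_def independent_list_pmf_bind_map2[symmetric] nn_integral_bind_pmf nn_integral_map_pmf ..
  also have "\<dots> = (\<integral>\<^sup>+xs. \<integral>\<^sup>+ys. F xs ys \<partial>independent_list_pmf n (k' xs) \<partial>independent_list_pmf n (\<lambda>_. p))"
  proof (rule nn_integral_pmf_cong)
    fix xs assume "xs \<in> set_pmf (independent_list_pmf n (\<lambda>_. p))"
    then have l: "length xs = n" by (rule length_independent_list)
    have e: "independent_list_pmf n (k' xs) = independent_list_pmf n (\<lambda>i. k (xs ! i))"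
      by (rule independent_list_pmf_cong) (rule assms[OF l])
    show "(\<integral>\<^sup>+ys. F (map fst (map2 Pair xs ys)) (map snd (map2 Pair xs ys)) \<partial>independent_list_pmf n (\<lambda>i. k (xs ! i))) =
      (\<integral>\<^sup>+ys. F xs ys \<partial>independent_list_pmf n (k' xs))"
      unfolding e by (rule nn_integral_pmf_cong) (simp add: l length_independent_list)
  qed
  finally show ?thesis ..
qed

text \<open>A rival \<open>v'\<close> is independent of the output, whose law is the mixture of the
  laws \<open>k v\<close>. For fixed \<open>v'\<close> what remains is the probability, under the
  mixture, that the likelihood of \<open>v'\<close> exceeds that of the mixture by the factor
  \<open>1 / \<tau>\<close>.\<close>

lemma rival_bound:
  fixes p :: "'v pmf" and k :: "'v \<Rightarrow> 'y pmf"
  assumes "0 < \<tau>" "\<And>v y. G v y \<Longrightarrow> pmf (bind_pmf p k) y \<le> \<tau> * pmf (k v) y"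
  shows "(\<integral>\<^sup>+v. \<integral>\<^sup>+y. \<integral>\<^sup>+v'. (if G v' y then 1 else 0) \<partial>p \<partial>k v \<partial>p) \<le> ennreal \<tau>"
proof -
  have "(\<integral>\<^sup>+v. \<integral>\<^sup>+y. \<integral>\<^sup>+v'. (if G v' y then 1 else 0) \<partial>p \<partial>k v \<partial>p) = (\<integral>\<^sup>+y. \<integral>\<^sup>+v'. (if G v' y then 1 else 0) \<partial>p \<partial>bind_pmf p k)"
    by (rule nn_integral_bind_pmf[symmetric])
  also have "\<dots> = (\<integral>\<^sup>+v'. \<integral>\<^sup>+y. (if G v' y then 1 else 0) \<partial>bind_pmf p k \<partial>p)" by (rule nn_integral_pmf_swap)
  also have "\<dots> \<le> (\<integral>\<^sup>+v'. ennreal \<tau> \<partial>p)"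
  proof (rule nn_integral_pmf_mono)
    fix v'
    have "(\<integral>\<^sup>+y. (if G v' y then 1 else 0) \<partial>bind_pmf p k) \<le> (\<integral>\<^sup>+y. indicator {y. 1 / \<tau> * pmf (bind_pmf p k) y \<le> pmf (k v') y} y \<partial>bind_pmf p k)"
      using assms by (intro nn_integral_mono) (auto split: split_indicator simp: field_simps)
    also have "\<dots> \<le> ennreal \<tau>" using ratio_bound[of "1 / \<tau>" "bind_pmf p k" "k v'"] assms(1) by simp
    finally show "(\<integral>\<^sup>+y. (if G v' y then 1 else 0) \<partial>bind_pmf p k) \<le> ennreal \<tau>" .
  qed
  finally show ?thesis by simp
qed

text \<open>One-sided typicality: the logarithm of the product ratio is a sum of independent
  letters, and the weak law keeps it below its mean plus \<open>d\<close> per letter.\<close>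

lemma typical:
  fixes Q :: "'w pmf"
  assumes fin: "finite (set_pmf Q)" and pos: "\<And>w. w \<in> set_pmf Q \<Longrightarrow> 0 < a w" "\<And>w. w \<in> set_pmf Q \<Longrightarrow> 0 < b w" and d: "0 < d" "0 < e"
  shows "\<forall>\<^sub>F n in sequentially. measure_pmf.prob (replicate_pmf n Q)
     {ws. 2 powr (real n * (measure_pmf.expectation Q (\<lambda>w. log 2 (a w / b w)) + d)) * (\<Prod>w\<leftarrow>ws. b w) < (\<Prod>w\<leftarrow>ws. a w)} \<le> e"
proof -
  let ?g = "\<lambda>w. log 2 (a w / b w)"
  let ?mu = "measure_pmf.expectation Q ?g"
  have P: "(\<Prod>w\<leftarrow>ws. a w) > 0 \<and> (\<Prod>w\<leftarrow>ws. b w) > 0 \<and> log 2 ((\<Prod>w\<leftarrow>ws. a w) / (\<Prod>w\<leftarrow>ws. b w)) = (\<Sum>w\<leftarrow>ws. ?g w)" if "set ws \<subseteq> set_pmf Q" for ws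
    using that
  proof (induction ws)
    case (Cons w ws)
    then have h: "0 < (\<Prod>w\<leftarrow>ws. a w)" "0 < (\<Prod>w\<leftarrow>ws. b w)" "log 2 ((\<Prod>w\<leftarrow>ws. a w) / (\<Prod>w\<leftarrow>ws. b w)) = (\<Sum>w\<leftarrow>ws. ?g w)"
      "0 < a w" "0 < b w" by (auto intro: pos)
    have "(\<Prod>w\<leftarrow>w # ws. a w) / (\<Prod>w\<leftarrow>w # ws. b w) = (a w / b w) * ((\<Prod>w\<leftarrow>ws. a w) / (\<Prod>w\<leftarrow>ws. b w))" by simp
    then have "log 2 ((\<Prod>w\<leftarrow>w # ws. a w) / (\<Prod>w\<leftarrow>w # ws. b w)) = ?g w + log 2 ((\<Prod>w\<leftarrow>ws. a w) / (\<Prod>w\<leftarrow>ws. b w))"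
      using h by (simp only: log_mult_pos divide_pos_pos)
    then show ?case using h by simp
  qed simp
  have sub: "measure_pmf.prob (replicate_pmf n Q) {ws. 2 powr (real n * (?mu + d)) * (\<Prod>w\<leftarrow>ws. b w) < (\<Prod>w\<leftarrow>ws. a w)} \<le>
    measure_pmf.prob (replicate_pmf n Q) {ws. d * real n \<le> \<bar>(\<Sum>w\<leftarrow>ws. ?g w) - real n * ?mu\<bar>}" for n
  proof (rule measure_pmf.finite_measure_mono_AE)
    show "AE ws in replicate_pmf n Q. ws \<in> {ws. 2 powr (real n * (?mu + d)) * (\<Prod>w\<leftarrow>ws. b w) < (\<Prod>w\<leftarrow>ws. a w)} \<longrightarrow>
       ws \<in> {ws. d * real n \<le> \<bar>(\<Sum>w\<leftarrow>ws. ?g w) - real n * ?mu\<bar>}"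
      unfolding AE_measure_pmf_iff mem_Collect_eq
    proof (intro ballI impI)
      fix ws assume ws: "ws \<in> set_pmf (replicate_pmf n Q)" and lt: "2 powr (real n * (?mu + d)) * (\<Prod>w\<leftarrow>ws. b w) < (\<Prod>w\<leftarrow>ws. a w)"
      have "set ws \<subseteq> set_pmf Q" using ws by (auto simp: set_replicate_pmf)
      note P = P[OF this]
      have "2 powr (real n * (?mu + d)) < (\<Prod>w\<leftarrow>ws. a w) / (\<Prod>w\<leftarrow>ws. b w)" using P lt by (simp add: field_simps)
      then have "real n * (?mu + d) < (\<Sum>w\<leftarrow>ws. ?g w)" using P by (simp add: less_log_iff[symmetric] del: powr_less_cancel_iff)
      then show "d * real n \<le> \<bar>(\<Sum>w\<leftarrow>ws. ?g w) - real n * ?mu\<bar>" by (simp add: algebra_simps)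
    qed
  qed auto
  show ?thesis
    using weak_law[OF fin d, of ?g] by eventually_elim (use sub in \<open>rule order_trans\<close>)
qed

lemma pmf_independent_list_map:
  assumes "length ws = n" "\<And>i. i < n \<Longrightarrow> k i = \<kappa> (ws ! i)"
  shows "pmf (independent_list_pmf n k) (map g ws) = (\<Prod>w\<leftarrow>ws. pmf (\<kappa> w) (g w))"
  using assms by (subst pmf_independent_list) (auto simp: prod.list_conv_set_nth atLeast0LessThan intro!: prod.cong)

lemma nn_integral_ind: "(\<integral>\<^sup>+x. (if P x then 1 else 0) \<partial>measure_pmf p) = emeasure (measure_pmf p) {x. P x}"
proof -
  have "(\<integral>\<^sup>+x. (if P x then 1 else 0) \<partial>measure_pmf p) = (\<integral>\<^sup>+x. indicator {x. P x} x \<partial>measure_pmf p)"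
    by (intro nn_integral_cong) (auto split: split_indicator)
  then show ?thesis by simp
qed

text \<open>\<open>qU\<close> generates the codebook of \<open>U\<close>, and Encoder 2 tests candidates against \<open>post s2\<close>.\<close>

locale test_channel = cribbing_mac pS zf W
  for pS :: "('s1::finite \<times> 's2::finite) pmf" and zf :: "'x1::finite \<Rightarrow> 's1 \<Rightarrow> 'z::finite"
    and W :: "'x1 \<Rightarrow> 'x2::finite \<Rightarrow> 's1 \<Rightarrow> 's2 \<Rightarrow> 'y::finite pmf" +
  fixes pU :: "'s1 \<Rightarrow> 'u pmf" and pZ :: "'s1 \<Rightarrow> 'u \<Rightarrow> 'z pmf" and p1 :: "'v1 pmf" and p2 :: "'v2 pmf"
    and f1 :: "'v1 \<Rightarrow> 'z \<Rightarrow> 'u \<Rightarrow> 's1 \<Rightarrow> 'x1" and f2 :: "'v2 \<Rightarrow> 'z \<Rightarrow> 'u \<Rightarrow> 's2 \<Rightarrow> 'x2"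
    and qU :: "'u pmf" and post :: "'s2 \<Rightarrow> 'u pmf"
  assumes finite_laws: "\<And>s1. finite (set_pmf (pU s1))" "finite (set_pmf p1)" "finite (set_pmf p2)"
    and dominated: "\<And>s1 s2 u. (s1, s2) \<in> set_pmf pS \<Longrightarrow> u \<in> set_pmf (pU s1) \<Longrightarrow> u \<in> set_pmf qU \<and> u \<in> set_pmf (post s2)"
    and crib_consistent: "\<And>s1 u z v1. u \<in> set_pmf (pU s1) \<Longrightarrow> z \<in> set_pmf (pZ s1 u) \<Longrightarrow> v1 \<in> set_pmf p1 \<Longrightarrow> zf (f1 v1 z u s1) s1 = z"
begin

definition ch :: "'s1 \<times> 's2 \<Rightarrow> 'u \<Rightarrow> 'z \<Rightarrow> 'v1 \<Rightarrow> 'v2 \<Rightarrow> 'y pmf" where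
  "ch s u z v1 v2 = W (f1 v1 z u (fst s)) (f2 v2 z u (snd s)) (fst s) (snd s)"

text \<open>Nested to the left with one \<open>pair_kernel\<close> per drawn variable, so that
  \<open>nn_integral_pair_kernel_list\<close> can be applied level by level.\<close>

definition Q :: "(((((('s1 \<times> 's2) \<times> 'u) \<times> 'z) \<times> 'v1) \<times> 'v2) \<times> 'y) pmf" where
  "Q = pair_kernel (pair_kernel (pair_kernel (pair_kernel (pair_kernel pS (\<lambda>s. pU (fst s))) (\<lambda>(s, u). pZ (fst s) u)) (\<lambda>_. p1)) (\<lambda>_. p2))
     (\<lambda>((((s, u), z), v1), v2). ch s u z v1 v2)"

text \<open>\<open>out1\<close> to \<open>out4\<close> are the laws of the output for an observer
  who lacks \<open>v1\<close>, lacks \<open>v2\<close>, lacks both, or knows nothing but the states.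
  They are the denominators of the four information densities.\<close>

definition out1 :: "'s1 \<times> 's2 \<Rightarrow> 'u \<Rightarrow> 'z \<Rightarrow> 'v2 \<Rightarrow> 'y pmf" where
  "out1 s u z v2 = bind_pmf p1 (\<lambda>v1. ch s u z v1 v2)"
definition out2 :: "'s1 \<times> 's2 \<Rightarrow> 'u \<Rightarrow> 'z \<Rightarrow> 'v1 \<Rightarrow> 'y pmf" where
  "out2 s u z v1 = bind_pmf p2 (\<lambda>v2. ch s u z v1 v2)"
definition out3 :: "'s1 \<times> 's2 \<Rightarrow> 'u \<Rightarrow> 'z \<Rightarrow> 'y pmf" where
  "out3 s u z = bind_pmf p1 (\<lambda>v1. out2 s u z v1)"
definition out4 :: "'s1 \<times> 's2 \<Rightarrow> 'y pmf" where
  "out4 s = bind_pmf (pU (fst s)) (\<lambda>u. bind_pmf (pZ (fst s) u) (\<lambda>z. out3 s u z))"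

abbreviation "gS \<equiv> (\<lambda>(((((s :: 's1 \<times> 's2, u :: 'u), z :: 'z), v1 :: 'v1), v2 :: 'v2), y :: 'y). s)"
abbreviation "gU \<equiv> (\<lambda>(((((s :: 's1 \<times> 's2, u :: 'u), z :: 'z), v1 :: 'v1), v2 :: 'v2), y :: 'y). u)"
abbreviation "gZ \<equiv> (\<lambda>(((((s :: 's1 \<times> 's2, u :: 'u), z :: 'z), v1 :: 'v1), v2 :: 'v2), y :: 'y). z)"
abbreviation "gV1 \<equiv> (\<lambda>(((((s :: 's1 \<times> 's2, u :: 'u), z :: 'z), v1 :: 'v1), v2 :: 'v2), y :: 'y). v1)"
abbreviation "gV2 \<equiv> (\<lambda>(((((s :: 's1 \<times> 's2, u :: 'u), z :: 'z), v1 :: 'v1), v2 :: 'v2), y :: 'y). v2)"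
abbreviation "gY \<equiv> (\<lambda>(((((s :: 's1 \<times> 's2, u :: 'u), z :: 'z), v1 :: 'v1), v2 :: 'v2), y :: 'y). y)"

definition "lU w = pmf (pU (fst (gS w))) (gU w)"
definition "lR w = pmf qU (gU w)" for w :: "(((((('s1 \<times> 's2) \<times> 'u) \<times> 'z) \<times> 'v1) \<times> 'v2) \<times> 'y)"
definition "lP w = pmf (post (snd (gS w))) (gU w)"
definition "lZ w = pmf (pZ (fst (gS w)) (gU w)) (gZ w)"
definition "lW w = pmf (ch (gS w) (gU w) (gZ w) (gV1 w) (gV2 w)) (gY w)"
definition "l1 w = pmf (out1 (gS w) (gU w) (gZ w) (gV2 w)) (gY w)"
definition "l2 w = pmf (out2 (gS w) (gU w) (gZ w) (gV1 w)) (gY w)"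
definition "l3 w = pmf (out3 (gS w) (gU w) (gZ w)) (gY w)"
definition "l4 w = pmf (out4 (gS w)) (gY w)"

definition atyp :: "nat \<Rightarrow> real \<Rightarrow> ((((((('s1 \<times> 's2) \<times> 'u) \<times> 'z) \<times> 'v1) \<times> 'v2) \<times> 'y) \<Rightarrow> real) \<Rightarrow> ((((((('s1 \<times> 's2) \<times> 'u) \<times> 'z) \<times> 'v1) \<times> 'v2) \<times> 'y) \<Rightarrow> real) \<Rightarrow> ennreal" where
  "atyp n c a b = emeasure (measure_pmf (replicate_pmf n Q)) {ws. c * (\<Prod>w\<leftarrow>ws. b w) < (\<Prod>w\<leftarrow>ws. a w)}"

definition "pUn n s1 = independent_list_pmf n (\<lambda>i. pU (s1 ! i))"
definition "pZn n s1 u = independent_list_pmf n (\<lambda>i. pZ (s1 ! i) (u ! i))"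
definition "qUn n = independent_list_pmf n (\<lambda>_. qU)"
definition "postn n s2 = independent_list_pmf n (\<lambda>i. post (s2 ! i))"
definition "qZn n = independent_list_pmf n (\<lambda>_. pmf_of_set (UNIV :: 'z set))"
definition "p1n n = independent_list_pmf n (\<lambda>_. p1)"
definition "p2n n = independent_list_pmf n (\<lambda>_. p2)"
definition "f1n n v1 z u s1 = map (\<lambda>i. f1 (v1 ! i) (z ! i) (u ! i) (s1 ! i)) [0..<n]"
definition "f2n n v2 z u s2 = map (\<lambda>i. f2 (v2 ! i) (z ! i) (u ! i) (s2 ! i)) [0..<n]"
abbreviation "chn n s1 s2 u z v1 v2 \<equiv> block_channel n (f1n n v1 z u s1) (f2n n v2 z u s2) s1 s2"
definition "out1n n s1 s2 u z v2 = bind_pmf (p1n n) (\<lambda>v1. chn n s1 s2 u z v1 v2)"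
definition "out2n n s1 s2 u z v1 = bind_pmf (p2n n) (\<lambda>v2. chn n s1 s2 u z v1 v2)"
definition "out3n n s1 s2 u z = bind_pmf (p1n n) (\<lambda>v1. out2n n s1 s2 u z v1)"
definition "out4n n s1 s2 = bind_pmf (pUn n s1) (\<lambda>u. bind_pmf (pZn n s1 u) (\<lambda>z. out3n n s1 s2 u z))"

lemma chn_alt: "chn n s1 s2 u z v1 v2 = independent_list_pmf n (\<lambda>i. ch (s1 ! i, s2 ! i) (u ! i) (z ! i) (v1 ! i) (v2 ! i))"
  by (rule independent_list_pmf_cong) (simp add: f1n_def f2n_def ch_def)

lemma out1n_alt: "out1n n s1 s2 u z v2 = independent_list_pmf n (\<lambda>i. out1 (s1 ! i, s2 ! i) (u ! i) (z ! i) (v2 ! i))"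
  unfolding out1n_def out1_def p1n_def chn_alt by (rule independent_list_pmf_bind)
lemma out2n_alt: "out2n n s1 s2 u z v1 = independent_list_pmf n (\<lambda>i. out2 (s1 ! i, s2 ! i) (u ! i) (z ! i) (v1 ! i))"
  unfolding out2n_def out2_def p2n_def chn_alt by (rule independent_list_pmf_bind)
lemma out3n_alt: "out3n n s1 s2 u z = independent_list_pmf n (\<lambda>i. out3 (s1 ! i, s2 ! i) (u ! i) (z ! i))"
  unfolding out3n_def out3_def p1n_def out2n_alt by (rule independent_list_pmf_bind)
lemma out4n_alt: "out4n n s1 s2 = independent_list_pmf n (\<lambda>i. out4 (s1 ! i, s2 ! i))"
  unfolding out4n_def out4_def pUn_def pZn_def out3n_alt fst_conv
  by (simp only: independent_list_pmf_bind[where k = "\<lambda>i z. out3 (s1 ! i, s2 ! i) (u ! i) z" for u]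
      independent_list_pmf_bind[where k = "\<lambda>i u. bind_pmf (pZ (s1 ! i) u) (\<lambda>z. out3 (s1 ! i, s2 ! i) u z)"])

lemma joint_integral:
  fixes F :: "_ \<Rightarrow> _ \<Rightarrow> _ \<Rightarrow> _ \<Rightarrow> _ \<Rightarrow> _ \<Rightarrow> ennreal"
  shows "(\<integral>\<^sup>+s. \<integral>\<^sup>+u. \<integral>\<^sup>+z. \<integral>\<^sup>+v1. \<integral>\<^sup>+v2. \<integral>\<^sup>+y. F s u z v1 v2 y \<partial>chn n (map fst s) (map snd s) u z v1 v2 \<partial>p2n n \<partial>p1n n \<partial>pZn n (map fst s) u \<partial>pUn n (map fst s) \<partial>replicate_pmf n pS) =
    (\<integral>\<^sup>+ws. F (map gS ws) (map gU ws) (map gZ ws) (map gV1 ws) (map gV2 ws) (map gY ws) \<partial>replicate_pmf n Q)"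
  unfolding replicate_pmf_eq_independent_list pUn_def pZn_def p1n_def p2n_def chn_alt Q_def
  apply (subst nn_integral_pair_kernel_list[where k = "\<lambda>s. pU (fst s)"], simp)
  apply (subst nn_integral_pair_kernel_list[where k = "\<lambda>(s, u). pZ (fst s) u"], simp add: split_beta)
  apply (subst nn_integral_pair_kernel_list[where k = "\<lambda>_. p1"], simp)
  apply (subst nn_integral_pair_kernel_list[where k = "\<lambda>_. p2"], simp)
  apply (subst nn_integral_pair_kernel_list[where k = "\<lambda>((((s, u), z), v1), v2). ch s u z v1 v2"], simp add: split_beta)
  apply (simp add: comp_def split_beta')
  done

end

context test_channel
begin

lemma pmf_joint:
  assumes "length ws = n"
  shows "pmf (pUn n (map fst (map gS ws))) (map gU ws) = (\<Prod>w\<leftarrow>ws. lU w)"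
    and "pmf (qUn n) (map gU ws) = (\<Prod>w\<leftarrow>ws. lR w)"
    and "pmf (postn n (map snd (map gS ws))) (map gU ws) = (\<Prod>w\<leftarrow>ws. lP w)"
    and "pmf (pZn n (map fst (map gS ws)) (map gU ws)) (map gZ ws) = (\<Prod>w\<leftarrow>ws. lZ w)"
    and "pmf (qZn n) (map gZ ws) = (\<Prod>w\<leftarrow>ws. 1 / real CARD('z))"
    and "pmf (chn n (map fst (map gS ws)) (map snd (map gS ws)) (map gU ws) (map gZ ws) (map gV1 ws) (map gV2 ws)) (map gY ws) = (\<Prod>w\<leftarrow>ws. lW w)"
    and "pmf (out1n n (map fst (map gS ws)) (map snd (map gS ws)) (map gU ws) (map gZ ws) (map gV2 ws)) (map gY ws) = (\<Prod>w\<leftarrow>ws. l1 w)"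
    and "pmf (out2n n (map fst (map gS ws)) (map snd (map gS ws)) (map gU ws) (map gZ ws) (map gV1 ws)) (map gY ws) = (\<Prod>w\<leftarrow>ws. l2 w)"
    and "pmf (out3n n (map fst (map gS ws)) (map snd (map gS ws)) (map gU ws) (map gZ ws)) (map gY ws) = (\<Prod>w\<leftarrow>ws. l3 w)"
    and "pmf (out4n n (map fst (map gS ws)) (map snd (map gS ws))) (map gY ws) = (\<Prod>w\<leftarrow>ws. l4 w)"
  unfolding lU_def lR_def lP_def lZ_def lW_def l1_def l2_def l3_def l4_def
    pUn_def qUn_def postn_def pZn_def qZn_def chn_alt out1n_alt out2n_alt out3n_alt out4n_alt
  apply (subst pmf_independent_list_map[OF assms, where \<kappa> = "\<lambda>w. pU (fst (gS w))"]; simp add: assms)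
  apply (subst pmf_independent_list_map[OF assms, where \<kappa> = "\<lambda>_. qU"]; simp)
  apply (subst pmf_independent_list_map[OF assms, where \<kappa> = "\<lambda>w. post (snd (gS w))"]; simp add: assms)
  apply (subst pmf_independent_list_map[OF assms, where \<kappa> = "\<lambda>w. pZ (fst (gS w)) (gU w)"]; simp add: assms)
  apply (subst pmf_independent_list_map[OF assms, where \<kappa> = "\<lambda>_. pmf_of_set UNIV"]; simp)
  apply (rule pmf_independent_list_map[OF assms]; simp add: assms)+
  done

lemma atyp_joint:
  "(\<integral>\<^sup>+s. \<integral>\<^sup>+u. (if MU * pmf (qUn n) u < pmf (pUn n (map fst s)) u then 1 else 0) \<partial>pUn n (map fst s) \<partial>replicate_pmf n pS) = atyp n MU lU lR" (is ?U)
  "(\<integral>\<^sup>+s. \<integral>\<^sup>+u. (if \<tau> * pmf (postn n (map snd s)) u < pmf (qUn n) u then 1 else 0) \<partial>pUn n (map fst s) \<partial>replicate_pmf n pS) = atyp n \<tau> lR lP" (is ?P)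
  "(\<integral>\<^sup>+s. \<integral>\<^sup>+u. \<integral>\<^sup>+z. (if MZ * pmf (qZn n) z < pmf (pZn n (map fst s) u) z then 1 else 0) \<partial>pZn n (map fst s) u \<partial>pUn n (map fst s) \<partial>replicate_pmf n pS) = atyp n MZ lZ (\<lambda>_. 1 / real CARD('z))" (is ?Z)
  "(\<integral>\<^sup>+s. \<integral>\<^sup>+u. \<integral>\<^sup>+z. \<integral>\<^sup>+v1. \<integral>\<^sup>+v2. \<integral>\<^sup>+y. (if \<tau> * pmf (chn n (map fst s) (map snd s) u z v1 v2) y < pmf (out1n n (map fst s) (map snd s) u z v2) y then 1 else 0)
     \<partial>chn n (map fst s) (map snd s) u z v1 v2 \<partial>p2n n \<partial>p1n n \<partial>pZn n (map fst s) u \<partial>pUn n (map fst s) \<partial>replicate_pmf n pS) = atyp n \<tau> l1 lW" (is ?O1)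
  "(\<integral>\<^sup>+s. \<integral>\<^sup>+u. \<integral>\<^sup>+z. \<integral>\<^sup>+v1. \<integral>\<^sup>+v2. \<integral>\<^sup>+y. (if \<tau> * pmf (chn n (map fst s) (map snd s) u z v1 v2) y < pmf (out2n n (map fst s) (map snd s) u z v1) y then 1 else 0)
     \<partial>chn n (map fst s) (map snd s) u z v1 v2 \<partial>p2n n \<partial>p1n n \<partial>pZn n (map fst s) u \<partial>pUn n (map fst s) \<partial>replicate_pmf n pS) = atyp n \<tau> l2 lW" (is ?O2)
  "(\<integral>\<^sup>+s. \<integral>\<^sup>+u. \<integral>\<^sup>+z. \<integral>\<^sup>+v1. \<integral>\<^sup>+v2. \<integral>\<^sup>+y. (if \<tau> * pmf (chn n (map fst s) (map snd s) u z v1 v2) y < pmf (out3n n (map fst s) (map snd s) u z) y then 1 else 0)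
     \<partial>chn n (map fst s) (map snd s) u z v1 v2 \<partial>p2n n \<partial>p1n n \<partial>pZn n (map fst s) u \<partial>pUn n (map fst s) \<partial>replicate_pmf n pS) = atyp n \<tau> l3 lW" (is ?O3)
  "(\<integral>\<^sup>+s. \<integral>\<^sup>+u. \<integral>\<^sup>+z. \<integral>\<^sup>+v1. \<integral>\<^sup>+v2. \<integral>\<^sup>+y. (if \<tau> * pmf (chn n (map fst s) (map snd s) u z v1 v2) y < pmf (out4n n (map fst s) (map snd s)) y then 1 else 0)
     \<partial>chn n (map fst s) (map snd s) u z v1 v2 \<partial>p2n n \<partial>p1n n \<partial>pZn n (map fst s) u \<partial>pUn n (map fst s) \<partial>replicate_pmf n pS) = atyp n \<tau> l4 lW" (is ?O4)
proof -
  note j = joint_integral[where n = n, unfolded nn_integral_pmf_const]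
  have c: "(\<integral>\<^sup>+ws. (if A ws then 1 else 0) \<partial>replicate_pmf n Q) = atyp n \<tau> a b"
    if "\<And>ws. length ws = n \<Longrightarrow> A ws \<longleftrightarrow> \<tau> * (\<Prod>w\<leftarrow>ws. b w) < (\<Prod>w\<leftarrow>ws. a w)" for A \<tau> a b
    unfolding atyp_def nn_integral_ind[symmetric]
    by (rule nn_integral_pmf_cong) (simp add: set_replicate_pmf that)
  show ?U using joint_integral[where n = n and F = "\<lambda>s u z v1 v2 y. if MU * pmf (qUn n) u < pmf (pUn n (map fst s)) u then 1 else 0"]
    unfolding nn_integral_pmf_const by (rule trans) (rule c, simp only: pmf_joint)
  show ?P using joint_integral[where n = n and F = "\<lambda>s u z v1 v2 y. if \<tau> * pmf (postn n (map snd s)) u < pmf (qUn n) u then 1 else 0"]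
    unfolding nn_integral_pmf_const by (rule trans) (rule c, simp only: pmf_joint)
  show ?Z using joint_integral[where n = n and F = "\<lambda>s u z v1 v2 y. if MZ * pmf (qZn n) z < pmf (pZn n (map fst s) u) z then 1 else 0"]
    unfolding nn_integral_pmf_const by (rule trans) (rule c, simp only: pmf_joint)
  show ?O1 ?O2 ?O3 ?O4
    by (subst joint_integral, rule c, simp only: pmf_joint)+
qed

end

context test_channel
begin

text \<open>The terms of \<open>oneshot_bound\<close> for product laws, averaged over the states,
  with \<open>C = 4\<close>. \<open>xU\<close> is the part of the failure to cover by
  \<open>u\<close> that is due to the limited number \<open>K\<close> of attempts.\<close>

definition total_err where
  "total_err n MU MZ \<tau>1 \<tau>2 \<tau>3 \<tau>4 \<tau>5 xU K Kz L nA M1 M2 =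
     (2 * atyp n MU lU lR + xU) + 4 * (2 * atyp n MZ lZ (\<lambda>_. 1 / real CARD('z)) + ennreal (exp (- real Kz / (4 * MZ))))
     + 4 * atyp n \<tau>5 lR lP + of_nat (2 * (K - 1)) * ennreal (\<tau>5 / real L) + of_nat (nA * L - 1) * (of_nat Kz * ennreal ((1 / real CARD('z)) ^ n))
     + 4 * (4 * (atyp n \<tau>1 l1 lW + atyp n \<tau>2 l2 lW + atyp n \<tau>3 l3 lW + atyp n \<tau>4 l4 lW))
     + of_nat (M1 - 1) * ennreal \<tau>1 + of_nat (M2 - 1) * ennreal \<tau>2 + of_nat (M1 - 1) * (of_nat (M2 - 1) * ennreal \<tau>3)
     + of_nat (nA - 1) * (of_nat M1 * (of_nat M2 * (4 * (4 * (4 * (4 * ennreal \<tau>4))))))"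

text \<open>The one-shot bound is applied to each state sequence; averaging over the states
  afterwards turns its tests into the atypicality probabilities \<open>atyp\<close>.\<close>

lemma block_schemes:
  assumes pos: "0 < MU" "0 < MZ" "0 < \<tau>1" "0 < \<tau>2" "0 < \<tau>3" "0 < \<tau>4" "0 < \<tau>5" "0 < K" "0 < L"
    and xU: "xU = ennreal (exp (- real K / (4 * MU))) \<or> MU = 1 \<and> (\<forall>s\<in>set_pmf pS. pU (fst s) = qU)"
  shows "\<exists>C. (\<forall>b\<in>set_pmf C. sound n L nA b) \<and> (\<forall>a w m1 m2. a < nA \<longrightarrow> w < nA * L \<longrightarrow> m1 < M1 \<longrightarrow> m2 < M2 \<longrightarrow>
    mean_err n C a w m1 m2 \<le>
     total_err n MU MZ \<tau>1 \<tau>2 \<tau>3 \<tau>4 \<tau>5 xU K Kz L nA M1 M2)"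
proof -
  define D where "D = nat \<lceil>4 * MU\<rceil>"
  define D' where "D' = nat \<lceil>4 * MZ\<rceil>"
  have D: "4 * MU \<le> real D" "4 * MZ \<le> real D'" unfolding D_def D'_def by linarith+
  have D0: "0 < D" "0 < D'" using D pos by (auto intro!: Nat.gr0I)
  \<comment> \<open>The guard on the length makes the consistency of crib and input hold for lists
    of every length.\<close>
  define AU where "AU s1 c \<longleftrightarrow> length s1 = n \<and> acc (pUn n) (qUn n) MU D s1 c" for s1 c
  define AZ where "AZ s1 u d \<longleftrightarrow> acc (\<lambda>(s1, u). pZn n s1 u) (qZn n) MZ D' (s1, u) d" for s1 u d
  define G2 where "G2 s2 u \<longleftrightarrow> pmf (qUn n) u \<le> \<tau>5 * pmf (postn n s2) u" for s2 u
  define Gd where "Gd s1 s2 u z v1 v2 y \<longleftrightarrow> pmf (out1n n s1 s2 u z v2) y \<le> \<tau>1 * pmf (chn n s1 s2 u z v1 v2) y \<and>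
     pmf (out2n n s1 s2 u z v1) y \<le> \<tau>2 * pmf (chn n s1 s2 u z v1 v2) y \<and>
     pmf (out3n n s1 s2 u z) y \<le> \<tau>3 * pmf (chn n s1 s2 u z v1 v2) y \<and>
     pmf (out4n n s1 s2) y \<le> \<tau>4 * pmf (chn n s1 s2 u z v1 v2) y" for s1 s2 u z v1 v2 y
  let ?qU = "cand (qUn n) D L" and ?qZ = "cand (qZn n) D' 1" and ?lab = "\<lambda>c. snd (snd c)"
  interpret cs: coding_scheme ?qU ?lab fst AU ?qZ fst AZ "p1n n" "p2n n" "f1n n" "f2n n" "map2 zf" "block_channel n" G2 Gd K Kz nA "nA * L" M1 M2 "pUn n" "pZn n" 4
  proof
    fix s1 and F :: "'u list \<Rightarrow> ennreal"
    show "(\<integral>\<^sup>+c. (if AU s1 c then F (fst c) else 0) \<partial>?qU) \<le> emeasure (measure_pmf ?qU) {c. AU s1 c} * (4 * (\<integral>\<^sup>+u. F u \<partial>pUn n s1))"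
    proof (cases "length s1 = n")
      case True then show ?thesis using acc_dom[OF D(1) pos(1), where p = "pUn n" and q = "qUn n" and s = s1 and F = F and L = L] by (simp add: AU_def)
    qed (simp add: AU_def)
  next
    fix s1 u and F :: "'z list \<Rightarrow> ennreal"
    show "(\<integral>\<^sup>+d. (if AZ s1 u d then F (fst d) else 0) \<partial>?qZ) \<le> emeasure (measure_pmf ?qZ) {d. AZ s1 u d} * (4 * (\<integral>\<^sup>+z. F z \<partial>pZn n s1 u))"
      using acc_dom[OF D(2) pos(2), where p = "\<lambda>(s1, u). pZn n s1 u" and q = "qZn n" and s = "(s1, u)" and F = F and L = 1] by (simp add: AZ_def)
  next
    fix s1 and c :: "'u list \<times> nat \<times> nat" and d :: "'z list \<times> nat \<times> nat" and v1
    assume h: "AU s1 c" "AZ s1 (fst c) d" and v1: "v1 \<in> set_pmf (p1n n)"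
    have s1: "length s1 = n" using h(1) by (simp add: AU_def)
    have u: "fst c \<in> set_pmf (pUn n s1)" using h(1) acc_pos[of "pUn n" "qUn n" MU D s1 "fst c" "fst (snd c)" "snd (snd c)"]
      by (simp add: AU_def set_pmf_iff)
    have z: "fst d \<in> set_pmf (pZn n s1 (fst c))"
      using h(2) acc_pos[of "\<lambda>(s1, u). pZn n s1 u" "qZn n" MZ D' "(s1, fst c)" "fst d" "fst (snd d)" "snd (snd d)"]
      by (simp add: AZ_def set_pmf_iff)
    show "map2 zf (f1n n v1 (fst d) (fst c) s1) s1 = fst d"
    proof (rule nth_equalityI)
      show "length (map2 zf (f1n n v1 (fst d) (fst c) s1) s1) = length (fst d)"
        using z s1 by (simp add: f1n_def pZn_def length_independent_list)
      fix i assume "i < length (map2 zf (f1n n v1 (fst d) (fst c) s1) s1)"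
      then have i: "i < n" using s1 by (simp add: f1n_def)
      have "fst c ! i \<in> set_pmf (pU (s1 ! i))" "fst d ! i \<in> set_pmf (pZ (s1 ! i) (fst c ! i))" "v1 ! i \<in> set_pmf p1"
        using u z v1 nth_independent_list[OF _ i] unfolding pUn_def pZn_def p1n_def by fast+
      then show "map2 zf (f1n n v1 (fst d) (fst c) s1) s1 ! i = fst d ! i"
        using i s1 crib_consistent by (simp add: f1n_def)
    qed
  next
    show "0 < K" by (rule pos)
  qed
  define C where "C = map_pmf cs.scheme (replicate_pmf nA cs.book)"
  have sound: "sound n L nA b" if mem: "b \<in> set_pmf C" for b
  proof -
    obtain cb where b: "b = cs.scheme cb" and cb: "cb \<in> set_pmf (replicate_pmf nA cs.book)" using mem unfolding C_def set_map_pmf by blast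
    have "bin_of b a s1 < L" if a: "a < nA" for a s1
    proof -
      obtain ul zl v1l v2l where e: "cb ! a = (ul, zl, v1l, v2l)" by (cases "cb ! a")
      have "cb \<in> lists (set_pmf cs.book)" "length cb = nA" using cb by (simp_all only: set_replicate_pmf Int_iff mem_Collect_eq)
      then have "cb ! a \<in> set_pmf cs.book" using nth_mem[of a cb] a by (simp only: in_lists_conv_set)
      then have ul: "set ul \<subseteq> set_pmf ?qU" "length ul = K" unfolding e cs.book_def by (simp_all add: set_replicate_pmf lists_eq_set)
      have "cs.u_cand ul s1 \<in> set ul" using ul(2) pos
        by (auto simp: cs.u_cand_def find_Some_iff split: option.split intro!: hd_in_set)
      then have "cs.u_cand ul s1 \<in> set_pmf ?qU" using ul by auto
      then show ?thesis using pos D0 by (auto simp: b cs.scheme_def e cand_def set_pmf_of_set lessThan_empty_iff)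
    qed
    then show ?thesis unfolding sound_def b cs.scheme_def by (auto simp: f1n_def f2n_def split: prod.split)
  qed
  have s_bound: "(\<integral>\<^sup>+b. block_err (map2 zf) (block_channel n) b a w m1 m2 (map fst s) (map snd s) \<partial>C) \<le>
      (2 * (\<integral>\<^sup>+u. (if MU * pmf (qUn n) u < pmf (pUn n (map fst s)) u then 1 else 0) \<partial>pUn n (map fst s)) + xU)
      + 4 * (2 * (\<integral>\<^sup>+u. \<integral>\<^sup>+z. (if MZ * pmf (qZn n) z < pmf (pZn n (map fst s) u) z then 1 else 0) \<partial>pZn n (map fst s) u \<partial>pUn n (map fst s)) + ennreal (exp (- real Kz / (4 * MZ))))
      + 4 * (\<integral>\<^sup>+u. (if \<tau>5 * pmf (postn n (map snd s)) u < pmf (qUn n) u then 1 else 0) \<partial>pUn n (map fst s))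
      + of_nat (2 * (K - 1)) * ennreal (\<tau>5 / real L) + of_nat (nA * L - 1) * (of_nat Kz * ennreal ((1 / real CARD('z)) ^ n))
      + 4 * (4 * (\<integral>\<^sup>+u. \<integral>\<^sup>+z. \<integral>\<^sup>+v1. \<integral>\<^sup>+v2. \<integral>\<^sup>+y. (
           (if \<tau>1 * pmf (chn n (map fst s) (map snd s) u z v1 v2) y < pmf (out1n n (map fst s) (map snd s) u z v2) y then 1 else 0) +
           (if \<tau>2 * pmf (chn n (map fst s) (map snd s) u z v1 v2) y < pmf (out2n n (map fst s) (map snd s) u z v1) y then 1 else 0) +
           (if \<tau>3 * pmf (chn n (map fst s) (map snd s) u z v1 v2) y < pmf (out3n n (map fst s) (map snd s) u z) y then 1 else 0) +
           (if \<tau>4 * pmf (chn n (map fst s) (map snd s) u z v1 v2) y < pmf (out4n n (map fst s) (map snd s)) y then 1 else 0))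
         \<partial>chn n (map fst s) (map snd s) u z v1 v2 \<partial>p2n n \<partial>p1n n \<partial>pZn n (map fst s) u \<partial>pUn n (map fst s)))
      + of_nat (M1 - 1) * ennreal \<tau>1 + of_nat (M2 - 1) * ennreal \<tau>2 + of_nat (M1 - 1) * (of_nat (M2 - 1) * ennreal \<tau>3)
      + of_nat (nA - 1) * (of_nat M1 * (of_nat M2 * (4 * (4 * (4 * (4 * ennreal \<tau>4))))))"
    if s: "s \<in> set_pmf (replicate_pmf n pS)" and m: "a < nA" "w < nA * L" "m1 < M1" "m2 < M2" for a w m1 m2 s
  proof -
    let ?s1 = "map fst s" and ?s2 = "map snd s"
    have ls: "length s = n" "set s \<subseteq> set_pmf pS" using s by (auto simp: set_replicate_pmf)
    \<comment> \<open>The label is uniform and independent of the codeword, which gives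
      \<open>1 / L\<close>; passing \<open>G2\<close> is a change of measure from \<open>qUn\<close>
      to \<open>postn\<close>, which gives \<open>\<tau>5\<close>.\<close>
    have D5: "emeasure (measure_pmf ?qU) {c. snd (snd c) = l \<and> G2 ?s2 (fst c)} \<le> ennreal (\<tau>5 / real L)" for l
    proof -
      have lab: "(\<integral>\<^sup>+l'. (if l' = l then 1 else 0) \<partial>pmf_of_set {..<L}) \<le> ennreal (1 / real L)"
        using pos unfolding nn_integral_ind by (simp add: emeasure_pmf_single lessThan_empty_iff split: split_indicator)
      have "emeasure (measure_pmf ?qU) {c. snd (snd c) = l \<and> G2 ?s2 (fst c)} = (\<integral>\<^sup>+u. \<integral>\<^sup>+t. \<integral>\<^sup>+l'. (if l' = l \<and> G2 ?s2 u then 1 else 0) \<partial>pmf_of_set {..<L} \<partial>pmf_of_set {..<D} \<partial>qUn n)"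
        unfolding nn_integral_ind[symmetric] cand_def nn_integral_pair_pmf' by simp
      also have "\<dots> \<le> (\<integral>\<^sup>+u. (if G2 ?s2 u then 1 else 0) * ennreal (1 / real L) \<partial>qUn n)"
        using lab by (intro nn_integral_mono) auto
      also have "\<dots> = (\<integral>\<^sup>+u. (if G2 ?s2 u then 1 else 0) \<partial>qUn n) * ennreal (1 / real L)"
        by (rule nn_integral_multc) simp
      also have "\<dots> \<le> ennreal \<tau>5 * ennreal (1 / real L)"
      proof (rule mult_right_mono)
        have "{u. G2 ?s2 u} = {u. 1 / \<tau>5 * pmf (qUn n) u \<le> pmf (postn n ?s2) u}" using pos by (auto simp: G2_def field_simps)
        then show "(\<integral>\<^sup>+u. (if G2 ?s2 u then 1 else 0) \<partial>qUn n) \<le> ennreal \<tau>5"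
          using ratio_bound[of "1 / \<tau>5" "qUn n" "postn n ?s2"] pos unfolding nn_integral_ind by simp
      qed simp
      also have "\<dots> = ennreal (\<tau>5 / real L)" using pos by (simp add: ennreal_mult'[symmetric])
      finally show ?thesis .
    qed
    have Dz: "emeasure (measure_pmf ?qZ) {d. fst d = z} \<le> ennreal ((1 / real CARD('z)) ^ n)" for z
    proof -
      have "emeasure (measure_pmf ?qZ) {d. fst d = z} = emeasure (measure_pmf (map_pmf fst ?qZ)) {z}"
        by (simp add: vimage_def)
      also have "map_pmf fst ?qZ = qZn n" unfolding cand_def by (rule map_fst_pair_pmf)
      also have "emeasure (measure_pmf (qZn n)) {z} \<le> ennreal ((1 / real CARD('z)) ^ n)"
      proof (cases "length z = n")
        case True then show ?thesis by (simp add: emeasure_pmf_single qZn_def pmf_independent_list)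
      next
        case False
        then have "z \<notin> set_pmf (qZn n)" unfolding qZn_def using length_independent_list by blast
        then show ?thesis by (simp add: emeasure_pmf_single set_pmf_iff)
      qed
      finally show ?thesis .
    qed
    have e1: "(\<integral>\<^sup>+v1. \<integral>\<^sup>+y. \<integral>\<^sup>+v1'. cs.ind (Gd ?s1 ?s2 u z v1' v2 y) \<partial>p1n n \<partial>chn n ?s1 ?s2 u z v1 v2 \<partial>p1n n) \<le> ennreal \<tau>1" for u z v2
      by (rule rival_bound[OF pos(3)]) (simp add: Gd_def out1n_def)
    have e2: "(\<integral>\<^sup>+v2. \<integral>\<^sup>+y. \<integral>\<^sup>+v2'. cs.ind (Gd ?s1 ?s2 u z v1 v2' y) \<partial>p2n n \<partial>chn n ?s1 ?s2 u z v1 v2 \<partial>p2n n) \<le> ennreal \<tau>2" for u z v1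
      by (rule rival_bound[OF pos(4)]) (simp add: Gd_def out2n_def)
    have e3: "(\<integral>\<^sup>+v1. \<integral>\<^sup>+v2. \<integral>\<^sup>+y. \<integral>\<^sup>+v1'. \<integral>\<^sup>+v2'. cs.ind (Gd ?s1 ?s2 u z v1' v2' y) \<partial>p2n n \<partial>p1n n \<partial>chn n ?s1 ?s2 u z v1 v2 \<partial>p2n n \<partial>p1n n) \<le> ennreal \<tau>3" for u z
      using rival_bound[OF pos(5), of "\<lambda>(v1, v2) y. Gd ?s1 ?s2 u z v1 v2 y" "bind_pmf (p1n n) (\<lambda>v1. map_pmf (Pair v1) (p2n n))" "\<lambda>(v1, v2). chn n ?s1 ?s2 u z v1 v2"]
      by (simp add: Gd_def out3n_def out2n_def bind_assoc_pmf bind_map_pmf split_beta)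
    have e4: "(\<integral>\<^sup>+u. \<integral>\<^sup>+z. \<integral>\<^sup>+v1. \<integral>\<^sup>+v2. \<integral>\<^sup>+y. (\<integral>\<^sup>+u'. \<integral>\<^sup>+z'. \<integral>\<^sup>+v1'. \<integral>\<^sup>+v2'. cs.ind (Gd ?s1 ?s2 u' z' v1' v2' y) \<partial>p2n n \<partial>p1n n \<partial>pZn n ?s1 u' \<partial>pUn n ?s1)
        \<partial>chn n ?s1 ?s2 u z v1 v2 \<partial>p2n n \<partial>p1n n \<partial>pZn n ?s1 u \<partial>pUn n ?s1) \<le> ennreal \<tau>4"
      using rival_bound[OF pos(6), of "\<lambda>(u, z, v1, v2) y. Gd ?s1 ?s2 u z v1 v2 y"
        "bind_pmf (pUn n ?s1) (\<lambda>u. bind_pmf (pZn n ?s1 u) (\<lambda>z. bind_pmf (p1n n) (\<lambda>v1. map_pmf (\<lambda>v2. (u, z, v1, v2)) (p2n n))))" "\<lambda>(u, z, v1, v2). chn n ?s1 ?s2 u z v1 v2"]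
      by (simp add: Gd_def out4n_def out3n_def out2n_def bind_assoc_pmf bind_map_pmf split_beta)
    have failU: "emeasure (measure_pmf ?qU) {c. \<not> AU ?s1 c} ^ K \<le>
       2 * (\<integral>\<^sup>+u. (if MU * pmf (qUn n) u < pmf (pUn n ?s1) u then 1 else 0) \<partial>pUn n ?s1) + xU"
      using xU
    proof
      assume "xU = ennreal (exp (- real K / (4 * MU)))"
      then show ?thesis using acc_fail[OF D(1) pos(1), of "qUn n" L "pUn n" ?s1 K] ls
        unfolding AU_def nn_integral_ind by simp
    next
      assume x: "MU = 1 \<and> (\<forall>s\<in>set_pmf pS. pU (fst s) = qU)"
      have "pUn n ?s1 = qUn n" unfolding pUn_def qUn_def
        by (rule independent_list_pmf_cong) (use x ls in \<open>auto dest: nth_mem\<close>)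
      then have "emeasure (measure_pmf ?qU) {c. \<not> AU ?s1 c} = 0"
        using acc_certain[OF D0(1), of "pUn n" ?s1 "qUn n" L] ls x by (simp add: AU_def)
      then show ?thesis using pos by (simp add: zero_power)
    qed
    have failZ: "emeasure (measure_pmf ?qZ) {d. \<not> AZ ?s1 u d} ^ Kz \<le>
       2 * (\<integral>\<^sup>+z. (if MZ * pmf (qZn n) z < pmf (pZn n ?s1 u) z then 1 else 0) \<partial>pZn n ?s1 u) + ennreal (exp (- real Kz / (4 * MZ)))" for u
      using acc_fail[OF D(2) pos(2), of "qZn n" 1 "\<lambda>(s1, u). pZn n s1 u" "(?s1, u)" Kz]
      unfolding AZ_def nn_integral_ind by simp
    have failZ': "(\<integral>\<^sup>+u. emeasure (measure_pmf ?qZ) {d. \<not> AZ ?s1 u d} ^ Kz \<partial>pUn n ?s1) \<le>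
      2 * (\<integral>\<^sup>+u. \<integral>\<^sup>+z. (if MZ * pmf (qZn n) z < pmf (pZn n ?s1 u) z then 1 else 0) \<partial>pZn n ?s1 u \<partial>pUn n ?s1) + ennreal (exp (- real Kz / (4 * MZ)))"
      using nn_integral_mono[OF failZ, of "measure_pmf (pUn n ?s1)"] by (simp add: nn_integral_add nn_integral_cmult)
    have G2': "(\<integral>\<^sup>+u. cs.ind (\<not> G2 ?s2 u) \<partial>pUn n ?s1) = (\<integral>\<^sup>+u. (if \<tau>5 * pmf (postn n ?s2) u < pmf (qUn n) u then 1 else 0) \<partial>pUn n ?s1)"
      by (intro nn_integral_cong) (simp add: G2_def not_le)
    have Gd': "cs.ind (\<not> Gd ?s1 ?s2 u z v1 v2 y) \<le>
         (if \<tau>1 * pmf (chn n ?s1 ?s2 u z v1 v2) y < pmf (out1n n ?s1 ?s2 u z v2) y then 1 else 0) +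
         (if \<tau>2 * pmf (chn n ?s1 ?s2 u z v1 v2) y < pmf (out2n n ?s1 ?s2 u z v1) y then 1 else 0) +
         (if \<tau>3 * pmf (chn n ?s1 ?s2 u z v1 v2) y < pmf (out3n n ?s1 ?s2 u z) y then 1 else 0) +
         (if \<tau>4 * pmf (chn n ?s1 ?s2 u z v1 v2) y < pmf (out4n n ?s1 ?s2) y then 1 else 0)" for u z v1 v2 y
      by (auto simp: Gd_def not_le add.assoc add_increasing)
    have "(\<integral>\<^sup>+b. block_err (map2 zf) (block_channel n) b a w m1 m2 ?s1 ?s2 \<partial>C) =
      (\<integral>\<^sup>+cb. block_err (map2 zf) (block_channel n) (cs.scheme cb) a w m1 m2 ?s1 ?s2 \<partial>replicate_pmf nA cs.book)"
      unfolding C_def by (rule nn_integral_map_pmf)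
    also note cs.oneshot_bound[OF m, of ?s2, OF D5 Dz e1 e2 e3 e4]
    finally show ?thesis
      unfolding G2' by (rule order_trans) (intro add_mono mult_left_mono failU failZ' order_refl nn_integral_mono Gd' zero_le)
  qed
  have "mean_err n C a w m1 m2 \<le>
     total_err n MU MZ \<tau>1 \<tau>2 \<tau>3 \<tau>4 \<tau>5 xU K Kz L nA M1 M2" if m: "a < nA" "w < nA * L" "m1 < M1" "m2 < M2" for a w m1 m2
    apply (subst nn_integral_pmf_swap)
    apply (rule order_trans, rule nn_integral_pmf_mono, rule s_bound[OF _ m], assumption)
    unfolding total_err_def atyp_joint[symmetric]
    apply (simp add: nn_integral_add nn_integral_cmult)
    done
  with sound show ?thesis by blast
qed

end

section \<open>Exponents, codebook sizes and vanishing error\<close>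

lemma tendsto_0_le_ennreal:
  fixes f :: "nat \<Rightarrow> ennreal"
  assumes "g \<longlonglongrightarrow> 0" "\<forall>\<^sub>F n in sequentially. f n \<le> ennreal (g n)"
  shows "f \<longlonglongrightarrow> 0"
proof (rule tendsto_sandwich[of "\<lambda>_. 0" f sequentially "\<lambda>n. ennreal (g n)"])
  show "(\<lambda>n. ennreal (g n)) \<longlonglongrightarrow> 0" using tendsto_ennrealI[OF assms(1)] by simp
qed (use assms in auto)

lemma tendsto_0_cmult_ennreal:
  fixes f :: "nat \<Rightarrow> ennreal"
  shows "f \<longlonglongrightarrow> 0 \<Longrightarrow> c \<noteq> \<top> \<Longrightarrow> (\<lambda>n. c * f n) \<longlonglongrightarrow> 0"
  using ennreal_tendsto_cmult[of c f 0 sequentially] by (simp add: top.not_eq_extremum)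

lemma powr_floor:
  assumes "0 \<le> x"
  shows "0 < nat \<lfloor>2 powr x\<rfloor>" "real (nat \<lfloor>2 powr x\<rfloor>) \<le> 2 powr x" "2 powr (x - 1) \<le> real (nat \<lfloor>2 powr x\<rfloor>)"
proof -
  have "1 \<le> 2 powr x" using assms by (simp add: ge_one_powr_ge_zero)
  then have 1: "1 \<le> \<lfloor>2 powr x\<rfloor>" by simp
  then show "0 < nat \<lfloor>2 powr x\<rfloor>" "real (nat \<lfloor>2 powr x\<rfloor>) \<le> 2 powr x" by (simp_all add: of_nat_nat)
  have "2 powr x < real_of_int \<lfloor>2 powr x\<rfloor> + 1" by linarith
  also have "\<dots> \<le> 2 * real_of_int \<lfloor>2 powr x\<rfloor>" using 1 by linarith
  finally show "2 powr (x - 1) \<le> real (nat \<lfloor>2 powr x\<rfloor>)" using 1 by (simp add: powr_diff of_nat_nat)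
qed

lemma exp_ratio_bound:
  assumes "0 < M" shows "ennreal (exp (- real (nat \<lceil>real n * M\<rceil>) / (4 * M))) \<le> ennreal (exp (- real n / 4))"
proof (rule ennreal_leI)
  have "real n * M \<le> real (nat \<lceil>real n * M\<rceil>)" by linarith
  then have "real n / 4 \<le> real (nat \<lceil>real n * M\<rceil>) / (4 * M)" using assms by (simp add: field_simps)
  then show "exp (- real (nat \<lceil>real n * M\<rceil>) / (4 * M)) \<le> exp (- real n / 4)" by simp
qed

lemma in_pair_kernel: "(x, y) \<in> set_pmf (pair_kernel p k) \<longleftrightarrow> x \<in> set_pmf p \<and> y \<in> set_pmf (k x)"
  by (auto simp: pair_kernel_def)

context test_channel
begin

text \<open>Exponents of the thresholds: \<open>dU\<close> is an average divergence,
  \<open>dZ\<close> compares the crib with a uniform one, and \<open>d1\<close> to \<open>d4\<close>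
  are negatives of mutual informations between strategies and output. The sum \<open>dU + dP\<close>
  is the exponent of the number of bins.\<close>

definition "dU = measure_pmf.expectation Q (\<lambda>w. log 2 (lU w / lR w))"
definition "dP = measure_pmf.expectation Q (\<lambda>w. log 2 (lR w / lP w))"
definition "dZ = measure_pmf.expectation Q (\<lambda>w. log 2 (lZ w / (1 / real CARD('z))))"
definition "d1 = measure_pmf.expectation Q (\<lambda>w. log 2 (l1 w / lW w))"
definition "d2 = measure_pmf.expectation Q (\<lambda>w. log 2 (l2 w / lW w))"
definition "d3 = measure_pmf.expectation Q (\<lambda>w. log 2 (l3 w / lW w))"
definition "d4 = measure_pmf.expectation Q (\<lambda>w. log 2 (l4 w / lW w))"

lemma finite_Q: "finite (set_pmf Q)"
  unfolding Q_def pair_kernel_def using finite_laws by (auto simp: split_beta)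

lemma in_Q: "(((((s, u), z), v1), v2), y) \<in> set_pmf Q \<longleftrightarrow> s \<in> set_pmf pS \<and> u \<in> set_pmf (pU (fst s)) \<and> z \<in> set_pmf (pZ (fst s) u) \<and>
    v1 \<in> set_pmf p1 \<and> v2 \<in> set_pmf p2 \<and> y \<in> set_pmf (ch s u z v1 v2)"
  unfolding Q_def by (simp add: in_pair_kernel)

lemma positive:
  assumes "w \<in> set_pmf Q"
  shows "0 < lU w" "0 < lR w" "0 < lP w" "0 < lZ w" "0 < lW w" "0 < l1 w" "0 < l2 w" "0 < l3 w" "0 < l4 w"
proof -
  obtain s u z v1 v2 y where w: "w = (((((s, u), z), v1), v2), y)" by (metis surj_pair)
  note m = assms[unfolded w in_Q]
  have "u \<in> set_pmf qU" "u \<in> set_pmf (post (snd s))" using m dominated[of "fst s" "snd s" u] by auto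
  then show "0 < lU w" "0 < lR w" "0 < lP w" "0 < lZ w" "0 < lW w" using m
    unfolding lU_def lR_def lP_def lZ_def lW_def w by (auto simp: pmf_positive)
  have o2: "y \<in> set_pmf (out2 s u z v1)" using m by (auto simp: out2_def)
  then have o3: "y \<in> set_pmf (out3 s u z)" using m by (auto simp: out3_def)
  then have "y \<in> set_pmf (out4 s)" using m by (auto simp: out4_def)
  moreover have "y \<in> set_pmf (out1 s u z v2)" using m by (auto simp: out1_def)
  ultimately show "0 < l1 w" "0 < l2 w" "0 < l3 w" "0 < l4 w" using o2 o3
    unfolding l1_def l2_def l3_def l4_def w by (auto simp: pmf_positive)
qed

lemma atyp_tendsto:
  assumes "\<And>w. w \<in> set_pmf Q \<Longrightarrow> 0 < a w" "\<And>w. w \<in> set_pmf Q \<Longrightarrow> 0 < b w" "0 < d"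
  shows "(\<lambda>n. atyp n (2 powr (real n * (measure_pmf.expectation Q (\<lambda>w. log 2 (a w / b w)) + d))) a b) \<longlonglongrightarrow> 0"
proof -
  have "(\<lambda>n. measure_pmf.prob (replicate_pmf n Q) {ws. 2 powr (real n * (measure_pmf.expectation Q (\<lambda>w. log 2 (a w / b w)) + d)) * (\<Prod>w\<leftarrow>ws. b w) < (\<Prod>w\<leftarrow>ws. a w)}) \<longlonglongrightarrow> 0"
  proof (rule tendstoI)
    fix e :: real assume "0 < e" then have e: "0 < e / 2" by simp
    have "\<forall>\<^sub>F n in sequentially. measure_pmf.prob (replicate_pmf n Q) {ws. 2 powr (real n * (measure_pmf.expectation Q (\<lambda>w. log 2 (a w / b w)) + d)) * (\<Prod>w\<leftarrow>ws. b w) < (\<Prod>w\<leftarrow>ws. a w)} \<le> e / 2"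
      by (rule typical[OF finite_Q assms e])
    then have "\<forall>\<^sub>F n in sequentially. measure_pmf.prob (replicate_pmf n Q) {ws. 2 powr (real n * (measure_pmf.expectation Q (\<lambda>w. log 2 (a w / b w)) + d)) * (\<Prod>w\<leftarrow>ws. b w) < (\<Prod>w\<leftarrow>ws. a w)} < e"
      by (rule eventually_mono) (use e in linarith)
    then show "\<forall>\<^sub>F n in sequentially. dist (measure_pmf.prob (replicate_pmf n Q) {ws. 2 powr (real n * (measure_pmf.expectation Q (\<lambda>w. log 2 (a w / b w)) + d)) * (\<Prod>w\<leftarrow>ws. b w) < (\<Prod>w\<leftarrow>ws. a w)}) 0 < e"
      by simp
  qed
  then show ?thesis unfolding atyp_def measure_pmf.emeasure_eq_measure by (rule tendsto_ennrealI[of _ 0, simplified])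
qed

text \<open>Every threshold exceeds its exponent by \<open>d\<close>, so the atypicality terms
  vanish by the weak law; the other terms are products of codebook sizes with thresholds, and their
  decay is assumed.\<close>

lemma total_err_tendsto:
  assumes 1: "(\<lambda>n. atyp n (MU n) lU lR) \<longlonglongrightarrow> 0" "xU \<longlonglongrightarrow> 0"
    "(\<lambda>n. ennreal (exp (- real (Kz n) / (4 * (MZ n))))) \<longlonglongrightarrow> 0"
    "(\<lambda>n. of_nat (2 * (K n - 1)) * ennreal (\<tau>5 n / real (L n))) \<longlonglongrightarrow> 0"
    "(\<lambda>n. of_nat (nA n * L n - 1) * (of_nat (Kz n) * ennreal ((1 / real CARD('z)) ^ n))) \<longlonglongrightarrow> 0"
    "(\<lambda>n. of_nat (M1 n - 1) * ennreal (\<tau>1 n)) \<longlonglongrightarrow> 0" "(\<lambda>n. of_nat (M2 n - 1) * ennreal (\<tau>2 n)) \<longlonglongrightarrow> 0"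
    "(\<lambda>n. of_nat (M1 n - 1) * (of_nat (M2 n - 1) * ennreal (\<tau>3 n))) \<longlonglongrightarrow> 0"
    "(\<lambda>n. of_nat (nA n - 1) * (of_nat (M1 n) * (of_nat (M2 n) * ennreal (\<tau>4 n)))) \<longlonglongrightarrow> 0"
    and 2: "\<And>n. MZ n = 2 powr (real n * (dZ + d))" "\<And>n. \<tau>1 n = 2 powr (real n * (d1 + d))" "\<And>n. \<tau>2 n = 2 powr (real n * (d2 + d))"
      "\<And>n. \<tau>3 n = 2 powr (real n * (d3 + d))" "\<And>n. \<tau>4 n = 2 powr (real n * (d4 + d))" "\<And>n. \<tau>5 n = 2 powr (real n * (dP + d))" and d: "0 < d"
  shows "(\<lambda>n. total_err n (MU n) (MZ n) (\<tau>1 n) (\<tau>2 n) (\<tau>3 n) (\<tau>4 n) (\<tau>5 n) (xU n) (K n) (Kz n) (L n) (nA n) (M1 n) (M2 n)) \<longlonglongrightarrow> 0"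
proof -
  have a: "(\<lambda>n. atyp n (MZ n) lZ (\<lambda>_. 1 / real CARD('z))) \<longlonglongrightarrow> 0" "(\<lambda>n. atyp n (\<tau>5 n) lR lP) \<longlonglongrightarrow> 0"
    "(\<lambda>n. atyp n (\<tau>1 n) l1 lW) \<longlonglongrightarrow> 0" "(\<lambda>n. atyp n (\<tau>2 n) l2 lW) \<longlonglongrightarrow> 0" "(\<lambda>n. atyp n (\<tau>3 n) l3 lW) \<longlonglongrightarrow> 0" "(\<lambda>n. atyp n (\<tau>4 n) l4 lW) \<longlonglongrightarrow> 0"
    unfolding 2 dZ_def dP_def d1_def d2_def d3_def d4_def by (intro atyp_tendsto positive d; simp)+
  have e: "of_nat (nA n - 1) * (of_nat (M1 n) * (of_nat (M2 n) * (4 * (4 * (4 * (4 * ennreal (\<tau>4 n))))))) =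
     256 * (of_nat (nA n - 1) * (of_nat (M1 n) * (of_nat (M2 n) * ennreal (\<tau>4 n))))" for n
    by (simp add: mult_ac)
  show ?thesis unfolding total_err_def e
    by (intro tendsto_add_zero tendsto_0_cmult_ennreal 1 a) simp_all
qed

text \<open>Origin of \<open>5 * \<delta>\<close>: about \<open>2^{n(dU + \<delta>)}\<close>
  candidates cover the states; times the threshold of Encoder 2 this is
  \<open>2^{n(dU + dP + 2\<delta>)}\<close>, and \<open>L\<close> gets one more
  \<open>\<delta>\<close> so that confusions in a bin vanish. The crib then distinguishes about
  \<open>2^{n(a + dU + dP + 3\<delta>)}\<close> announcements with
  \<open>2^{n(dZ + \<delta>)}\<close> words each, among \<open>|Z|^n\<close> sequences, and the last
  \<open>\<delta>\<close> makes collisions vanish. In the other alternative nothing is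
  announced.\<close>

lemma codebooks_exist:
  assumes d: "0 < \<delta>" and r: "0 \<le> a" "0 \<le> b1" "0 \<le> b2"
    and crib: "a + dU + dP + dZ + 5 * \<delta> \<le> log 2 (real CARD('z)) \<and> 0 \<le> dU + dP + 3 * \<delta> \<and> 0 \<le> dZ + \<delta> \<or> a = 0 \<and> (\<forall>s\<in>set_pmf pS. pU (fst s) = qU)"
    and m1: "b1 = 0 \<or> b1 + d1 + 2 * \<delta> \<le> 0" and m2: "b2 = 0 \<or> b2 + d2 + 2 * \<delta> \<le> 0"
    and m3: "b1 = 0 \<or> b2 = 0 \<or> b1 + b2 + d3 + 2 * \<delta> \<le> 0" and m4: "a = 0 \<or> a + b1 + b2 + d4 + 2 * \<delta> \<le> 0" and e: "0 < e"
  defines "nA \<equiv> \<lambda>n. nat \<lfloor>2 powr (real n * a)\<rfloor>" and "M1 \<equiv> \<lambda>n. nat \<lfloor>2 powr (real n * b1)\<rfloor>" and "M2 \<equiv> \<lambda>n. nat \<lfloor>2 powr (real n * b2)\<rfloor>"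
  shows "\<forall>\<^sub>F n in sequentially. \<exists>L C. 0 < L \<and> (\<forall>b\<in>set_pmf C. sound n L (nA n) b) \<and>
    (\<forall>a w m1 m2. a < nA n \<longrightarrow> w < nA n * L \<longrightarrow> m1 < M1 n \<longrightarrow> m2 < M2 n \<longrightarrow>
      mean_err n C a w m1 m2 \<le> e)"
proof -
  define MZ where "MZ n = 2 powr (real n * (dZ + \<delta>))" for n :: nat
  define \<tau>1 where "\<tau>1 n = 2 powr (real n * (d1 + \<delta>))" for n :: nat
  define \<tau>2 where "\<tau>2 n = 2 powr (real n * (d2 + \<delta>))" for n :: nat
  define \<tau>3 where "\<tau>3 n = 2 powr (real n * (d3 + \<delta>))" for n :: nat
  define \<tau>4 where "\<tau>4 n = 2 powr (real n * (d4 + \<delta>))" for n :: nat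
  define \<tau>5 where "\<tau>5 n = 2 powr (real n * (dP + \<delta>))" for n :: nat
  define Kz where "Kz n = nat \<lceil>real n * MZ n\<rceil>" for n
  have r': "0 \<le> real n * a" "0 \<le> real n * b1" "0 \<le> real n * b2" for n using r by simp_all
  have lim: "(\<lambda>n. c * real n * 2 powr (- real n * \<delta>)) \<longlonglongrightarrow> 0" "(\<lambda>n. c * 2 powr (- real n * \<delta>)) \<longlonglongrightarrow> 0" "(\<lambda>n. exp (- real n / 4)) \<longlonglongrightarrow> 0" for c :: real
    using d by real_asymp+
  have decay: "2 powr (real n * x) * 2 powr (real n * y) \<le> 2 powr (- real n * \<delta>)" if "x + y + \<delta> \<le> 0" for x y n
  proof -
    have "real n * (x + y + \<delta>) \<le> 0" using that by (simp add: mult_nonneg_nonpos)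
    then show ?thesis by (simp add: powr_add[symmetric] algebra_simps)
  qed
  have fl: "real (nA n) \<le> 2 powr (real n * a)" "real (M1 n) \<le> 2 powr (real n * b1)" "real (M2 n) \<le> 2 powr (real n * b2)" for n
    unfolding nA_def M1_def M2_def by (rule powr_floor r')+
  have fl': "real (nA n - 1) \<le> 2 powr (real n * a)" "real (M1 n - 1) \<le> 2 powr (real n * b1)" "real (M2 n - 1) \<le> 2 powr (real n * b2)" for n
    using fl[of n] by linarith+
  have tM1: "(\<lambda>n. of_nat (M1 n - 1) * ennreal (\<tau>1 n)) \<longlonglongrightarrow> 0"
  proof (cases "b1 = 0")
    case False
    have "real (M1 n - 1) * \<tau>1 n \<le> 2 powr (- real n * \<delta>)" for n
    proof -
      have "real (M1 n - 1) * \<tau>1 n \<le> 2 powr (real n * b1) * 2 powr (real n * (d1 + \<delta>))"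
        unfolding \<tau>1_def by (intro mult_mono fl fl' order_refl) simp_all
      also have "\<dots> \<le> 2 powr (- real n * \<delta>)" by (rule decay) (use m1 False in simp)
      finally show ?thesis .
    qed
    then show ?thesis by (intro tendsto_0_le_ennreal[OF lim(2)[of 1]] always_eventually allI)
       (simp add: ennreal_of_nat_eq_real_of_nat ennreal_mult'[symmetric] ennreal_leI)
  qed (simp add: M1_def)
  have tM2: "(\<lambda>n. of_nat (M2 n - 1) * ennreal (\<tau>2 n)) \<longlonglongrightarrow> 0"
  proof (cases "b2 = 0")
    case False
    have "real (M2 n - 1) * \<tau>2 n \<le> 2 powr (- real n * \<delta>)" for n
    proof -
      have "real (M2 n - 1) * \<tau>2 n \<le> 2 powr (real n * b2) * 2 powr (real n * (d2 + \<delta>))"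
        unfolding \<tau>2_def by (intro mult_mono fl fl' order_refl) simp_all
      also have "\<dots> \<le> 2 powr (- real n * \<delta>)" by (rule decay) (use m2 False in simp)
      finally show ?thesis .
    qed
    then show ?thesis by (intro tendsto_0_le_ennreal[OF lim(2)[of 1]] always_eventually allI)
       (simp add: ennreal_of_nat_eq_real_of_nat ennreal_mult'[symmetric] ennreal_leI)
  qed (simp add: M2_def)
  have tM3: "(\<lambda>n. of_nat (M1 n - 1) * (of_nat (M2 n - 1) * ennreal (\<tau>3 n))) \<longlonglongrightarrow> 0"
  proof (cases "b1 = 0 \<or> b2 = 0")
    case False
    have "real (M1 n - 1) * (real (M2 n - 1) * \<tau>3 n) \<le> 2 powr (- real n * \<delta>)" for n
    proof -
      have "real (M1 n - 1) * (real (M2 n - 1) * \<tau>3 n) \<le> 2 powr (real n * b1) * (2 powr (real n * b2) * 2 powr (real n * (d3 + \<delta>)))"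
        unfolding \<tau>3_def by (intro mult_mono fl fl' order_refl) simp_all
      also have "\<dots> = 2 powr (real n * (b1 + b2)) * 2 powr (real n * (d3 + \<delta>))"
        by (simp add: powr_add[symmetric] algebra_simps)
      also have "\<dots> \<le> 2 powr (- real n * \<delta>)" by (rule decay) (use m3 False in simp)
      finally show ?thesis .
    qed
    then show ?thesis by (intro tendsto_0_le_ennreal[OF lim(2)[of 1]] always_eventually allI)
       (simp add: ennreal_of_nat_eq_real_of_nat ennreal_mult'[symmetric] ennreal_leI)
  qed (auto simp: M1_def M2_def)
  have tA: "(\<lambda>n. of_nat (nA n - 1) * (of_nat (M1 n) * (of_nat (M2 n) * ennreal (\<tau>4 n)))) \<longlonglongrightarrow> 0"
  proof (cases "a = 0")
    case False
    have "real (nA n - 1) * (real (M1 n) * (real (M2 n) * \<tau>4 n)) \<le> 2 powr (- real n * \<delta>)" for n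
    proof -
      have "real (nA n - 1) * (real (M1 n) * (real (M2 n) * \<tau>4 n)) \<le>
        2 powr (real n * a) * (2 powr (real n * b1) * (2 powr (real n * b2) * 2 powr (real n * (d4 + \<delta>))))"
        unfolding \<tau>4_def by (intro mult_mono fl fl' order_refl) simp_all
      also have "\<dots> = 2 powr (real n * (a + b1 + b2)) * 2 powr (real n * (d4 + \<delta>))"
        by (simp add: powr_add[symmetric] algebra_simps)
      also have "\<dots> \<le> 2 powr (- real n * \<delta>)" by (rule decay) (use m4 False in simp)
      finally show ?thesis .
    qed
    then show ?thesis by (intro tendsto_0_le_ennreal[OF lim(2)[of 1]] always_eventually allI)
       (simp add: ennreal_of_nat_eq_real_of_nat ennreal_mult'[symmetric] ennreal_leI)
  qed (simp add: nA_def)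
  have tZ: "(\<lambda>n. ennreal (exp (- real (Kz n) / (4 * MZ n)))) \<longlonglongrightarrow> 0"
    unfolding Kz_def by (intro tendsto_0_le_ennreal[OF lim(3)] always_eventually allI exp_ratio_bound) (simp add: MZ_def)
  have "\<exists>MU xU K L. (\<forall>n>0. 0 < MU n \<and> 0 < K n \<and> 0 < L n) \<and>
     (\<forall>n. xU n = ennreal (exp (- real (K n) / (4 * MU n))) \<or> MU n = 1 \<and> (\<forall>s\<in>set_pmf pS. pU (fst s) = qU)) \<and>
     (\<lambda>n. atyp n (MU n) lU lR) \<longlonglongrightarrow> 0 \<and> xU \<longlonglongrightarrow> 0 \<and> (\<lambda>n. of_nat (2 * (K n - 1)) * ennreal (\<tau>5 n / real (L n))) \<longlonglongrightarrow> 0 \<and>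
     (\<lambda>n. of_nat (nA n * L n - 1) * (of_nat (Kz n) * ennreal ((1 / real CARD('z)) ^ n))) \<longlonglongrightarrow> 0"
    (is "\<exists>MU xU K L. ?P MU xU K L")
    using crib
  proof
    assume c: "a + dU + dP + dZ + 5 * \<delta> \<le> log 2 (real CARD('z)) \<and> 0 \<le> dU + dP + 3 * \<delta> \<and> 0 \<le> dZ + \<delta>"
    define MU where "MU n = 2 powr (real n * (dU + \<delta>))" for n :: nat
    define K where "K n = nat \<lceil>real n * MU n\<rceil>" for n
    define L where "L n = nat \<lceil>2 powr (real n * (dU + dP + 3 * \<delta>))\<rceil>" for n :: nat
    have L: "2 powr (real n * (dU + dP + 3 * \<delta>)) \<le> real (L n)" for n unfolding L_def by linarith
    have pos: "0 < MU n \<and> 0 < K n \<and> 0 < L n" if "0 < n" for n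
    proof -
      have "0 < real n * MU n" using that by (simp add: MU_def)
      moreover have "0 < real (L n)" using L[of n] by (rule less_le_trans[rotated]) simp
      ultimately show ?thesis by (simp add: K_def MU_def)
    qed
    have K: "real (2 * (K n - 1)) * (\<tau>5 n / real (L n)) \<le> 2 * real n * 2 powr (- real n * \<delta>)" for n
    proof -
      have "real (2 * (K n - 1)) \<le> 2 * (real n * MU n)"
        unfolding K_def using of_nat_0_le_iff[of n] by (cases "0 < n * MU n") (simp_all add: MU_def, linarith?)
      moreover have "\<tau>5 n / real (L n) \<le> \<tau>5 n / 2 powr (real n * (dU + dP + 3 * \<delta>))"
        by (rule divide_left_mono[OF L]) (use L[of n] in \<open>auto simp: \<tau>5_def intro!: mult_pos_pos less_le_trans[OF _ L[of n]]\<close>)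
      ultimately have "real (2 * (K n - 1)) * (\<tau>5 n / real (L n)) \<le> 2 * (real n * MU n) * (\<tau>5 n / 2 powr (real n * (dU + dP + 3 * \<delta>)))"
        by (intro mult_mono) (auto simp: MU_def \<tau>5_def)
      also have "\<dots> = 2 * real n * 2 powr (- real n * \<delta>)"
        by (simp add: MU_def \<tau>5_def powr_diff[symmetric] powr_add[symmetric] algebra_simps)
      finally show ?thesis .
    qed
    have B: "real (nA n * L n - 1) * (real (Kz n) * (1 / real CARD('z)) ^ n) \<le> 4 * real n * 2 powr (- real n * \<delta>)" if n: "0 < n" for n
    proof -
      have z: "(1 / real CARD('z)) ^ n = 2 powr (- real n * log 2 (real CARD('z)))"
      proof -
        have "2 powr (- real n * log 2 (real CARD('z))) = (2 powr (log 2 (real CARD('z)))) powr (- real n)" unfolding powr_powr by (simp add: mult.commute)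
        then show ?thesis by (simp add: powr_minus powr_realpow power_one_over inverse_eq_divide)
      qed
      \<comment> \<open>The nonnegativity conditions make the exponentials at least 1, so rounding
        up at most doubles them.\<close>
      have l1: "real (L n) \<le> 2 * 2 powr (real n * (dU + dP + 3 * \<delta>))"
      proof -
        have "1 \<le> 2 powr (real n * (dU + dP + 3 * \<delta>))" using c by (intro ge_one_powr_ge_zero) simp_all
        then show ?thesis unfolding L_def by linarith
      qed
      have l2: "real (Kz n) \<le> 2 * real n * 2 powr (real n * (dZ + \<delta>))"
      proof -
        have "1 \<le> MZ n" unfolding MZ_def using c by (intro ge_one_powr_ge_zero) simp_all
        then have "1 * 1 \<le> real n * MZ n" using n by (intro mult_mono) simp_all
        then show ?thesis unfolding Kz_def MZ_def by linarith
      qed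
      have "real (nA n * L n - 1) * (real (Kz n) * (1 / real CARD('z)) ^ n) \<le> (real (nA n) * real (L n)) * (real (Kz n) * (1 / real CARD('z)) ^ n)"
        by (intro mult_right_mono) (simp_all del: of_nat_mult add: of_nat_mult[symmetric])
      also have "\<dots> \<le> (2 powr (real n * a) * (2 * 2 powr (real n * (dU + dP + 3 * \<delta>)))) * ((2 * real n * 2 powr (real n * (dZ + \<delta>))) * 2 powr (- real n * log 2 (real CARD('z))))"
        unfolding z by (intro mult_mono l1 l2 fl order_refl) simp_all
      also have "\<dots> = 4 * real n * (2 powr (real n * (a + (dU + dP + 3 * \<delta>) + (dZ + \<delta>))) * 2 powr (real n * (- log 2 (real CARD('z)))))"
        unfolding powr_add distrib_left[of "real n"] by (simp add: mult_ac)
      also have "\<dots> \<le> 4 * real n * 2 powr (- real n * \<delta>)" by (intro mult_left_mono decay) (use c in simp_all)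
      finally show ?thesis .
    qed
    have "?P MU (\<lambda>n. ennreal (exp (- real (K n) / (4 * MU n)))) K L"
    proof (intro conjI allI impI)
      show "(\<lambda>n. atyp n (MU n) lU lR) \<longlonglongrightarrow> 0" unfolding MU_def dU_def by (intro atyp_tendsto positive d)
      show "(\<lambda>n. ennreal (exp (- real (K n) / (4 * MU n)))) \<longlonglongrightarrow> 0"
        unfolding K_def by (intro tendsto_0_le_ennreal[OF lim(3)] always_eventually allI exp_ratio_bound) (simp add: MU_def)
      show "(\<lambda>n. of_nat (2 * (K n - 1)) * ennreal (\<tau>5 n / real (L n))) \<longlonglongrightarrow> 0"
        using K by (intro tendsto_0_le_ennreal[OF lim(1)[of 2]] always_eventually allI)
          (simp add: ennreal_of_nat_eq_real_of_nat ennreal_mult'[symmetric] ennreal_leI \<tau>5_def del: of_nat_mult)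
      show "(\<lambda>n. of_nat (nA n * L n - 1) * (of_nat (Kz n) * ennreal ((1 / real CARD('z)) ^ n))) \<longlonglongrightarrow> 0"
        using B by (intro tendsto_0_le_ennreal[OF lim(1)[of 4]] eventually_mono[OF eventually_gt_at_top[of 0]])
          (simp add: ennreal_of_nat_eq_real_of_nat ennreal_mult'[symmetric] ennreal_leI del: of_nat_mult)
    qed (use pos in auto)
    then show ?thesis by (rule_tac exI, rule_tac exI, rule_tac exI, rule_tac exI)
  next
    assume c: "a = 0 \<and> (\<forall>s\<in>set_pmf pS. pU (fst s) = qU)"
    have "atyp n 1 lU lR = 0" for n
    proof -
      have "(\<Prod>w\<leftarrow>ws. lU w) = (\<Prod>w\<leftarrow>ws. lR w)" if "ws \<in> set_pmf (replicate_pmf n Q)" for ws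
      proof -
        have "lU w = lR w" if "w \<in> set_pmf Q" for w
          using that c by (cases w) (auto simp: in_Q lU_def lR_def)
        moreover have "ws \<in> lists (set_pmf Q)" using that by (simp add: set_replicate_pmf)
        ultimately have "map lU ws = map lR ws" by (simp add: in_lists_conv_set)
        then show ?thesis by (simp only:)
      qed
      then show ?thesis unfolding atyp_def by (auto simp: measure_pmf.emeasure_eq_measure measure_pmf_zero_iff)
    qed
    \<comment> \<open>Equal laws leave nothing atypical for \<open>MU = 1\<close>, and with one
      candidate, one bin and \<open>nA n = 1\<close> the confusion terms are empty.\<close>
    then have "?P (\<lambda>_. 1) (\<lambda>_. 0) (\<lambda>_. 1) (\<lambda>_. 1)" using c by (simp add: nA_def)
    then show ?thesis by (rule_tac exI, rule_tac exI, rule_tac exI, rule_tac exI)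
  qed
  then obtain MU xU K L where P: "?P MU xU K L" by (elim exE)
  have "(\<lambda>n. total_err n (MU n) (MZ n) (\<tau>1 n) (\<tau>2 n) (\<tau>3 n) (\<tau>4 n) (\<tau>5 n) (xU n) (K n) (Kz n) (L n) (nA n) (M1 n) (M2 n)) \<longlonglongrightarrow> 0"
    by (rule total_err_tendsto[OF _ _ tZ _ _ tM1 tM2 tM3 tA MZ_def \<tau>1_def \<tau>2_def \<tau>3_def \<tau>4_def \<tau>5_def d]) (use P in simp_all)
  then have "\<forall>\<^sub>F n in sequentially. total_err n (MU n) (MZ n) (\<tau>1 n) (\<tau>2 n) (\<tau>3 n) (\<tau>4 n) (\<tau>5 n) (xU n) (K n) (Kz n) (L n) (nA n) (M1 n) (M2 n) < e"
    using e by (rule order_tendstoD(2))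
  then show ?thesis using eventually_gt_at_top[of 0]
  proof eventually_elim
    case (elim n)
    have "\<exists>C. (\<forall>b\<in>set_pmf C. sound n (L n) (nA n) b) \<and> (\<forall>a w m1 m2. a < nA n \<longrightarrow> w < nA n * L n \<longrightarrow> m1 < M1 n \<longrightarrow> m2 < M2 n \<longrightarrow>
      mean_err n C a w m1 m2 \<le>
       total_err n (MU n) (MZ n) (\<tau>1 n) (\<tau>2 n) (\<tau>3 n) (\<tau>4 n) (\<tau>5 n) (xU n) (K n) (Kz n) (L n) (nA n) (M1 n) (M2 n))"
      by (rule block_schemes) (use P elim in \<open>auto simp: MZ_def \<tau>1_def \<tau>2_def \<tau>3_def \<tau>4_def \<tau>5_def\<close>)
    then obtain C where C: "\<forall>b\<in>set_pmf C. sound n (L n) (nA n) b" "\<forall>a w m1 m2. a < nA n \<longrightarrow> w < nA n * L n \<longrightarrow> m1 < M1 n \<longrightarrow> m2 < M2 n \<longrightarrow>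
      mean_err n C a w m1 m2 \<le>
       total_err n (MU n) (MZ n) (\<tau>1 n) (\<tau>2 n) (\<tau>3 n) (\<tau>4 n) (\<tau>5 n) (xU n) (K n) (Kz n) (L n) (nA n) (M1 n) (M2 n)"
      by (elim exE conjE)
    show ?case
    proof (rule exI[of _ "L n"], rule exI[of _ C], intro conjI allI impI)
      show "0 < L n" using P elim by simp
      show "\<forall>b\<in>set_pmf C. sound n (L n) (nA n) b" by (rule C)
      fix a w m1 m2 assume "a < nA n" "w < nA n * L n" "m1 < M1 n" "m2 < M2 n"
      then show "mean_err n C a w m1 m2 \<le> e"
        using C(2) less_imp_le[OF elim(1)] by (meson order_trans)
    qed
  qed
qed

end

section \<open>Rates of the concatenated code\<close>

lemma card_messages: "real (card (messages n R)) \<le> 2 powr (real n * R)"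
proof -
  have "real (nat \<lfloor>2 powr (real n * R)\<rfloor>) \<le> 2 powr (real n * R)" by (rule of_nat_floor) simp
  then show ?thesis by (simp add: messages_def)
qed

text \<open>Each of the two floors loses at most one bit, hence the subtracted 2.\<close>

lemma powr_floor_power:
  assumes "0 \<le> x" "0 \<le> y" "r \<le> real k * (x + y - 2)"
  shows "2 powr r \<le> real ((nat \<lfloor>2 powr x\<rfloor> * nat \<lfloor>2 powr y\<rfloor>) ^ k)"
proof -
  have "2 powr r \<le> 2 powr (real k * (x + y - 2))" using assms by simp
  also have "\<dots> = (2 powr (x - 1) * 2 powr (y - 1)) ^ k"
    by (simp add: powr_add[symmetric] powr_realpow[symmetric] powr_powr mult.commute)
  also have "\<dots> \<le> (real (nat \<lfloor>2 powr x\<rfloor>) * real (nat \<lfloor>2 powr y\<rfloor>)) ^ k"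
    by (intro power_mono mult_mono powr_floor assms) auto
  finally show ?thesis by simp
qed

text \<open>The opening block carries no message. The resulting factor \<open>k / (k + 1)\<close> is
  absorbed by the strict inequality once \<open>k\<close> is large.\<close>

lemma rate_split:
  assumes "R = 0 \<or> R < (c :: real)" "0 \<le> R"
  shows "\<forall>\<^sub>F k in sequentially. R = 0 \<or> real (Suc k) * R < real k * c"
proof (cases "R = 0")
  case False
  then have R: "0 < c - R" using assms by auto
  have "\<forall>\<^sub>F k in sequentially. R / (c - R) < real k" using eventually_gt_at_top[of "nat \<lceil>R / (c - R)\<rceil>"]
    by eventually_elim linarith
  then show ?thesis
  proof eventually_elim
    case (elim k)
    then have "R < real k * (c - R)" using R by (simp add: divide_less_eq)
    then show ?case by (simp add: algebra_simps)
  qed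
qed simp

context test_channel
begin

text \<open>\<open>a\<close> is the rate of the part of message 1 that passes through the crib,
  \<open>b1\<close> that of the rest, and \<open>b2\<close> the rate of message 2. A rate 0 means a
  single codeword, which has no rivals; hence the disjunctions.\<close>

lemma achievable_rates:
  assumes d: "0 < \<delta>" and r: "0 \<le> a" "0 \<le> b1" "0 \<le> b2"
    and crib: "a + dU + dP + dZ + 5 * \<delta> \<le> log 2 (real CARD('z)) \<and> 0 \<le> dU + dP + 3 * \<delta> \<and> 0 \<le> dZ + \<delta> \<or> a = 0 \<and> (\<forall>s\<in>set_pmf pS. pU (fst s) = qU)"
    and m: "b1 = 0 \<or> b1 + d1 + 2 * \<delta> \<le> 0" "b2 = 0 \<or> b2 + d2 + 2 * \<delta> \<le> 0"
     "b1 = 0 \<or> b2 = 0 \<or> b1 + b2 + d3 + 2 * \<delta> \<le> 0" "a = 0 \<or> a + b1 + b2 + d4 + 2 * \<delta> \<le> 0"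
    and R: "0 \<le> R1" "0 \<le> R2" "R1 = 0 \<or> R1 < a + b1" "R2 = 0 \<or> R2 < b2"
  shows "achievable pS zf W R1 R2"
  unfolding achievable_def
proof (intro conjI R allI impI)
  fix \<epsilon> :: real and N :: nat assume eps: "0 < \<epsilon>"
  define nA where "nA n = nat \<lfloor>2 powr (real n * a)\<rfloor>" for n :: nat
  define M1 where "M1 n = nat \<lfloor>2 powr (real n * b1)\<rfloor>" for n :: nat
  define M2 where "M2 n = nat \<lfloor>2 powr (real n * b2)\<rfloor>" for n :: nat
  have "\<forall>\<^sub>F k in sequentially. (R1 = 0 \<or> real (Suc k) * R1 < real k * (a + b1)) \<and> (R2 = 0 \<or> real (Suc k) * R2 < real k * b2)"
    by (intro eventually_conj rate_split R)
  then obtain k where k: "R1 = 0 \<or> real (Suc k) * R1 < real k * (a + b1)" "R2 = 0 \<or> real (Suc k) * R2 < real k * b2"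
    by (auto simp: eventually_sequentially)
  \<comment> \<open>The number of blocks is fixed before the block length, so each of them may be
    asked to contribute this little; the 2 makes the total strictly smaller than
    \<open>\<epsilon>\<close>.\<close>
  define e where "e = ennreal (\<epsilon> / (2 * real (Suc k)))"
  have e: "0 < e" "of_nat (Suc k) * e < ennreal \<epsilon>"
    using eps unfolding e_def by (auto simp: ennreal_of_nat_eq_real_of_nat ennreal_mult'[symmetric] ennreal_less_iff field_simps simp del: of_nat_Suc)
  have large: "\<forall>\<^sub>F n in sequentially. R = 0 \<or> real (Suc k * n) * R \<le> real k * (real n * c - 2)" if "R = 0 \<or> real (Suc k) * R < real k * c" for R c
  proof (cases "R = 0")
    case False
    then have p: "0 < real k * c - real (Suc k) * R" using that by simp
    have "\<forall>\<^sub>F n in sequentially. 2 * real k / (real k * c - real (Suc k) * R) < real n"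
      using eventually_gt_at_top[of "nat \<lceil>2 * real k / (real k * c - real (Suc k) * R)\<rceil>"] by eventually_elim linarith
    then show ?thesis
    proof eventually_elim
      case (elim n)
      then have "2 * real k < real n * (real k * c - real (Suc k) * R)" using p by (simp add: divide_less_eq del: of_nat_Suc)
      then show ?case by (simp add: algebra_simps)
    qed
  qed simp
  have "\<forall>\<^sub>F n in sequentially. N \<le> n \<and> (R1 = 0 \<or> real (Suc k * n) * R1 \<le> real k * (real n * (a + b1) - 2)) \<and>
      (R2 = 0 \<or> real (Suc k * n) * R2 \<le> real k * (real n * b2 - 2)) \<and>
    (\<exists>L C. 0 < L \<and> (\<forall>b\<in>set_pmf C. sound n L (nA n) b) \<and>
    (\<forall>a w m1 m2. a < nA n \<longrightarrow> w < nA n * L \<longrightarrow> m1 < M1 n \<longrightarrow> m2 < M2 n \<longrightarrow>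
      mean_err n C a w m1 m2 \<le> e))"
    unfolding nA_def M1_def M2_def
    by (intro eventually_conj eventually_ge_at_top large k codebooks_exist[OF d r crib m e(1)])
  from eventually_happens'[OF sequentially_bot this] obtain n L C where n: "N \<le> n" "R1 = 0 \<or> real (Suc k * n) * R1 \<le> real k * (real n * (a + b1) - 2)"
      "R2 = 0 \<or> real (Suc k * n) * R2 \<le> real k * (real n * b2 - 2)"
    and L: "0 < L" and C: "\<forall>b\<in>set_pmf C. sound n L (nA n) b"
     "\<forall>a w m1 m2. a < nA n \<longrightarrow> w < nA n * L \<longrightarrow> m1 < M1 n \<longrightarrow> m2 < M2 n \<longrightarrow>
      mean_err n C a w m1 m2 \<le> e"
    by (elim exE conjE)
  have pos: "0 < nA n" "0 < M1 n" "0 < M2 n" unfolding nA_def M1_def M2_def by (intro powr_floor mult_nonneg_nonneg r; simp)+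
  have c1: "card (messages (Suc k * n) R1) \<le> (nA n * M1 n) ^ k"
  proof (cases "R1 = 0")
    case True then show ?thesis using pos by (simp add: messages_def Suc_le_eq)
  next
    case False
    have "real (card (messages (Suc k * n) R1)) \<le> 2 powr (real (Suc k * n) * R1)" by (rule card_messages)
    also have "\<dots> \<le> real ((nA n * M1 n) ^ k)" unfolding nA_def M1_def
      by (rule powr_floor_power) (use n(2) False r in \<open>simp_all add: algebra_simps\<close>)
    finally show ?thesis by (simp only: of_nat_le_iff)
  qed
  have c2: "card (messages (Suc k * n) R2) \<le> M2 n ^ k"
  proof (cases "R2 = 0")
    case True then show ?thesis using pos by (simp add: messages_def Suc_le_eq)
  next
    case False
    have "real (card (messages (Suc k * n) R2)) \<le> 2 powr (real (Suc k * n) * R2)" by (rule card_messages)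
    also have "\<dots> \<le> real ((nat \<lfloor>2 powr (real n * b2)\<rfloor> * nat \<lfloor>2 powr (0 :: real)\<rfloor>) ^ k)"
      by (rule powr_floor_power) (use n(3) False r in \<open>simp_all add: algebra_simps\<close>)
    also have "\<dots> = real (M2 n ^ k)" by (simp add: M2_def)
    finally show ?thesis by (simp only: of_nat_le_iff)
  qed
  have "\<exists>c. is_code R1 R2 (Suc k * n) c \<and> error_prob pS zf W R1 R2 (Suc k * n) c \<le> \<epsilon>"
    by (rule block_markov_code[OF _ _ L pos R(1,2) refl c1 c2 e(2)]) (use C in blast)+
  moreover have "N \<le> Suc k * n" using n(1) by simp
  ultimately show "\<exists>n\<ge>N. \<exists>c. is_code R1 R2 n c \<and> error_prob pS zf W R1 R2 n c \<le> \<epsilon>" by blast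
qed

end

section \<open>Achievability of the single-letter region\<close>

text \<open>The conditional law of \<open>B\<close> given \<open>A = a\<close>, meaningful for
  \<open>a\<close> attained on the support.\<close>

definition kern :: "'w pmf \<Rightarrow> ('w \<Rightarrow> 'a) \<Rightarrow> ('w \<Rightarrow> 'b) \<Rightarrow> 'a \<Rightarrow> 'b pmf" where
  "kern P A B a = map_pmf B (cond_pmf P {w. A w = a})"

text \<open>Resampling the outcome conditionally on \<open>A\<close> leaves both \<open>A\<close>
  and the law \<open>P\<close> unchanged.\<close>

lemma disintegrate: "map_pmf (\<lambda>w. (A w, B w)) P = pair_kernel (map_pmf A P) (kern P A B)"
proof -
  have ne: "set_pmf P \<inter> {w'. A w' = A w} \<noteq> {}" if "w \<in> set_pmf P" for w using that by auto
  have canc: "bind_pmf P (\<lambda>w. cond_pmf P {w'. A w' = A w}) = P"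
    by (rule bind_cond_pmf_cancel) (auto simp: eq_commute)
  have "pair_kernel (map_pmf A P) (kern P A B) = bind_pmf P (\<lambda>w. map_pmf (\<lambda>w'. (A w, B w')) (cond_pmf P {w'. A w' = A w}))"
    by (simp add: pair_kernel_def kern_def bind_map_pmf map_pmf_comp)
  also have "\<dots> = bind_pmf P (\<lambda>w. map_pmf (\<lambda>w'. (A w', B w')) (cond_pmf P {w'. A w' = A w}))"
    by (intro bind_pmf_cong refl map_pmf_cong) (use ne in \<open>auto simp: set_cond_pmf\<close>)
  also have "\<dots> = map_pmf (\<lambda>w'. (A w', B w')) (bind_pmf P (\<lambda>w. cond_pmf P {w'. A w' = A w}))"
    by (simp add: map_bind_pmf)
  finally show ?thesis unfolding canc by simp
qed

lemma kern_support:
  assumes "a \<in> A ` set_pmf P" "b \<in> set_pmf (kern P A B a)"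
  shows "\<exists>w\<in>set_pmf P. A w = a \<and> B w = b"
proof -
  have "set_pmf P \<inter> {w. A w = a} \<noteq> {}" using assms(1) by auto
  then show ?thesis using assms(2) by (auto simp: kern_def set_cond_pmf)
qed

lemma hc_last:
  assumes fin: "finite (set_pmf (pair_kernel p k))" and k: "\<And>x. x \<in> set_pmf p \<Longrightarrow> k x = k' (B x)"
  shows "hc (pair_kernel p k) snd (\<lambda>w. B (fst w)) = measure_pmf.expectation (pair_kernel p k) (\<lambda>w. - log 2 (pmf (k (fst w)) (snd w)))"
proof -
  have "hc (pair_kernel p k) snd (\<lambda>w. B (fst w)) = measure_pmf.expectation (pair_kernel p k) (\<lambda>w. - log 2 (pmf (k' (B (fst w))) (snd w)))"
  proof (rule hc_kernel[OF fin])
    have f: "map_pmf fst (pair_kernel p k) = p"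
      by (simp add: pair_kernel_def map_bind_pmf map_pmf_comp bind_return_pmf' del: bind_map_pmf)
    have "map_pmf (\<lambda>w. B (fst w)) (pair_kernel p k) = map_pmf B p" using arg_cong[OF f, of "map_pmf B"] by (simp add: map_pmf_comp)
    then show "map_pmf (\<lambda>w. (B (fst w), snd w)) (pair_kernel p k) = bind_pmf (map_pmf (\<lambda>w. B (fst w)) (pair_kernel p k)) (\<lambda>b. map_pmf (Pair b) (k' b))"
      by (simp add: bind_map_pmf) (auto simp: pair_kernel_def map_bind_pmf map_pmf_comp k intro!: bind_pmf_cong)
  qed
  also have "\<dots> = measure_pmf.expectation (pair_kernel p k) (\<lambda>w. - log 2 (pmf (k (fst w)) (snd w)))"
    by (rule expectation_pmf_cong) (auto simp: in_pair_kernel k)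
  finally show ?thesis .
qed

lemma hc_gibbs_kernel:
  assumes fin: "finite (set_pmf P)" and k: "\<And>w. w \<in> set_pmf P \<Longrightarrow> A w \<in> set_pmf (k (B w))"
  shows "hc P A B \<le> measure_pmf.expectation P (\<lambda>w. - log 2 (pmf (k (B w)) (A w)))"
proof (rule hc_gibbs[OF fin, where r = "\<lambda>a b. pmf (k b) a"])
  show "(\<Sum>a\<in>A ` set_pmf P. pmf (k b) a) \<le> 1" for b
    using measure_pmf.prob_le_1[of "k b" "A ` set_pmf P"] fin by (simp add: measure_measure_pmf_finite)
qed (use k in \<open>auto simp: pmf_positive\<close>)

text \<open>The codeword symbol is an element \<open>t\<close> of an arbitrary type, from which both encoders compute the
  auxiliary value: \<open>t\<close> is \<open>u\<close> itself, or a function that is evaluated at the conditional law of \<open>U\<close>.\<close>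

locale law_channel = cribbing_mac pS zf W
  for pS :: "('s1::finite \<times> 's2::finite) pmf" and zf :: "'x1::finite \<Rightarrow> 's1 \<Rightarrow> 'z::finite"
    and W :: "'x1 \<Rightarrow> 'x2::finite \<Rightarrow> 's1 \<Rightarrow> 's2 \<Rightarrow> 'y::finite pmf" +
  fixes pX1U :: "'s1 \<Rightarrow> ('x1 \<times> nat) pmf" and pX2 :: "'z \<Rightarrow> nat \<Rightarrow> 's2 \<Rightarrow> 'x2 pmf"
    and T :: "'s1 \<Rightarrow> 't pmf" and ht :: "'s1 \<Rightarrow> 't \<Rightarrow> nat" and h2 :: "'s2 \<Rightarrow> 't \<Rightarrow> nat"
    and qT :: "'t pmf" and post :: "'s2 \<Rightarrow> 't pmf"
  assumes finite_law: "\<And>s1. finite (set_pmf (pX1U s1))" "\<And>s1. finite (set_pmf (T s1))"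
    and aux_law: "\<And>s1. map_pmf (ht s1) (T s1) = map_pmf snd (pX1U s1)"
    and shared: "\<And>s1 s2 t. (s1, s2) \<in> set_pmf pS \<Longrightarrow> t \<in> set_pmf (T s1) \<Longrightarrow> h2 s2 t = ht s1 t \<and> t \<in> set_pmf qT \<and> t \<in> set_pmf (post s2)"
begin

lemma shared': "s \<in> set_pmf pS \<Longrightarrow> t \<in> set_pmf (T (fst s)) \<Longrightarrow> h2 (snd s) t = ht (fst s) t"
  using shared[of "fst s" "snd s" t] by simp

definition kZ :: "'s1 \<Rightarrow> nat \<Rightarrow> 'z pmf" where "kZ s1 = kern (pX1U s1) snd (\<lambda>a. zf (fst a) s1)"
definition kX :: "'s1 \<Rightarrow> nat \<times> 'z \<Rightarrow> 'x1 pmf" where "kX s1 = kern (pX1U s1) (\<lambda>a. (snd a, zf (fst a) s1)) fst"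
definition Us :: "nat set" where "Us = (\<Union>s1. snd ` set_pmf (pX1U s1))"
text \<open>Functional representation: a strategy assigns an input to every triple
  \<open>(z,u,s1)\<close>, with independent values of the prescribed conditional laws. It can thus
  be drawn independently of the triple at which it is evaluated. The index set is cut down to the
  finite \<open>Us\<close> to have finitely many strategies.\<close>

definition strat1 :: "('z \<times> nat \<times> 's1 \<Rightarrow> 'x1) pmf" where
  "strat1 = Pi_pmf (UNIV \<times> Us \<times> UNIV) undefined (\<lambda>(z, u, s1). kX s1 (u, z))"
definition strat2 :: "('z \<times> nat \<times> 's2 \<Rightarrow> 'x2) pmf" where
  "strat2 = Pi_pmf (UNIV \<times> Us \<times> UNIV) undefined (\<lambda>(z, u, s2). pX2 z u s2)"

lemma finite_Us: "finite Us" unfolding Us_def using finite_law by auto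

lemma in_Us: "t \<in> set_pmf (T s1) \<Longrightarrow> ht s1 t \<in> snd ` set_pmf (pX1U s1)" "t \<in> set_pmf (T s1) \<Longrightarrow> ht s1 t \<in> Us"
proof -
  assume "t \<in> set_pmf (T s1)"
  then have "ht s1 t \<in> set_pmf (map_pmf (ht s1) (T s1))" by simp
  then show "ht s1 t \<in> snd ` set_pmf (pX1U s1)" unfolding aux_law by simp
  then show "ht s1 t \<in> Us" by (auto simp: Us_def)
qed

lemma strat1_component: "u \<in> Us \<Longrightarrow> map_pmf (\<lambda>v. v (z, u, s1)) strat1 = kX s1 (u, z)"
  unfolding strat1_def by (subst Pi_pmf_component) (auto simp: finite_Us)

lemma strat2_component: "u \<in> Us \<Longrightarrow> map_pmf (\<lambda>v. v (z, u, s2)) strat2 = pX2 z u s2"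
  unfolding strat2_def by (subst Pi_pmf_component) (auto simp: finite_Us)

lemma crib_kX:
  assumes "t \<in> set_pmf (T s1)" "z \<in> set_pmf (kZ s1 (ht s1 t))" "x \<in> set_pmf (kX s1 (ht s1 t, z))"
  shows "zf x s1 = z"
proof -
  have "(ht s1 t, z) \<in> (\<lambda>a. (snd a, zf (fst a) s1)) ` set_pmf (pX1U s1)"
    using kern_support[OF in_Us(1)[OF assms(1)] assms(2)[unfolded kZ_def]] by force
  from kern_support[OF this assms(3)[unfolded kX_def]] show ?thesis by auto
qed

sublocale test_channel pS zf W T "\<lambda>s1 t. kZ s1 (ht s1 t)" strat1 strat2 "\<lambda>v z t s1. v (z, ht s1 t, s1)" "\<lambda>v z t s2. v (z, h2 s2 t, s2)" qT post
proof
  show "finite (set_pmf strat1)" "finite (set_pmf strat2)"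
    unfolding strat1_def strat2_def by (subst set_Pi_pmf; auto simp: finite_Us intro!: finite_PiE_dflt)+
  show "zf (v (z, ht s1 t, s1)) s1 = z" if "t \<in> set_pmf (T s1)" "z \<in> set_pmf (kZ s1 (ht s1 t))" "v \<in> set_pmf strat1" for s1 t z v
  proof -
    have "v (z, ht s1 t, s1) \<in> set_pmf (map_pmf (\<lambda>v. v (z, ht s1 t, s1)) strat1)" using that by simp
    then have "v (z, ht s1 t, s1) \<in> set_pmf (kX s1 (ht s1 t, z))" unfolding strat1_component[OF in_Us(2)[OF that(1)]] .
    then show ?thesis by (rule crib_kX[OF that(1,2)])
  qed
qed (use finite_law shared in auto)

abbreviation letter_of :: "(((((('s1 \<times> 's2) \<times> 't) \<times> 'z) \<times> ('z \<times> nat \<times> 's1 \<Rightarrow> 'x1)) \<times> ('z \<times> nat \<times> 's2 \<Rightarrow> 'x2)) \<times> 'y) \<Rightarrow> ('s1 \<times> 's2 \<times> 'x1 \<times> 'x2 \<times> 'y) \<times> nat" where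
  "letter_of \<equiv> (\<lambda>(((((s, t), z), v1), v2), y). ((fst s, snd s, v1 (z, ht (fst s) t, fst s), v2 (z, ht (fst s) t, snd s), y), ht (fst s) t))"

text \<open>The crib symbol is generated before the input, because its codeword is chosen
  separately; \<open>x1\<close> is then drawn among the inputs that produce this symbol.\<close>

lemma pX1U_split: "pX1U s1 = bind_pmf (map_pmf snd (pX1U s1)) (\<lambda>u. bind_pmf (kZ s1 u) (\<lambda>z. map_pmf (\<lambda>x. (x, u)) (kX s1 (u, z))))"
proof -
  have "pX1U s1 = map_pmf (\<lambda>b. (snd b, fst (fst b))) (map_pmf (\<lambda>a. ((snd a, zf (fst a) s1), fst a)) (pX1U s1))"
    by (simp add: map_pmf_comp)
  also have "\<dots> = bind_pmf (map_pmf (\<lambda>a. (snd a, zf (fst a) s1)) (pX1U s1)) (\<lambda>a. map_pmf (\<lambda>x. (x, fst a)) (kX s1 a))"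
    unfolding disintegrate[of "\<lambda>a. (snd a, zf (fst a) s1)"] by (simp add: pair_kernel_def map_bind_pmf map_pmf_comp kX_def)
  also have "\<dots> = bind_pmf (map_pmf snd (pX1U s1)) (\<lambda>u. bind_pmf (kZ s1 u) (\<lambda>z. map_pmf (\<lambda>x. (x, u)) (kX s1 (u, z))))"
    unfolding disintegrate[of snd] by (simp add: pair_kernel_def bind_assoc_pmf bind_map_pmf kZ_def)
  finally show ?thesis .
qed

text \<open>Evaluating a strategy at the actual arguments gives back the kernel it was built from,
  so the test channel induces the prescribed single-letter law, for either choice of the symbol
  type.\<close>

lemma letter_of_Q: "map_pmf letter_of Q = letter_law pX1U pX2"
proof -
  have sp: "bind_pmf (pX1U s1) F = bind_pmf (map_pmf snd (pX1U s1)) (\<lambda>u. bind_pmf (kZ s1 u) (\<lambda>z. bind_pmf (kX s1 (u, z)) (\<lambda>x. F (x, u))))"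
    for s1 and F :: "'x1 \<times> nat \<Rightarrow> 'b pmf"
    using arg_cong[OF pX1U_split[of s1], of "\<lambda>p. bind_pmf p F"] by (simp only: bind_assoc_pmf bind_map_pmf[of "\<lambda>x. (x, u)" for u])
  have "map_pmf letter_of Q = bind_pmf pS (\<lambda>s. bind_pmf (T (fst s)) (\<lambda>t. bind_pmf (kZ (fst s) (ht (fst s) t)) (\<lambda>z. bind_pmf strat1 (\<lambda>v1. bind_pmf strat2 (\<lambda>v2.
     map_pmf (\<lambda>y. ((fst s, snd s, v1 (z, ht (fst s) t, fst s), v2 (z, ht (fst s) t, snd s), y), ht (fst s) t)) (ch s t z v1 v2))))))"
    unfolding Q_def pair_kernel_def by (simp add: map_bind_pmf bind_assoc_pmf bind_map_pmf map_pmf_comp)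
  also have "\<dots> = bind_pmf pS (\<lambda>s. bind_pmf (T (fst s)) (\<lambda>t. bind_pmf (kZ (fst s) (ht (fst s) t)) (\<lambda>z.
     bind_pmf (map_pmf (\<lambda>v. v (z, ht (fst s) t, fst s)) strat1) (\<lambda>x1. bind_pmf (map_pmf (\<lambda>v. v (z, ht (fst s) t, snd s)) strat2) (\<lambda>x2.
     map_pmf (\<lambda>y. ((fst s, snd s, x1, x2, y), ht (fst s) t)) (W x1 x2 (fst s) (snd s)))))))"
    unfolding bind_map_pmf ch_def by (intro bind_pmf_cong refl) (simp add: shared')
  also have "\<dots> = bind_pmf pS (\<lambda>s. bind_pmf (T (fst s)) (\<lambda>t. bind_pmf (kZ (fst s) (ht (fst s) t)) (\<lambda>z.
     bind_pmf (kX (fst s) (ht (fst s) t, z)) (\<lambda>x1. bind_pmf (pX2 (zf x1 (fst s)) (ht (fst s) t) (snd s)) (\<lambda>x2.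
     map_pmf (\<lambda>y. ((fst s, snd s, x1, x2, y), ht (fst s) t)) (W x1 x2 (fst s) (snd s)))))))"
    by (intro bind_pmf_cong refl) (simp_all add: strat1_component strat2_component in_Us crib_kX)
  also have "\<dots> = bind_pmf pS (\<lambda>s. bind_pmf (map_pmf (ht (fst s)) (T (fst s))) (\<lambda>u. bind_pmf (kZ (fst s) u) (\<lambda>z.
     bind_pmf (kX (fst s) (u, z)) (\<lambda>x1. bind_pmf (pX2 (zf x1 (fst s)) u (snd s)) (\<lambda>x2.
     map_pmf (\<lambda>y. ((fst s, snd s, x1, x2, y), u)) (W x1 x2 (fst s) (snd s)))))))"
    by (simp add: bind_map_pmf)
  also have "\<dots> = bind_pmf pS (\<lambda>s. bind_pmf (pX1U (fst s)) (\<lambda>a. bind_pmf (pX2 (zf (fst a) (fst s)) (snd a) (snd s)) (\<lambda>x2.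
     map_pmf (\<lambda>y. ((fst s, snd s, fst a, x2, y), snd a)) (W (fst a) x2 (fst s) (snd s)))))"
    unfolding aux_law by (simp only: sp fst_conv snd_conv)
  also have "\<dots> = letter_law pX1U pX2"
    unfolding letter_law_def single_letter_def Let_def
    by (simp add: map_bind_pmf bind_map_pmf split_beta' map_pmf_comp) (simp add: map_pmf_def bind_assoc_pmf bind_return_pmf)
  finally show ?thesis .
qed

lemma hc_letter: "hc (letter_law pX1U pX2) A B = hc Q (\<lambda>w. A (letter_of w)) (\<lambda>w. B (letter_of w))"
  unfolding letter_of_Q[symmetric] hc_map ..

lemma hc_channel:
  assumes B: "B = (\<lambda>w. B' (fst w))" and k: "\<And>s t z v1 v2 y. (((((s, t), z), v1), v2), y) \<in> set_pmf Q \<Longrightarrow> k' (B' ((((s, t), z), v1), v2)) = ch s t z v1 v2"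
  shows "hc Q gY B = measure_pmf.expectation Q (\<lambda>w. - log 2 (lW w))"
proof -
  define p where "p = pair_kernel (pair_kernel (pair_kernel (pair_kernel pS (\<lambda>s. T (fst s))) (\<lambda>(s, t). kZ (fst s) (ht (fst s) t))) (\<lambda>_. strat1)) (\<lambda>_. strat2)"
  define c where "c = (\<lambda>((((s, t), z), v1), v2). ch s t z v1 v2)"
  have Q: "Q = pair_kernel p c" unfolding Q_def p_def c_def ..
  have "hc (pair_kernel p c) snd (\<lambda>w. B' (fst w)) = measure_pmf.expectation (pair_kernel p c) (\<lambda>w. - log 2 (pmf (c (fst w)) (snd w)))"
  proof (rule hc_last[where k' = k'])
    show "finite (set_pmf (pair_kernel p c))" using finite_Q unfolding Q .
    fix x assume x: "x \<in> set_pmf p"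
    obtain s t z v1 v2 where e: "x = ((((s, t), z), v1), v2)" by (metis surj_pair)
    obtain y where "y \<in> set_pmf (c x)" using set_pmf_not_empty[of "c x"] by blast
    then have "(((((s, t), z), v1), v2), y) \<in> set_pmf Q" using x unfolding Q by (simp add: in_pair_kernel e)
    from k[OF this] show "c x = k' (B' x)" by (simp add: e c_def)
  qed
  moreover have "gY = snd" by auto
  moreover have "(\<lambda>w. - log 2 (lW w)) = (\<lambda>w. - log 2 (pmf (c (fst w)) (snd w)))" by (auto simp: lW_def c_def)
  ultimately show ?thesis unfolding Q B by (simp only:)
qed

text \<open>The output law with some strategies averaged out is computable from \<open>B\<close>. As
  a guess of the output from \<open>B\<close> it bounds \<open>hc\<close> from above, so the
  exponent reached by the decoder is at least the mutual information.\<close>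

lemma info_le:
  assumes k: "\<And>w. w \<in> set_pmf Q \<Longrightarrow> pmf (k (B w)) (gY w) = l w" "\<And>w. w \<in> set_pmf Q \<Longrightarrow> 0 < l w"
  and C: "hc Q gY C = measure_pmf.expectation Q (\<lambda>w. - log 2 (lW w))"
  shows "hc Q gY B - hc Q gY C \<le> - measure_pmf.expectation Q (\<lambda>w. log 2 (l w / lW w))"
proof -
  note int = integrable_finite_pmf[OF finite_Q]
  have "hc Q gY B \<le> measure_pmf.expectation Q (\<lambda>w. - log 2 (pmf (k (B w)) (gY w)))"
    by (rule hc_gibbs_kernel[OF finite_Q]) (use k in \<open>simp add: set_pmf_iff less_imp_neq[symmetric]\<close>)
  also have "\<dots> = measure_pmf.expectation Q (\<lambda>w. - log 2 (l w))" by (rule expectation_pmf_cong) (simp add: k)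
  finally have "hc Q gY B \<le> measure_pmf.expectation Q (\<lambda>w. - log 2 (l w))" .
  moreover have "measure_pmf.expectation Q (\<lambda>w. log 2 (l w / lW w)) = measure_pmf.expectation Q (\<lambda>w. log 2 (l w) - log 2 (lW w))"
    by (rule expectation_pmf_cong) (simp add: log_divide_pos k positive)
  ultimately show ?thesis unfolding C by (simp add: int)
qed

lemma support_facts:
  assumes "(((((s, t), z), v1), v2), y) \<in> set_pmf Q"
  shows "h2 (snd s) t = ht (fst s) t" "zf (v1 (z, ht (fst s) t, fst s)) (fst s) = z"
  using assms shared'[of s t] crib_consistent[of t "fst s" z v1] by (auto simp: in_Q)

lemma support_pair:
  "((((((s1, s2), t), z), v1), v2), y) \<in> set_pmf Q \<Longrightarrow> h2 s2 t = ht s1 t \<and> zf (v1 (z, ht s1 t, s1)) s1 = z"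
  using support_facts[of "(s1, s2)"] by simp

lemma rate_infos:
  assumes "represents (e, (i1, i2, i3, hz, hs), j) pX1U pX2"
  shows "i1 \<le> - d1" "i2 \<le> - d2" "i3 \<le> - d3" "info4 (\<lambda>w. j $ w) \<le> - d4"
proof -
  note i = represents_info[OF assms]
  have Y: "(\<lambda>w. Yc (fst (letter_of w))) = gY" by auto
  show "i1 \<le> - d1" unfolding i hc_letter Y d1_def
  proof (rule info_le)
    show "hc Q gY (\<lambda>w. ((X1c (fst (letter_of w)), X2c (fst (letter_of w)), Zc (fst (letter_of w)), S1c (fst (letter_of w)), S2c (fst (letter_of w))), snd (letter_of w))) =
      measure_pmf.expectation Q (\<lambda>w. - log 2 (lW w))"
      by (rule hc_channel[where B' = "\<lambda>x. case letter_of (x, undefined) of ((s1, s2, x1, x2, y), u) \<Rightarrow> ((x1, x2, zf x1 s1, s1, s2), u)" and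
          k' = "\<lambda>((x1, x2, z, s1, s2), u). W x1 x2 s1 s2"]) (auto simp: ch_def support_facts)
    show "pmf ((\<lambda>((x2, z, s1, s2), u). bind_pmf strat1 (\<lambda>v1. W (v1 (z, u, s1)) x2 s1 s2))
      ((X2c (fst (letter_of w)), Zc (fst (letter_of w)), S1c (fst (letter_of w)), S2c (fst (letter_of w))), snd (letter_of w))) (gY w) = l1 w"
      if "w \<in> set_pmf Q" for w
      using that by (cases w) (auto simp: l1_def out1_def ch_def dest!: support_pair)
  qed (rule positive)
  show "i2 \<le> - d2" unfolding i hc_letter Y d2_def
  proof (rule info_le)
    show "hc Q gY (\<lambda>w. ((X2c (fst (letter_of w)), X1c (fst (letter_of w)), S1c (fst (letter_of w)), S2c (fst (letter_of w))), snd (letter_of w))) =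
      measure_pmf.expectation Q (\<lambda>w. - log 2 (lW w))"
      by (rule hc_channel[where B' = "\<lambda>x. case letter_of (x, undefined) of ((s1, s2, x1, x2, y), u) \<Rightarrow> ((x2, x1, s1, s2), u)" and
          k' = "\<lambda>((x2, x1, s1, s2), u). W x1 x2 s1 s2"]) (auto simp: ch_def support_facts)
    show "pmf ((\<lambda>((x1, s1, s2), u). bind_pmf strat2 (\<lambda>v2. W x1 (v2 (zf x1 s1, u, s2)) s1 s2))
      ((X1c (fst (letter_of w)), S1c (fst (letter_of w)), S2c (fst (letter_of w))), snd (letter_of w))) (gY w) = l2 w"
      if "w \<in> set_pmf Q" for w
      using that by (cases w) (auto simp: l2_def out2_def ch_def dest!: support_pair)
  qed (rule positive)
  show "i3 \<le> - d3" unfolding i hc_letter Y d3_def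
  proof (rule info_le)
    show "hc Q gY (\<lambda>w. (((X1c (fst (letter_of w)), X2c (fst (letter_of w))), Zc (fst (letter_of w)), S1c (fst (letter_of w)), S2c (fst (letter_of w))), snd (letter_of w))) =
      measure_pmf.expectation Q (\<lambda>w. - log 2 (lW w))"
      by (rule hc_channel[where B' = "\<lambda>x. case letter_of (x, undefined) of ((s1, s2, x1, x2, y), u) \<Rightarrow> (((x1, x2), zf x1 s1, s1, s2), u)" and
          k' = "\<lambda>(((x1, x2), z, s1, s2), u). W x1 x2 s1 s2"]) (auto simp: ch_def support_facts)
    show "pmf ((\<lambda>((z, s1, s2), u). bind_pmf strat1 (\<lambda>v1. bind_pmf strat2 (\<lambda>v2. W (v1 (z, u, s1)) (v2 (z, u, s2)) s1 s2)))
      ((Zc (fst (letter_of w)), S1c (fst (letter_of w)), S2c (fst (letter_of w))), snd (letter_of w))) (gY w) = l3 w"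
      if "w \<in> set_pmf Q" for w
      using that by (cases w) (auto simp: l3_def out3_def out2_def ch_def dest!: support_pair)
  qed (rule positive)
  show "info4 (\<lambda>w. j $ w) \<le> - d4" unfolding i hc_letter Y d4_def
  proof (rule info_le)
    show "hc Q gY (\<lambda>w. ((X1c (fst (letter_of w)), X2c (fst (letter_of w))), S1c (fst (letter_of w)), S2c (fst (letter_of w)))) =
      measure_pmf.expectation Q (\<lambda>w. - log 2 (lW w))"
      by (rule hc_channel[where B' = "\<lambda>x. case letter_of (x, undefined) of ((s1, s2, x1, x2, y), u) \<Rightarrow> ((x1, x2), s1, s2)" and
          k' = "\<lambda>((x1, x2), s1, s2). W x1 x2 s1 s2"]) (auto simp: ch_def support_facts)
    show "pmf (out4 (S1c (fst (letter_of w)), S2c (fst (letter_of w)))) (gY w) = l4 w" for w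
      by (cases w) (auto simp: l4_def)
  qed (rule positive)
qed

end

section \<open>Equality cases of entropy inequalities\<close>

lemma hc_cong_on:
  assumes "\<And>w. w \<in> set_pmf P \<Longrightarrow> A w = A' w" "\<And>w. w \<in> set_pmf P \<Longrightarrow> B w = B' w"
  shows "hc P A B = hc P A' B'"
proof -
  have "map_pmf (\<lambda>w. (A w, B w)) P = map_pmf (\<lambda>w. (A' w, B' w)) P" "map_pmf B P = map_pmf B' P"
    by (rule map_pmf_cong; use assms in simp)+
  then show ?thesis unfolding hc_def by (intro expectation_pmf_cong) (simp add: assms)
qed

text \<open>Zero entropy would force conditional probability 1 at every outcome of the support,
  while \<open>w\<close> and \<open>w'\<close> share the same value of \<open>B\<close>.\<close>

lemma hc_pos:
  assumes fin: "finite (set_pmf P)" and w: "w \<in> set_pmf P" "w' \<in> set_pmf P" "B w' = B w" "A w' \<noteq> A w"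
  shows "0 < hc P A B"
proof (rule ccontr)
  assume "\<not> 0 < hc P A B"
  then have z: "hc P A B = 0" using hc_nonneg[of P A B] by simp
  let ?f = "\<lambda>w. - log 2 (pmf (map_pmf (\<lambda>w. (A w, B w)) P) (A w, B w) / pmf (map_pmf B P) (B w))"
  have pos: "0 < pmf (map_pmf (\<lambda>w. (A w, B w)) P) (A w, B w)" if "w \<in> set_pmf P" for w
    by (rule pmf_map_pos[OF that, of "\<lambda>w. (A w, B w)"])
  have nn: "log 2 (pmf (map_pmf (\<lambda>w. (A w, B w)) P) (A w, B w) / pmf (map_pmf B P) (B w)) \<le> 0" if "w \<in> set_pmf P" for w
    using log2_quot_nonpos[OF pos[OF that] pmf_map_mono[of P "\<lambda>w. (A w, B w)" "(A w, B w)" B "B w"]] by auto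
  have "AE w in P. ?f w = 0"
    using z unfolding hc_def
    by (subst (asm) integral_nonneg_eq_0_iff_AE) (auto simp: integrable_finite_pmf[OF fin] AE_measure_pmf_iff nn simp del: pmf_map)
  then have f0: "?f w = 0" using w(1) by (simp add: AE_measure_pmf_iff)
  have "{(A w, B w), (A w', B w)} \<subseteq> snd -` {B w}" "(A w, B w) \<noteq> (A w', B w)" using w by auto
  have "pmf (map_pmf (\<lambda>w. (A w, B w)) P) (A w, B w) + pmf (map_pmf (\<lambda>w. (A w, B w)) P) (A w', B w') =
     measure_pmf.prob (map_pmf (\<lambda>w. (A w, B w)) P) {(A w, B w), (A w', B w')}"
    using w(4) by (subst measure_measure_pmf_finite) auto
  also have "\<dots> \<le> measure_pmf.prob (map_pmf (\<lambda>w. (A w, B w)) P) (snd -` {B w})"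
    by (rule measure_pmf.finite_measure_mono) (use w in auto)
  also have "\<dots> = pmf (map_pmf B P) (B w)" by (simp add: pmf_map vimage_def)
  finally have "pmf (map_pmf (\<lambda>w. (A w, B w)) P) (A w, B w) < pmf (map_pmf B P) (B w)" using pos[OF w(2)] by linarith
  then have "?f w > 0" using pos[OF w(1)] by (simp add: log_less_zero_cancel_iff del: pmf_map)
  then show False using f0 by simp
qed

lemma pmf_eq_on_support:
  assumes "finite (set_pmf p)" "\<And>u. u \<in> set_pmf p \<Longrightarrow> pmf q u = pmf p u"
  shows "q = p"
proof -
  have "measure_pmf.prob q (set_pmf p) = (\<Sum>u\<in>set_pmf p. pmf p u)"
    using assms by (simp add: measure_measure_pmf_finite)
  also have "\<dots> = 1" by (rule sum_pmf_eq_1) (use assms in auto)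
  finally have "set_pmf q \<subseteq> set_pmf p" by (simp add: measure_pmf.prob_eq_1 AE_measure_pmf_iff subset_iff)
  then show ?thesis by (intro pmf_eqI) (metis assms(2) pmf_eq_0_set_pmf subsetD)
qed

lemma expectation_ratio_le_1:
  assumes fin: "finite (set_pmf (pair_kernel p k))"
  shows "measure_pmf.expectation (pair_kernel p k) (\<lambda>w. pmf (q (fst w)) (snd w) / pmf (k (fst w)) (snd w)) \<le> 1"
proof -
  have "(\<integral>\<^sup>+w. ennreal (pmf (q (fst w)) (snd w) / pmf (k (fst w)) (snd w)) \<partial>pair_kernel p k) =
    (\<integral>\<^sup>+x. \<integral>\<^sup>+u. ennreal (pmf (q x) u / pmf (k x) u) \<partial>k x \<partial>p)"
    by (simp add: pair_kernel_def)
  also have "\<dots> \<le> (\<integral>\<^sup>+x. 1 \<partial>p)"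
  proof (rule nn_integral_pmf_mono)
    fix x
    have "(\<integral>\<^sup>+u. ennreal (pmf (q x) u / pmf (k x) u) \<partial>k x) = (\<integral>\<^sup>+u. ennreal (pmf (k x) u) * ennreal (pmf (q x) u / pmf (k x) u) \<partial>count_space UNIV)"
      by (rule nn_integral_measure_pmf)
    also have "\<dots> \<le> (\<integral>\<^sup>+u. ennreal (pmf (q x) u) \<partial>count_space UNIV)"
      by (intro nn_integral_mono) (auto simp: ennreal_mult'[symmetric])
    also have "\<dots> = 1" by (rule nn_integral_pmf_eq_1)
    finally show "(\<integral>\<^sup>+u. ennreal (pmf (q x) u / pmf (k x) u) \<partial>k x) \<le> 1" .
  qed
  finally have "(\<integral>\<^sup>+w. ennreal (pmf (q (fst w)) (snd w) / pmf (k (fst w)) (snd w)) \<partial>pair_kernel p k) \<le> 1" by simp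
  then show ?thesis
    by (subst (asm) nn_integral_eq_integral[OF integrable_finite_pmf[OF fin]]) simp_all
qed

text \<open>Here \<open>P\<close> is the joint law of the states and \<open>U\<close>. The chain
  rule in both orders gives \<open>I(U;S_1|S_2) = H(U|S_2) - H(U|S_1,S_2)\<close>, where the last
  term is the log-loss of \<open>k\<close>, since \<open>U\<close> depends on the states through
  \<open>S_1\<close>. If the difference is not positive, the equality case of
  \<open>ln x \<le> x - 1\<close> forces both conditional laws of \<open>U\<close> to agree.\<close>

lemma posterior:
  fixes pS :: "('s1 \<times> 's2) pmf" and k :: "'s1 \<Rightarrow> 'u pmf"
  defines "P \<equiv> pair_kernel pS (\<lambda>s. k (fst s))"
  defines "post \<equiv> kern P (\<lambda>w. snd (fst w)) snd"
  assumes fin: "finite (set_pmf P)"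
  shows "hc P snd (\<lambda>w. snd (fst w)) = measure_pmf.expectation P (\<lambda>w. - log 2 (pmf (post (snd (fst w))) (snd w)))"
    and "hc P snd fst = measure_pmf.expectation P (\<lambda>w. - log 2 (pmf (k (fst (fst w))) (snd w)))"
    and "hc pS fst snd - hc P (\<lambda>w. fst (fst w)) (\<lambda>w. (snd (fst w), snd w)) = hc P snd (\<lambda>w. snd (fst w)) - hc P snd fst"
    and "hc P snd fst \<le> hc P snd (\<lambda>w. snd (fst w))"
    and "\<And>s1 s2 u. (s1, s2) \<in> set_pmf pS \<Longrightarrow> u \<in> set_pmf (k s1) \<Longrightarrow> u \<in> set_pmf (post s2)"
    and "hc P snd (\<lambda>w. snd (fst w)) \<le> hc P snd fst \<Longrightarrow> (s1, s2) \<in> set_pmf pS \<Longrightarrow> post s2 = k s1"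
proof -
  show a: "hc P snd (\<lambda>w. snd (fst w)) = measure_pmf.expectation P (\<lambda>w. - log 2 (pmf (post (snd (fst w))) (snd w)))"
    using disintegrate[of "\<lambda>w. snd (fst w)" snd P] unfolding pair_kernel_def[of "map_pmf _ _"] post_def by (rule hc_kernel[OF fin])
  show b: "hc P snd fst = measure_pmf.expectation P (\<lambda>w. - log 2 (pmf (k (fst (fst w))) (snd w)))"
    using hc_last[of pS "\<lambda>s. k (fst s)" "\<lambda>s. k (fst s)" "\<lambda>s. s"] fin unfolding P_def by simp
  have f: "map_pmf fst P = pS"
    unfolding P_def by (simp add: pair_kernel_def map_bind_pmf map_pmf_comp bind_return_pmf' del: bind_map_pmf)
  have "hc pS fst snd = hc P (\<lambda>w. fst (fst w)) (\<lambda>w. snd (fst w))" unfolding f[symmetric] hc_map ..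
  moreover have "hc P (\<lambda>w. (fst (fst w), snd w)) (\<lambda>w. snd (fst w)) = hc P snd (\<lambda>w. snd (fst w)) + hc P (\<lambda>w. fst (fst w)) (\<lambda>w. (snd w, snd (fst w)))"
    by (rule hc_chain[OF fin])
  moreover have "hc P (\<lambda>w. (snd w, fst (fst w))) (\<lambda>w. snd (fst w)) = hc P (\<lambda>w. fst (fst w)) (\<lambda>w. snd (fst w)) + hc P snd (\<lambda>w. (fst (fst w), snd (fst w)))"
    by (rule hc_chain[OF fin])
  moreover have "hc P (\<lambda>w. (snd w, fst (fst w))) (\<lambda>w. snd (fst w)) = hc P (\<lambda>w. (fst (fst w), snd w)) (\<lambda>w. snd (fst w))"
    by (rule hc_cong) auto
  moreover have "hc P (\<lambda>w. fst (fst w)) (\<lambda>w. (snd w, snd (fst w))) = hc P (\<lambda>w. fst (fst w)) (\<lambda>w. (snd (fst w), snd w))"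
    by (rule hc_cong) auto
  moreover have "hc P snd (\<lambda>w. (fst (fst w), snd (fst w))) = hc P snd fst" by simp
  ultimately show "hc pS fst snd - hc P (\<lambda>w. fst (fst w)) (\<lambda>w. (snd (fst w), snd w)) = hc P snd (\<lambda>w. snd (fst w)) - hc P snd fst"
    by linarith
  show "hc P snd fst \<le> hc P snd (\<lambda>w. snd (fst w))" by (rule hc_mono_cond[OF fin]) simp
  have mem: "((s1, s2), u) \<in> set_pmf P \<longleftrightarrow> (s1, s2) \<in> set_pmf pS \<and> u \<in> set_pmf (k s1)" for s1 s2 u
    by (simp add: P_def in_pair_kernel)
  show post: "u \<in> set_pmf (post s2)" if "(s1, s2) \<in> set_pmf pS" "u \<in> set_pmf (k s1)" for s1 s2 u
  proof -
    have m: "((s1, s2), u) \<in> set_pmf P \<inter> {w. snd (fst w) = s2}" using that by (simp add: mem)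
    then have "set_pmf P \<inter> {w. snd (fst w) = s2} \<noteq> {}" by blast
    from set_cond_pmf[OF this] show ?thesis unfolding post_def kern_def set_map_pmf using m by force
  qed
  assume le: "hc P snd (\<lambda>w. snd (fst w)) \<le> hc P snd fst" and s: "(s1, s2) \<in> set_pmf pS"
  let ?a = "\<lambda>w. pmf (k (fst (fst w))) (snd w)" and ?b = "\<lambda>w. pmf (post (snd (fst w))) (snd w)"
  note int = integrable_finite_pmf[OF fin]
  have pos: "0 < ?a w" "0 < ?b w" if "w \<in> set_pmf P" for w
    using that post mem by (cases w; auto simp: pmf_positive)+
  have r: "measure_pmf.expectation P (\<lambda>w. ?b w / ?a w) \<le> 1"
    using expectation_ratio_le_1[of pS "\<lambda>s. k (fst s)" "\<lambda>s. post (snd s)"] fin unfolding P_def by simp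
  \<comment> \<open>The deficit in \<open>ln x \<le> x - 1\<close> at the likelihood ratio:
    nonnegative, and of mean at most 0 under the hypothesis \<open>le\<close>.\<close>
  define g where "g w = ?b w / ?a w - 1 - ln (?b w / ?a w)" for w
  have g: "0 \<le> g w" if "w \<in> set_pmf P" for w
    unfolding g_def using ln_le_minus_one[of "?b w / ?a w"] pos[OF that] by simp
  have "measure_pmf.expectation P g = measure_pmf.expectation P (\<lambda>w. (?b w / ?a w - 1) - ln 2 * (- log 2 (?a w) - - log 2 (?b w)))"
    unfolding g_def
  proof (rule expectation_pmf_cong)
    fix w assume "w \<in> set_pmf P"
    then show "?b w / ?a w - 1 - ln (?b w / ?a w) = (?b w / ?a w - 1) - ln 2 * (- log 2 (?a w) - - log 2 (?b w))"
      using pos[of w] by (simp add: ln_div log_def algebra_simps)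
  qed
  also have "\<dots> = (measure_pmf.expectation P (\<lambda>w. ?b w / ?a w) - 1) - ln 2 * (hc P snd fst - hc P snd (\<lambda>w. snd (fst w)))"
    unfolding a b by (simp add: int)
  also have "\<dots> \<le> 0 - 0" using r le by (intro diff_mono) auto
  finally have "measure_pmf.expectation P g = 0"
    using integral_nonneg_AE[of g "measure_pmf P"] g by (simp add: AE_measure_pmf_iff)
  then have "AE w in P. g w = 0"
    by (subst (asm) integral_nonneg_eq_0_iff_AE) (auto simp: int AE_measure_pmf_iff g)
  then have g0: "g w = 0" if "w \<in> set_pmf P" for w using that by (simp add: AE_measure_pmf_iff)
  show "post s2 = k s1"
  proof (rule pmf_eq_on_support)
    have "finite (snd ` set_pmf P)" using fin by simp
    moreover have "set_pmf (k s1) \<subseteq> snd ` set_pmf P" using s mem by force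
    ultimately show "finite (set_pmf (k s1))" by (rule rev_finite_subset)
    fix u assume "u \<in> set_pmf (k s1)"
    then have m: "((s1, s2), u) \<in> set_pmf P" using s mem by simp
    let ?t = "pmf (post s2) u / pmf (k s1) u"
    have "0 < ?t" using pos[OF m] by simp
    moreover have "ln ?t = ?t - 1" using g0[OF m] by (simp add: g_def)
    ultimately have "?t = 1" by (rule ln_eq_minus_one)
    then show "pmf (post s2) u = pmf (k s1) u" using pos[OF m] by simp
  qed
qed

lemma map_fst_pair_kernel: "map_pmf fst (pair_kernel p k) = p"
  by (simp add: pair_kernel_def map_bind_pmf map_pmf_comp bind_return_pmf' del: bind_map_pmf)

context test_channel
begin

lemma map_Q_SU: "map_pmf (\<lambda>w. (gS w, gU w)) Q = pair_kernel pS (\<lambda>s. pU (fst s))"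
proof -
  have "map_pmf (\<lambda>w. (gS w, gU w)) Q = map_pmf fst (map_pmf fst (map_pmf fst (map_pmf fst Q)))"
    unfolding map_pmf_comp by (rule map_pmf_cong) auto
  then show ?thesis unfolding Q_def map_fst_pair_kernel .
qed

lemma map_Q_SUZ: "map_pmf (\<lambda>w. ((gS w, gU w), gZ w)) Q = pair_kernel (pair_kernel pS (\<lambda>s. pU (fst s))) (\<lambda>(s, u). pZ (fst s) u)"
proof -
  have "map_pmf (\<lambda>w. ((gS w, gU w), gZ w)) Q = map_pmf fst (map_pmf fst (map_pmf fst Q))"
    unfolding map_pmf_comp by (rule map_pmf_cong) auto
  then show ?thesis unfolding Q_def map_fst_pair_kernel .
qed

text \<open>The codebook law cancels: a poor \<open>qU\<close> needs more candidates to cover, but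
  the test of Encoder 2 gains the same amount.\<close>

lemma state_rate:
  "dU + dP = measure_pmf.expectation (pair_kernel pS (\<lambda>s. pU (fst s))) (\<lambda>w. - log 2 (pmf (post (snd (fst w))) (snd w))) -
     measure_pmf.expectation (pair_kernel pS (\<lambda>s. pU (fst s))) (\<lambda>w. - log 2 (pmf (pU (fst (fst w))) (snd w)))"
proof -
  note int = integrable_finite_pmf[OF finite_Q]
  have "dU = measure_pmf.expectation Q (\<lambda>w. log 2 (lU w) - log 2 (lR w))" unfolding dU_def
    by (rule expectation_pmf_cong) (simp add: log_divide_pos positive)
  moreover have "dP = measure_pmf.expectation Q (\<lambda>w. log 2 (lR w) - log 2 (lP w))" unfolding dP_def
    by (rule expectation_pmf_cong) (simp add: log_divide_pos positive)
  ultimately show ?thesis unfolding map_Q_SU[symmetric] integral_map_pmf lU_def[symmetric] lP_def[symmetric] fst_conv snd_conv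
    by (simp add: int)
qed

lemma crib_rate:
  "dZ = log 2 (real CARD('z)) - hc Q gZ (\<lambda>w. (fst (gS w), gU w))" "0 \<le> dZ"
proof -
  note int = integrable_finite_pmf[OF finite_Q]
  let ?P = "pair_kernel (pair_kernel pS (\<lambda>s. pU (fst s))) (\<lambda>(s, u). pZ (fst s) u)"
  have fin: "finite (set_pmf ?P)" using finite_Q unfolding map_Q_SUZ[symmetric] by simp
  have "hc Q gZ (\<lambda>w. (fst (gS w), gU w)) = hc ?P snd (\<lambda>w. (fst (fst (fst w)), snd (fst w)))"
    unfolding map_Q_SUZ[symmetric] hc_map by simp
  also have "\<dots> = measure_pmf.expectation ?P (\<lambda>w. - log 2 (pmf ((\<lambda>(s, u). pZ (fst s) u) (fst w)) (snd w)))"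
    by (rule hc_last[OF fin, where B = "\<lambda>x. (fst (fst x), snd x)" and k' = "\<lambda>(s1, u). pZ s1 u"]) auto
  also have "\<dots> = measure_pmf.expectation Q (\<lambda>w. - log 2 (lZ w))"
    unfolding map_Q_SUZ[symmetric] integral_map_pmf by (simp add: lZ_def)
  finally have h: "hc Q gZ (\<lambda>w. (fst (gS w), gU w)) = measure_pmf.expectation Q (\<lambda>w. - log 2 (lZ w))" .
  have "dZ = measure_pmf.expectation Q (\<lambda>w. log 2 (lZ w) + log 2 (real CARD('z)))" unfolding dZ_def
    by (rule expectation_pmf_cong) (simp add: log_mult_pos positive)
  then show d: "dZ = log 2 (real CARD('z)) - hc Q gZ (\<lambda>w. (fst (gS w), gU w))" unfolding h by (simp add: int)
  have "hc Q gZ (\<lambda>w. (fst (gS w), gU w)) \<le> measure_pmf.expectation Q (\<lambda>w. - log 2 (pmf (pmf_of_set (UNIV :: 'z set)) (gZ w)))"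
    by (rule hc_gibbs_kernel[OF finite_Q]) simp
  then show "0 \<le> dZ" unfolding d by (simp add: log_divide)
qed

end

context law_channel
begin

text \<open>If the symbol encodes \<open>u\<close> injectively by one map for all states, entropies
  given the symbol are entropies given \<open>U\<close>.\<close>

lemma crib_info:
  assumes "represents (e, (i1, i2, i3, hz, hs), j) pX1U pX2" "\<And>s1 t. ht s1 t = g t" "inj g"
  shows "hz = hc Q gZ (\<lambda>w. (fst (gS w), gU w))"
    "hs = hc (pair_kernel pS (\<lambda>s. T (fst s))) (\<lambda>w. fst (fst w)) (\<lambda>w. (snd (fst w), snd w))"
proof -
  have "hz = hc (letter_law pX1U pX2) (\<lambda>x. Zc (fst x)) (\<lambda>x. (S1c (fst x), snd x))"
    by (rule represents_info(4)[OF assms(1)])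
  also have "\<dots> = hc Q gZ (\<lambda>w. (fst (gS w), ht (fst (gS w)) (gU w)))" unfolding hc_letter
    by (rule hc_cong_on) (auto dest!: support_pair)
  also have "\<dots> = hc Q gZ (\<lambda>w. (fst (gS w), g (gU w)))" unfolding assms(2) ..
  also have "\<dots> = hc Q gZ (\<lambda>w. (fst (gS w), gU w))"
    by (rule hc_cong) (simp_all add: inj_eq[OF assms(3)])
  finally show "hz = hc Q gZ (\<lambda>w. (fst (gS w), gU w))" .
  have "hs = hc (letter_law pX1U pX2) (\<lambda>x. S1c (fst x)) (\<lambda>x. (S2c (fst x), snd x))"
    by (rule represents_info(5)[OF assms(1)])
  also have "\<dots> = hc Q (\<lambda>w. fst (gS w)) (\<lambda>w. (snd (gS w), ht (fst (gS w)) (gU w)))" unfolding hc_letter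
    by (rule hc_cong_on) auto
  also have "\<dots> = hc Q (\<lambda>w. fst (gS w)) (\<lambda>w. (snd (gS w), g (gU w)))" unfolding assms(2) ..
  also have "\<dots> = hc Q (\<lambda>w. fst (gS w)) (\<lambda>w. (snd (gS w), gU w))"
    by (rule hc_cong) (simp_all add: inj_eq[OF assms(3)])
  also have "\<dots> = hc (pair_kernel pS (\<lambda>s. T (fst s))) (\<lambda>w. fst (fst w)) (\<lambda>w. (snd (fst w), snd w))"
    unfolding map_Q_SU[symmetric] hc_map by simp
  finally show "hs = hc (pair_kernel pS (\<lambda>s. T (fst s))) (\<lambda>w. fst (fst w)) (\<lambda>w. (snd (fst w), snd w))" .
qed

end

section \<open>Achievability for a law of finite support\<close>

context cribbing_mac
begin

text \<open>\<open>r2\<close> may be negative here, as truncation at 0 happens only in the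
  conclusion; so \<open>r1 \<le> info4\<close> does not follow from the bound on the sum and is a
  hypothesis of its own.\<close>

lemma achievable_strict:
  assumes fin: "\<And>s1. finite (set_pmf (pX1U s1))" and rep: "represents (e, (i1, i2, i3, hz, hs), j) pX1U pX2"
    and r: "hc pS fst snd - hs < hz" "r1 \<le> i1 + hz - (hc pS fst snd - hs)" "r2 \<le> i2" "r1 + r2 \<le> i3 + hz - (hc pS fst snd - hs)"
      "r1 + r2 \<le> info4 (\<lambda>w. j $ w)" "r1 \<le> info4 (\<lambda>w. j $ w)"
    and eta: "0 < \<eta>"
  shows "achievable pS zf W (max 0 (r1 - \<eta>)) (max 0 (r2 - \<eta>))"
proof -
  define pU where "pU s1 = map_pmf snd (pX1U s1)" for s1
  define P where "P = pair_kernel pS (\<lambda>s. pU (fst s))"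
  define post where "post = kern P (\<lambda>w. snd (fst w)) snd"
  define A where "A = (\<Union>s1. set_pmf (pU s1))"
  have finU: "finite (set_pmf (pU s1))" for s1 using fin by (simp add: pU_def)
  then have A: "finite A" "A \<noteq> {}" by (auto simp: A_def set_pmf_not_empty)
  have finP: "finite (set_pmf P)" using finU by (simp add: P_def pair_kernel_def)
  note po = posterior[of pS pU, folded P_def, OF finP, folded post_def]
  \<comment> \<open>The codebook of \<open>U\<close> is generated uniformly. A law that charges all
    values of \<open>U\<close> is suitable, since it cancels in \<open>dU + dP\<close>.\<close>
  interpret lc: law_channel pS zf W pX1U pX2 pU "\<lambda>_ u. u" "\<lambda>_ u. u" "pmf_of_set A" post
    using fin finU po(5) A by unfold_locales (auto simp: pU_def[symmetric] A_def set_pmf_of_set)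
  define IU where "IU = hc pS fst snd - hs"
  have ci: "hz = hc lc.Q lc.gZ (\<lambda>w. (fst (lc.gS w), lc.gU w))" "hs = hc P (\<lambda>w. fst (fst w)) (\<lambda>w. (snd (fst w), snd w))"
    unfolding P_def by (rule lc.crib_info[OF rep, of id]; simp)+
  have s: "lc.dU + lc.dP = IU" "0 \<le> IU"
    unfolding lc.state_rate[folded P_def] po(1)[symmetric] po(2)[symmetric] IU_def ci(2) po(3) using po(4) by simp_all
  have z: "lc.dZ = log 2 (real CARD('z)) - hz" "0 \<le> lc.dZ" unfolding ci(1) by (rule lc.crib_rate)+
  note inf = lc.rate_infos[OF rep]
  note r = r[folded IU_def]
  \<comment> \<open>In the condition on \<open>b1\<close> seven \<open>d\<close> add up, and
    \<open>7 / 16\<close> stays below the reserved \<open>1 / 2\<close> of \<open>\<eta>\<close>.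
    The other bound keeps \<open>hz - IU - 5 * d\<close> positive, so that \<open>a\<close> is
    nonnegative.\<close>
  define d where "d = min (\<eta> / 16) ((hz - IU) / 10)"
  have d: "0 < d" "d \<le> \<eta> / 16" "10 * d \<le> hz - IU" using eta r(1) by (auto simp: d_def min_def field_simps)
  define t1 where "t1 = max 0 (r1 - \<eta> / 2)"
  \<comment> \<open>The crib carries as much of message 1 as its slack permits; the strategies carry
    only the excess \<open>b1\<close>.\<close>
  define a where "a = min t1 (hz - IU - 5 * d)"
  define b1 where "b1 = t1 - a"
  define b2 where "b2 = max 0 (r2 - \<eta> / 2)"
  show ?thesis
  proof (rule lc.achievable_rates[where \<delta> = d and a = a and ?b1.0 = b1 and ?b2.0 = b2])
    show "0 < d" by (rule d)
    show "0 \<le> a" "0 \<le> b1" "0 \<le> b2" using d by (auto simp: a_def b1_def b2_def t1_def)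
    have "a \<le> hz - IU - 5 * d" by (simp add: a_def)
    then have "a + lc.dU + lc.dP + lc.dZ + 5 * d \<le> log 2 (real CARD('z)) \<and> 0 \<le> lc.dU + lc.dP + 3 * d \<and> 0 \<le> lc.dZ + d"
      using s z d by linarith
    then show "a + lc.dU + lc.dP + lc.dZ + 5 * d \<le> log 2 (real CARD('z)) \<and> 0 \<le> lc.dU + lc.dP + 3 * d \<and> 0 \<le> lc.dZ + d \<or> a = 0 \<and> (\<forall>s\<in>set_pmf pS. pU (fst s) = pmf_of_set A)" ..
    show "b1 = 0 \<or> b1 + lc.d1 + 2 * d \<le> 0" "b2 = 0 \<or> b2 + lc.d2 + 2 * d \<le> 0" "b1 = 0 \<or> b2 = 0 \<or> b1 + b2 + lc.d3 + 2 * d \<le> 0"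
      "a = 0 \<or> a + b1 + b2 + lc.d4 + 2 * d \<le> 0"
      using inf r d eta unfolding b1_def b2_def a_def t1_def by linarith+
    show "max 0 (r1 - \<eta>) = 0 \<or> max 0 (r1 - \<eta>) < a + b1" "max 0 (r2 - \<eta>) = 0 \<or> max 0 (r2 - \<eta>) < b2"
      using eta unfolding b1_def b2_def t1_def by linarith+
  qed auto
qed

text \<open>The state cost is nonnegative and at most \<open>hz \<le> 0\<close>, so
  \<open>posterior\<close> identifies the conditional laws of \<open>U\<close> at the two encoders.
  With \<open>a = 0\<close> and a state-independent codeword nothing is announced, and message 1 is
  carried by strategies alone.\<close>

lemma achievable_degenerate:
  assumes fin: "\<And>s1. finite (set_pmf (pX1U s1))" and rep: "represents (e, (i1, i2, i3, hz, hs), j) pX1U pX2"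
    and deg: "hz \<le> 0"
    and r: "hc pS fst snd - hs \<le> hz" "r1 \<le> i1 + hz - (hc pS fst snd - hs)" "r2 \<le> i2" "r1 + r2 \<le> i3 + hz - (hc pS fst snd - hs)"
      "r1 + r2 \<le> info4 (\<lambda>w. j $ w)"
    and eta: "0 < \<eta>"
  shows "achievable pS zf W (max 0 (r1 - \<eta>)) (max 0 (r2 - \<eta>))"
proof -
  define pU where "pU s1 = map_pmf snd (pX1U s1)" for s1
  define P where "P = pair_kernel pS (\<lambda>s. pU (fst s))"
  define post where "post = kern P (\<lambda>w. snd (fst w)) snd"
  define A where "A = (\<Union>s1. set_pmf (pU s1))"
  have finU: "finite (set_pmf (pU s1))" for s1 using fin by (simp add: pU_def)
  then have A: "finite A" "A \<noteq> {}" by (auto simp: A_def set_pmf_not_empty)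
  have finP: "finite (set_pmf P)" using finU by (simp add: P_def pair_kernel_def)
  note po = posterior[of pS pU, folded P_def, OF finP, folded post_def]
  \<comment> \<open>This instance evaluates \<open>hs\<close>; the code is taken from the instance
    \<open>dc\<close>.\<close>
  interpret lc: law_channel pS zf W pX1U pX2 pU "\<lambda>_ u. u" "\<lambda>_ u. u" "pmf_of_set A" post
    using fin finU po(5) A by unfold_locales (auto simp: pU_def[symmetric] A_def set_pmf_of_set)
  have "hs = hc P (\<lambda>w. fst (fst w)) (\<lambda>w. (snd (fst w), snd w))"
    unfolding P_def by (rule lc.crib_info[OF rep, of id]; simp)
  then have IU: "hc pS fst snd - hs = hc P snd (\<lambda>w. snd (fst w)) - hc P snd fst" using po(3) by simp
  have eq: "post s2 = pU s1" if "(s1, s2) \<in> set_pmf pS" for s1 s2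
    using po(6)[OF _ that] IU deg r(1) by simp
  \<comment> \<open>One independent coordinate for each conditional law, distributed as that law:
    the coordinate selected by the actual \<open>s1\<close> has the conditional law of
    \<open>U\<close>, although \<open>Tau\<close> itself ignores the states.\<close>
  define Tau where "Tau = Pi_pmf (range pU) undefined (\<lambda>\<pi>. \<pi>)"
  have comp: "map_pmf (\<lambda>\<tau>. \<tau> (pU s1)) Tau = pU s1" for s1
    unfolding Tau_def by (subst Pi_pmf_component) auto
  interpret dc: law_channel pS zf W pX1U pX2 "\<lambda>_. Tau" "\<lambda>s1 \<tau>. \<tau> (pU s1)" "\<lambda>s2 \<tau>. \<tau> (post s2)" Tau "\<lambda>_. Tau"
  proof
    show "finite (set_pmf Tau)" unfolding Tau_def
      by (subst set_Pi_pmf) (auto intro!: finite_PiE_dflt finU)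
    show "map_pmf (\<lambda>\<tau>. \<tau> (pU s1)) Tau = map_pmf snd (pX1U s1)" for s1 using comp[of s1] by (simp add: pU_def)
  qed (use fin eq in auto)
  note inf = dc.rate_infos[OF rep]
  have h: "hz - (hc pS fst snd - hs) \<le> 0" using IU deg po(4) by linarith
  show ?thesis
  proof (rule dc.achievable_rates[where \<delta> = "\<eta> / 16" and a = 0 and ?b1.0 = "max 0 (r1 - \<eta> / 2)" and ?b2.0 = "max 0 (r2 - \<eta> / 2)"])
    show "0 + dc.dU + dc.dP + dc.dZ + 5 * (\<eta> / 16) \<le> log 2 (real CARD('z)) \<and> 0 \<le> dc.dU + dc.dP + 3 * (\<eta> / 16) \<and> 0 \<le> dc.dZ + \<eta> / 16 \<or>
      (0::real) = 0 \<and> (\<forall>s\<in>set_pmf pS. Tau = Tau)" by simp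
    show "max 0 (r1 - \<eta> / 2) = 0 \<or> max 0 (r1 - \<eta> / 2) + dc.d1 + 2 * (\<eta> / 16) \<le> 0" "max 0 (r2 - \<eta> / 2) = 0 \<or> max 0 (r2 - \<eta> / 2) + dc.d2 + 2 * (\<eta> / 16) \<le> 0"
      "max 0 (r1 - \<eta> / 2) = 0 \<or> max 0 (r2 - \<eta> / 2) = 0 \<or> max 0 (r1 - \<eta> / 2) + max 0 (r2 - \<eta> / 2) + dc.d3 + 2 * (\<eta> / 16) \<le> 0"
      using inf r h eta by linarith+
    show "max 0 (r1 - \<eta>) = 0 \<or> max 0 (r1 - \<eta>) < 0 + max 0 (r1 - \<eta> / 2)" "max 0 (r2 - \<eta>) = 0 \<or> max 0 (r2 - \<eta>) < max 0 (r2 - \<eta> / 2)"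
      using eta by linarith+
  qed (use eta in auto)
qed

end

section \<open>Strict slack by mixing, and the closure\<close>

context cribbing_mac
begin

lemma finite_letter_law: "(\<And>s1. finite (set_pmf (pX1U s1))) \<Longrightarrow> finite (set_pmf (letter_law pX1U pX2))"
  by (auto simp: letter_law_def single_letter_def Let_def split_beta')

lemma in_letter_law:
  "((s1, s2, x1, x2, y), u) \<in> set_pmf (letter_law pX1U pX2) \<longleftrightarrow> (s1, s2) \<in> set_pmf pS \<and> (x1, u) \<in> set_pmf (pX1U s1) \<and>
     x2 \<in> set_pmf (pX2 (zf x1 s1) u s2) \<and> y \<in> set_pmf (W x1 x2 s1 s2)"
  by (simp add: set_pmf_iff pmf_letter_law)

text \<open>With \<open>U\<close> constant the state cost is 0, and a uniform \<open>X_1\<close>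
  makes the crib random given \<open>S_1\<close> as soon as \<open>zf\<close> separates two inputs
  at a state of positive probability. This gives a point of the hull with strict slack.\<close>

lemma slack_point:
  assumes "(s1, s2) \<in> set_pmf pS" "zf x s1 \<noteq> zf x' s1"
  shows "\<exists>e i1 i2 i3 hz hs j. (e, (i1, i2, i3, hz, hs), j) \<in> convex hull (point ` params) \<and>
     (\<forall>s1. (\<Sum>x1\<in>UNIV. e $ (s1, x1)) = pmf (map_pmf fst pS) s1) \<and> 0 \<le> i1 \<and> 0 \<le> i2 \<and> 0 \<le> i3 \<and> 0 < hz \<and> hc pS fst snd = hs"
proof -
  define pX1U where "pX1U = (\<lambda>_ :: 's1. map_pmf (\<lambda>x. (x, 0 :: nat)) (pmf_of_set (UNIV :: 'x1 set)))"
  define pX2 where "pX2 = (\<lambda>(_ :: 'z) (_ :: nat) (_ :: 's2). pmf_of_set (UNIV :: 'x2 set))"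
  obtain v where v: "v \<in> convex hull (point ` params)" "represents v pX1U pX2" using law_in_hull by blast
  obtain e i1 i2 i3 hz hs j where e: "v = (e, (i1, i2, i3, hz, hs), j)" by (cases v) auto
  define L where "L = letter_law pX1U pX2"
  have fin: "finite (set_pmf L)" unfolding L_def by (rule finite_letter_law) (simp add: pX1U_def)
  note inf = represents_info[OF v(2)[unfolded e], folded L_def]
  have "0 \<le> i1" "0 \<le> i2" "0 \<le> i3"
    unfolding inf(1-3) diff_ge_0_iff_ge by (rule hc_mono_cond[OF fin], force)+
  moreover have "0 < hz"
  proof -
    obtain y y' where "y \<in> set_pmf (W x undefined s1 s2)" "y' \<in> set_pmf (W x' undefined s1 s2)"
      using set_pmf_not_empty by (metis all_not_in_conv)
    then have m: "((s1, s2, x, undefined, y), 0) \<in> set_pmf L" "((s1, s2, x', undefined, y'), 0) \<in> set_pmf L"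
      using assms by (simp_all add: L_def in_letter_law pX1U_def pX2_def)
    show ?thesis unfolding inf(4) by (rule hc_pos[OF fin m]) (use assms in auto)
  qed
  moreover have "hc pS fst snd = hs"
  proof -
    have u: "snd w = 0" if "w \<in> set_pmf L" for w
      using that by (cases w) (auto simp: L_def in_letter_law pX1U_def)
    have "hs = hc L (\<lambda>x. S1c (fst x)) (\<lambda>x. S2c (fst x))" unfolding inf(5)
      by (rule hc_cong) (simp_all add: u)
    also have "\<dots> = hc (map_pmf (\<lambda>w. (S1c (fst w), S2c (fst w))) L) fst snd" unfolding hc_map by simp
    finally show ?thesis unfolding L_def marginal_S ..
  qed
  moreover have "\<forall>s1. (\<Sum>x1\<in>UNIV. e $ (s1, x1)) = pmf (map_pmf fst pS) s1"
    using v(2) unfolding e represents_def by blast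
  ultimately show ?thesis using v(1) unfolding e by blast
qed

text \<open>Mixing changes the averaged quantities linearly and \<open>info4\<close> continuously.
  Each rate loses one \<open>\<eta>\<close> to the mixing weight, one to the change of
  \<open>info4\<close> and one in the coding step; hence the 3.\<close>

lemma geo_achievable:
  assumes v: "v \<in> convex hull (point ` params)" "vec_bounds v r1 r2" and r: "0 \<le> r1" "0 \<le> r2" and eta: "0 < \<eta>"
  shows "\<exists>R1 R2. achievable pS zf W R1 R2 \<and> \<bar>R1 - r1\<bar> \<le> 3 * \<eta> \<and> \<bar>R2 - r2\<bar> \<le> 3 * \<eta>"
proof -
  obtain e i1 i2 i3 hz hs j where e: "v = (e, (i1, i2, i3, hz, hs), j)" by (cases v) auto
  define IU where "IU = hc pS fst snd - hs"
  have b: "\<And>s1. (\<Sum>x1\<in>UNIV. e $ (s1, x1)) = pmf (map_pmf fst pS) s1" "IU \<le> hz" "r1 \<le> i1 + hz - IU" "r2 \<le> i2"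
     "r1 + r2 \<le> i3 + hz - IU" "r1 + r2 \<le> info4 (\<lambda>w. j $ w)"
    using v(2) unfolding e vec_bounds_def IU_def prod.case by blast+
  show ?thesis
  proof (cases "\<exists>s1 s2 x x'. (s1, s2) \<in> set_pmf pS \<and> zf x s1 \<noteq> zf x' s1")
    case False
    obtain pX1U pX2 where law: "\<And>s1. finite (set_pmf (pX1U s1))" "represents (e, (i1, i2, i3, hz, hs), j) pX1U pX2"
      using law_of_hull[OF v(1)[unfolded e]] b(1) by auto
    have "hz = 0" unfolding represents_info(4)[OF law(2)]
    proof (rule hc_determined)
      fix w w' assume m: "w \<in> set_pmf (letter_law pX1U pX2)" "w' \<in> set_pmf (letter_law pX1U pX2)"
        and eq: "(S1c (fst w'), snd w') = (S1c (fst w), snd w)"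
      obtain s1 s2 x1 x2 y u where w: "w = ((s1, s2, x1, x2, y), u)" by (metis surj_pair)
      obtain s1' s2' x1' x2' y' u' where w': "w' = ((s1', s2', x1', x2', y'), u')" by (metis surj_pair)
      have "(s1, s2) \<in> set_pmf pS" "s1' = s1" using m(1) eq by (simp_all add: w w' in_letter_law)
      then show "Zc (fst w') = Zc (fst w)" using False unfolding w w' by auto
    qed
    then have "achievable pS zf W (max 0 (r1 - \<eta>)) (max 0 (r2 - \<eta>))"
      using achievable_degenerate[OF law _ _ _ _ _ _ eta, of r1 r2] b unfolding IU_def by simp
    moreover have "\<bar>max 0 (r1 - \<eta>) - r1\<bar> \<le> 3 * \<eta>" "\<bar>max 0 (r2 - \<eta>) - r2\<bar> \<le> 3 * \<eta>"
      using r eta by (auto simp: max_def)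
    ultimately show ?thesis by blast
  next
    case True
    then obtain s1 s2 x x' where "(s1, s2) \<in> set_pmf pS" "zf x s1 \<noteq> zf x' s1" by (elim exE conjE)
    from slack_point[OF this] obtain e0 k1 k2 k3 hz0 hs0 j0 where v0: "(e0, (k1, k2, k3, hz0, hs0), j0) \<in> convex hull (point ` params)"
      and m0: "\<forall>s1. (\<Sum>x1\<in>UNIV. e0 $ (s1, x1)) = pmf (map_pmf fst pS) s1"
      and k: "0 \<le> k1" "0 \<le> k2" "0 \<le> k3" "0 < hz0" "hc pS fst snd = hs0"
      by (elim exE conjE)
    have jn: "0 \<le> j $ w" "0 \<le> j0 $ w" for w using hull_nonneg[OF v(1), of w] hull_nonneg[OF v0, of w] by (simp_all add: e)
    define f where "f t = info4 (\<lambda>w. (1 - t) * j $ w + t * j0 $ w)" for t :: real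
    have cf: "continuous_on {0..1} f" unfolding f_def
      by (rule continuous_on_info4) (auto intro!: continuous_intros add_nonneg_nonneg mult_nonneg_nonneg jn)
    then have "\<exists>d>0. \<forall>t\<in>{0..1}. dist t 0 < d \<longrightarrow> dist (f t) (f 0) < \<eta>"
      using bspec[OF cf[unfolded continuous_on_iff], of 0] eta by simp
    then obtain d where d: "0 < d" "\<And>t. t \<in> {0..1} \<Longrightarrow> dist t 0 < d \<Longrightarrow> dist (f t) (f 0) < \<eta>" by blast
    \<comment> \<open>The bounds keep \<open>t\<close> below 1, strictly within the modulus of
      continuity of \<open>info4\<close>, and small against both rates; the \<open>1 +\<close> keeps
      the denominator positive when both rates are 0.\<close>
    define t where "t = min (1 / 2) (min (d / 2) (\<eta> / (1 + r1 + r2)))"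
    have tp: "0 < t" "t < 1" "t < d" "t \<le> \<eta> / (1 + r1 + r2)" using d(1) eta r by (auto simp: t_def)
    then have "t * (1 + r1 + r2) \<le> \<eta>" using r by (simp add: field_simps)
    moreover have "t * r1 \<le> t * (1 + r1 + r2)" "t * r2 \<le> t * (1 + r1 + r2)" using tp r by (intro mult_left_mono; simp)+
    ultimately have tr: "t * r1 \<le> \<eta>" "t * r2 \<le> \<eta>" by linarith+
    define v' where "v' = (1 - t) *\<^sub>R v + t *\<^sub>R (e0, (k1, k2, k3, hz0, hs0), j0)"
    have v': "v' \<in> convex hull (point ` params)" unfolding v'_def
      by (rule convexD[OF convex_convex_hull v(1) v0]) (use tp in auto)
    define i1' i2' i3' hz' hs' where h: "i1' = (1 - t) * i1 + t * k1" "i2' = (1 - t) * i2 + t * k2" "i3' = (1 - t) * i3 + t * k3"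
      "hz' = (1 - t) * hz + t * hz0" "hs' = (1 - t) * hs + t * hs0"
    define e' j' where ej: "e' = (1 - t) *\<^sub>R e + t *\<^sub>R e0" "j' = (1 - t) *\<^sub>R j + t *\<^sub>R j0"
    have v'e: "v' = (e', (i1', i2', i3', hz', hs'), j')" by (simp add: v'_def e h ej)
    have "(\<Sum>x1\<in>UNIV. fst v' $ (s1, x1)) = pmf (map_pmf fst pS) s1" for s1
    proof -
      have "(\<Sum>x1\<in>UNIV. fst v' $ (s1, x1)) = (1 - t) * (\<Sum>x1\<in>UNIV. e $ (s1, x1)) + t * (\<Sum>x1\<in>UNIV. e0 $ (s1, x1))"
        by (simp add: v'e ej sum.distrib sum_distrib_left)
      also have "\<dots> = pmf (map_pmf fst pS) s1" unfolding b(1) m0[rule_format] by (simp add: left_diff_distrib)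
      finally show ?thesis .
    qed
    from law_of_hull[OF v' this] obtain pX1U pX2 where law: "\<And>s1. finite (set_pmf (pX1U s1))" "represents (e', (i1', i2', i3', hz', hs'), j') pX1U pX2"
      unfolding v'e by blast
    have j4: "info4 (\<lambda>w. j $ w) - \<eta> \<le> info4 (\<lambda>w. j' $ w)"
    proof -
      have "dist (f t) (f 0) < \<eta>" by (rule d(2)) (use tp in auto)
      then show ?thesis by (simp add: f_def ej dist_real_def)
    qed
    have IU': "hc pS fst snd - hs' = (1 - t) * IU" unfolding h IU_def k(5) by (simp add: algebra_simps)
    have c: "(1 - t) * x \<le> (1 - t) * y" if "x \<le> y" for x y using that tp by (intro mult_left_mono) auto
    have tk: "0 \<le> t * k1" "0 \<le> t * k2" "0 \<le> t * k3" "0 < t * hz0" using tp k by simp_all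
    have c': "(1 - t) * IU \<le> (1 - t) * hz" "(1 - t) * r1 \<le> (1 - t) * i1 + (1 - t) * hz - (1 - t) * IU" "(1 - t) * r2 \<le> (1 - t) * i2"
      "(1 - t) * r1 + (1 - t) * r2 \<le> (1 - t) * i3 + (1 - t) * hz - (1 - t) * IU"
      using c[OF b(2)] c[OF b(3)] c[OF b(4)] c[OF b(5)] by (simp_all add: algebra_simps)
    have rr: "r1 - \<eta> \<le> (1 - t) * r1" "(1 - t) * r1 \<le> r1" "r2 - \<eta> \<le> (1 - t) * r2" "(1 - t) * r2 \<le> r2"
      using tr tp r by (simp_all add: algebra_simps)
    have "achievable pS zf W (max 0 (((1 - t) * r1 - \<eta>) - \<eta>)) (max 0 (((1 - t) * r2 - \<eta>) - \<eta>))"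
      by (rule achievable_strict[OF law _ _ _ _ _ _ eta]; (unfold IU')?; use h(1-4) c' tk j4 rr b(6) r eta in linarith)
    moreover have "\<bar>max 0 (((1 - t) * r1 - \<eta>) - \<eta>) - r1\<bar> \<le> 3 * \<eta>" "\<bar>max 0 (((1 - t) * r2 - \<eta>) - \<eta>) - r2\<bar> \<le> 3 * \<eta>"
      using r eta rr by linarith+
    ultimately show ?thesis by blast
  qed
qed

text \<open>The geometric region is closed and contains the achievable pairs, hence their closure;
  conversely each of its points is a limit of achievable pairs.\<close>

lemma capacity_region_eq_geo:
  "capacity_region pS zf W = {(R1, R2). 0 \<le> R1 \<and> 0 \<le> R2 \<and> (\<exists>v \<in> convex hull (point ` params). vec_bounds v R1 R2)}"
proof (rule subset_antisym)
  have "{(R1, R2). 0 \<le> R1 \<and> 0 \<le> R2 \<and> (\<exists>v \<in> convex hull (point ` params). vec_bounds v R1 R2)} =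
    ({0..} \<times> {0..}) \<inter> {(R1, R2). \<exists>v \<in> convex hull (point ` params). vec_bounds v R1 R2}" by auto
  moreover have "closed (({0..} \<times> {0..}) \<inter> {(R1, R2). \<exists>v \<in> convex hull (point ` params). vec_bounds v R1 R2})"
    by (intro closed_Int closed_Times closed_geo) auto
  ultimately show "capacity_region pS zf W \<subseteq> {(R1, R2). 0 \<le> R1 \<and> 0 \<le> R2 \<and> (\<exists>v \<in> convex hull (point ` params). vec_bounds v R1 R2)}"
    unfolding capacity_region_def using converse by (intro closure_minimal) (auto simp: achievable_def)
  show "{(R1, R2). 0 \<le> R1 \<and> 0 \<le> R2 \<and> (\<exists>v \<in> convex hull (point ` params). vec_bounds v R1 R2)} \<subseteq> capacity_region pS zf W"
  proof clarify
    fix r1 r2 v assume h: "0 \<le> r1" "0 \<le> r2" "v \<in> convex hull (point ` params)" "vec_bounds v r1 r2"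
    show "(r1, r2) \<in> capacity_region pS zf W" unfolding capacity_region_def closure_approachable
    proof (intro allI impI)
      fix e :: real assume "0 < e"
      then have "0 < e / 9" by simp
      from geo_achievable[OF h(3,4,1,2) this] obtain R1 R2 where R: "achievable pS zf W R1 R2" "\<bar>R1 - r1\<bar> \<le> 3 * (e / 9)" "\<bar>R2 - r2\<bar> \<le> 3 * (e / 9)" by blast
      have "dist (R1, R2) (r1, r2) \<le> \<bar>R1 - r1\<bar> + \<bar>R2 - r2\<bar>"
        using sqrt_sum_squares_le_sum_abs[of "R1 - r1" "R2 - r2"] by (simp add: dist_Pair_Pair dist_real_def)
      also have "\<dots> < e" using R \<open>0 < e\<close> by linarith
      finally show "\<exists>y\<in>{(R1, R2). achievable pS zf W R1 R2}. dist y (r1, r2) < e" using R(1) by blast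
    qed
  qed
qed

end

theorem theorem3:
  fixes pS :: "('s1::finite \<times> 's2::finite) pmf"
    and zf :: "'x1::finite \<Rightarrow> 's1 \<Rightarrow> 'z::finite"
    and W :: "'x1 \<Rightarrow> 'x2::finite \<Rightarrow> 's1 \<Rightarrow> 's2 \<Rightarrow> 'y::finite pmf"
  shows "capacity_region pS zf W =
    {(R1, R2). 0 \<le> R1 \<and> 0 \<le> R2 \<and>
      (\<exists>(pX1U :: 's1 \<Rightarrow> ('x1 \<times> nat) pmf) (pX2 :: 'z \<Rightarrow> nat \<Rightarrow> 's2 \<Rightarrow> 'x2 pmf).
        let P = single_letter pS zf W pX1U pX2;
            S1 = (\<lambda>(s1, s2, x1, u, z, x2, y). s1);
            S2 = (\<lambda>(s1, s2, x1, u, z, x2, y). s2);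
            X1 = (\<lambda>(s1, s2, x1, u, z, x2, y). x1);
            U = (\<lambda>(s1, s2, x1, u, z, x2, y). u);
            Z = (\<lambda>(s1, s2, x1, u, z, x2, y). z);
            X2 = (\<lambda>(s1, s2, x1, u, z, x2, y). x2);
            Y = (\<lambda>(s1, s2, x1, u, z, x2, y). y);
            HZ = cond_entropy P Z (\<lambda>w. (S1 w, U w));
            IU = cond_mutual_info P U S1 S2
        in IU \<le> HZ \<and>
           R1 \<le> cond_mutual_info P X1 Y (\<lambda>w. (X2 w, Z w, S1 w, S2 w, U w)) + HZ - IU \<and>
           R2 \<le> cond_mutual_info P X2 Y (\<lambda>w. (X1 w, S1 w, S2 w, U w)) \<and>
           R1 + R2 \<le> cond_mutual_info P (\<lambda>w. (X1 w, X2 w)) Y (\<lambda>w. (Z w, S1 w, S2 w, U w))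
                       + HZ - IU \<and>
           R1 + R2 \<le> cond_mutual_info P (\<lambda>w. (X1 w, X2 w)) Y (\<lambda>w. (S1 w, S2 w)))}"
proof -
  interpret cribbing_mac pS zf W .
  \<comment> \<open>Both directions pass through \<open>represents\<close>. A law obtained from the
    hull has finitely many values of \<open>U\<close>, a law given by the region may have infinitely
    many.\<close>
  have eq: "(\<exists>v \<in> convex hull (point ` params). vec_bounds v R1 R2) \<longleftrightarrow>
      (\<exists>pX1U pX2. region_bounds (single_letter pS zf W pX1U pX2) R1 R2)" for R1 R2
  proof
    assume "\<exists>v \<in> convex hull (point ` params). vec_bounds v R1 R2"
    then obtain v where v: "v \<in> convex hull (point ` params)" "vec_bounds v R1 R2" by blast
    then have "\<And>s1. (\<Sum>x1\<in>UNIV. fst v $ (s1, x1)) = pmf (map_pmf fst pS) s1"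
      unfolding vec_bounds_def by (simp add: split_beta' del: pmf_map)
    from law_of_hull[OF v(1) this] show "\<exists>pX1U pX2. region_bounds (single_letter pS zf W pX1U pX2) R1 R2"
      using represents_bounds v(2) by blast
  next
    assume "\<exists>pX1U pX2. region_bounds (single_letter pS zf W pX1U pX2) R1 R2"
    then show "\<exists>v \<in> convex hull (point ` params). vec_bounds v R1 R2" using geo_of_region by blast
  qed
  show ?thesis unfolding capacity_region_eq_geo eq region_bounds_def Let_def ..
qed

end
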